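(* Let $(M^n,g)$ be a compact Riemannian $\mathrm{Spin^c}$ manifold of dimension $n\geqslant 2$, and denote by $i\Omega$ the curvature form of the connection $A$ on the $\mathbb{S}^1$-principal bundle $\mathbb{S}^1M$ of the $\mathrm{Spin^c}$ structure. Let $\lambda_1$ be the first eigenvalue of the Dirac operator $D$ and $\psi\not\equiv0$ an eigenspinor with $D\psi=\lambda_1\psi$. Then equality $$\lambda_1^2=\inf_M\Big(\frac14S_g-\frac{c_n}{4}|\Omega|_g+|\ell^\psi|^2\Big)$$ (infimum over the points where $\psi\neq0$) holds if and only if both $$\nabla_X\psi=-\ell^\psi(X)\cdot\psi\quad\text{for any } X\in\Gamma(TM),\qquad\text{and}\qquad \Omega\cdot\psi=i\frac{c_n}{2}|\Omega|_g\,\psi,$$ where $c_n=2[\frac n2]^{1/2}$ and the first equation is required wherever $\ell^\psi$ is defined, i.e. where $\psi\neq 0$.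
   Context: $M$ is compact, connected, oriented, without boundary, of dimension $n\ge 2$. A $\mathrm{Spin^c}$ structure on $(M^n,g)$ is a $\mathrm{Spin}^c_n$-principal bundle $\mathrm{Spin^c}M$ and an $\mathbb S^1$-principal bundle $\mathbb S^1M$ over $M$ together with a double covering $\theta:\mathrm{Spin^c}M\to SOM\times_M\mathbb S^1M$ with $\theta(ua)=\theta(u)\xi(a)$ for all $u\in\mathrm{Spin^c}M$, $a\in\mathrm{Spin}^c_n$, where $SOM$ is the bundle of positively oriented orthonormal frames and $\xi:\mathrm{Spin}^c_n\to SO_n\times\mathbb S^1$ is the 2-fold covering. $\Sigma^cM$ is the associated complex spinor bundle (complex rank $2^{[n/2]}$), with Hermitian product $\langle\cdot,\cdot\rangle$ and Clifford multiplication $X\cdot\psi$, for which $X\cdot X\cdot\psi=-|X|^2\psi$ and $\langle X\cdot\psi,\varphi\rangle=-\langle\psi,X\cdot\varphi\rangle$; it is extended to forms by $(e_i^*\wedge e_j^* )\cdot\psi=e_i\cdot e_j\cdot\psi$ for $i\neq j$ in an orthonormal frame. A connection 1-form $A:T(\mathbb S^1M)\to i\mathbb R$ on $\mathbb S^1M$ is fixed; its curvature is $F_A=dA=i\Omega$, with $\Omega$ regarded as a real 2-form on $M$ ($i\Omega$ is the curvature of the associated line bundle). With the Levi-Civita connection $\nabla^M$ it induces the covariant derivative $\nabla$ on $\Sigma^cM$: locally, for $\psi=[b,\sigma]$, $\nabla_{e_i}\psi=[b,\,e_i(\sigma)+\frac14\sum_j e_j\cdot\nabla^M_{e_i}e_j\cdot\sigma+\frac12A(s_*(e_i))\sigma]$,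 where $s$ is a local section of $\mathbb S^1M$. The Dirac operator is $D\psi=\sum_i e_i\cdot\nabla_{e_i}\psi$ for a local orthonormal frame $(e_i)$. "First eigenvalue" of $D$ means an eigenvalue of smallest absolute value. $S_g$ is the scalar curvature of $g$, and $|\Omega|_g^2=\sum_{i<j}\Omega(e_i,e_j)^2$. For a spinor field $\phi$, on the complement of its zero set, $\ell^\phi$ is the symmetric endomorphism field with $g(\ell^\phi(X),Y)=\frac12\mathrm{Re}\langle X\cdot\nabla_Y\phi+Y\cdot\nabla_X\phi,\frac{\phi}{|\phi|^2}\rangle$; $|\ell^\phi|^2=\sum_i g(\ell^\phi(e_i),\ell^\phi(e_i))$. *)

theory Defs
  imports "HOL-Analysis.Analysis"
begin

section \<open>Smooth manifolds\<close>

text \<open>\<open>C\<^sup>k\<close> and \<open>C\<^sup>\<infinity>\<close> on an open set \<open>U\<close> of a Euclidean space.\<close>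

primrec ck_on ::
  "nat \<Rightarrow> 'a::euclidean_space set \<Rightarrow> ('a \<Rightarrow> 'b::real_normed_vector) \<Rightarrow> bool" where
  "ck_on 0 U f \<longleftrightarrow> continuous_on U f"
| "ck_on (Suc k) U f \<longleftrightarrow> (\<forall>x\<in>U. f differentiable (at x)) \<and>
     (\<forall>v. ck_on k U (\<lambda>x. frechet_derivative f (at x) v))"

definition smooth_on ::
  "'a::euclidean_space set \<Rightarrow> ('a \<Rightarrow> 'b::real_normed_vector) \<Rightarrow> bool" where
  "smooth_on U f \<longleftrightarrow> (\<forall>k. ck_on k U f)"

text \<open>A chart is a pair of its domain and a map, whose values outside the domain are irrelevant.\<close>

type_synonym ('m, 'e) chart = "'m set \<times> ('m \<Rightarrow> 'e)"

definition chart_inv :: "('m, 'e) chart \<Rightarrow> 'e \<Rightarrow> 'm" where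
  "chart_inv c = inv_into (fst c) (snd c)"

definition smooth_map ::
  "('m::topological_space, 'e::euclidean_space) chart set \<Rightarrow>
   ('k::topological_space, 'f::euclidean_space) chart set \<Rightarrow> 'm set \<Rightarrow> ('m \<Rightarrow> 'k) \<Rightarrow> bool" where
  "smooth_map A B U F \<longleftrightarrow> continuous_on U F \<and>
     (\<forall>c\<in>A. \<forall>d\<in>B.
        smooth_on (snd c ` (fst c \<inter> U \<inter> F -` fst d)) (snd d \<circ> F \<circ> chart_inv c))"

text \<open>The manifold is the whole type \<open>'m\<close>. Charts are homeomorphisms onto open subsets of the model
  space, so there is no boundary. The Hausdorff property and second countability are left to the
  sort of \<open>'m\<close>.\<close>

definition smooth_atlas ::
  "('m::topological_space, 'e::euclidean_space) chart set \<Rightarrow> bool" where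
  "smooth_atlas A \<longleftrightarrow>
     (\<Union>c\<in>A. fst c) = UNIV \<and>
     (\<forall>c\<in>A. open (fst c) \<and> open (snd c ` fst c) \<and>
        homeomorphism (fst c) (snd c ` fst c) (snd c) (chart_inv c)) \<and>
     (\<forall>c\<in>A. \<forall>d\<in>A. smooth_on (snd c ` (fst c \<inter> fst d)) (snd d \<circ> chart_inv c))"

definition oriented_atlas ::
  "('m::topological_space, real^'n::finite) chart set \<Rightarrow> bool" where
  "oriented_atlas A \<longleftrightarrow>
     (\<forall>c\<in>A. \<forall>d\<in>A. \<forall>y\<in>snd c ` (fst c \<inter> fst d).
        det (matrix (frechet_derivative (snd d \<circ> chart_inv c) (at y))) > 0)"

definition eucl_atlas :: "('e::euclidean_space, 'e) chart set" where
  "eucl_atlas = {(UNIV, \<lambda>x. x)}"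

definition prod_atlas ::
  "('m, 'e) chart set \<Rightarrow> ('k, 'f) chart set \<Rightarrow> ('m \<times> 'k, 'e \<times> 'f) chart set" where
  "prod_atlas A B = {(fst c \<times> fst d, map_prod (snd c) (snd d)) | c d. c \<in> A \<and> d \<in> B}"

text \<open>Smoothness on an arbitrary subset: locally the restriction of a smooth map on an open set.\<close>

definition smooth_on_subset ::
  "('m::topological_space, 'e::euclidean_space) chart set \<Rightarrow>
   ('k::topological_space, 'f::euclidean_space) chart set \<Rightarrow> 'm set \<Rightarrow> ('m \<Rightarrow> 'k) \<Rightarrow> bool" where
  "smooth_on_subset A B S f \<longleftrightarrow>
     (\<forall>x\<in>S. \<exists>W F. open W \<and> x \<in> W \<and> smooth_map A B W F \<and> (\<forall>y\<in>W \<inter> S. F y = f y))"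

definition chart_at :: "('m, 'e) chart set \<Rightarrow> 'm \<Rightarrow> ('m, 'e) chart" where
  "chart_at A x = (SOME c. c \<in> A \<and> x \<in> fst c)"

text \<open>A tangent vector at \<open>x\<close> is the family of its components in the charts around \<open>x\<close>, subject to the
  transformation law. The value on all other charts is \<open>0\<close>, so that equality of tangent vectors at
  \<open>x\<close> is equality of functions.\<close>

type_synonym ('m, 'e) tvec = "('m, 'e) chart \<Rightarrow> 'e"

definition tangent ::
  "('m, 'e::euclidean_space) chart set \<Rightarrow> 'm \<Rightarrow> ('m, 'e) tvec \<Rightarrow> bool" where
  "tangent A x v \<longleftrightarrow>
     (\<forall>c. \<not> (c \<in> A \<and> x \<in> fst c) \<longrightarrow> v c = 0) \<and>
     (\<forall>c\<in>A. \<forall>d\<in>A. x \<in> fst c \<longrightarrow> x \<in> fst d \<longrightarrow>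
        v d = frechet_derivative (snd d \<circ> chart_inv c) (at (snd c x)) (v c))"

definition tadd :: "('m, 'e::euclidean_space) tvec \<Rightarrow> ('m, 'e) tvec \<Rightarrow> ('m, 'e) tvec" where
  "tadd v w = (\<lambda>c. v c + w c)"

definition tscale :: "real \<Rightarrow> ('m, 'e::euclidean_space) tvec \<Rightarrow> ('m, 'e) tvec" where
  "tscale r v = (\<lambda>c. r *\<^sub>R v c)"

text \<open>The tangent vector at \<open>x\<close> with components \<open>w\<close> in the chart \<open>c\<close>.\<close>

definition tvec_of ::
  "('m, 'e::euclidean_space) chart set \<Rightarrow> ('m, 'e) chart \<Rightarrow> 'm \<Rightarrow> 'e \<Rightarrow> ('m, 'e) tvec" where
  "tvec_of A c x w = (\<lambda>d. if d \<in> A \<and> x \<in> fst d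
     then frechet_derivative (snd d \<circ> chart_inv c) (at (snd c x)) w else 0)"

definition push ::
  "('m, 'e::euclidean_space) chart set \<Rightarrow> ('k, 'f::euclidean_space) chart set \<Rightarrow> ('m \<Rightarrow> 'k) \<Rightarrow>
   'm \<Rightarrow> ('m, 'e) tvec \<Rightarrow> ('k, 'f) tvec" where
  "push A B F x v = (\<lambda>d. if d \<in> B \<and> F x \<in> fst d
     then (let c = chart_at A x in
       frechet_derivative (snd d \<circ> F \<circ> chart_inv c) (at (snd c x)) (v c)) else 0)"

definition dir_deriv ::
  "('m, 'e::euclidean_space) chart set \<Rightarrow> ('m \<Rightarrow> 'v::real_normed_vector) \<Rightarrow>
   'm \<Rightarrow> ('m, 'e) tvec \<Rightarrow> 'v" where
  "dir_deriv A f x v = (let c = chart_at A x in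
     frechet_derivative (f \<circ> chart_inv c) (at (snd c x)) (v c))"

definition smooth_vfield ::
  "('m::topological_space, 'e::euclidean_space) chart set \<Rightarrow> ('m \<Rightarrow> ('m, 'e) tvec) \<Rightarrow> bool" where
  "smooth_vfield A X \<longleftrightarrow> (\<forall>x. tangent A x (X x)) \<and>
     (\<forall>c\<in>A. smooth_map A eucl_atlas (fst c) (\<lambda>x. X x c))"

definition smooth_1form ::
  "('m, 'e::euclidean_space) chart set \<Rightarrow>
   ('m \<Rightarrow> ('m, 'e) tvec \<Rightarrow> 'v::real_normed_vector) \<Rightarrow> bool" where
  "smooth_1form A \<alpha> \<longleftrightarrow>
     (\<forall>x v w r. tangent A x v \<longrightarrow> tangent A x w \<longrightarrow>
        \<alpha> x (tadd v w) = \<alpha> x v + \<alpha> x w \<and> \<alpha> x (tscale r v) = r *\<^sub>R \<alpha> x v) \<and>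
     (\<forall>c\<in>A. \<forall>w. smooth_on (snd c ` fst c)
        (\<lambda>y. \<alpha> (chart_inv c y) (tvec_of A c (chart_inv c y) w)))"

text \<open>Convention: \<open>d\<alpha>(V,W) = V(\<alpha>(W)) - W(\<alpha>(V)) - \<alpha>([V,W])\<close>, evaluated on coordinate fields.\<close>

definition ext_deriv ::
  "('m, 'e::euclidean_space) chart set \<Rightarrow>
   ('m \<Rightarrow> ('m, 'e) tvec \<Rightarrow> 'v::real_normed_vector) \<Rightarrow>
   'm \<Rightarrow> ('m, 'e) tvec \<Rightarrow> ('m, 'e) tvec \<Rightarrow> 'v" where
  "ext_deriv A \<alpha> x v w =
     (let c = chart_at A x;
          a = (\<lambda>u y. \<alpha> (chart_inv c y) (tvec_of A c (chart_inv c y) u))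
      in frechet_derivative (a (w c)) (at (snd c x)) (v c)
       - frechet_derivative (a (v c)) (at (snd c x)) (w c))"


section \<open>Riemannian geometry\<close>

type_synonym ('m, 'n) metric = "'m \<Rightarrow> ('m, real^'n) tvec \<Rightarrow> ('m, real^'n) tvec \<Rightarrow> real"

definition riemannian_metric ::
  "('m, real^'n::finite) chart set \<Rightarrow> ('m, 'n) metric \<Rightarrow> bool" where
  "riemannian_metric A g \<longleftrightarrow>
     (\<forall>x u v w r. tangent A x u \<longrightarrow> tangent A x v \<longrightarrow> tangent A x w \<longrightarrow>
        g x u v = g x v u \<and>
        g x (tadd u v) w = g x u w + g x v w \<and>
        g x (tscale r u) v = r * g x u v \<and>
        (u \<noteq> (\<lambda>c. 0) \<longrightarrow> g x u u > 0)) \<and>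
     (\<forall>c\<in>A. \<forall>v w. smooth_on (snd c ` fst c)
        (\<lambda>y. g (chart_inv c y) (tvec_of A c (chart_inv c y) v) (tvec_of A c (chart_inv c y) w)))"

definition partial :: "'n::finite \<Rightarrow> (real^'n \<Rightarrow> real) \<Rightarrow> real^'n \<Rightarrow> real" where
  "partial i f y = frechet_derivative f (at y) (axis i 1)"

definition gram ::
  "('m, real^'n::finite) chart set \<Rightarrow> ('m, 'n) metric \<Rightarrow> ('m, real^'n) chart \<Rightarrow>
   real^'n \<Rightarrow> real^'n^'n" where
  "gram A g c y = (\<chi> i j. g (chart_inv c y)
     (tvec_of A c (chart_inv c y) (axis i 1)) (tvec_of A c (chart_inv c y) (axis j 1)))"

text \<open>\<open>christoffel A g c k i j\<close> is the symbol \<open>\<Gamma>\<close> with upper index \<open>k\<close> and lower indices \<open>i, j\<close> of the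
  Levi-Civita connection.\<close>

definition christoffel ::
  "('m, real^'n::finite) chart set \<Rightarrow> ('m, 'n) metric \<Rightarrow> ('m, real^'n) chart \<Rightarrow>
   'n \<Rightarrow> 'n \<Rightarrow> 'n \<Rightarrow> real^'n \<Rightarrow> real" where
  "christoffel A g c k i j y = (\<Sum>l\<in>UNIV. matrix_inv (gram A g c y) $ k $ l *
     (partial i (\<lambda>z. gram A g c z $ j $ l) y + partial j (\<lambda>z. gram A g c z $ i $ l) y
      - partial l (\<lambda>z. gram A g c z $ i $ j) y)) / 2"

definition levi_civita ::
  "('m, real^'n::finite) chart set \<Rightarrow> ('m, 'n) metric \<Rightarrow> 'm \<Rightarrow> ('m, real^'n) tvec \<Rightarrow>
   ('m \<Rightarrow> ('m, real^'n) tvec) \<Rightarrow> ('m, real^'n) tvec" where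
  "levi_civita A g x X Y = (let c = chart_at A x in
     tvec_of A c x (dir_deriv A (\<lambda>y. Y y c) x X +
       (\<chi> k. \<Sum>i\<in>UNIV. \<Sum>j\<in>UNIV. christoffel A g c k i j (snd c x) * X c $ i * Y x c $ j)))"

text \<open>\<open>R(\<partial>\<^sub>i,\<partial>\<^sub>j)\<partial>\<^sub>k = (\<Sum>l. riem l k i j) \<partial>\<^sub>l\<close> with
  \<open>R(X,Y) = \<nabla>\<^sub>X\<nabla>\<^sub>Y - \<nabla>\<^sub>Y\<nabla>\<^sub>X - \<nabla>\<close> along \<open>[X,Y]\<close>; round spheres get positive scalar
  curvature.\<close>

definition riem ::
  "('m, real^'n::finite) chart set \<Rightarrow> ('m, 'n) metric \<Rightarrow> ('m, real^'n) chart \<Rightarrow>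
   'n \<Rightarrow> 'n \<Rightarrow> 'n \<Rightarrow> 'n \<Rightarrow> real^'n \<Rightarrow> real" where
  "riem A g c l k i j y =
     partial i (christoffel A g c l j k) y - partial j (christoffel A g c l i k) y +
     (\<Sum>m\<in>UNIV. christoffel A g c l i m y * christoffel A g c m j k y
             - christoffel A g c l j m y * christoffel A g c m i k y)"

definition scal ::
  "('m, real^'n::finite) chart set \<Rightarrow> ('m, 'n) metric \<Rightarrow> 'm \<Rightarrow> real" where
  "scal A g x = (let c = chart_at A x; y = snd c x in
     \<Sum>j\<in>UNIV. \<Sum>k\<in>UNIV. matrix_inv (gram A g c y) $ j $ k * (\<Sum>i\<in>UNIV. riem A g c i k i j y))"

definition orthonormal_frame ::
  "('m, real^'n::finite) chart set \<Rightarrow> ('m, 'n) metric \<Rightarrow> 'm \<Rightarrow> ('n \<Rightarrow> ('m, real^'n) tvec) \<Rightarrow> bool"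
  where
  "orthonormal_frame A g x e \<longleftrightarrow> (\<forall>i. tangent A x (e i)) \<and>
     (\<forall>i j. g x (e i) (e j) = (if i = j then 1 else 0))"

text \<open>The fibre of \<open>SOM\<close> at \<open>x\<close>, and the right action \<open>(eR)\<^sub>j = (\<Sum>i. R\<^sub>i\<^sub>j e\<^sub>i)\<close> of \<open>SO\<^sub>n\<close>.\<close>

definition SO_frame ::
  "('m, real^'n::finite) chart set \<Rightarrow> ('m, 'n) metric \<Rightarrow> 'm \<Rightarrow> ('n \<Rightarrow> ('m, real^'n) tvec) \<Rightarrow> bool"
  where
  "SO_frame A g x e \<longleftrightarrow> orthonormal_frame A g x e \<and>
     (\<forall>c\<in>A. x \<in> fst c \<longrightarrow> det (\<chi> i. e i c) > 0)"

definition frame_act ::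
  "('n::finite \<Rightarrow> ('m, real^'n) tvec) \<Rightarrow> real^'n^'n \<Rightarrow> ('n \<Rightarrow> ('m, real^'n) tvec)" where
  "frame_act e R = (\<lambda>j c. \<Sum>i\<in>UNIV. R $ i $ j *\<^sub>R e i c)"


section \<open>Clifford multiplication and the group \<open>Spin\<^sup>c\<^sub>n\<close>\<close>

definition hermitian :: "complex^'s::finite \<Rightarrow> complex^'s \<Rightarrow> complex" where
  "hermitian \<sigma> \<tau> = (\<Sum>k\<in>UNIV. \<sigma> $ k * cnj (\<tau> $ k))"

text \<open>A unitary complex representation of the Clifford algebra of \<open>\<real>\<^sup>n\<close>, given by the images
  \<open>\<gamma> i\<close> of the standard basis. By the dimension condition it is irreducible, i.e. it is the complex
  spinor module \<open>\<Sigma>\<^sub>n\<close> (one of the two choices if \<open>n\<close> is odd).\<close>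

definition clifford_module :: "('n::finite \<Rightarrow> complex^'s^'s::finite) \<Rightarrow> bool" where
  "clifford_module \<gamma> \<longleftrightarrow> CARD('s) = 2 ^ (CARD('n) div 2) \<and>
     (\<forall>i j. \<gamma> i ** \<gamma> j + \<gamma> j ** \<gamma> i = mat (if i = j then -2 else 0)) \<and>
     (\<forall>i \<sigma> \<tau>. hermitian (\<gamma> i *v \<sigma>) \<tau> = - hermitian \<sigma> (\<gamma> i *v \<tau>))"

definition clifford :: "('n::finite \<Rightarrow> complex^'s^'s::finite) \<Rightarrow> real^'n \<Rightarrow> complex^'s^'s" where
  "clifford \<gamma> v = (\<Sum>i\<in>UNIV. v $ i *\<^sub>R \<gamma> i)"

text \<open>The complex spin representation is faithful on \<open>Spin\<^sup>c\<^sub>n\<close> (it is so on the complexified even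
  Clifford algebra), hence \<open>Spin\<^sup>c\<^sub>n\<close> is identified with its image: the matrices
  \<open>z v\<^sub>1 \<dots> v\<^sub>2\<^sub>k\<close> with \<open>z \<in> S\<^sup>1\<close> and unit vectors \<open>v\<^sub>i\<close>.\<close>

definition spinc_product ::
  "('n::finite \<Rightarrow> complex^'s^'s::finite) \<Rightarrow> complex \<Rightarrow> (real^'n) list \<Rightarrow> complex^'s^'s" where
  "spinc_product \<gamma> z vs = mat z ** foldr (\<lambda>v M. clifford \<gamma> v ** M) vs (mat 1)"

definition spinc_group :: "('n::finite \<Rightarrow> complex^'s^'s::finite) \<Rightarrow> (complex^'s^'s) set" where
  "spinc_group \<gamma> = {spinc_product \<gamma> z vs | z vs.
     norm z = 1 \<and> even (length vs) \<and> (\<forall>v\<in>set vs. norm v = 1)}"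

text \<open>The covering \<open>\<xi>(z s) = (Ad s, z\<^sup>2)\<close> for \<open>s \<in> Spin\<^sub>n\<close>, \<open>z \<in> S\<^sup>1\<close>.\<close>

definition spinc_xi ::
  "('n::finite \<Rightarrow> complex^'s^'s::finite) \<Rightarrow> complex^'s^'s \<Rightarrow> (real^'n^'n) \<times> complex" where
  "spinc_xi \<gamma> a =
     ((THE R. \<forall>v. a ** clifford \<gamma> v = clifford \<gamma> (R *v v) ** a),
      (THE w. \<exists>z vs. norm z = 1 \<and> even (length vs) \<and> (\<forall>v\<in>set vs. norm v = 1) \<and>
                a = spinc_product \<gamma> z vs \<and> w = z\<^sup>2))"


section \<open>Principal bundles and connections\<close>

text \<open>A smooth (right) principal bundle whose structure group \<open>G\<close> is an embedded Lie group in the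
  Euclidean space \<open>'g\<close>. For a local section \<open>s\<close> over \<open>U\<close>, the last four lines say that
  \<open>(y,a) \<mapsto> s(y)a\<close> is a diffeomorphism from \<open>U \<times> G\<close> onto the preimage of \<open>U\<close>, with inverse
  \<open>u \<mapsto> (\<pi>(u), \<tau>(u))\<close>.\<close>

definition principal_bundle ::
  "('m::topological_space, 'e::euclidean_space) chart set \<Rightarrow>
   'g::euclidean_space set \<Rightarrow> ('g \<Rightarrow> 'g \<Rightarrow> 'g) \<Rightarrow> 'g \<Rightarrow>
   ('p::topological_space, 'f::euclidean_space) chart set \<Rightarrow> ('p \<Rightarrow> 'm) \<Rightarrow> ('p \<Rightarrow> 'g \<Rightarrow> 'p) \<Rightarrow> bool" where
  "principal_bundle A G mul one B \<pi> act \<longleftrightarrow>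
     smooth_atlas B \<and> smooth_map B A UNIV \<pi> \<and>
     (\<forall>u. act u one = u) \<and>
     (\<forall>u. \<forall>a\<in>G. \<forall>b\<in>G. act (act u a) b = act u (mul a b)) \<and>
     (\<forall>u. \<forall>a\<in>G. \<pi> (act u a) = \<pi> u) \<and>
     (\<forall>x. \<exists>U s \<tau>. open U \<and> x \<in> U \<and> smooth_map A B U s \<and> (\<forall>y\<in>U. \<pi> (s y) = y) \<and>
        smooth_on_subset (prod_atlas A eucl_atlas) B (U \<times> G) (\<lambda>(y, a). act (s y) a) \<and>
        smooth_map B eucl_atlas (\<pi> -` U) \<tau> \<and>
        (\<forall>u\<in>\<pi> -` U. \<tau> u \<in> G \<and> act (s (\<pi> u)) (\<tau> u) = u) \<and>
        (\<forall>y\<in>U. \<forall>a\<in>G. \<tau> (act (s y) a) = a))"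

text \<open>The velocity at \<open>t = 0\<close> of \<open>t \<mapsto> q e\<^sup>i\<^sup>t\<close>.\<close>

definition circle_vertical ::
  "('q, 'f::euclidean_space) chart set \<Rightarrow> ('q \<Rightarrow> complex \<Rightarrow> 'q) \<Rightarrow> 'q \<Rightarrow> ('q, 'f) tvec" where
  "circle_vertical B act q = (\<lambda>c. if c \<in> B \<and> q \<in> fst c
     then vector_derivative (\<lambda>t. snd c (act q (cis t))) (at 0) else 0)"

definition circle_connection ::
  "('q, 'f::euclidean_space) chart set \<Rightarrow> ('q \<Rightarrow> complex \<Rightarrow> 'q) \<Rightarrow>
   ('q \<Rightarrow> ('q, 'f) tvec \<Rightarrow> complex) \<Rightarrow> bool" where
  "circle_connection B act \<alpha> \<longleftrightarrow> smooth_1form B \<alpha> \<and>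
     (\<forall>q v. tangent B q v \<longrightarrow> Re (\<alpha> q v) = 0) \<and>
     (\<forall>q. \<alpha> q (circle_vertical B act q) = \<i>) \<and>
     (\<forall>q v z. tangent B q v \<longrightarrow> norm z = 1 \<longrightarrow>
        \<alpha> (act q z) (push B B (\<lambda>r. act r z) q v) = \<alpha> q v)"


section \<open>\<open>Spin\<^sup>c\<close> manifolds\<close>

text \<open>The prefix \<open>spin_\<close> refers to the total space \<open>'p\<close> of the \<open>Spin\<^sup>c\<^sub>n\<close>-bundle (with model space
  \<open>'e\<close>), the prefix \<open>circ_\<close> to the total space \<open>'q\<close> of the \<open>S\<^sup>1\<close>-bundle.\<close>

record ('m, 'n::finite, 'p, 'e, 'q, 's::finite) spinc =
  base_atlas :: "('m, real^'n) chart set"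
  base_metric :: "'m \<Rightarrow> ('m, real^'n) tvec \<Rightarrow> ('m, real^'n) tvec \<Rightarrow> real"
  gam :: "'n \<Rightarrow> complex^'s^'s"
  spin_atlas :: "('p, 'e) chart set"
  spin_proj :: "'p \<Rightarrow> 'm"
  spin_act :: "'p \<Rightarrow> complex^'s^'s \<Rightarrow> 'p"
  circ_atlas :: "('q, (real^'n) \<times> real) chart set"
  circ_proj :: "'q \<Rightarrow> 'm"
  circ_act :: "'q \<Rightarrow> complex \<Rightarrow> 'q"
  theta :: "'p \<Rightarrow> ('n \<Rightarrow> ('m, real^'n) tvec) \<times> 'q"
  conn :: "'q \<Rightarrow> ('q, (real^'n) \<times> real) tvec \<Rightarrow> complex"

text \<open>The last four conjuncts state that \<open>\<theta>\<close> is a smooth map over the identity of \<open>M\<close> into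
  \<open>SOM \<times>\<^sub>M S\<^sup>1M\<close>, two-to-one, onto and \<open>\<xi>\<close>-equivariant. In local trivialisations
  equivariance makes \<open>\<theta>\<close> the map \<open>id \<times> \<xi>\<close> up to a translation, so it is a covering map.\<close>

definition spinc_manifold ::
  "('m::topological_space, 'n::finite, 'p::topological_space, 'e::euclidean_space,
    'q::topological_space, 's::finite) spinc \<Rightarrow> bool" where
  "spinc_manifold S \<longleftrightarrow>
     smooth_atlas (base_atlas S) \<and> oriented_atlas (base_atlas S) \<and>
     riemannian_metric (base_atlas S) (base_metric S) \<and>
     clifford_module (gam S) \<and>
     principal_bundle (base_atlas S) (spinc_group (gam S)) (**) (mat 1)
       (spin_atlas S) (spin_proj S) (spin_act S) \<and>
     principal_bundle (base_atlas S) {z. norm z = 1} (*) 1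
       (circ_atlas S) (circ_proj S) (circ_act S) \<and>
     circle_connection (circ_atlas S) (circ_act S) (conn S) \<and>
     (\<forall>u. SO_frame (base_atlas S) (base_metric S) (spin_proj S u) (fst (theta S u)) \<and>
          circ_proj S (snd (theta S u)) = spin_proj S u) \<and>
     ((\<forall>c\<in>base_atlas S. \<forall>i.
          smooth_map (spin_atlas S) eucl_atlas (spin_proj S -` fst c) (\<lambda>u. fst (theta S u) i c)) \<and>
      smooth_map (spin_atlas S) (circ_atlas S) UNIV (\<lambda>u. snd (theta S u))) \<and>
     (\<forall>x e q. SO_frame (base_atlas S) (base_metric S) x e \<longrightarrow> circ_proj S q = x \<longrightarrow>
          card {u. theta S u = (e, q)} = 2) \<and>
     (\<forall>u. \<forall>a\<in>spinc_group (gam S).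
          theta S (spin_act S u a) =
            (frame_act (fst (theta S u)) (fst (spinc_xi (gam S) a)),
             circ_act S (snd (theta S u)) (snd (spinc_xi (gam S) a))))"

text \<open>\<open>F\<^sub>A = dA\<close> is the pullback of \<open>i\<Omega>\<close> to the total space of the \<open>S\<^sup>1\<close>-bundle.\<close>

definition curv ::
  "('m, 'n::finite, 'p, 'e, 'q, 's::finite) spinc \<Rightarrow> 'm \<Rightarrow>
   ('m, real^'n) tvec \<Rightarrow> ('m, real^'n) tvec \<Rightarrow> real" where
  "curv S x X Y = (THE r. \<forall>q v w.
     circ_proj S q = x \<longrightarrow> tangent (circ_atlas S) q v \<longrightarrow> tangent (circ_atlas S) q w \<longrightarrow>
     push (circ_atlas S) (base_atlas S) (circ_proj S) q v = X \<longrightarrow>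
     push (circ_atlas S) (base_atlas S) (circ_proj S) q w = Y \<longrightarrow>
     ext_deriv (circ_atlas S) (conn S) q v w = \<i> * complex_of_real r)"

definition frame_at ::
  "('m, 'n::finite, 'p, 'e, 'q, 's::finite) spinc \<Rightarrow> 'm \<Rightarrow> 'n \<Rightarrow> ('m, real^'n) tvec" where
  "frame_at S x = (SOME e. orthonormal_frame (base_atlas S) (base_metric S) x e)"

text \<open>A sum over \<open>i < j\<close> is half the sum over all \<open>i \<noteq> j\<close> (no order is fixed on the index type).\<close>

definition curv_norm ::
  "('m, 'n::finite, 'p, 'e, 'q, 's::finite) spinc \<Rightarrow> 'm \<Rightarrow> real" where
  "curv_norm S x = sqrt ((\<Sum>i\<in>UNIV. \<Sum>j\<in>UNIV - {i}.
     (curv S x (frame_at S x i) (frame_at S x j))\<^sup>2) / 2)"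


section \<open>The spinor bundle\<close>

text \<open>The associated bundle \<open>\<Sigma>\<^sup>cM\<close>: its element \<open>[u,\<sigma>]\<close> is the class of \<open>(u,\<sigma>)\<close> under
  \<open>(ua,\<sigma>) \<sim> (u,a\<sigma>)\<close>, encoded as a set of pairs.\<close>

type_synonym ('p, 's) spinor = "('p \<times> (complex^'s)) set"

definition spinor_class ::
  "('m, 'n::finite, 'p, 'e, 'q, 's::finite) spinc \<Rightarrow> 'p \<Rightarrow> complex^'s \<Rightarrow> ('p, 's) spinor" where
  "spinor_class S u \<sigma> = {(spin_act S u a, \<tau>) | a \<tau>. a \<in> spinc_group (gam S) \<and> a *v \<tau> = \<sigma>}"

definition spinor_fibre ::
  "('m, 'n::finite, 'p, 'e, 'q, 's::finite) spinc \<Rightarrow> 'm \<Rightarrow> ('p, 's) spinor set" where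
  "spinor_fibre S x = {spinor_class S u \<sigma> | u \<sigma>. spin_proj S u = x}"

text \<open>The \<open>\<sigma>\<close> with \<open>c = [u,\<sigma>]\<close>.\<close>

definition spinor_coord :: "('p, 's::finite) spinor \<Rightarrow> 'p \<Rightarrow> complex^'s" where
  "spinor_coord c u = (THE \<sigma>. (u, \<sigma>) \<in> c)"

definition spinor_zero ::
  "('m, 'n::finite, 'p, 'e, 'q, 's::finite) spinc \<Rightarrow> 'm \<Rightarrow> ('p, 's) spinor" where
  "spinor_zero S x = {(u, 0) | u. spin_proj S u = x}"

definition spinor_add ::
  "('p, 's::finite) spinor \<Rightarrow> ('p, 's) spinor \<Rightarrow> ('p, 's) spinor" where
  "spinor_add c d = {(u, \<sigma> + \<tau>) | u \<sigma> \<tau>. (u, \<sigma>) \<in> c \<and> (u, \<tau>) \<in> d}"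

definition spinor_scale :: "complex \<Rightarrow> ('p, 's::finite) spinor \<Rightarrow> ('p, 's) spinor" where
  "spinor_scale z c = {(u, z *s \<sigma>) | u \<sigma>. (u, \<sigma>) \<in> c}"

definition spinor_herm :: "('p, 's::finite) spinor \<Rightarrow> ('p, 's) spinor \<Rightarrow> complex" where
  "spinor_herm c d = (THE z. \<forall>u \<sigma> \<tau>. (u, \<sigma>) \<in> c \<and> (u, \<tau>) \<in> d \<longrightarrow> z = hermitian \<sigma> \<tau>)"

definition spinor_norm2 :: "('p, 's::finite) spinor \<Rightarrow> real" where
  "spinor_norm2 c = Re (spinor_herm c c)"

text \<open>The components of \<open>X\<close> in the orthonormal frame underlying \<open>u\<close>.\<close>

definition frame_coords ::
  "('m, 'n::finite, 'p, 'e, 'q, 's::finite) spinc \<Rightarrow> 'p \<Rightarrow> ('m, real^'n) tvec \<Rightarrow> real^'n" where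
  "frame_coords S u X = (\<chi> i. base_metric S (spin_proj S u) X (fst (theta S u) i))"

definition cliff_mult ::
  "('m, 'n::finite, 'p, 'e, 'q, 's::finite) spinc \<Rightarrow> ('m, real^'n) tvec \<Rightarrow>
   ('p, 's) spinor \<Rightarrow> ('p, 's) spinor" where
  "cliff_mult S X c = {(u, clifford (gam S) (frame_coords S u X) *v \<sigma>) | u \<sigma>. (u, \<sigma>) \<in> c}"

text \<open>\<open>\<Omega> \<cdot> c\<close> for \<open>c\<close> in the fibre over \<open>x\<close>.\<close>

definition curv_mult ::
  "('m, 'n::finite, 'p, 'e, 'q, 's::finite) spinc \<Rightarrow> 'm \<Rightarrow> ('p, 's) spinor \<Rightarrow> ('p, 's) spinor" where
  "curv_mult S x c = {(u, (1/2) *\<^sub>R (\<Sum>i\<in>UNIV. \<Sum>j\<in>UNIV - {i}.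
       curv S x (fst (theta S u) i) (fst (theta S u) j) *\<^sub>R (gam S i *v (gam S j *v \<sigma>))))
     | u \<sigma>. (u, \<sigma>) \<in> c}"

definition local_section ::
  "('m::topological_space, 'n::finite, 'p::topological_space, 'e::euclidean_space, 'q, 's::finite) spinc
   \<Rightarrow> 'm set \<Rightarrow> ('m \<Rightarrow> 'p) \<Rightarrow> bool" where
  "local_section S U b \<longleftrightarrow> open U \<and> smooth_map (base_atlas S) (spin_atlas S) U b \<and>
     (\<forall>y\<in>U. spin_proj S (b y) = y)"

definition spinor_field ::
  "('m::topological_space, 'n::finite, 'p::topological_space, 'e::euclidean_space, 'q, 's::finite) spinc
   \<Rightarrow> ('m \<Rightarrow> ('p, 's) spinor) \<Rightarrow> bool" where
  "spinor_field S \<psi> \<longleftrightarrow> (\<forall>x. \<psi> x \<in> spinor_fibre S x) \<and>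
     (\<forall>U b. local_section S U b \<longrightarrow>
        smooth_map (base_atlas S) eucl_atlas U (\<lambda>y. spinor_coord (\<psi> y) (b y)))"

text \<open>The covariant derivative of \<open>\<psi> = [b,\<sigma>]\<close> in the direction \<open>X\<close>, where \<open>\<theta> \<circ> b = (e,s)\<close>; the
  result does not depend on the local section \<open>b\<close>.\<close>

definition nabla ::
  "('m::topological_space, 'n::finite, 'p::topological_space, 'e::euclidean_space, 'q, 's::finite) spinc
   \<Rightarrow> ('m \<Rightarrow> ('p, 's) spinor) \<Rightarrow> 'm \<Rightarrow> ('m, real^'n) tvec \<Rightarrow> ('p, 's) spinor" where
  "nabla S \<psi> x X =
     (let b = (SOME b. \<exists>U. x \<in> U \<and> local_section S U b);
          \<sigma> = (\<lambda>y. spinor_coord (\<psi> y) (b y));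
          e = (\<lambda>j y. fst (theta S (b y)) j);
          s = (\<lambda>y. snd (theta S (b y)))
      in spinor_class S (b x)
        (dir_deriv (base_atlas S) \<sigma> x X
         + (1/4) *\<^sub>R (\<Sum>j\<in>UNIV. gam S j *v
             (clifford (gam S)
               (frame_coords S (b x) (levi_civita (base_atlas S) (base_metric S) x X (e j))) *v \<sigma> x))
         + (1/2 * conn S (s x) (push (base_atlas S) (circ_atlas S) s x X)) *s \<sigma> x))"

definition dirac ::
  "('m::topological_space, 'n::finite, 'p::topological_space, 'e::euclidean_space, 'q, 's::finite) spinc
   \<Rightarrow> ('m \<Rightarrow> ('p, 's) spinor) \<Rightarrow> 'm \<Rightarrow> ('p, 's) spinor" where
  "dirac S \<psi> x =
     (let u = (SOME u. spin_proj S u = x)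
      in spinor_class S u
        (\<Sum>i\<in>UNIV. gam S i *v spinor_coord (nabla S \<psi> x (fst (theta S u) i)) u))"

definition eigenspinor ::
  "('m::topological_space, 'n::finite, 'p::topological_space, 'e::euclidean_space, 'q, 's::finite) spinc
   \<Rightarrow> complex \<Rightarrow> ('m \<Rightarrow> ('p, 's) spinor) \<Rightarrow> bool" where
  "eigenspinor S \<mu> \<psi> \<longleftrightarrow> spinor_field S \<psi> \<and> (\<exists>x. \<psi> x \<noteq> spinor_zero S x) \<and>
     (\<forall>x. dirac S \<psi> x = spinor_scale \<mu> (\<psi> x))"

text \<open>The spectrum of \<open>D\<close> is real; all complex eigenvalues are nevertheless taken into account.\<close>

definition first_eigenvalue ::
  "('m::topological_space, 'n::finite, 'p::topological_space, 'e::euclidean_space, 'q, 's::finite) spinc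
   \<Rightarrow> real \<Rightarrow> bool" where
  "first_eigenvalue S l \<longleftrightarrow> (\<exists>\<phi>. eigenspinor S (complex_of_real l) \<phi>) \<and>
     (\<forall>\<mu> \<phi>. eigenspinor S \<mu> \<phi> \<longrightarrow> \<bar>l\<bar> \<le> norm \<mu>)"

text \<open>The endomorphism \<open>\<ell>\<^sup>\<phi>\<close> at a point \<open>x\<close> with \<open>\<phi>(x) \<noteq> 0\<close>.\<close>

definition ell ::
  "('m::topological_space, 'n::finite, 'p::topological_space, 'e::euclidean_space, 'q, 's::finite) spinc
   \<Rightarrow> ('m \<Rightarrow> ('p, 's) spinor) \<Rightarrow> 'm \<Rightarrow> ('m, real^'n) tvec \<Rightarrow> ('m, real^'n) tvec" where
  "ell S \<phi> x X = (THE Z. tangent (base_atlas S) x Z \<and>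
     (\<forall>Y. tangent (base_atlas S) x Y \<longrightarrow>
        base_metric S x Z Y =
          1/2 * Re (spinor_herm
            (spinor_add (cliff_mult S X (nabla S \<phi> x Y)) (cliff_mult S Y (nabla S \<phi> x X)))
            (spinor_scale (complex_of_real (1 / spinor_norm2 (\<phi> x))) (\<phi> x)))))"

definition ell_norm2 ::
  "('m::topological_space, 'n::finite, 'p::topological_space, 'e::euclidean_space, 'q, 's::finite) spinc
   \<Rightarrow> ('m \<Rightarrow> ('p, 's) spinor) \<Rightarrow> 'm \<Rightarrow> real" where
  "ell_norm2 S \<phi> x = (\<Sum>i\<in>UNIV.
     base_metric S x (ell S \<phi> x (frame_at S x i)) (ell S \<phi> x (frame_at S x i)))"

definition c_const :: "nat \<Rightarrow> real" where
  "c_const n = 2 * sqrt (real (n div 2))"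

end

theory Submission
  imports Defs
begin

text \<open>No integration is needed. Put \<open>u = |\<psi>|\<^sup>2\<close>, \<open>f = S/4 - c\<^sub>n|\<Omega>|/4 + |\<ell>|\<^sup>2\<close> and
  \<open>P\<^sub>X\<psi> = \<nabla>\<^sub>X\<psi> + \<ell>(X)\<cdot>\<psi>\<close>. Pairing the Schroedinger-Lichnerowicz formula with \<open>\<psi>\<close> gives pointwise
  \<open>\<lambda>\<^sup>2u = |\<nabla>\<psi>|\<^sup>2 - \<Delta>u/2 + Su/4 + \<langle>i\<Omega>\<cdot>\<psi>,\<psi>\<rangle>/2\<close>, where \<open>\<Delta>\<close> is the trace of the Hessian. On \<open>{u > 0}\<close> one has
  \<open>|\<nabla>\<psi>|\<^sup>2 = |P\<psi>|\<^sup>2 + |\<ell>|\<^sup>2u\<close>, and \<open>r = \<langle>i\<Omega>\<cdot>\<psi>,\<psi>\<rangle> + c\<^sub>n|\<Omega>|u/2\<close> is nonnegative, with \<open>r = 0\<close> exactly when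
  \<open>i\<Omega>\<cdot>\<psi> = - c\<^sub>n|\<Omega>|\<psi>/2\<close>. Hence \<open>fu = \<lambda>\<^sup>2u + \<Delta>u/2 - |P\<psi>|\<^sup>2 - r/2\<close>. If \<open>\<lambda>\<^sup>2\<close> is the infimum of \<open>f\<close>, then
  \<open>\<Delta>u \<ge> 0\<close> on \<open>{u > 0}\<close>; by the strong maximum principle \<open>u\<close> is constant, so \<open>P\<psi> = 0\<close> and \<open>r = 0\<close>.
  Conversely \<open>P\<psi> = 0\<close> makes \<open>u\<close> locally constant on \<open>{u > 0}\<close>, and with \<open>r = 0\<close> this gives
  \<open>f = \<lambda>\<^sup>2\<close> there.\<close>

section \<open>Smooth functions on open subsets of Euclidean spaces\<close>

text \<open>The constant c_n comes from linear algebra: the numbers <i e_k e_l psi, psi> form an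
  antisymmetric matrix of operator norm at most |psi|^2 and rank at most 2[n/2], so Cauchy-Schwarz
  against Omega costs the factor c_n/2. The splitting of |nabla psi|^2 is Pythagoras: X -> -l(X).psi
  is the orthogonal projection of nabla psi onto the maps X -> L(X).psi with L symmetric. Zeros of
  psi obstruct a global argument, since l and the lower bound on f exist only off them; the maximum
  principle is therefore applied only near maximum points, where u > 0, and the set of these points
  is open and closed. Most of the work lies in reaching the pointwise formula. Connection, Dirac
  operator, curvature and l are given by choices and definite descriptions on quotient bundles,
  while the formula is a computation in an orthonormal frame on an open subset of R^n. The bridge is
  the independence of the covariant derivative of chart and section; its decisive point is that a
  skew operator commuting with the Clifford action and with i is a real multiple of i, which a trace
  detects.\<close>

abbreviation dd :: "('a::euclidean_space \<Rightarrow> 'b::real_normed_vector) \<Rightarrow> 'a \<Rightarrow> 'a \<Rightarrow> 'b" where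
  "dd f x \<equiv> frechet_derivative f (at x)"

lemma dd_works: "f differentiable (at x) \<Longrightarrow> (f has_derivative dd f x) (at x)"
  by (simp add: frechet_derivative_works)

lemma dd_eqI: "(f has_derivative f') (at x) \<Longrightarrow> dd f x = f'"
  by (metis frechet_derivative_at)

lemma linear_dd: "f differentiable (at x) \<Longrightarrow> linear (dd f x)"
  using dd_works has_derivative_linear by blast

lemma has_derivative_cong_open:
  assumes "open U" "x \<in> U" "\<And>y. y \<in> U \<Longrightarrow> f y = g y" "(f has_derivative f') (at x)"
  shows "(g has_derivative f') (at x)"
  using has_derivative_transform_within_open[OF assms(4,1,2)] assms(3) by blast

text \<open>\<open>frechet_derivative\<close> is a choice among the derivatives at x, and f and g
  have the same ones there, so the two choices coincide.\<close>

lemma dd_cong_open: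
  assumes "open U" "x \<in> U" "\<And>y. y \<in> U \<Longrightarrow> f y = g y"
  shows "dd f x = dd g x"
proof -
  have "(f has_derivative f') (at x) \<longleftrightarrow> (g has_derivative f') (at x)" for f'
    using assms has_derivative_cong_open[of U x f g f'] has_derivative_cong_open[of U x g f f'] by metis
  then show ?thesis unfolding frechet_derivative_def by presburger
qed

lemma differentiable_cong_open:
  assumes "open U" "x \<in> U" "\<And>y. y \<in> U \<Longrightarrow> f y = g y" "f differentiable (at x)"
  shows "g differentiable (at x)"
  using assms has_derivative_cong_open unfolding differentiable_def by metis

lemma ck_on_cong:
  assumes "open U" "\<And>y. y \<in> U \<Longrightarrow> f y = g y" "ck_on k U f"
  shows "ck_on k U g"
  using assms(2,3)
proof (induction k arbitrary: f g)
  case 0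
  then show ?case by (metis ck_on.simps(1) continuous_on_cong)
next
  case (Suc k)
  have "ck_on k U (\<lambda>x. dd g x v)" for v
  proof (rule Suc.IH)
    show "ck_on k U (\<lambda>x. dd f x v)" using Suc.prems by simp
    show "dd f y v = dd g y v" if "y \<in> U" for y
      using dd_cong_open[OF assms(1) that, of f g] Suc.prems by simp
  qed
  moreover have "g differentiable (at x)" if "x \<in> U" for x
    using differentiable_cong_open[OF assms(1) that, of f g] Suc.prems that by simp
  ultimately show ?case by simp
qed

lemma ck_on_mono: "ck_on k U f \<Longrightarrow> V \<subseteq> U \<Longrightarrow> ck_on k V f"
proof (induction k arbitrary: f)
  case 0
  then show ?case using continuous_on_subset by auto
qed auto

lemma ck_on_SucD: "ck_on (Suc k) U f \<Longrightarrow> ck_on k U f"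
proof (induction k arbitrary: f)
  case 0
  then show ?case
    by (auto intro!: continuous_at_imp_continuous_on differentiable_imp_continuous_within)
next
  case (Suc k)
  then show ?case by (metis ck_on.simps(2))
qed

lemma ck_on_local:
  assumes "\<And>x. x \<in> U \<Longrightarrow> \<exists>W. open W \<and> x \<in> W \<and> ck_on k W f"
  shows "ck_on k U f"
  using assms
proof (induction k arbitrary: f)
  case 0
  then have "\<And>x. x \<in> U \<Longrightarrow> isCont f x"
    by (metis ck_on.simps(1) continuous_on_eq_continuous_at)
  then show ?case by (simp add: continuous_at_imp_continuous_on)
next
  case (Suc k)
  have "ck_on k U (\<lambda>x. dd f x v)" for v
    using Suc.prems by (intro Suc.IH) (metis ck_on.simps(2))
  moreover have "f differentiable (at x)" if "x \<in> U" for x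
    using Suc.prems[OF that] by (auto simp: ck_on.simps(2))
  ultimately show ?case by simp
qed

lemma ck_on_const: "ck_on k U (\<lambda>x. c)"
  by (induction k arbitrary: c) auto

lemma ck_on_bounded_linear:
  assumes "bounded_linear L" "open U" "ck_on k U f"
  shows "ck_on k U (\<lambda>x. L (f x))"
  using assms(3)
proof (induction k arbitrary: f)
  case 0
  then show ?case using bounded_linear.continuous_on[OF assms(1)] by auto
next
  case (Suc k)
  have der: "((\<lambda>x. L (f x)) has_derivative (\<lambda>v. L (dd f x v))) (at x)" if "x \<in> U" for x
    using Suc.prems that by (intro bounded_linear.has_derivative[OF assms(1)] dd_works) simp
  have "ck_on k U (\<lambda>x. dd (\<lambda>x. L (f x)) x v)" for v
  proof (rule ck_on_cong[OF assms(2)])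
    show "ck_on k U (\<lambda>x. L (dd f x v))" using Suc by simp
  qed (simp add: dd_eqI[OF der])
  then show ?case using der by (auto simp: differentiable_def)
qed

lemma ck_on_add:
  assumes "open U" "ck_on k U f" "ck_on k U g"
  shows "ck_on k U (\<lambda>x. f x + g x)"
  using assms(2,3)
proof (induction k arbitrary: f g)
  case 0
  then show ?case by (auto intro: continuous_on_add)
next
  case (Suc k)
  have der: "((\<lambda>x. f x + g x) has_derivative (\<lambda>v. dd f x v + dd g x v)) (at x)" if "x \<in> U" for x
    using Suc.prems that by (intro has_derivative_add dd_works) simp_all
  have "ck_on k U (\<lambda>x. dd (\<lambda>x. f x + g x) x v)" for v
  proof (rule ck_on_cong[OF assms(1)])
    show "ck_on k U (\<lambda>x. dd f x v + dd g x v)" using Suc by simp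
  qed (simp add: dd_eqI[OF der])
  then show ?case using der by (auto simp: differentiable_def)
qed

lemma ck_on_bounded_bilinear:
  assumes "bounded_bilinear B" "open U" "ck_on k U f" "ck_on k U g"
  shows "ck_on k U (\<lambda>x. B (f x) (g x))"
  using assms(3,4)
proof (induction k arbitrary: f g)
  case 0
  then show ?case using bounded_bilinear.continuous_on[OF assms(1)] by auto
next
  case (Suc k)
  have der: "((\<lambda>x. B (f x) (g x)) has_derivative (\<lambda>v. B (f x) (dd g x v) + B (dd f x v) (g x))) (at x)"
    if "x \<in> U" for x
    using Suc.prems that by (intro bounded_bilinear.FDERIV[OF assms(1)] dd_works) simp_all
  have "ck_on k U (\<lambda>x. dd (\<lambda>x. B (f x) (g x)) x v)" for v
  proof (rule ck_on_cong[OF assms(2)])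
    show "ck_on k U (\<lambda>x. B (f x) (dd g x v) + B (dd f x v) (g x))"
      using Suc.prems(1)[THEN ck_on_SucD] Suc.prems(2)[THEN ck_on_SucD] Suc.prems
      by (intro ck_on_add[OF assms(2)] Suc.IH) simp_all
  qed (simp add: dd_eqI[OF der])
  then show ?case using der by (auto simp: differentiable_def)
qed

lemma ck_on_sum:
  assumes "open U" "\<And>i. i \<in> I \<Longrightarrow> ck_on k U (f i)"
  shows "ck_on k U (\<lambda>x. \<Sum>i\<in>I. f i x)"
  using assms(2) by (induction I rule: infinite_finite_induct)
    (simp_all add: ck_on_const ck_on_add[OF assms(1)])

lemma linear_eq_sum_Basis:
  fixes L :: "'a::euclidean_space \<Rightarrow> 'b::real_vector"
  assumes "linear L"
  shows "L v = (\<Sum>b\<in>Basis. (v \<bullet> b) *\<^sub>R L b)"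
proof -
  have "L v = L (\<Sum>b\<in>Basis. (v \<bullet> b) *\<^sub>R b)" by (simp add: euclidean_representation)
  also have "\<dots> = (\<Sum>b\<in>Basis. (v \<bullet> b) *\<^sub>R L b)"
    by (simp only: linear_sum[OF assms] linear_scale[OF assms])
  finally show ?thesis .
qed

lemma ck_on_compose:
  fixes f :: "'b::euclidean_space \<Rightarrow> 'c::real_normed_vector" and g :: "'a::euclidean_space \<Rightarrow> 'b"
  assumes "open U" "open V" "ck_on k V f" "ck_on k U g" "g ` U \<subseteq> V"
  shows "ck_on k U (\<lambda>x. f (g x))"
  using assms(3-5)
proof (induction k arbitrary: f g)
  case 0
  then show ?case using continuous_on_compose2 by auto
next
  case (Suc k)
  have der: "((\<lambda>x. f (g x)) has_derivative (\<lambda>v. dd f (g x) (dd g x v))) (at x)" if "x \<in> U" for x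
    using has_derivative_compose[OF dd_works dd_works, of g x f] Suc.prems that by auto
  have "ck_on k U (\<lambda>x. dd (\<lambda>x. f (g x)) x v)" for v
  proof (rule ck_on_cong[OF assms(1)])
    have g: "ck_on k U g" and gv: "ck_on k U (\<lambda>x. dd g x v)"
      using Suc.prems(2) ck_on_SucD[OF Suc.prems(2)] by simp_all
    \<comment> \<open>Expanded in a basis, the chain rule becomes a sum of products of composites,
      so the induction hypothesis applies to each \<open>dd f (g x) b\<close> with b fixed.\<close>
    show "ck_on k U (\<lambda>x. \<Sum>b\<in>Basis. (dd g x v \<bullet> b) *\<^sub>R dd f (g x) b)"
      using Suc.prems g gv
      by (intro ck_on_sum assms(1) ck_on_bounded_bilinear[OF bounded_bilinear_scaleR]
          ck_on_bounded_linear[OF bounded_linear_inner_left] Suc.IH) auto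
    show "(\<Sum>b\<in>Basis. (dd g x v \<bullet> b) *\<^sub>R dd f (g x) b) = dd (\<lambda>x. f (g x)) x v" if "x \<in> U" for x
    proof -
      have "linear (dd f (g x))" using Suc.prems that by (intro linear_dd) auto
      then show ?thesis by (simp add: dd_eqI[OF der[OF that]] linear_eq_sum_Basis[symmetric])
    qed
  qed
  then show ?case using der by (auto simp: differentiable_def)
qed

lemma smooth_on_cong:
  "open U \<Longrightarrow> (\<And>y. y \<in> U \<Longrightarrow> f y = g y) \<Longrightarrow> smooth_on U f \<Longrightarrow> smooth_on U g"
  unfolding smooth_on_def using ck_on_cong by metis

lemma smooth_on_mono: "smooth_on U f \<Longrightarrow> V \<subseteq> U \<Longrightarrow> smooth_on V f"
  unfolding smooth_on_def using ck_on_mono by blast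

lemma smooth_on_local:
  "(\<And>x. x \<in> U \<Longrightarrow> \<exists>W. open W \<and> x \<in> W \<and> smooth_on W f) \<Longrightarrow> smooth_on U f"
  unfolding smooth_on_def by (meson ck_on_local)

lemma smooth_on_differentiable: "smooth_on U f \<Longrightarrow> x \<in> U \<Longrightarrow> f differentiable (at x)"
  unfolding smooth_on_def by (metis ck_on.simps(2))

lemma smooth_on_has_derivative: "smooth_on U f \<Longrightarrow> x \<in> U \<Longrightarrow> (f has_derivative dd f x) (at x)"
  by (simp add: dd_works smooth_on_differentiable)

lemma smooth_on_continuous: "smooth_on U f \<Longrightarrow> continuous_on U f"
  unfolding smooth_on_def by (metis ck_on.simps(1))

lemma smooth_on_dd: "smooth_on U f \<Longrightarrow> smooth_on U (\<lambda>x. dd f x v)"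
  unfolding smooth_on_def by (metis ck_on.simps(2))

lemma smooth_on_const: "smooth_on U (\<lambda>x. c)"
  by (simp add: smooth_on_def ck_on_const)

lemma smooth_on_id: "smooth_on U (\<lambda>x. x)"
proof -
  have "ck_on k U (\<lambda>x. x)" for k
  proof (cases k)
    case (Suc m)
    have "dd (\<lambda>x. x) x = (\<lambda>v. v)" for x :: 'a by (rule dd_eqI) simp
    then show ?thesis by (simp add: Suc ck_on_const)
  qed simp
  then show ?thesis by (simp add: smooth_on_def)
qed

lemma smooth_on_bounded_linear:
  "bounded_linear L \<Longrightarrow> open U \<Longrightarrow> smooth_on U f \<Longrightarrow> smooth_on U (\<lambda>x. L (f x))"
  by (simp add: smooth_on_def ck_on_bounded_linear)

lemma smooth_on_bounded_bilinear:
  "bounded_bilinear B \<Longrightarrow> open U \<Longrightarrow> smooth_on U f \<Longrightarrow> smooth_on U g \<Longrightarrow> smooth_on U (\<lambda>x. B (f x) (g x))"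
  by (simp add: smooth_on_def ck_on_bounded_bilinear)

lemma smooth_on_add:
  "open U \<Longrightarrow> smooth_on U f \<Longrightarrow> smooth_on U g \<Longrightarrow> smooth_on U (\<lambda>x. f x + g x)"
  by (simp add: smooth_on_def ck_on_add)

lemma smooth_on_sum:
  "open U \<Longrightarrow> (\<And>i. i \<in> I \<Longrightarrow> smooth_on U (f i)) \<Longrightarrow> smooth_on U (\<lambda>x. \<Sum>i\<in>I. f i x)"
  by (simp add: smooth_on_def ck_on_sum)

lemma smooth_on_minus:
  "open U \<Longrightarrow> smooth_on U f \<Longrightarrow> smooth_on U (\<lambda>x. - f x)"
  using smooth_on_bounded_linear[OF bounded_linear_minus[OF bounded_linear_ident]] by blast

lemma smooth_on_diff:
  "open U \<Longrightarrow> smooth_on U f \<Longrightarrow> smooth_on U g \<Longrightarrow> smooth_on U (\<lambda>x. f x - g x)"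
  using smooth_on_add[of U f "\<lambda>x. - g x"] smooth_on_minus[of U g] by simp

lemmas smooth_on_scaleR = smooth_on_bounded_bilinear[OF bounded_bilinear_scaleR]
lemmas smooth_on_mult = smooth_on_bounded_bilinear[OF bounded_bilinear_mult]
lemmas smooth_on_inner = smooth_on_bounded_bilinear[OF bounded_bilinear_inner]
lemmas smooth_on_vec_nth = smooth_on_bounded_linear[OF bounded_linear_vec_nth]

lemma smooth_on_compose:
  "open U \<Longrightarrow> open V \<Longrightarrow> smooth_on V f \<Longrightarrow> smooth_on U g \<Longrightarrow> g ` U \<subseteq> V \<Longrightarrow> smooth_on U (\<lambda>x. f (g x))"
  by (simp add: smooth_on_def ck_on_compose)

lemma smooth_on_dd_field:
  assumes "open U" "smooth_on U f" "smooth_on U w"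
  shows "smooth_on U (\<lambda>x. dd f x (w x))"
proof (rule smooth_on_cong[OF assms(1)])
  show "smooth_on U (\<lambda>x. \<Sum>b\<in>Basis. (w x \<bullet> b) *\<^sub>R dd f x b)"
    using assms by (intro smooth_on_sum smooth_on_scaleR smooth_on_inner smooth_on_const smooth_on_dd)
  show "(\<Sum>b\<in>Basis. (w x \<bullet> b) *\<^sub>R dd f x b) = dd f x (w x)" if "x \<in> U" for x
    using linear_dd[OF smooth_on_differentiable[OF assms(2) that]] by (simp add: linear_eq_sum_Basis[symmetric])
qed

lemma smooth_on_vec_lambda:
  fixes f :: "'i::finite \<Rightarrow> 'a::euclidean_space \<Rightarrow> 'b::euclidean_space"
  assumes "open U" "\<And>i. smooth_on U (f i)"
  shows "smooth_on U (\<lambda>x. \<chi> i. f i x)"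
proof -
  have "(\<chi> i. f i x) = (\<Sum>i\<in>UNIV. axis i (f i x))" for x
    by (simp add: vec_eq_iff axis_def sum.delta if_distrib cong: if_cong)
  moreover have "bounded_linear (axis i :: 'b \<Rightarrow> 'b^'i)" for i
    by (intro linear_conv_bounded_linear[THEN iffD1] linearI) (auto simp: axis_def vec_eq_iff)
  ultimately show ?thesis
    using assms by (auto intro!: smooth_on_sum smooth_on_bounded_linear[where L = "axis _"])
qed

text \<open>Both iterated derivatives approximate the second difference
  \<open>f(x+s(v+w)) - f(x+sv) - f(x+sw) + f(x)\<close> to order \<open>s\<^sup>2\<close>.\<close>

lemma second_difference_bound:
  fixes f :: "'a::euclidean_space \<Rightarrow> 'b::real_normed_vector"
  assumes "open U" "smooth_on U f" "x \<in> U" "\<epsilon> > 0"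
  shows "\<forall>\<^sub>F s in at_right 0.
    norm (f (x + s *\<^sub>R v + s *\<^sub>R w) - f (x + s *\<^sub>R v) - f (x + s *\<^sub>R w) + f x - s\<^sup>2 *\<^sub>R dd (\<lambda>z. dd f z v) x w) \<le> \<epsilon> * s\<^sup>2"
proof -
  let ?B = "\<lambda>z. dd (\<lambda>z. dd f z v) z w"
  have "continuous_on U ?B" by (intro smooth_on_continuous smooth_on_dd assms)
  then have "isCont ?B x" using assms continuous_on_eq_continuous_at by blast
  then obtain d where d: "d > 0" "\<And>z. dist z x < d \<Longrightarrow> norm (?B z - ?B x) < \<epsilon>"
    unfolding continuous_at_eps_delta using assms(4) by (metis dist_norm)
  obtain r where r: "r > 0" "ball x r \<subseteq> U" using assms(1,3) open_contains_ball by blast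
  \<comment> \<open>For s below this bound the whole parallelogram spanned by s v and s w at x stays
    where the second derivative is close to its value at x; the summand 1 keeps the denominator
    positive when v and w vanish.\<close>
  define \<delta> where "\<delta> = min d r / (norm v + norm w + 1)"
  have nn: "norm v + norm w + 1 > 0" by (smt (verit) norm_ge_zero)
  then have "\<delta> > 0" using d r by (simp add: \<delta>_def)
  have close: "x + a *\<^sub>R v + b *\<^sub>R w \<in> U" "norm (?B (x + a *\<^sub>R v + b *\<^sub>R w) - ?B x) \<le> \<epsilon>"
    if "0 \<le> a" "a \<le> s" "0 \<le> b" "b \<le> s" "0 < s" "s < \<delta>" for a b s
  proof -
    have "norm (a *\<^sub>R v + b *\<^sub>R w) \<le> a * norm v + b * norm w"
      using norm_triangle_ineq[of "a *\<^sub>R v" "b *\<^sub>R w"] that by simp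
    also have "\<dots> \<le> s * norm v + s * norm w" using that by (intro add_mono mult_right_mono) auto
    also have "\<dots> \<le> s * (norm v + norm w + 1)" using that by (simp add: algebra_simps)
    also have "\<dots> < min d r" using that nn by (simp add: \<delta>_def pos_less_divide_eq)
    finally have *: "dist (x + a *\<^sub>R v + b *\<^sub>R w) x < min d r" by (simp add: dist_norm add.assoc)
    then show "x + a *\<^sub>R v + b *\<^sub>R w \<in> U" using r by (auto simp: dist_commute subset_eq)
    show "norm (?B (x + a *\<^sub>R v + b *\<^sub>R w) - ?B x) \<le> \<epsilon>" using * d(2) by (meson less_imp_le min_less_iff_conj)
  qed
  have f': "(f has_derivative dd f z) (at z)" if "z \<in> U" for z
    using smooth_on_has_derivative assms that by blast
  have f'': "((\<lambda>z. dd f z v) has_derivative dd (\<lambda>z. dd f z v) z) (at z)" if "z \<in> U" for z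
    using smooth_on_has_derivative smooth_on_dd assms that by blast
  have "norm (f (x + s *\<^sub>R v + s *\<^sub>R w) - f (x + s *\<^sub>R v) - f (x + s *\<^sub>R w) + f x - s\<^sup>2 *\<^sub>R ?B x) \<le> \<epsilon> * s\<^sup>2"
    if s: "0 < s" "s < \<delta>" for s
  proof -
    \<comment> \<open>The mean value inequality in the direction w, applied to the derivative along
      v. A second application, in the direction v, then yields the second difference.\<close>
    have 1: "norm (dd f (x + a *\<^sub>R v + s *\<^sub>R w) v - dd f (x + a *\<^sub>R v) v - s *\<^sub>R ?B x) \<le> \<epsilon> * s"
      if a: "a \<in> {0..s}" for a
    proof -
      let ?\<phi> = "\<lambda>b. dd f (x + a *\<^sub>R v + b *\<^sub>R w) v - b *\<^sub>R ?B x"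
      have "norm (?\<phi> s - ?\<phi> 0) \<le> \<epsilon> * norm (s - 0)"
      proof (rule differentiable_bound[of "{0..s}" ?\<phi> "\<lambda>b h. h *\<^sub>R (?B (x + a *\<^sub>R v + b *\<^sub>R w) - ?B x)"])
        fix b assume b: "b \<in> {0..s}"
        have U: "x + a *\<^sub>R v + b *\<^sub>R w \<in> U" using a b s close(1) by auto
        have lin: "linear (dd (\<lambda>z. dd f z v) (x + a *\<^sub>R v + b *\<^sub>R w))"
          using f''[OF U] has_derivative_linear by blast
        have "((\<lambda>b. x + a *\<^sub>R v + b *\<^sub>R w) has_derivative (\<lambda>h. h *\<^sub>R w)) (at b within {0..s})"
          by (auto intro!: derivative_eq_intros)
        from has_derivative_compose[OF this f''[OF U]]
        have "((\<lambda>b. dd f (x + a *\<^sub>R v + b *\<^sub>R w) v) has_derivative (\<lambda>h. h *\<^sub>R ?B (x + a *\<^sub>R v + b *\<^sub>R w))) (at b within {0..s})"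
          by (simp add: linear_scale[OF lin])
        from has_derivative_diff[OF this has_derivative_scaleR_left[OF has_derivative_ident, of "?B x"]]
        show "(?\<phi> has_derivative (\<lambda>h. h *\<^sub>R (?B (x + a *\<^sub>R v + b *\<^sub>R w) - ?B x))) (at b within {0..s})"
          by (simp add: algebra_simps)
        show "onorm (\<lambda>h. h *\<^sub>R (?B (x + a *\<^sub>R v + b *\<^sub>R w) - ?B x)) \<le> \<epsilon>"
          using close(2)[of a s b] a b s assms(4)
          by (intro onorm_le) (auto simp: mult.commute[of \<epsilon>] intro!: mult_left_mono)
      qed (use s in auto)
      then show ?thesis using s by (simp add: algebra_simps)
    qed
    let ?\<psi> = "\<lambda>a. f (x + a *\<^sub>R v + s *\<^sub>R w) - f (x + a *\<^sub>R v) - a *\<^sub>R (s *\<^sub>R ?B x)"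
    have "norm (?\<psi> s - ?\<psi> 0) \<le> (\<epsilon> * s) * norm (s - 0)"
    proof (rule differentiable_bound[of "{0..s}" ?\<psi>
          "\<lambda>a h. h *\<^sub>R (dd f (x + a *\<^sub>R v + s *\<^sub>R w) v - dd f (x + a *\<^sub>R v) v - s *\<^sub>R ?B x)"])
      fix a assume a: "a \<in> {0..s}"
      have U: "x + a *\<^sub>R v + s *\<^sub>R w \<in> U" "x + a *\<^sub>R v \<in> U"
        using a s close(1)[of a s s] close(1)[of a s 0] by auto
      have *: "((\<lambda>a. f (x + a *\<^sub>R v + c *\<^sub>R w)) has_derivative (\<lambda>h. h *\<^sub>R dd f (x + a *\<^sub>R v + c *\<^sub>R w) v)) (at a within {0..s})"
        if "x + a *\<^sub>R v + c *\<^sub>R w \<in> U" for c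
      proof -
        have lin: "linear (dd f (x + a *\<^sub>R v + c *\<^sub>R w))"
          using f'[OF that] has_derivative_linear by blast
        have "((\<lambda>a. x + a *\<^sub>R v + c *\<^sub>R w) has_derivative (\<lambda>h. h *\<^sub>R v)) (at a within {0..s})"
          by (auto intro!: derivative_eq_intros)
        from has_derivative_compose[OF this f'[OF that]] show ?thesis
          by (simp add: linear_scale[OF lin])
      qed
      from has_derivative_diff[OF has_derivative_diff[OF *[of s] *[of 0]] has_derivative_scaleR_left[OF has_derivative_ident, of "s *\<^sub>R ?B x"]] U
      show "(?\<psi> has_derivative (\<lambda>h. h *\<^sub>R (dd f (x + a *\<^sub>R v + s *\<^sub>R w) v - dd f (x + a *\<^sub>R v) v - s *\<^sub>R ?B x))) (at a within {0..s})"
        by (simp add: algebra_simps)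
      show "onorm (\<lambda>h. h *\<^sub>R (dd f (x + a *\<^sub>R v + s *\<^sub>R w) v - dd f (x + a *\<^sub>R v) v - s *\<^sub>R ?B x)) \<le> \<epsilon> * s"
        using 1[OF a] s assms(4)
        by (intro onorm_le) (auto simp: mult.commute[of "\<epsilon> * s"] intro!: mult_left_mono)
    qed (use s in auto)
    then show ?thesis using s by (simp add: algebra_simps power2_eq_square)
  qed
  then show ?thesis using \<open>\<delta> > 0\<close> unfolding eventually_at_right_field by auto
qed

lemma dd_dd_commute:
  fixes f :: "'a::euclidean_space \<Rightarrow> 'b::real_normed_vector"
  assumes "open U" "smooth_on U f" "x \<in> U"
  shows "dd (\<lambda>z. dd f z v) x w = dd (\<lambda>z. dd f z w) x v"
proof (rule ccontr)
  let ?B = "dd (\<lambda>z. dd f z v) x w" and ?C = "dd (\<lambda>z. dd f z w) x v"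
  assume "?B \<noteq> ?C"
  \<comment> \<open>One third, so that the two approximation errors together stay below the norm of
    the difference.\<close>
  then have pos: "norm (?B - ?C) / 3 > 0" by simp
  have "\<forall>\<^sub>F s in at_right 0. (0::real) < s" by (simp add: eventually_at_right_less)
  then have "\<forall>\<^sub>F s in at_right (0::real). False"
    using second_difference_bound[OF assms pos, of v w] second_difference_bound[OF assms pos, of w v]
  proof eventually_elim
    case (elim s)
    define X where "X = f (x + s *\<^sub>R v + s *\<^sub>R w) - f (x + s *\<^sub>R v) - f (x + s *\<^sub>R w) + f x"
    have Y: "X = f (x + s *\<^sub>R w + s *\<^sub>R v) - f (x + s *\<^sub>R w) - f (x + s *\<^sub>R v) + f x"
      by (simp add: X_def algebra_simps)
    have "s\<^sup>2 * norm (?B - ?C) = norm ((X - s\<^sup>2 *\<^sub>R ?C) - (X - s\<^sup>2 *\<^sub>R ?B))"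
      by (simp add: scaleR_diff_right[symmetric])
    also have "\<dots> \<le> norm (?B - ?C) / 3 * s\<^sup>2 + norm (?B - ?C) / 3 * s\<^sup>2"
      using elim(3)[folded Y] elim(2)[folded X_def] norm_triangle_ineq4[of "X - s\<^sup>2 *\<^sub>R ?C" "X - s\<^sup>2 *\<^sub>R ?B"]
      by linarith
    finally have "norm (?B - ?C) * s\<^sup>2 \<le> 0" by (simp add: algebra_simps)
    then show ?case using pos elim(1) by (simp add: mult_le_0_iff)
  qed
  then show False by simp
qed

section \<open>Derivatives of fields of linear maps\<close>

lemma dd_linear_combination:
  assumes "f differentiable (at y)" "g differentiable (at y)"
  shows "dd (\<lambda>z. a *\<^sub>R f z + b *\<^sub>R g z) y = (\<lambda>v. a *\<^sub>R dd f y v + b *\<^sub>R dd g y v)"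
  by (intro dd_eqI has_derivative_add has_derivative_scaleR_right dd_works assms)

lemma dd_sum:
  assumes "\<And>i. i \<in> I \<Longrightarrow> f i differentiable (at y)"
  shows "dd (\<lambda>z. \<Sum>i\<in>I. f i z) y = (\<lambda>v. \<Sum>i\<in>I. dd (f i) y v)"
  by (intro dd_eqI has_derivative_sum dd_works assms)

lemma dd_bounded_linear:
  assumes "bounded_linear L" "f differentiable (at y)"
  shows "dd (\<lambda>z. L (f z)) y = (\<lambda>v. L (dd f y v))"
  by (intro dd_eqI bounded_linear.has_derivative[OF assms(1)] dd_works assms)

lemma dd_vec_nth:
  fixes f :: "'a::euclidean_space \<Rightarrow> real^'i"
  assumes "f differentiable (at y)"
  shows "dd (\<lambda>z. f z $ i) y = (\<lambda>v. dd f y v $ i)"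
  by (rule dd_bounded_linear[OF bounded_linear_vec_nth assms])

text \<open>In finite dimension a field of linear maps is a finite sum over a basis, so
  differentiability of \<open>T z v\<close> for each fixed v already yields the product rule. It
  serves wherever a form or a derivative is evaluated along a moving frame.\<close>

lemma dd_field:
  fixes T :: "'a::euclidean_space \<Rightarrow> 'c::euclidean_space \<Rightarrow> 'b::real_normed_vector"
  assumes V: "open V" "y \<in> V" and lin: "\<And>z. z \<in> V \<Longrightarrow> linear (T z)"
    and T: "\<And>v. (\<lambda>z. T z v) differentiable (at y)" and a: "a differentiable (at y)"
  shows "((\<lambda>z. T z (a z)) has_derivative (\<lambda>X. dd (\<lambda>z. T z (a y)) y X + T y (dd a y X))) (at y)"
proof -
  have rep: "T z v = (\<Sum>b\<in>Basis. (v \<bullet> b) *\<^sub>R T z b)" if "z \<in> V" for z v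
    using linear_eq_sum_Basis[OF lin[OF that]] .
  have "((\<lambda>z. \<Sum>b\<in>Basis. (a z \<bullet> b) *\<^sub>R T z b) has_derivative
      (\<lambda>X. \<Sum>b\<in>Basis. (a y \<bullet> b) *\<^sub>R dd (\<lambda>z. T z b) y X + (dd a y X \<bullet> b) *\<^sub>R T y b)) (at y)"
    by (intro has_derivative_sum has_derivative_scaleR has_derivative_inner_left dd_works T a)
  moreover have "dd (\<lambda>z. T z (a y)) y X = (\<Sum>b\<in>Basis. (a y \<bullet> b) *\<^sub>R dd (\<lambda>z. T z b) y X)" for X
  proof -
    have "((\<lambda>z. \<Sum>b\<in>Basis. (a y \<bullet> b) *\<^sub>R T z b) has_derivative
        (\<lambda>X. \<Sum>b\<in>Basis. (a y \<bullet> b) *\<^sub>R dd (\<lambda>z. T z b) y X)) (at y)"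
      by (intro has_derivative_sum has_derivative_scaleR_right dd_works T)
    then have "((\<lambda>z. T z (a y)) has_derivative (\<lambda>X. \<Sum>b\<in>Basis. (a y \<bullet> b) *\<^sub>R dd (\<lambda>z. T z b) y X)) (at y)"
      by (rule has_derivative_cong_open[OF V, rotated]) (simp add: rep[symmetric])
    then show ?thesis by (simp add: dd_eqI)
  qed
  ultimately have "((\<lambda>z. \<Sum>b\<in>Basis. (a z \<bullet> b) *\<^sub>R T z b) has_derivative
      (\<lambda>X. dd (\<lambda>z. T z (a y)) y X + T y (dd a y X))) (at y)"
    using V(2) by (simp add: sum.distrib rep[symmetric])
  then show ?thesis
    by (rule has_derivative_cong_open[OF V, rotated]) (simp add: rep[symmetric])
qed

lemma smooth_on_field:
  fixes T :: "'a::euclidean_space \<Rightarrow> 'c::euclidean_space \<Rightarrow> 'b::real_normed_vector"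
  assumes "open V" "\<And>z. z \<in> V \<Longrightarrow> linear (T z)" "\<And>v. smooth_on V (\<lambda>z. T z v)" "smooth_on V a"
  shows "smooth_on V (\<lambda>z. T z (a z))"
proof (rule smooth_on_cong[OF assms(1)])
  show "smooth_on V (\<lambda>z. \<Sum>b\<in>Basis. (a z \<bullet> b) *\<^sub>R T z b)"
    using assms by (intro smooth_on_sum smooth_on_scaleR smooth_on_inner smooth_on_const)
  show "(\<Sum>b\<in>Basis. (a z \<bullet> b) *\<^sub>R T z b) = T z (a z)" if "z \<in> V" for z
    using linear_eq_sum_Basis[OF assms(2)[OF that], of "a z"] by simp
qed

section \<open>Clifford modules\<close>

text \<open>If S x were nonzero, moving from x in the direction - S x would make the quadratic form
  negative to first order.\<close>

lemma psd_kernel: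
  fixes S :: "'a::real_inner \<Rightarrow> 'a"
  assumes "linear S" "\<And>x y. S x \<bullet> y = x \<bullet> S y" "\<And>x. S x \<bullet> x \<ge> 0" "S x \<bullet> x = 0"
  shows "S x = 0"
proof -
  define b where "b = S x \<bullet> S x"
  define c where "c = S (S x) \<bullet> S x"
  have *: "2 * t * b + t\<^sup>2 * c \<ge> 0" for t
  proof -
    have "0 \<le> S (x + t *\<^sub>R S x) \<bullet> (x + t *\<^sub>R S x)" by (rule assms(3))
    also have "\<dots> = 2 * t * b + t\<^sup>2 * c"
      using assms(2)[of x "S x"] assms(2)[of "S x" x] assms(4)
      by (simp add: linear_add[OF assms(1)] linear_scale[OF assms(1)] inner_simps b_def c_def
          power2_eq_square inner_commute algebra_simps)
    finally show ?thesis .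
  qed
  have "c \<ge> 0" by (simp add: c_def assms(3))
  have "b = 0"
  proof (rule ccontr)
    assume "b \<noteq> 0"
    then have "b > 0" by (simp add: b_def)
    have "2 * (- b / (c + 1)) * b + (- b / (c + 1))\<^sup>2 * c = b\<^sup>2 * (- 2 * (c + 1) + c) / (c + 1)\<^sup>2"
      using \<open>c \<ge> 0\<close> by (simp add: divide_simps power2_eq_square) (simp add: algebra_simps)?
    also have "\<dots> < 0" using \<open>b > 0\<close> \<open>c \<ge> 0\<close> by (simp add: divide_neg_pos mult_pos_neg)
    finally show False using *[of "- b / (c + 1)"] by linarith
  qed
  then show ?thesis by (simp add: b_def)
qed

text \<open>An antisymmetric matrix has even rank, so at most 2[n/2] singular values, each at most
  c, contribute to the Frobenius norm. For odd n the determinant vanishes, and a unit kernel vector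
  v accounts for the missing singular value. This is the origin of [n/2] in c_n.\<close>

lemma antisymmetric_frobenius_bound:
  fixes M :: "real^'n^'n::finite"
  assumes anti: "\<And>i j. M $ i $ j = - M $ j $ i" and bound: "\<And>x. norm (M *v x) \<le> c * norm x" and "c \<ge> 0"
  shows "(\<Sum>i\<in>UNIV. \<Sum>j\<in>UNIV. (M $ i $ j)\<^sup>2) \<le> 2 * real (CARD('n) div 2) * c\<^sup>2"
proof -
  have col: "(\<Sum>i\<in>UNIV. (M $ i $ j)\<^sup>2) = (norm (M *v axis j 1))\<^sup>2" for j
    unfolding power2_norm_eq_inner
    by (simp add: matrix_vector_mult_basis column_def inner_vec_def power2_eq_square)
  have tot: "(\<Sum>i\<in>UNIV. \<Sum>j\<in>UNIV. (M $ i $ j)\<^sup>2) = (\<Sum>j\<in>UNIV. (norm (M *v axis j 1))\<^sup>2)"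
    by (subst sum.swap) (simp add: col)
  have sq: "(norm (M *v x))\<^sup>2 \<le> c\<^sup>2 * (norm x)\<^sup>2" for x
    using power_mono[OF bound, of x 2] by (simp add: power_mult_distrib)
  show ?thesis
  proof (cases "even CARD('n)")
    case True
    have "(\<Sum>j\<in>UNIV. (norm (M *v axis j 1))\<^sup>2) \<le> (\<Sum>j\<in>(UNIV::'n set). c\<^sup>2)"
      using sq[of "axis _ 1"] by (intro sum_mono) simp
    also have "\<dots> = real (2 * (CARD('n) div 2)) * c\<^sup>2" using True by simp
    finally show ?thesis by (simp add: tot)
  next
    case False
    have "M = (\<chi> i. (-1) *s transpose M $ i)" by (simp add: vec_eq_iff transpose_def) (metis anti)
    then have "det M = det (\<chi> i. (-1) *s transpose M $ i)" by simp
    also have "\<dots> = (-1) ^ CARD('n) * det M" by (subst det_rows_mul) (simp add: vec_lambda_eta)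
    finally have "det M = 0" using False by simp
    then obtain v0 where v0: "v0 \<noteq> 0" "M *v v0 = 0"
      using invertible_det_nz[of M] invertible_left_inverse[of M] matrix_left_invertible_ker[of M] by auto
    define v where "v = v0 /\<^sub>R norm v0"
    have v: "v \<bullet> v = 1" "M *v v = 0"
      using v0 by (simp_all add: v_def matrix_vector_mult_scaleR dot_square_norm power2_eq_square field_simps)
    have "(norm (M *v axis j 1))\<^sup>2 \<le> c\<^sup>2 * (1 - (v $ j)\<^sup>2)" for j
    proof -
      \<comment> \<open>Removing the component along the kernel vector leaves the image unchanged
        and lowers the squared length by the square of \<open>v $ j\<close>; these squares add up to
        1.\<close>
      let ?w = "axis j 1 - v $ j *\<^sub>R v"
      have "M *v axis j 1 = M *v ?w"
        using v by (simp add: matrix_vector_mult_diff_distrib matrix_vector_mult_scaleR)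
      moreover have "(norm ?w)\<^sup>2 = 1 - (v $ j)\<^sup>2"
        unfolding power2_norm_eq_inner
        using v by (simp add: inner_simps inner_axis inner_axis' power2_eq_square)
      ultimately show ?thesis using sq[of ?w] by simp
    qed
    then have "(\<Sum>j\<in>UNIV. (norm (M *v axis j 1))\<^sup>2) \<le> (\<Sum>j\<in>UNIV. c\<^sup>2 * (1 - (v $ j)\<^sup>2))" by (rule sum_mono)
    also have "\<dots> = c\<^sup>2 * (real CARD('n) - (\<Sum>j\<in>UNIV. (v $ j)\<^sup>2))"
      by (simp add: sum_distrib_left[symmetric] sum_subtractf)
    also have "(\<Sum>j\<in>UNIV. (v $ j)\<^sup>2) = 1" using v by (simp add: inner_vec_def power2_eq_square)
    also have "real CARD('n) - 1 = 2 * real (CARD('n) div 2)"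
      using odd_two_times_div_two_succ[OF False] by linarith
    finally show ?thesis by (simp add: tot mult.commute)
  qed
qed

text \<open>The spinor module as a real Euclidean space: J plays the role of multiplication by i,
  and skew-Hermitian operators become skew for the real inner product.\<close>

locale clifford_ops =
  fixes \<gamma> :: "'n::finite \<Rightarrow> 'a::euclidean_space \<Rightarrow> 'a" and J :: "'a \<Rightarrow> 'a"
  assumes linear_gam: "linear (\<gamma> i)" and linear_J: "linear J"
    and gam_rel: "\<gamma> i (\<gamma> j x) + \<gamma> j (\<gamma> i x) = (if i = j then -2 else 0) *\<^sub>R x"
    and gam_skew: "\<gamma> i x \<bullet> y = - (x \<bullet> \<gamma> i y)"
    and J_sq: "J (J x) = - x" and J_skew: "J x \<bullet> y = - (x \<bullet> J y)"
    and J_gam: "J (\<gamma> i x) = \<gamma> i (J x)"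
begin

lemmas gam_lin = linear_add[OF linear_gam] linear_diff[OF linear_gam] linear_scale[OF linear_gam]
  linear_sum[OF linear_gam] linear_0[OF linear_gam] linear_neg[OF linear_gam]
lemmas J_lin = linear_add[OF linear_J] linear_diff[OF linear_J] linear_scale[OF linear_J]
  linear_sum[OF linear_J] linear_0[OF linear_J] linear_neg[OF linear_J]

lemma gam_sq: "\<gamma> i (\<gamma> i x) = - x"
proof -
  have "2 *\<^sub>R \<gamma> i (\<gamma> i x) = 2 *\<^sub>R (- x)" using gam_rel[of i i x] by (simp add: scaleR_2)
  then show ?thesis by (simp only: scaleR_cancel_left) simp
qed

lemma gam_swap: "i \<noteq> j \<Longrightarrow> \<gamma> i (\<gamma> j x) = - \<gamma> j (\<gamma> i x)"
  using gam_rel[of i j x] by (simp add: add_eq_0_iff)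

definition cl :: "real^'n \<Rightarrow> 'a \<Rightarrow> 'a" where "cl v x = (\<Sum>i\<in>UNIV. v $ i *\<^sub>R \<gamma> i x)"

lemma cl_skew: "cl v x \<bullet> y = - (x \<bullet> cl v y)"
  by (simp add: cl_def inner_sum_left inner_sum_right gam_skew sum_negf)

lemma cl_rel: "cl v (cl w x) + cl w (cl v x) = (-2 * (v \<bullet> w)) *\<^sub>R x"
proof -
  have 1: "cl v (cl w x) = (\<Sum>i\<in>UNIV. \<Sum>j\<in>UNIV. (v $ i * w $ j) *\<^sub>R \<gamma> i (\<gamma> j x))" for v w
    by (simp add: cl_def gam_lin scaleR_sum_right)
  have "cl w (cl v x) = (\<Sum>i\<in>UNIV. \<Sum>j\<in>UNIV. (v $ i * w $ j) *\<^sub>R \<gamma> j (\<gamma> i x))"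
    unfolding 1 by (subst sum.swap) (simp add: mult.commute)
  then have "cl v (cl w x) + cl w (cl v x) =
      (\<Sum>i\<in>UNIV. \<Sum>j\<in>UNIV. (v $ i * w $ j) *\<^sub>R (\<gamma> i (\<gamma> j x) + \<gamma> j (\<gamma> i x)))"
    by (simp add: 1 sum.distrib[symmetric] scaleR_add_right)
  also have "\<dots> = (\<Sum>i\<in>UNIV. \<Sum>j\<in>UNIV. if i = j then (-2 * (v $ i * w $ i)) *\<^sub>R x else 0)"
    by (intro sum.cong refl) (simp add: gam_rel)
  also have "\<dots> = (-2 * (v \<bullet> w)) *\<^sub>R x"
    by (simp add: inner_vec_def scaleR_sum_left sum_negf sum_distrib_left)
  finally show ?thesis .
qed

lemma cl_sq: "cl v (cl v x) = - ((v \<bullet> v) *\<^sub>R x)"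
proof -
  have "2 *\<^sub>R cl v (cl v x) = 2 *\<^sub>R (- ((v \<bullet> v) *\<^sub>R x))" using cl_rel[of v v x] by (simp add: scaleR_2)
  then show ?thesis by (simp only: scaleR_cancel_left) simp
qed

lemma cl_inner: "cl v x \<bullet> cl v x = (v \<bullet> v) * (x \<bullet> x)"
  by (simp add: cl_skew[of v x] cl_sq)

text \<open>Each pair \<open>\<gamma>\<^sub>a\<gamma>\<^sub>b\<close> splits an invariant subspace into two eigenspaces exchanged by \<open>\<gamma>\<^sub>b\<close>, which
  doubles the dimension.\<close>

lemma invariant_dim:
  assumes "subspace W" "W \<noteq> {0}" "inj_on f {..<2 * k}" "\<And>x. x \<in> W \<Longrightarrow> J x \<in> W"
    "\<And>i x. i < 2 * k \<Longrightarrow> x \<in> W \<Longrightarrow> \<gamma> (f i) x \<in> W"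
  shows "2 ^ Suc k \<le> dim W"
  using assms
proof (induction k arbitrary: W)
  case 0
  then obtain w where w: "w \<in> W" "w \<noteq> 0" using subspace_0 by blast
  \<comment> \<open>The base case starts from a real plane, since J gives W a complex
    structure.\<close>
  have orth: "w \<bullet> J w = 0" using J_skew[of w w] by (simp add: inner_commute)
  have "J w \<noteq> 0" using J_sq[of w] w J_lin(5) by fastforce
  moreover have "w \<noteq> J w" using orth w by auto
  ultimately have "independent {w, J w}"
    using w orth by (intro pairwise_orthogonal_independent) (auto simp: pairwise_def orthogonal_def inner_commute)
  then have "card {w, J w} \<le> dim W"
    using w 0 by (intro independent_card_le_dim) auto
  then show ?case using \<open>w \<noteq> J w\<close> by simp
next
  case (Suc k)
  define A where "A = \<gamma> (f (2 * k))"
  define B where "B = \<gamma> (f (2 * k + 1))"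
  have ne: "f (2 * k) \<noteq> f (2 * k + 1)" using inj_onD[OF Suc.prems(3), of "2 * k" "2 * k + 1"] by auto
  have AB: "A (B x) = - B (A x)" for x using gam_swap[OF ne] by (simp add: A_def B_def)
  have AA: "A (A x) = - x" "B (B x) = - x" for x by (simp_all add: A_def B_def gam_sq)
  have JA: "J (A x) = A (J x)" "J (B x) = B (J x)" for x by (simp_all add: A_def B_def J_gam)
  have lin: "linear A" "linear B" by (simp_all add: A_def B_def linear_gam)
  note L = linear_add[OF lin(1)] linear_scale[OF lin(1)] linear_neg[OF lin(1)] linear_0[OF lin(1)] linear_diff[OF lin(1)]
    linear_add[OF lin(2)] linear_scale[OF lin(2)] linear_neg[OF lin(2)] linear_0[OF lin(2)] linear_diff[OF lin(2)] J_lin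
  \<comment> \<open>A B squares to -1, J squares to -1 and commutes with both, so E is an
    involution. It commutes with J and the remaining generators, whereas B anticommutes with it and
    exchanges its eigenspaces.\<close>
  define E where "E x = J (A (B x))" for x
  have EE: "E (E x) = x" for x by (simp add: E_def JA L AB AA J_sq)
  have linE: "linear E" unfolding E_def by (intro linearI) (simp_all add: L)
  have EW: "E x \<in> W" "A x \<in> W" "B x \<in> W" if "x \<in> W" for x
    using Suc.prems(4,5) that by (auto simp: E_def A_def B_def)
  define Wp where "Wp = {x \<in> W. E x = x}"
  define Wm where "Wm = {x \<in> W. E x = - x}"
  have sub: "subspace Wp" "subspace Wm"
    using Suc.prems(1) unfolding Wp_def Wm_def subspace_def
    by (auto simp: linear_add[OF linE] linear_scale[OF linE] linear_0[OF linE])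
  have BE: "E (B x) = - B (E x)" for x by (simp add: E_def JA L AB AA J_sq)
  have Bpm: "B x \<in> Wm" if "x \<in> Wp" for x using that EW by (auto simp: Wp_def Wm_def BE)
  have Bmp: "B x \<in> Wp" if "x \<in> Wm" for x using that EW by (auto simp: Wp_def Wm_def BE L)
  have Wp0: "Wp \<noteq> {0}"
  proof
    assume "Wp = {0}"
    have "x = 0" if "x \<in> W" for x
    proof -
      \<comment> \<open>If \<open>Wp\<close> is trivial, so is the other eigenspace, because B
        carries it injectively into \<open>Wp\<close>; then x is the sum of two vanishing
        parts.\<close>
      have "x + E x \<in> Wp" "B (x - E x) \<in> Wp"
        using that EW Suc.prems(1) unfolding Wp_def
        by (auto simp: subspace_add subspace_diff linear_add[OF linE] linear_diff[OF linE] EE BE L)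
      then have "x + E x = 0" "B (x - E x) = 0" using \<open>Wp = {0}\<close> by auto
      then have "x + E x = 0" "x - E x = 0" using AA(2)[of "x - E x"] by (auto simp: L)
      then have "x + x = 0" by (metis add_0 add_diff_cancel_right' add_left_cancel diff_add_cancel)
      then show ?thesis by (simp add: scaleR_2[symmetric])
    qed
    then show False using Suc.prems(1,2) subspace_0 by blast
  qed
  have comm: "E (\<gamma> (f i) x) = \<gamma> (f i) (E x)" if "i < 2 * k" for i x
  proof -
    have "f (2 * k) \<noteq> f i" "f (2 * k + 1) \<noteq> f i"
      using inj_onD[OF Suc.prems(3), of i "2 * k"] inj_onD[OF Suc.prems(3), of i "2 * k + 1"] that by auto
    then have "A (\<gamma> (f i) y) = - \<gamma> (f i) (A y)" "B (\<gamma> (f i) y) = - \<gamma> (f i) (B y)" for y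
      unfolding A_def B_def by (metis gam_swap)+
    then show ?thesis by (simp add: E_def L gam_lin J_gam)
  qed
  have "2 ^ Suc k \<le> dim Wp"
  proof (rule Suc.IH[OF sub(1) Wp0])
    show "inj_on f {..<2 * k}" using Suc.prems(3) by (rule inj_on_subset) auto
    show "J x \<in> Wp" if "x \<in> Wp" for x
      using that Suc.prems(4)[of x] by (simp add: Wp_def E_def JA[symmetric])
    show "\<gamma> (f i) x \<in> Wp" if "i < 2 * k" "x \<in> Wp" for i x
      using that Suc.prems(5)[of i x] by (simp add: Wp_def comm)
  qed
  moreover have "dim Wp \<le> dim Wm"
  proof -
    have "inj_on B (span Wp)" by (metis AA(2) inj_onI minus_equation_iff)
    then have "dim (B ` Wp) = dim Wp" using lin(2) by (intro dim_image_eq)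
    then show ?thesis using dim_subset[of "B ` Wp" Wm] Bpm by auto
  qed
  moreover have "dim Wp + dim Wm \<le> dim W"
  proof -
    have "Wp \<inter> Wm = {0}"
      using subspace_0[OF sub(1)] subspace_0[OF sub(2)] by (auto simp: Wp_def Wm_def eq_neg_iff_add_eq_0 scaleR_2[symmetric])
    then have "dim {x + y | x y. x \<in> Wp \<and> y \<in> Wm} = dim Wp + dim Wm"
      using dim_sums_Int[OF sub] by simp
    moreover have "dim {x + y | x y. x \<in> Wp \<and> y \<in> Wm} \<le> dim W"
      using Suc.prems(1) by (intro dim_subset) (auto simp: Wp_def Wm_def subspace_add)
    ultimately show ?thesis by simp
  qed
  ultimately show ?case by simp
qed

text \<open>Schur's lemma in real form: the maximum of the Rayleigh quotient is an eigenvalue, its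
  eigenspace is invariant under J and all generators, and \<open>invariant_dim\<close> forces this
  eigenspace to be everything.\<close>

lemma symmetric_commutant:
  assumes dimension: "DIM('a) = 2 * 2 ^ (CARD('n) div 2)"
    and S: "linear S" "\<And>x y. S x \<bullet> y = x \<bullet> S y" "\<And>i x. S (\<gamma> i x) = \<gamma> i (S x)" "\<And>x. S (J x) = J (S x)"
  shows "\<exists>\<mu>. \<forall>x. S x = \<mu> *\<^sub>R x"
proof -
  have "continuous_on (sphere 0 1) (\<lambda>x. S x \<bullet> x)"
    using S(1) by (intro continuous_intros linear_continuous_on) (simp add: linear_conv_bounded_linear)
  moreover have "sphere (0::'a) 1 \<noteq> {}" by simp
  ultimately obtain x0 where x0: "x0 \<in> sphere 0 1" "\<And>y. y \<in> sphere 0 1 \<Longrightarrow> S y \<bullet> y \<le> S x0 \<bullet> x0"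
    using continuous_attains_sup[of "sphere 0 1" "\<lambda>x. S x \<bullet> x"] compact_sphere by blast
  define \<mu> where "\<mu> = S x0 \<bullet> x0"
  define T where "T x = \<mu> *\<^sub>R x - S x" for x
  have linT: "linear T" unfolding T_def by (intro linearI) (simp_all add: linear_add[OF S(1)] linear_scale[OF S(1)] algebra_simps)
  have pos: "T x \<bullet> x \<ge> 0" for x
  proof (cases "x = 0")
    case True then show ?thesis by simp
  next
    case False
    have "S (x /\<^sub>R norm x) \<bullet> (x /\<^sub>R norm x) \<le> \<mu>" unfolding \<mu>_def using False by (intro x0(2)) simp
    then have "(S x \<bullet> x) / (norm x)\<^sup>2 \<le> \<mu>" by (simp add: linear_scale[OF S(1)] power2_eq_square divide_simps)
    then have "S x \<bullet> x \<le> \<mu> * (norm x)\<^sup>2" using False by (simp add: divide_simps)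
    then show ?thesis by (simp add: T_def inner_simps power2_norm_eq_inner)
  qed
  have "T x0 = 0"
  proof (rule psd_kernel[OF linT _ pos])
    show "T x \<bullet> y = x \<bullet> T y" for x y by (simp add: T_def inner_simps S(2))
    show "T x0 \<bullet> x0 = 0" using x0(1) by (simp add: T_def inner_simps \<mu>_def dot_square_norm)
  qed
  define W where "W = {x. T x = 0}"
  have sub: "subspace W" unfolding W_def using linT by (rule linear_subspace_kernel)
  have "x0 \<in> W" "x0 \<noteq> 0" using \<open>T x0 = 0\<close> x0(1) by (auto simp: W_def)
  then have "W \<noteq> {0}" by blast
  obtain h :: "nat \<Rightarrow> 'n" where h: "bij_betw h {..<CARD('n)} UNIV"
    using ex_bij_betw_nat_finite[OF finite, of "UNIV :: 'n set"] by (auto simp: atLeast0LessThan)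
  \<comment> \<open>For odd n one generator is left out; the other 2[n/2] already force the full
    dimension.\<close>
  have "inj_on h {..<2 * (CARD('n) div 2)}"
    using bij_betw_imp_inj_on[OF h] by (rule inj_on_subset) auto
  then have "2 ^ Suc (CARD('n) div 2) \<le> dim W"
    by (rule invariant_dim[OF sub \<open>W \<noteq> {0}\<close>]) (simp_all add: W_def T_def S(3,4) gam_lin(3)[symmetric] J_lin(3)[symmetric])
  then have "dim W = DIM('a)" using dim_subset_UNIV[of W] dimension by simp
  then have "span W = UNIV" by (simp add: dim_eq_full)
  then have "W = UNIV" using sub by (simp add: span_eq_iff[THEN iffD2])
  then have "T x = 0" for x by (auto simp: W_def)
  then show ?thesis by (intro exI[of _ \<mu>]) (simp add: T_def)
qed

text \<open>The composite of J and T is symmetric and has the same commutation properties, so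
  \<open>symmetric_commutant\<close> makes it a real scalar.\<close>

lemma skew_commutant:
  assumes dimension: "DIM('a) = 2 * 2 ^ (CARD('n) div 2)"
    and T: "linear T" "\<And>x y. T x \<bullet> y = - (x \<bullet> T y)" "\<And>i x. T (\<gamma> i x) = \<gamma> i (T x)" "\<And>x. T (J x) = J (T x)"
  shows "\<exists>\<mu>. \<forall>x. T x = \<mu> *\<^sub>R J x"
proof -
  have "\<exists>\<mu>. \<forall>x. J (T x) = \<mu> *\<^sub>R x"
    by (rule symmetric_commutant[OF dimension])
      (auto intro!: linearI simp: linear_add[OF T(1)] linear_scale[OF T(1)] J_lin T(2-4) J_skew J_gam)
  then obtain \<mu> where "\<And>x. J (T x) = \<mu> *\<^sub>R x" by blast
  then have "- T x = \<mu> *\<^sub>R J x" for x by (metis J_lin(3) J_sq)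
  then show ?thesis by (intro exI[of _ "- \<mu>"]) (metis minus_equation_iff scaleR_left.minus)
qed

text \<open>Clifford multiplication by i\<Omega>. The factor 1/2 converts the sum over all ordered
  pairs into the sum over i < j for an antisymmetric \<Omega>.\<close>

definition form_op :: "('n \<Rightarrow> 'n \<Rightarrow> real) \<Rightarrow> 'a \<Rightarrow> 'a" where
  "form_op \<Omega> x = (1/2) *\<^sub>R (\<Sum>i\<in>UNIV. \<Sum>j\<in>UNIV. \<Omega> i j *\<^sub>R \<gamma> i (\<gamma> j (J x)))"

text \<open>The numbers \<open>M\<^sub>i\<^sub>j = \<langle>\<gamma>\<^sub>i\<gamma>\<^sub>jJx, x\<rangle>\<close> form an antisymmetric matrix of operator norm at most
  \<open>|x|\<^sup>2\<close>, because \<open>|cl(a)x + J cl(b)x|\<^sup>2 \<ge> 0\<close>; it has rank at most \<open>2[n/2]\<close>.\<close>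

lemma form_op_lower_bound:
  assumes "N\<^sup>2 = (\<Sum>i\<in>UNIV. \<Sum>j\<in>UNIV. (\<Omega> i j)\<^sup>2) / 2" "N \<ge> 0"
  shows "form_op \<Omega> x \<bullet> x \<ge> - (sqrt (real (CARD('n) div 2)) * N * (x \<bullet> x))"
proof -
  let ?m = "real (CARD('n) div 2)" and ?u = "x \<bullet> x"
  define M :: "real^'n^'n" where "M = (\<chi> i j. \<gamma> i (\<gamma> j (J x)) \<bullet> x)"
  have M: "M $ i $ j = J (\<gamma> j x) \<bullet> - \<gamma> i x" for i j
    by (simp add: M_def gam_skew[of i] J_gam)
  have diag: "M $ i $ i = 0" for i
    using J_skew[of x x] by (simp add: M_def gam_sq inner_commute)
  have anti: "M $ i $ j = - M $ j $ i" for i j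
  proof (cases "i = j")
    case False
    show ?thesis unfolding M_def by (simp add: gam_swap[OF False])
  qed (simp add: diag)
  have Mb: "a \<bullet> (M *v b) = - (cl a x \<bullet> J (cl b x))" for a b
  proof -
    have "a \<bullet> (M *v b) = (\<Sum>i\<in>UNIV. \<Sum>j\<in>UNIV. a $ i * (b $ j * M $ i $ j))"
      by (simp add: inner_vec_def matrix_vector_mult_def sum_distrib_left mult_ac)
    also have "\<dots> = - (cl a x \<bullet> J (cl b x))"
      by (simp add: M cl_def J_lin inner_sum_left inner_sum_right sum_distrib_left sum_negf inner_commute mult_ac)
        (rule sum.swap)?
    finally show ?thesis .
  qed
  have J_inner: "J y \<bullet> J y = y \<bullet> y" for y by (simp add: J_skew[of y] J_sq)
  have half: "2 * (a \<bullet> (M *v b)) \<le> (a \<bullet> a + b \<bullet> b) * ?u" for a b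
  proof -
    have "0 \<le> (cl a x + J (cl b x)) \<bullet> (cl a x + J (cl b x))" by simp
    also have "\<dots> = (a \<bullet> a + b \<bullet> b) * ?u + 2 * (cl a x \<bullet> J (cl b x))"
      by (simp add: inner_simps J_inner cl_inner inner_commute algebra_simps)
    finally show ?thesis by (simp add: Mb)
  qed
  have "norm (M *v b) \<le> ?u * norm b" for b
  proof (cases "M *v b = 0")
    case False
    \<comment> \<open>The scaling gives the test vector the length of b, so that both terms on the
      right of \<open>half\<close> are equal.\<close>
    let ?c = "norm b / norm (M *v b)"
    have c: "?c * (norm (M *v b))\<^sup>2 = norm b * norm (M *v b)" "?c\<^sup>2 * (norm (M *v b))\<^sup>2 = (norm b)\<^sup>2"
      using False by (simp_all add: power2_eq_square)
    have "2 * (?c * (norm (M *v b))\<^sup>2) \<le> (?c\<^sup>2 * (norm (M *v b))\<^sup>2 + (norm b)\<^sup>2) * ?u"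
      using half[of "?c *\<^sub>R (M *v b)" b]
      unfolding inner_scaleR_left inner_scaleR_right power2_norm_eq_inner by (simp add: power2_eq_square mult.assoc)
    then have *: "norm b * norm (M *v b) \<le> (norm b)\<^sup>2 * ?u" unfolding c by (simp add: algebra_simps)
    have "b \<noteq> 0" using False by auto
    then show ?thesis using * by (simp add: power2_eq_square mult.commute)
  qed simp
  then have frob: "(\<Sum>i\<in>UNIV. \<Sum>j\<in>UNIV. (M $ i $ j)\<^sup>2) \<le> 2 * ?m * ?u\<^sup>2"
    by (intro antisymmetric_frobenius_bound[OF anti]) simp_all
  have A: "form_op \<Omega> x \<bullet> x = (\<Sum>p\<in>UNIV \<times> UNIV. \<Omega> (fst p) (snd p) * M $ fst p $ snd p) / 2"
    by (simp add: form_op_def inner_sum_left M_def sum.cartesian_product case_prod_beta)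
  \<comment> \<open>Cauchy-Schwarz over ordered pairs, with \<Omega> and M regarded as vectors
    indexed by pairs.\<close>
  have B: "\<bar>\<Sum>p\<in>UNIV \<times> UNIV. \<Omega> (fst p) (snd p) * M $ fst p $ snd p\<bar> \<le>
      L2_set (\<lambda>p. \<Omega> (fst p) (snd p)) (UNIV \<times> UNIV) * L2_set (\<lambda>p. M $ fst p $ snd p) (UNIV \<times> UNIV)"
    by (rule order_trans[OF sum_abs]) (simp add: abs_mult L2_set_mult_ineq)
  have C: "L2_set (\<lambda>p. \<Omega> (fst p) (snd p)) (UNIV \<times> UNIV) = sqrt 2 * N"
  proof -
    have "(\<Sum>p\<in>UNIV \<times> UNIV. (\<Omega> (fst p) (snd p))\<^sup>2) = 2 * N\<^sup>2"
      using assms(1) by (simp add: sum.cartesian_product case_prod_beta)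
    then show ?thesis using assms(2) by (simp add: L2_set_def real_sqrt_mult)
  qed
  have D: "L2_set (\<lambda>p. M $ fst p $ snd p) (UNIV \<times> UNIV) \<le> sqrt 2 * sqrt ?m * ?u"
  proof -
    have "sqrt (2 * ?m * ?u\<^sup>2) = sqrt 2 * sqrt ?m * ?u" by (simp add: real_sqrt_mult)
    then show ?thesis using real_sqrt_le_mono[OF frob]
      by (simp add: L2_set_def sum.cartesian_product case_prod_beta)
  qed
  have E: "sqrt 2 * N * L2_set (\<lambda>p. M $ fst p $ snd p) (UNIV \<times> UNIV) \<le> sqrt 2 * N * (sqrt 2 * sqrt ?m * ?u)"
    using assms(2) D by (intro mult_left_mono) simp_all
  \<comment> \<open>The two factors \<open>sqrt 2\<close> come from summing over ordered pairs. What
    remains is \<open>sqrt (real (CARD('n) div 2))\<close>, which is c_n / 2.\<close>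
  have "2 * \<bar>form_op \<Omega> x \<bullet> x\<bar> \<le> sqrt 2 * N * (sqrt 2 * sqrt ?m * ?u)"
    using B[unfolded C] E unfolding A by linarith
  also have "\<dots> = 2 * (sqrt ?m * N * ?u)" by (simp add: mult_ac) 
  finally show ?thesis by linarith
qed

text \<open>The three skew factors give one sign, and restoring the order of the two gammas through
  the antisymmetry of \<Omega> gives the other.\<close>

lemma form_op_symmetric:
  assumes "\<And>i j. \<Omega> i j = - \<Omega> j i"
  shows "form_op \<Omega> x \<bullet> y = x \<bullet> form_op \<Omega> y"
proof -
  have "(\<Sum>i\<in>UNIV. \<Sum>j\<in>UNIV. \<Omega> i j * (\<gamma> i (\<gamma> j (J x)) \<bullet> y)) = (\<Sum>i\<in>UNIV. \<Sum>j\<in>UNIV. - \<Omega> i j * (x \<bullet> \<gamma> j (\<gamma> i (J y))))"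
    by (simp add: gam_skew J_skew J_gam)
  also have "\<dots> = (\<Sum>i\<in>UNIV. \<Sum>j\<in>UNIV. \<Omega> j i * (x \<bullet> \<gamma> j (\<gamma> i (J y))))"
    by (intro sum.cong refl) (metis assms)
  also have "\<dots> = (\<Sum>i\<in>UNIV. \<Sum>j\<in>UNIV. \<Omega> i j * (x \<bullet> \<gamma> i (\<gamma> j (J y))))" by (rule sum.swap)
  finally show ?thesis by (simp add: form_op_def inner_sum_left inner_sum_right)
qed

text \<open>By the lower bound, \<open>form_op\<close> plus the extremal constant times the identity
  is positive semidefinite; a vector on which its quadratic form vanishes lies in its kernel by
  \<open>psd_kernel\<close>.\<close>

lemma form_op_equality:
  assumes "N\<^sup>2 = (\<Sum>i\<in>UNIV. \<Sum>j\<in>UNIV. (\<Omega> i j)\<^sup>2) / 2" "N \<ge> 0" "\<And>i j. \<Omega> i j = - \<Omega> j i"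
    and "form_op \<Omega> x \<bullet> x = - (sqrt (real (CARD('n) div 2)) * N * (x \<bullet> x))"
  shows "form_op \<Omega> x = - (sqrt (real (CARD('n) div 2)) * N) *\<^sub>R x"
proof -
  let ?c = "sqrt (real (CARD('n) div 2)) * N"
  have "form_op \<Omega> x + ?c *\<^sub>R x = 0"
  proof (rule psd_kernel[where S = "\<lambda>x. form_op \<Omega> x + ?c *\<^sub>R x"])
    show "linear (\<lambda>x. form_op \<Omega> x + ?c *\<^sub>R x)"
      by (intro linearI) (simp_all add: form_op_def gam_lin J_lin sum.distrib algebra_simps scaleR_sum_right)
    show "(form_op \<Omega> x + ?c *\<^sub>R x) \<bullet> y = x \<bullet> (form_op \<Omega> y + ?c *\<^sub>R y)" for x y
      by (simp add: inner_simps form_op_symmetric[of \<Omega>, OF assms(3)])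
    show "0 \<le> (form_op \<Omega> x + ?c *\<^sub>R x) \<bullet> x" for x
      using form_op_lower_bound[OF assms(1,2), of x] by (simp add: inner_simps)
    show "(form_op \<Omega> x + ?c *\<^sub>R x) \<bullet> x = 0" using assms(4) by (simp add: inner_simps)
  qed
  then show ?thesis by (metis add_eq_0_iff2 scaleR_left.minus)
qed

end

section \<open>The Weitzenboeck formula in a local frame\<close>

lemma bounded_bilinear_matrix_vector: "bounded_bilinear ((*v) :: real^'n^'m \<Rightarrow> real^'n \<Rightarrow> real^'m)"
  by (simp add: bilinear_conv_bounded_bilinear[symmetric] bilinear_def)
    (auto intro!: linearI simp: matrix_vector_mult_add_rdistrib matrix_vector_right_distrib matrix_vector_mult_scaleR
      scaleR_matrix_vector_assoc)

text \<open>\<open>symb\<close> and \<open>riem_comp\<close> repeat \<open>christoffel\<close> and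
  \<open>riem\<close> as functions of the matrix field alone, so that the local computation involves
  only an open subset of R^n.\<close>

definition symb :: "(real^'n::finite \<Rightarrow> real^'n^'n) \<Rightarrow> 'n \<Rightarrow> 'n \<Rightarrow> 'n \<Rightarrow> real^'n \<Rightarrow> real" where
  "symb G k i j y = (\<Sum>l\<in>UNIV. matrix_inv (G y) $ k $ l *
     (partial i (\<lambda>z. G z $ j $ l) y + partial j (\<lambda>z. G z $ i $ l) y
      - partial l (\<lambda>z. G z $ i $ j) y)) / 2"

definition riem_comp :: "(real^'n::finite \<Rightarrow> real^'n^'n) \<Rightarrow> 'n \<Rightarrow> 'n \<Rightarrow> 'n \<Rightarrow> 'n \<Rightarrow> real^'n \<Rightarrow> real" where
  "riem_comp G l k i j y =
     partial i (symb G l j k) y - partial j (symb G l i k) y +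
     (\<Sum>m\<in>UNIV. symb G l i m y * symb G m j k y - symb G l j m y * symb G m i k y)"

definition Gam :: "(real^'n::finite \<Rightarrow> real^'n^'n) \<Rightarrow> real^'n \<Rightarrow> real^'n \<Rightarrow> real^'n \<Rightarrow> real^'n" where
  "Gam G y X Y = (\<chi> k. \<Sum>i\<in>UNIV. \<Sum>j\<in>UNIV. symb G k i j y * X $ i * Y $ j)"

lemma sum_axis:
  "(\<Sum>i\<in>UNIV. axis j (1::real) $ i * f i) = f j" "(\<Sum>i\<in>UNIV. f i * axis j (1::real) $ i) = f j"
  by (simp_all add: axis_def if_distrib if_distribR cong: if_cong)

lemma linear_Gam: "linear (Gam G y X)" "linear (\<lambda>X. Gam G y X Y)"
  by (auto intro!: linearI simp: Gam_def vec_eq_iff sum.distrib[symmetric] sum_distrib_left algebra_simps)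

text \<open>Positive definiteness is carried by the frame: a symmetric matrix admitting n
  orthonormal vectors is positive definite.\<close>

locale frame_geometry =
  fixes V :: "(real^'n::finite) set" and G :: "real^'n \<Rightarrow> real^'n^'n" and e :: "'n \<Rightarrow> real^'n \<Rightarrow> real^'n"
  assumes open_V: "open V" and smooth_G: "smooth_on V G"
    and G_sym: "y \<in> V \<Longrightarrow> G y $ i $ j = G y $ j $ i"
    and smooth_e: "smooth_on V (e i)"
    and orthonormal: "y \<in> V \<Longrightarrow> e i y \<bullet> (G y *v e j y) = (if i = j then 1 else 0)"
begin

definition ip :: "real^'n \<Rightarrow> real^'n \<Rightarrow> real^'n \<Rightarrow> real" where "ip y X Y = X \<bullet> (G y *v Y)"

lemma ip_linear: "linear (ip y X)" "linear (\<lambda>X. ip y X Y)"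
  by (auto intro!: linearI simp: ip_def inner_simps matrix_vector_right_distrib matrix_vector_mult_scaleR)

lemmas ip_lin = linear_add[OF ip_linear(1)] linear_scale[OF ip_linear(1)] linear_sum[OF ip_linear(1)]
  linear_diff[OF ip_linear(1)] linear_add[OF ip_linear(2)] linear_scale[OF ip_linear(2)]
  linear_sum[OF ip_linear(2)] linear_diff[OF ip_linear(2)]

lemma G_transfer: "y \<in> V \<Longrightarrow> X \<bullet> (G y *v Y) = (G y *v X) \<bullet> Y"
proof -
  assume y: "y \<in> V"
  have "transpose (G y) = G y" by (simp add: vec_eq_iff transpose_def G_sym[OF y])
  then show ?thesis by (metis dot_lmul_matrix vector_transpose_matrix)
qed

lemma ip_sym: "y \<in> V \<Longrightarrow> ip y X Y = ip y Y X"
  unfolding ip_def by (metis G_transfer inner_commute)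

lemma ip_e: "y \<in> V \<Longrightarrow> ip y (e i y) (e j y) = (if i = j then 1 else 0)"
  by (simp add: ip_def orthonormal)

text \<open>Orthonormality says that the covectors G e_k form a left inverse of the frame matrix; a
  left inverse of a square matrix is also a right inverse.\<close>

lemma frame_dual:
  assumes y: "y \<in> V"
  shows "(\<Sum>k\<in>UNIV. e k y $ i * (G y *v e k y) $ j) = (if i = j then 1 else 0)"
proof -
  define E :: "real^'n^'n" where "E = (\<chi> i k. e k y $ i)"
  define P :: "real^'n^'n" where "P = (\<chi> k j. (G y *v e k y) $ j)"
  have "P ** E = mat 1"
    using orthonormal[OF y] by (simp add: vec_eq_iff matrix_matrix_mult_def P_def E_def mat_def inner_vec_def mult.commute)
  then have "E ** P = mat 1" by (simp add: matrix_left_right_inverse)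
  then have "(E ** P) $ i $ j = mat 1 $ i $ j" by simp
  then show ?thesis by (simp add: matrix_matrix_mult_def P_def E_def mat_def)
qed

lemma frame_expand:
  assumes y: "y \<in> V"
  shows "X = (\<Sum>k\<in>UNIV. ip y X (e k y) *\<^sub>R e k y)"
proof -
  have "(\<Sum>k\<in>UNIV. ip y X (e k y) *\<^sub>R e k y) $ i = X $ i" for i
  proof -
    have "(\<Sum>k\<in>UNIV. ip y X (e k y) *\<^sub>R e k y) $ i = (\<Sum>k\<in>UNIV. \<Sum>j\<in>UNIV. X $ j * (e k y $ i * (G y *v e k y) $ j))"
      by (simp add: ip_def inner_vec_def sum_distrib_left sum_distrib_right mult_ac)
    also have "\<dots> = (\<Sum>j\<in>UNIV. X $ j * (if i = j then 1 else 0))"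
      by (subst sum.swap) (simp add: sum_distrib_left[symmetric] frame_dual[OF y])
    finally show ?thesis by (simp add: if_distrib cong: if_cong)
  qed
  then show ?thesis by (simp add: vec_eq_iff)
qed

lemma ip_frame_sum:
  assumes y: "y \<in> V"
  shows "ip y X Y = (\<Sum>k\<in>UNIV. ip y X (e k y) * ip y Y (e k y))"
proof -
  have "ip y X Y = ip y (\<Sum>k\<in>UNIV. ip y X (e k y) *\<^sub>R e k y) Y" by (simp add: frame_expand[OF y, symmetric])
  then show ?thesis by (simp add: ip_lin ip_sym[OF y, of "e _ y"])
qed

lemma frame_eqI: "y \<in> V \<Longrightarrow> (\<And>k. ip y X (e k y) = ip y Y (e k y)) \<Longrightarrow> X = Y"
  by (metis (no_types, lifting) frame_expand sum.cong)

text \<open>The inverse metric is polynomial in the frame, which later gives the smoothness of the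
  Christoffel symbols without differentiating matrix inversion.\<close>

lemma inverse_metric:
  assumes y: "y \<in> V"
  shows "matrix_inv (G y) = (\<chi> i j. \<Sum>k\<in>UNIV. e k y $ i * e k y $ j)" "G y ** matrix_inv (G y) = mat 1"
proof -
  define K :: "real^'n^'n" where "K = (\<chi> i j. \<Sum>k\<in>UNIV. e k y $ i * e k y $ j)"
  have "(K ** G y) $ i $ j = mat 1 $ i $ j" for i j
  proof -
    have "(K ** G y) $ i $ j = (\<Sum>m\<in>UNIV. \<Sum>k\<in>UNIV. e k y $ i * (G y $ j $ m * e k y $ m))"
      by (simp add: K_def matrix_matrix_mult_def sum_distrib_right G_sym[OF y, of _ j] mult.assoc)
        (simp only: mult.commute[of "G y $ j $ _"])
    also have "\<dots> = (\<Sum>k\<in>UNIV. e k y $ i * (G y *v e k y) $ j)"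
      by (subst sum.swap) (simp add: matrix_vector_mult_def sum_distrib_left)
    finally show ?thesis by (simp add: frame_dual[OF y] mat_def)
  qed
  then have K: "K ** G y = mat 1" by (simp add: vec_eq_iff)
  then have K': "G y ** K = mat 1" by (simp add: matrix_left_right_inverse)
  then have "G y ** matrix_inv (G y) = mat 1"
    unfolding matrix_inv_def using K someI[of "\<lambda>A'. G y ** A' = mat 1 \<and> A' ** G y = mat 1" K] by blast
  moreover from this have "matrix_inv (G y) = K"
    by (metis K matrix_mul_assoc matrix_mul_lid matrix_mul_rid)
  ultimately show "matrix_inv (G y) = (\<chi> i j. \<Sum>k\<in>UNIV. e k y $ i * e k y $ j)" "G y ** matrix_inv (G y) = mat 1"
    by (simp_all add: K_def)
qed

lemma smooth_e_nth: "smooth_on V (\<lambda>y. e k y $ i)"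
  by (rule smooth_on_vec_nth[OF open_V smooth_e])

lemma smooth_G_nth: "smooth_on V (\<lambda>y. G y $ i $ j)"
  by (rule smooth_on_vec_nth[OF open_V smooth_on_vec_nth[OF open_V smooth_G]])

lemma smooth_partial: "smooth_on V f \<Longrightarrow> smooth_on V (partial i f)"
  unfolding partial_def by (rule smooth_on_dd)

lemma smooth_symb: "smooth_on V (symb G k i j)"
proof (rule smooth_on_cong[OF open_V])
  show "smooth_on V (\<lambda>y. (1/2) *\<^sub>R (\<Sum>l\<in>UNIV. (\<Sum>m\<in>UNIV. e m y $ k * e m y $ l) *
     (partial i (\<lambda>z. G z $ j $ l) y + partial j (\<lambda>z. G z $ i $ l) y - partial l (\<lambda>z. G z $ i $ j) y)))"
    by (intro smooth_on_scaleR smooth_on_const smooth_on_sum smooth_on_mult smooth_on_add smooth_on_diff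
        smooth_partial smooth_G_nth smooth_e_nth open_V)
qed (simp add: symb_def inverse_metric)

lemma smooth_Gam:
  assumes "smooth_on V X" "smooth_on V Y"
  shows "smooth_on V (\<lambda>y. Gam G y (X y) (Y y))"
  unfolding Gam_def using assms
  by (intro smooth_on_vec_lambda smooth_on_sum smooth_on_mult smooth_symb smooth_on_vec_nth open_V)

lemma symb_sym: "y \<in> V \<Longrightarrow> symb G k i j y = symb G k j i y"
proof -
  assume y: "y \<in> V"
  have "partial l (\<lambda>z. G z $ i $ j) y = partial l (\<lambda>z. G z $ j $ i) y" for l
    unfolding partial_def using dd_cong_open[OF open_V y, of "\<lambda>z. G z $ i $ j" "\<lambda>z. G z $ j $ i"] G_sym by simp
  then show ?thesis unfolding symb_def by (simp add: add.commute)
qed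

lemma Gam_sym: "y \<in> V \<Longrightarrow> Gam G y X Y = Gam G y Y X"
  unfolding Gam_def by (subst sum.swap) (simp add: symb_sym[of y] mult_ac)

lemma differentiable_G: "y \<in> V \<Longrightarrow> G differentiable (at y)"
  using smooth_on_differentiable[OF smooth_G] .

lemma dd_G_expand: "y \<in> V \<Longrightarrow> dd G y X = (\<Sum>i\<in>UNIV. X $ i *\<^sub>R dd G y (axis i 1))"
proof -
  assume "y \<in> V"
  then have lin: "linear (dd G y)" using differentiable_G linear_dd by blast
  have "X = (\<Sum>i\<in>UNIV. X $ i *\<^sub>R axis i 1)"
    by (simp add: vec_eq_iff axis_def if_distrib cong: if_cong)
  then have "dd G y X = dd G y (\<Sum>i\<in>UNIV. X $ i *\<^sub>R axis i 1)" by simp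
  then show ?thesis by (simp only: linear_sum[OF lin] linear_scale[OF lin])
qed

lemma partial_G: "y \<in> V \<Longrightarrow> partial i (\<lambda>z. G z $ j $ l) y = dd G y (axis i 1) $ j $ l"
  unfolding partial_def
  by (rule fun_cong[OF dd_bounded_linear[where L = "\<lambda>A. A $ j $ l"]])
    (simp_all add: differentiable_G bounded_linear_compose[OF bounded_linear_vec_nth bounded_linear_vec_nth])

lemma dd_G_nth: "y \<in> V \<Longrightarrow> dd G y X $ j $ l = (\<Sum>i\<in>UNIV. X $ i * partial i (\<lambda>z. G z $ j $ l) y)"
  by (subst dd_G_expand) (simp_all add: partial_G)

text \<open>Christoffel symbols of the first kind: lowering the upper index cancels the inverse
  metric and leaves three derivatives of the metric.\<close>

lemma ip_Gam:
  assumes y: "y \<in> V"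
  shows "2 * ip y (Gam G y X Y) Z =
    Y \<bullet> (dd G y X *v Z) + X \<bullet> (dd G y Y *v Z) - X \<bullet> (dd G y Z *v Y)"
proof -
  define p where "p = (\<lambda>i j l. partial i (\<lambda>z. G z $ j $ l) y)"
  define t :: "real^'n" where "t = (\<chi> l. \<Sum>i\<in>UNIV. \<Sum>j\<in>UNIV. (p i j l + p j i l - p l i j) * X $ i * Y $ j)"
  have "Gam G y X Y $ k = (1/2) * (matrix_inv (G y) *v t) $ k" for k
  proof -
    have "Gam G y X Y $ k = (\<Sum>i\<in>UNIV. \<Sum>j\<in>UNIV. \<Sum>l\<in>UNIV. matrix_inv (G y) $ k $ l * ((p i j l + p j i l - p l i j) * X $ i * Y $ j) / 2)"
      by (simp add: Gam_def symb_def p_def sum_distrib_right sum_divide_distrib mult.assoc)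
    also have "\<dots> = (\<Sum>i\<in>UNIV. \<Sum>l\<in>UNIV. \<Sum>j\<in>UNIV. matrix_inv (G y) $ k $ l * ((p i j l + p j i l - p l i j) * X $ i * Y $ j) / 2)"
      by (intro sum.cong refl sum.swap)
    also have "\<dots> = (\<Sum>l\<in>UNIV. \<Sum>i\<in>UNIV. \<Sum>j\<in>UNIV. matrix_inv (G y) $ k $ l * ((p i j l + p j i l - p l i j) * X $ i * Y $ j) / 2)"
      by (rule sum.swap)
    also have "\<dots> = (1/2) * (matrix_inv (G y) *v t) $ k"
      by (simp add: matrix_vector_mult_def t_def sum_distrib_left)
    finally show ?thesis .
  qed
  then have "Gam G y X Y = (1/2) *\<^sub>R (matrix_inv (G y) *v t)" by (simp add: vec_eq_iff)
  then have "2 * ip y (Gam G y X Y) Z = (G y *v (matrix_inv (G y) *v t)) \<bullet> Z"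
    by (simp add: ip_def G_transfer[OF y] matrix_vector_mult_scaleR)
  also have "\<dots> = t \<bullet> Z" by (simp add: matrix_vector_mul_assoc inverse_metric(2)[OF y])
  also have "\<dots> = Y \<bullet> (dd G y X *v Z) + X \<bullet> (dd G y Y *v Z) - X \<bullet> (dd G y Z *v Y)"
  proof -
    have 1: "U \<bullet> (dd G y W *v Q) = (\<Sum>l\<in>UNIV. \<Sum>i\<in>UNIV. \<Sum>j\<in>UNIV. p i j l * W $ i * U $ j * Q $ l)" for U W Q
    proof -
      have "U \<bullet> (dd G y W *v Q) = (\<Sum>j\<in>UNIV. \<Sum>l\<in>UNIV. \<Sum>i\<in>UNIV. p i j l * W $ i * U $ j * Q $ l)"
        by (simp add: inner_vec_def matrix_vector_mult_def dd_G_nth[OF y] p_def sum_distrib_left sum_distrib_right mult_ac)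
      also have "\<dots> = (\<Sum>l\<in>UNIV. \<Sum>j\<in>UNIV. \<Sum>i\<in>UNIV. p i j l * W $ i * U $ j * Q $ l)" by (rule sum.swap)
      also have "\<dots> = (\<Sum>l\<in>UNIV. \<Sum>i\<in>UNIV. \<Sum>j\<in>UNIV. p i j l * W $ i * U $ j * Q $ l)"
        by (intro sum.cong refl sum.swap)
      finally show ?thesis .
    qed
    have 2: "X \<bullet> (dd G y Y *v Z) = (\<Sum>l\<in>UNIV. \<Sum>i\<in>UNIV. \<Sum>j\<in>UNIV. p j i l * Y $ j * X $ i * Z $ l)"
      unfolding 1 by (intro sum.cong refl sum.swap)
    have 3: "X \<bullet> (dd G y Z *v Y) = (\<Sum>l\<in>UNIV. \<Sum>i\<in>UNIV. \<Sum>j\<in>UNIV. p l i j * Z $ l * X $ i * Y $ j)"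
    proof -
      have "X \<bullet> (dd G y Z *v Y) = (\<Sum>j\<in>UNIV. \<Sum>l\<in>UNIV. \<Sum>i\<in>UNIV. p l i j * Z $ l * X $ i * Y $ j)" by (rule 1)
      also have "\<dots> = (\<Sum>l\<in>UNIV. \<Sum>j\<in>UNIV. \<Sum>i\<in>UNIV. p l i j * Z $ l * X $ i * Y $ j)" by (rule sum.swap)
      also have "\<dots> = (\<Sum>l\<in>UNIV. \<Sum>i\<in>UNIV. \<Sum>j\<in>UNIV. p l i j * Z $ l * X $ i * Y $ j)"
        by (intro sum.cong refl sum.swap)
      finally show ?thesis .
    qed
    show ?thesis
      unfolding 1[of Y X Z] 2 3 sum.distrib[symmetric] sum_subtractf[symmetric]
      by (simp add: inner_vec_def t_def sum_distrib_right sum_distrib_left algebra_simps)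
  qed
  finally show ?thesis .
qed

definition cov :: "real^'n \<Rightarrow> real^'n \<Rightarrow> (real^'n \<Rightarrow> real^'n) \<Rightarrow> real^'n" where
  "cov y X F = dd F y X + Gam G y X (F y)"

lemma metric_compatible:
  assumes y: "y \<in> V" and F: "F differentiable (at y)" and H: "H differentiable (at y)"
  shows "((\<lambda>z. ip z (F z) (H z)) has_derivative (\<lambda>X. ip y (cov y X F) (H y) + ip y (F y) (cov y X H))) (at y)"
proof -
  have "((\<lambda>z. F z \<bullet> (G z *v H z)) has_derivative
      (\<lambda>X. F y \<bullet> (G y *v dd H y X + dd G y X *v H y) + dd F y X \<bullet> (G y *v H y))) (at y)"
    by (intro has_derivative_inner bounded_bilinear.FDERIV[OF bounded_bilinear_matrix_vector] dd_works F H differentiable_G y)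
  moreover have "F y \<bullet> (G y *v dd H y X + dd G y X *v H y) + dd F y X \<bullet> (G y *v H y) =
      ip y (cov y X F) (H y) + ip y (F y) (cov y X H)" for X
  proof -
    have sym: "U \<bullet> (dd G y X *v W) = W \<bullet> (dd G y X *v U)" for U W
    proof -
      have "dd G y X $ i $ j = dd G y X $ j $ i" for i j
        unfolding dd_G_nth[OF y] partial_def
        using dd_cong_open[OF open_V y, of "\<lambda>z. G z $ i $ j" "\<lambda>z. G z $ j $ i"] G_sym by simp
      then have "transpose (dd G y X) = dd G y X" by (simp add: vec_eq_iff transpose_def)
      then show ?thesis by (metis dot_lmul_matrix inner_commute vector_transpose_matrix)
    qed
    \<comment> \<open>When the two symbols of the first kind with swapped arguments are added,
      everything cancels except the derivative of G along X.\<close>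
    have "2 * (ip y (Gam G y X (F y)) (H y) + ip y (F y) (Gam G y X (H y))) = 2 * (F y \<bullet> (dd G y X *v H y))"
      using ip_Gam[OF y, of X "F y" "H y"] ip_Gam[OF y, of X "H y" "F y"] sym[of "F y" "H y"]
        sym[of X "H y"] sym[of X "F y"]
      by (simp add: ip_sym[OF y, of "F y"] distrib_left)
    then show ?thesis by (simp add: cov_def ip_lin) (simp add: ip_def inner_simps)
  qed
  ultimately have "((\<lambda>z. F z \<bullet> (G z *v H z)) has_derivative
      (\<lambda>X. ip y (cov y X F) (H y) + ip y (F y) (cov y X H))) (at y)" by (rule has_derivative_eq_rhs[OF _ ext])
  then show ?thesis by (simp only: ip_def)
qed

lemma cov_torsion: "y \<in> V \<Longrightarrow> cov y (A y) B - cov y (B y) A = dd B y (A y) - dd A y (B y)"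
  by (simp add: cov_def Gam_sym[of y "A y"])

lemma smooth_cov:
  assumes "smooth_on V A" "smooth_on V F"
  shows "smooth_on V (\<lambda>y. cov y (A y) F)"
  unfolding cov_def using assms by (intro smooth_on_add smooth_on_dd_field smooth_Gam open_V)

lemma smooth_ip:
  assumes "smooth_on V X" "smooth_on V Y"
  shows "smooth_on V (\<lambda>y. ip y (X y) (Y y))"
  unfolding ip_def using assms
  by (intro smooth_on_inner smooth_on_bounded_bilinear[OF bounded_bilinear_matrix_vector] smooth_G open_V)

definition om :: "'n \<Rightarrow> 'n \<Rightarrow> 'n \<Rightarrow> real^'n \<Rightarrow> real" where
  "om k j l y = ip y (cov y (e k y) (e j)) (e l y)"

lemma smooth_om: "smooth_on V (om k j l)"
  unfolding om_def[abs_def] by (intro smooth_ip smooth_cov smooth_e)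

lemma differentiable_e: "y \<in> V \<Longrightarrow> e i differentiable (at y)"
  using smooth_on_differentiable[OF smooth_e] .

lemma differentiable_om: "y \<in> V \<Longrightarrow> om k j l differentiable (at y)"
  using smooth_on_differentiable[OF smooth_om] .

lemma cov_e_antisym:
  assumes y: "y \<in> V"
  shows "ip y (cov y X (e j)) (e l y) = - ip y (cov y X (e l)) (e j y)"
proof -
  have "((\<lambda>z. ip z (e j z) (e l z)) has_derivative (\<lambda>X. 0)) (at y)"
    by (rule has_derivative_cong_open[OF open_V y _ has_derivative_const]) (simp add: ip_e)
  from has_derivative_unique[OF metric_compatible[OF y differentiable_e[OF y] differentiable_e[OF y]] this]
  have "ip y (cov y X (e j)) (e l y) + ip y (e j y) (cov y X (e l)) = 0" by (rule fun_cong)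
  then show ?thesis by (simp add: ip_sym[OF y, of "e j y"])
qed

lemma om_antisym: "y \<in> V \<Longrightarrow> om k j l y = - om k l j y"
  unfolding om_def by (rule cov_e_antisym)

lemma cov_e: "y \<in> V \<Longrightarrow> cov y (e k y) (e j) = (\<Sum>m\<in>UNIV. om k j m y *\<^sub>R e m y)"
  unfolding om_def by (rule frame_expand)

lemma bracket_e:
  assumes "y \<in> V"
  shows "dd (e l) y (e k y) - dd (e k) y (e l y) = (\<Sum>m\<in>UNIV. (om k l m y - om l k m y) *\<^sub>R e m y)"
  using cov_torsion[OF assms, of "e k" "e l"] by (simp add: cov_e[OF assms] scaleR_diff_left sum_subtractf)

definition bracket_coeff :: "'n \<Rightarrow> 'n \<Rightarrow> 'n \<Rightarrow> real^'n \<Rightarrow> real" where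
  "bracket_coeff k l m y = ip y (dd (e l) y (e k y) - dd (e k) y (e l y)) (e m y)"

text \<open>Koszul's formula for an orthonormal frame: vanishing torsion and antisymmetry determine
  the connection from the brackets. Brackets transform simply under a change of chart, and this is
  used in \<open>wfun_chart\<close>.\<close>

lemma om_koszul:
  assumes y: "y \<in> V"
  shows "2 * om k j l y = bracket_coeff k j l y - bracket_coeff j l k y + bracket_coeff l k j y"
proof -
  have "bracket_coeff k l m y = om k l m y - om l k m y" for k l m
    unfolding bracket_coeff_def bracket_e[OF y] by (simp add: ip_lin ip_e[OF y] if_distrib cong: if_cong)
  then show ?thesis
    using om_antisym[OF y, of k j l] om_antisym[OF y, of j k l] om_antisym[OF y, of l k j] by simp
qed

text \<open>R(X,Y)Z evaluated on constant coordinate fields, whose brackets vanish.\<close>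

definition Rm :: "real^'n \<Rightarrow> real^'n \<Rightarrow> real^'n \<Rightarrow> real^'n \<Rightarrow> real^'n" where
  "Rm y X Y Z = dd (\<lambda>z. Gam G z Y Z) y X - dd (\<lambda>z. Gam G z X Z) y Y
    + Gam G y X (Gam G y Y Z) - Gam G y Y (Gam G y X Z)"

lemma differentiable_Gam: "y \<in> V \<Longrightarrow> (\<lambda>z. Gam G z X Y) differentiable (at y)"
  using smooth_on_differentiable[OF smooth_Gam[OF smooth_on_const smooth_on_const]] .

lemma linear_dd_Gam:
  assumes y: "y \<in> V"
  shows "linear (\<lambda>X. dd (\<lambda>z. Gam G z X Z) y W)" "linear (\<lambda>Z. dd (\<lambda>z. Gam G z X Z) y W)"
  using dd_linear_combination[OF differentiable_Gam[OF y] differentiable_Gam[OF y]]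
    dd_linear_combination[OF differentiable_Gam[OF y] differentiable_Gam[OF y], of 1 _ _ 1]
    dd_linear_combination[OF differentiable_Gam[OF y] differentiable_Gam[OF y], of _ _ _ 0]
  by (auto intro!: linearI simp: linear_add[OF linear_Gam(1)] linear_scale[OF linear_Gam(1)]
      linear_add[OF linear_Gam(2)] linear_scale[OF linear_Gam(2)])

lemma linear_Rm:
  assumes y: "y \<in> V"
  shows "linear (\<lambda>X. Rm y X Y Z)" "linear (\<lambda>Y. Rm y X Y Z)" "linear (\<lambda>Z. Rm y X Y Z)"
proof -
  have d: "linear (dd (\<lambda>z. Gam G z X Z) y)" for X Z using differentiable_Gam[OF y] linear_dd by blast
  have a: "dd (\<lambda>z. Gam G z A B + Gam G z C E) y W = dd (\<lambda>z. Gam G z A B) y W + dd (\<lambda>z. Gam G z C E) y W"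
    and r: "dd (\<lambda>z. c *\<^sub>R Gam G z A B) y W = c *\<^sub>R dd (\<lambda>z. Gam G z A B) y W" for A B C E W c
    using dd_linear_combination[OF differentiable_Gam[OF y] differentiable_Gam[OF y], of 1 A B 1 C E]
      dd_linear_combination[OF differentiable_Gam[OF y] differentiable_Gam[OF y], of c A B 0 A B] by simp_all
  note l = a r linear_add[OF d] linear_scale[OF d] linear_add[OF linear_dd_Gam(1)[OF y]] linear_scale[OF linear_dd_Gam(1)[OF y]]
    linear_add[OF linear_dd_Gam(2)[OF y]] linear_scale[OF linear_dd_Gam(2)[OF y]]
    linear_add[OF linear_Gam(1)] linear_scale[OF linear_Gam(1)] linear_add[OF linear_Gam(2)] linear_scale[OF linear_Gam(2)]
  show "linear (\<lambda>X. Rm y X Y Z)" "linear (\<lambda>Y. Rm y X Y Z)" "linear (\<lambda>Z. Rm y X Y Z)"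
    by (auto intro!: linearI simp: Rm_def l algebra_simps)
qed

text \<open>By the symmetry of the Christoffel form every term of the cyclic sum occurs twice, with
  opposite signs.\<close>

lemma Rm_bianchi:
  assumes y: "y \<in> V"
  shows "Rm y X Y Z + Rm y Y Z X + Rm y Z X Y = 0"
proof -
  have "dd (\<lambda>z. Gam G z A B) y = dd (\<lambda>z. Gam G z B A) y" for A B
    by (rule dd_cong_open[OF open_V y]) (rule Gam_sym)
  note swap = this
  show ?thesis
    unfolding Rm_def swap[of Z Y] swap[of Z X] swap[of Y X] Gam_sym[OF y, of Z Y] Gam_sym[OF y, of Z X] Gam_sym[OF y, of Y X]
    by simp
qed

text \<open>Tensoriality of curvature: the second derivatives of F commute, and the derivatives of A
  and B are absorbed by the bracket term.\<close>

lemma Rm_commutator: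
  assumes y: "y \<in> V" and sm: "smooth_on V A" "smooth_on V B" "smooth_on V F"
  shows "cov y (A y) (\<lambda>z. cov z (B z) F) - cov y (B y) (\<lambda>z. cov z (A z) F)
    - cov y (dd B y (A y) - dd A y (B y)) F = Rm y (A y) (B y) (F y)"
proof -
  have der: "dd (\<lambda>z. cov z (B z) F) y X = dd (\<lambda>z. dd F z (B y)) y X + dd F y (dd B y X)
      + (dd (\<lambda>z. Gam G z (B y) (F y)) y X + Gam G y (dd B y X) (F y) + Gam G y (B y) (dd F y X))"
    if sB: "smooth_on V B" for B X
  proof -
    have diff: "B differentiable (at y)" "F differentiable (at y)"
      using smooth_on_differentiable[OF _ y] sB sm by blast+
    have 1: "((\<lambda>z. dd F z (B z)) has_derivative (\<lambda>X. dd (\<lambda>z. dd F z (B y)) y X + dd F y (dd B y X))) (at y)"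
      using sm(3) y
      by (intro dd_field[OF open_V y] linear_dd smooth_on_differentiable[OF smooth_on_dd] diff)
        (auto intro: smooth_on_differentiable)
    have 2: "((\<lambda>z. Gam G z (B z) v) has_derivative (\<lambda>X. dd (\<lambda>z. Gam G z (B y) v) y X + Gam G y (dd B y X) v)) (at y)" for v
      by (intro dd_field[OF open_V y, where T = "\<lambda>z u. Gam G z u v"] linear_Gam differentiable_Gam y diff)
    have 3: "((\<lambda>z. Gam G z (B z) (F z)) has_derivative
        (\<lambda>X. dd (\<lambda>z. Gam G z (B z) (F y)) y X + Gam G y (B y) (dd F y X))) (at y)"
      using 2 by (intro dd_field[OF open_V y, where T = "\<lambda>z. Gam G z (B z)"] linear_Gam diff) (auto simp: differentiable_def)
    show ?thesis
      unfolding cov_def dd_eqI[OF has_derivative_add[OF 1 3]] dd_eqI[OF 2] ..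
  qed
  have lin: "linear (dd F y)" using sm(3) y linear_dd smooth_on_differentiable by blast
  have comm: "dd (\<lambda>z. dd F z (B y)) y (A y) = dd (\<lambda>z. dd F z (A y)) y (B y)"
    by (rule dd_dd_commute[OF open_V sm(3) y])
  show ?thesis
    unfolding cov_def[of y] der[OF sm(1)] der[OF sm(2)] Rm_def
    by (simp add: comm cov_def linear_diff[OF lin] linear_diff[OF linear_Gam(2)] linear_add[OF linear_Gam(1)] algebra_simps)
qed

text \<open>g(R(e_k,e_l)e_i,e_j) written through the connection coefficients alone, as in Cartan's
  second structure equation. This is the shape in which curvature emerges from commuting two spinor
  derivatives.\<close>

definition frameR :: "'n \<Rightarrow> 'n \<Rightarrow> 'n \<Rightarrow> 'n \<Rightarrow> real^'n \<Rightarrow> real" where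
  "frameR k l i j y = dd (om l i j) y (e k y) - dd (om k i j) y (e l y)
    + (\<Sum>m\<in>UNIV. om l i m y * om k m j y - om k i m y * om l m j y)
    - (\<Sum>m\<in>UNIV. (om k l m y - om l k m y) * om m i j y)"

lemma frameR_Rm:
  assumes y: "y \<in> V"
  shows "frameR k l i j y = ip y (Rm y (e k y) (e l y) (e i y)) (e j y)"
proof -
  have 1: "ip y (cov y (e k y) (\<lambda>z. cov z (e l z) (e i))) (e j y) = dd (om l i j) y (e k y) + (\<Sum>m\<in>UNIV. om l i m y * om k m j y)"
    for k l
  proof -
    have "dd (\<lambda>z. cov z (e l z) (e i)) y = dd (\<lambda>z. \<Sum>m\<in>UNIV. om l i m z *\<^sub>R e m z) y"
      by (rule dd_cong_open[OF open_V y]) (rule cov_e)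
    also have "\<dots> = (\<lambda>X. \<Sum>m\<in>UNIV. om l i m y *\<^sub>R dd (e m) y X + dd (om l i m) y X *\<^sub>R e m y)"
      by (intro dd_eqI has_derivative_sum has_derivative_scaleR dd_works differentiable_om differentiable_e y)
    finally have D: "dd (\<lambda>z. cov z (e l z) (e i)) y = (\<lambda>X. \<Sum>m\<in>UNIV. om l i m y *\<^sub>R dd (e m) y X + dd (om l i m) y X *\<^sub>R e m y)" .
    have "cov y (e k y) (\<lambda>z. cov z (e l z) (e i)) =
        dd (\<lambda>z. cov z (e l z) (e i)) y (e k y) + Gam G y (e k y) (\<Sum>m\<in>UNIV. om l i m y *\<^sub>R e m y)"
      by (simp only: cov_def[of y "e k y" "\<lambda>z. cov z (e l z) (e i)"] cov_e[OF y])
    then have "cov y (e k y) (\<lambda>z. cov z (e l z) (e i)) =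
        (\<Sum>m\<in>UNIV. om l i m y *\<^sub>R cov y (e k y) (e m) + dd (om l i m) y (e k y) *\<^sub>R e m y)"
      by (simp add: D cov_def[of y "e k y" "e _"] linear_sum[OF linear_Gam(1)] linear_scale[OF linear_Gam(1)]
          scaleR_add_right sum.distrib)
    then show ?thesis
      by (simp add: ip_lin ip_e[OF y] sum.distrib if_distrib om_def[symmetric] cong: if_cong)
  qed
  have 2: "ip y (cov y (\<Sum>m\<in>UNIV. c m *\<^sub>R e m y) (e i)) (e j y) = (\<Sum>m\<in>UNIV. c m * om m i j y)" for c
  proof -
    have lin: "linear (dd (e i) y)" using differentiable_e[OF y] linear_dd by blast
    have "cov y (\<Sum>m\<in>UNIV. c m *\<^sub>R e m y) (e i) = (\<Sum>m\<in>UNIV. c m *\<^sub>R cov y (e m y) (e i))"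
      by (simp add: cov_def linear_sum[OF lin] linear_scale[OF lin] linear_sum[OF linear_Gam(2)]
          linear_scale[OF linear_Gam(2)] scaleR_add_right sum.distrib)
    then show ?thesis by (simp add: ip_lin om_def)
  qed
  show ?thesis
    unfolding Rm_commutator[OF y smooth_e smooth_e smooth_e, symmetric] ip_lin 1 bracket_e[OF y] 2 frameR_def
    by (simp add: sum_subtractf)
qed

lemma frameR_antisym1: "frameR k l i j y = - frameR l k i j y"
  by (simp add: frameR_def sum_subtractf algebra_simps sum_negf sum.distrib)

lemma frameR_antisym2:
  assumes y: "y \<in> V"
  shows "frameR k l i j y = - frameR k l j i y"
proof -
  have neg: "dd (om k i j) y X = - dd (om k j i) y X" for k X
  proof -
    have "dd (om k i j) y = dd (\<lambda>z. - om k j i z) y"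
      by (rule dd_cong_open[OF open_V y]) (rule om_antisym)
    then show ?thesis using dd_bounded_linear[OF bounded_linear_minus[OF bounded_linear_ident] differentiable_om[OF y]]
      by metis
  qed
  have prod: "(\<Sum>m\<in>UNIV. om l i m y * om k m j y - om k i m y * om l m j y) =
      - (\<Sum>m\<in>UNIV. om l j m y * om k m i y - om k j m y * om l m i y)"
    unfolding sum_negf[symmetric]
  proof (rule sum.cong[OF refl])
    fix m
    show "om l i m y * om k m j y - om k i m y * om l m j y = - (om l j m y * om k m i y - om k j m y * om l m i y)"
      using om_antisym[OF y, of l i m] om_antisym[OF y, of k m j] om_antisym[OF y, of k i m] om_antisym[OF y, of l m j]
      by simp
  qed
  have "(\<Sum>m\<in>UNIV. (om k l m y - om l k m y) * om m i j y) = - (\<Sum>m\<in>UNIV. (om k l m y - om l k m y) * om m j i y)"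
    unfolding sum_negf[symmetric] by (intro sum.cong refl) (simp add: om_antisym[OF y, of _ i j])
  then show ?thesis unfolding frameR_def neg[of l] neg[of k] prod by simp
qed

lemma frameR_bianchi: "y \<in> V \<Longrightarrow> frameR k l i j y + frameR l i k j y + frameR i k l j y = 0"
  by (simp add: frameR_Rm ip_lin[symmetric] Rm_bianchi) (simp add: ip_def)

lemma Rm_axis:
  assumes y: "y \<in> V"
  shows "Rm y (axis i 1) (axis j 1) (axis k 1) $ l = riem_comp G l k i j y"
proof -
  have G2: "Gam G z (axis j 1) Y $ l = (\<Sum>m\<in>UNIV. symb G l j m z * Y $ m)" for z j Y l
  proof -
    have "Gam G z (axis j 1) Y $ l = (\<Sum>i\<in>UNIV. axis j 1 $ i * (\<Sum>m\<in>UNIV. symb G l i m z * Y $ m))"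
      by (simp add: Gam_def sum_distrib_left mult_ac)
    then show ?thesis by (simp add: sum_axis)
  qed
  have G1: "Gam G z (axis j 1) (axis k 1) $ l = symb G l j k z" for z j k l
    by (simp add: G2 sum_axis)
  have "dd (\<lambda>z. Gam G z (axis j 1) (axis k 1)) y X $ l = dd (symb G l j k) y X" for j k X
    using dd_vec_nth[OF differentiable_Gam[OF y], of "axis j 1" "axis k 1" l] by (simp add: G1[abs_def])
  then show ?thesis by (simp add: Rm_def riem_comp_def partial_def G2 sum_axis sum_subtractf)
qed

text \<open>The trace of X -> R(X,Y)Z is the same in the coordinate basis and in the frame, and the
  inverse metric, being a sum over the frame, converts the remaining contraction.\<close>

lemma scal_frameR:
  assumes y: "y \<in> V"
  shows "(\<Sum>j\<in>UNIV. \<Sum>k\<in>UNIV. matrix_inv (G y) $ j $ k * (\<Sum>i\<in>UNIV. riem_comp G i k i j y)) =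
    (\<Sum>k\<in>UNIV. \<Sum>l\<in>UNIV. frameR k l l k y)"
proof -
  have trace: "(\<Sum>k\<in>UNIV. ip y (L (e k y)) (e k y)) = (\<Sum>i\<in>UNIV. L (axis i 1) $ i)" if L: "linear L" for L
  proof -
    have "L (e k y) = (\<Sum>i\<in>UNIV. e k y $ i *\<^sub>R L (axis i 1))" for k
    proof -
      have "e k y = (\<Sum>i\<in>UNIV. e k y $ i *\<^sub>R axis i 1)"
        by (simp add: vec_eq_iff axis_def if_distrib cong: if_cong)
      then have "L (e k y) = L (\<Sum>i\<in>UNIV. e k y $ i *\<^sub>R axis i 1)" by simp
      then show ?thesis by (simp only: linear_sum[OF L] linear_scale[OF L])
    qed
    then have "(\<Sum>k\<in>UNIV. ip y (L (e k y)) (e k y)) =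
        (\<Sum>k\<in>UNIV. \<Sum>i\<in>UNIV. \<Sum>j\<in>UNIV. L (axis i 1) $ j * (e k y $ i * (G y *v e k y) $ j))"
      by (simp add: ip_lin) (simp add: ip_def inner_vec_def sum_distrib_left mult_ac)
    also have "\<dots> = (\<Sum>i\<in>UNIV. \<Sum>k\<in>UNIV. \<Sum>j\<in>UNIV. L (axis i 1) $ j * (e k y $ i * (G y *v e k y) $ j))"
      by (rule sum.swap)
    also have "\<dots> = (\<Sum>i\<in>UNIV. \<Sum>j\<in>UNIV. \<Sum>k\<in>UNIV. L (axis i 1) $ j * (e k y $ i * (G y *v e k y) $ j))"
      by (intro sum.cong refl sum.swap)
    also have "\<dots> = (\<Sum>i\<in>UNIV. L (axis i 1) $ i)"
      by (simp add: sum_distrib_left[symmetric] frame_dual[OF y] if_distrib cong: if_cong)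
    finally show ?thesis .
  qed
  define ric where "ric Y Z = (\<Sum>i\<in>UNIV. Rm y (axis i 1) Y Z $ i)" for Y Z
  have ric2: "ric (e l y) (e l y) = (\<Sum>j\<in>UNIV. \<Sum>k\<in>UNIV. e l y $ j * e l y $ k * ric (axis j 1) (axis k 1))" for l
  proof -
    have linY: "linear (\<lambda>Y. ric Y Z)" and linZ: "linear (ric Y)" for Y Z
      by (auto intro!: linearI simp: ric_def linear_add[OF linear_Rm(2)[OF y]] linear_scale[OF linear_Rm(2)[OF y]]
          linear_add[OF linear_Rm(3)[OF y]] linear_scale[OF linear_Rm(3)[OF y]] sum.distrib sum_distrib_left)
    have ex: "e l y = (\<Sum>i\<in>UNIV. e l y $ i *\<^sub>R axis i 1)"
      by (simp add: vec_eq_iff axis_def if_distrib cong: if_cong)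
    have "ric (e l y) (e l y) = ric (\<Sum>i\<in>UNIV. e l y $ i *\<^sub>R axis i 1) (\<Sum>i\<in>UNIV. e l y $ i *\<^sub>R axis i 1)"
      using ex by simp
    also have "\<dots> = (\<Sum>j\<in>UNIV. e l y $ j * ric (axis j 1) (\<Sum>i\<in>UNIV. e l y $ i *\<^sub>R axis i 1))"
      by (simp only: linear_sum[OF linY] linear_scale[OF linY] real_scaleR_def)
    finally show ?thesis
      by (simp only: linear_sum[OF linZ] linear_scale[OF linZ] sum_distrib_left real_scaleR_def mult.assoc)
  qed
  have "(\<Sum>k\<in>UNIV. \<Sum>l\<in>UNIV. frameR k l l k y) = (\<Sum>l\<in>UNIV. ric (e l y) (e l y))"
    unfolding frameR_Rm[OF y] ric_def
    by (subst sum.swap) (simp add: trace[OF linear_Rm(1)[OF y]])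
  also have "\<dots> = (\<Sum>l\<in>UNIV. \<Sum>j\<in>UNIV. \<Sum>k\<in>UNIV. e l y $ j * e l y $ k * ric (axis j 1) (axis k 1))"
    by (simp add: ric2)
  also have "\<dots> = (\<Sum>j\<in>UNIV. \<Sum>l\<in>UNIV. \<Sum>k\<in>UNIV. e l y $ j * e l y $ k * ric (axis j 1) (axis k 1))"
    by (rule sum.swap)
  also have "\<dots> = (\<Sum>j\<in>UNIV. \<Sum>k\<in>UNIV. \<Sum>l\<in>UNIV. e l y $ j * e l y $ k * ric (axis j 1) (axis k 1))"
    by (intro sum.cong refl sum.swap)
  also have "\<dots> = (\<Sum>j\<in>UNIV. \<Sum>k\<in>UNIV. matrix_inv (G y) $ j $ k * (\<Sum>i\<in>UNIV. riem_comp G i k i j y))"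
    by (simp add: inverse_metric(1)[OF y] sum_distrib_right ric_def Rm_axis[OF y])
  finally show ?thesis by simp
qed

end

section \<open>Clifford contractions of the curvature and the spin connection operator\<close>

context clifford_ops begin

lemma gam_swap_if: "\<gamma> i (\<gamma> j x) = - \<gamma> j (\<gamma> i x) - (if i = j then 2 *\<^sub>R x else 0)"
proof (cases "i = j")
  case True
  then show ?thesis by (simp add: gam_sq scaleR_2)
next
  case False
  then show ?thesis using gam_swap[OF False, of x] by simp
qed

text \<open>The cubic Clifford sum is rotated cyclically three times; the Bianchi identity makes the three
  rotations cancel up to contractions.\<close>

lemma bianchi_contraction:
  fixes r :: "'n \<Rightarrow> 'n \<Rightarrow> 'n \<Rightarrow> real"
  assumes anti: "\<And>k l i. r k l i = - r l k i" and bianchi: "\<And>k l i. r k l i + r l i k + r i k l = 0"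
  shows "(\<Sum>k\<in>UNIV. \<Sum>l\<in>UNIV. \<Sum>i\<in>UNIV. r k l i *\<^sub>R \<gamma> k (\<gamma> l (\<gamma> i x))) =
    2 *\<^sub>R (\<Sum>k\<in>UNIV. \<Sum>l\<in>UNIV. r k l k *\<^sub>R \<gamma> l x)"
proof -
  define S where "S r = (\<Sum>k\<in>UNIV. \<Sum>l\<in>UNIV. \<Sum>i\<in>UNIV. r k l i *\<^sub>R \<gamma> k (\<gamma> l (\<gamma> i x)))" for r :: "'n \<Rightarrow> 'n \<Rightarrow> 'n \<Rightarrow> real"
  have rot: "\<gamma> k (\<gamma> l (\<gamma> i x)) = \<gamma> l (\<gamma> i (\<gamma> k x)) + (if i = k then 2 *\<^sub>R \<gamma> l x else 0) - (if k = l then 2 *\<^sub>R \<gamma> i x else 0)"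
    for k l i
  proof -
    have "\<gamma> k (\<gamma> l (\<gamma> i x)) = - \<gamma> l (\<gamma> k (\<gamma> i x)) - (if k = l then 2 *\<^sub>R \<gamma> i x else 0)"
      by (rule gam_swap_if)
    moreover have "\<gamma> k (\<gamma> i x) = - \<gamma> i (\<gamma> k x) - (if i = k then 2 *\<^sub>R x else 0)"
      by (subst gam_swap_if) auto
    ultimately show ?thesis by (simp add: gam_lin)
  qed
  have S_rot: "S r = S (\<lambda>k l i. r i k l) + 2 *\<^sub>R (\<Sum>k\<in>UNIV. \<Sum>l\<in>UNIV. r k l k *\<^sub>R \<gamma> l x)
      - 2 *\<^sub>R (\<Sum>k\<in>UNIV. \<Sum>l\<in>UNIV. r k k l *\<^sub>R \<gamma> l x)" for r
  proof -
    have "S r = (\<Sum>k\<in>UNIV. \<Sum>l\<in>UNIV. \<Sum>i\<in>UNIV. r k l i *\<^sub>R \<gamma> l (\<gamma> i (\<gamma> k x)))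
      + (\<Sum>k\<in>UNIV. \<Sum>l\<in>UNIV. \<Sum>i\<in>UNIV. if i = k then (2 * r k l i) *\<^sub>R \<gamma> l x else 0)
      - (\<Sum>k\<in>UNIV. \<Sum>l\<in>UNIV. \<Sum>i\<in>UNIV. if k = l then (2 * r k l i) *\<^sub>R \<gamma> i x else 0)"
      unfolding S_def sum.distrib[symmetric] sum_subtractf[symmetric]
      by (intro sum.cong refl, subst rot) (simp add: algebra_simps)
    also have "(\<Sum>k\<in>UNIV. \<Sum>l\<in>UNIV. \<Sum>i\<in>UNIV. r k l i *\<^sub>R \<gamma> l (\<gamma> i (\<gamma> k x))) = S (\<lambda>k l i. r i k l)"
    proof -
      have "S (\<lambda>k l i. r i k l) = (\<Sum>l\<in>UNIV. \<Sum>i\<in>UNIV. \<Sum>k\<in>UNIV. r k l i *\<^sub>R \<gamma> l (\<gamma> i (\<gamma> k x)))" by (simp add: S_def)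
      also have "\<dots> = (\<Sum>l\<in>UNIV. \<Sum>k\<in>UNIV. \<Sum>i\<in>UNIV. r k l i *\<^sub>R \<gamma> l (\<gamma> i (\<gamma> k x)))" by (intro sum.cong refl sum.swap)
      also have "\<dots> = (\<Sum>k\<in>UNIV. \<Sum>l\<in>UNIV. \<Sum>i\<in>UNIV. r k l i *\<^sub>R \<gamma> l (\<gamma> i (\<gamma> k x)))" by (rule sum.swap)
      finally show ?thesis by simp
    qed
    also have "(\<Sum>k\<in>UNIV. \<Sum>l\<in>UNIV. \<Sum>i\<in>UNIV. if i = k then (2 * r k l i) *\<^sub>R \<gamma> l x else 0) =
        2 *\<^sub>R (\<Sum>k\<in>UNIV. \<Sum>l\<in>UNIV. r k l k *\<^sub>R \<gamma> l x)"
      by (simp add: scaleR_sum_right)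
    also have "(\<Sum>k\<in>UNIV. \<Sum>l\<in>UNIV. \<Sum>i\<in>UNIV. if k = l then (2 * r k l i) *\<^sub>R \<gamma> i x else 0) =
        2 *\<^sub>R (\<Sum>k\<in>UNIV. \<Sum>l\<in>UNIV. r k k l *\<^sub>R \<gamma> l x)"
    proof -
      have "(\<Sum>l\<in>UNIV. \<Sum>i\<in>UNIV. if k = l then (2 * r k l i) *\<^sub>R \<gamma> i x else 0) = (\<Sum>i\<in>UNIV. (2 * r k k i) *\<^sub>R \<gamma> i x)" for k
        by (subst sum.swap) simp
      then show ?thesis by (simp add: scaleR_sum_right)
    qed
    finally show ?thesis .
  qed
  define T where "T = (\<Sum>k\<in>UNIV. \<Sum>l\<in>UNIV. r k l k *\<^sub>R \<gamma> l x)"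
  have kk: "r k k l = 0" for k l using anti[of k k l] by simp
  have T': "(\<Sum>k\<in>UNIV. \<Sum>l\<in>UNIV. r l k k *\<^sub>R \<gamma> l x) = - T"
    unfolding T_def sum_negf[symmetric] by (intro sum.cong refl) (metis anti scaleR_minus_left)
  have 1: "S r = S (\<lambda>k l i. r i k l) + 2 *\<^sub>R T"
    using S_rot[of r] by (simp add: kk T_def)
  have 2: "S (\<lambda>k l i. r i k l) = S (\<lambda>k l i. r l i k) + 2 *\<^sub>R T"
    using S_rot[of "\<lambda>k l i. r i k l"] by (simp add: kk T')
  have "S r + S (\<lambda>k l i. r l i k) + S (\<lambda>k l i. r i k l) = 0"
    unfolding S_def sum.distrib[symmetric] scaleR_add_left[symmetric] bianchi by simp
  moreover have "3 *\<^sub>R v = v + v + v" for v :: 'a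
    using scaleR_add_left[of 1 2 v] by (simp add: scaleR_2)
  \<comment> \<open>Subtracting the vanishing sum of the three rotations leaves two differences,
    each a multiple of the contraction T.\<close>
  ultimately have "3 *\<^sub>R S r = (S r - S (\<lambda>k l i. r i k l)) + (S r - S (\<lambda>k l i. r l i k))"
    by (simp add: eq_neg_iff_add_eq_0[symmetric] algebra_simps)
  also have "\<dots> = 2 *\<^sub>R T + (2 *\<^sub>R T + 2 *\<^sub>R T)" unfolding 1 2 by simp
  also have "\<dots> = 3 *\<^sub>R (2 *\<^sub>R T)" by (simp add: scaleR_add_left[symmetric])
  finally have "3 *\<^sub>R S r = 3 *\<^sub>R (2 *\<^sub>R T)" .
  then have "S r = 2 *\<^sub>R T" by (simp only: scaleR_cancel_left) simp
  then show ?thesis by (simp add: S_def T_def)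
qed

text \<open>For distinct indices the product of the two anticommuting skew operators is again skew,
  so its quadratic form vanishes.\<close>

lemma gam_gam_inner: "\<gamma> k (\<gamma> j x) \<bullet> x = (if k = j then - (x \<bullet> x) else 0)"
proof (cases "k = j")
  case False
  have "\<gamma> k (\<gamma> j x) \<bullet> x = - (\<gamma> j x \<bullet> \<gamma> k x)" by (rule gam_skew)
  also have "\<dots> = \<gamma> j (\<gamma> k x) \<bullet> x" by (simp add: gam_skew[of j x] inner_commute)
  also have "\<dots> = - (\<gamma> k (\<gamma> j x) \<bullet> x)" by (simp add: gam_swap[OF False])
  finally show ?thesis using False by simp
qed (simp add: gam_sq)

text \<open>For each fixed last index \<open>bianchi_contraction\<close> reduces the quartic
  Clifford sum to a quadratic one, and pairing with x keeps only its diagonal. The factors 1/4 of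
  the spin connection and 1/2 of \<open>gam_gam_split\<close> turn the 2 here into S/4.\<close>

lemma curvature_term:
  fixes r :: "'n \<Rightarrow> 'n \<Rightarrow> 'n \<Rightarrow> 'n \<Rightarrow> real"
  assumes anti: "\<And>k l i j. r k l i j = - r l k i j" and anti2: "\<And>k l i j. r k l i j = - r k l j i"
    and bianchi: "\<And>k l i j. r k l i j + r l i k j + r i k l j = 0"
  shows "(\<Sum>k\<in>UNIV. \<Sum>l\<in>UNIV. \<gamma> k (\<gamma> l (\<Sum>i\<in>UNIV. \<Sum>j\<in>UNIV. r k l i j *\<^sub>R \<gamma> i (\<gamma> j x)))) \<bullet> x =
    2 * (\<Sum>k\<in>UNIV. \<Sum>l\<in>UNIV. r k l l k) * (x \<bullet> x)"
proof -
  have "(\<Sum>k\<in>UNIV. \<Sum>l\<in>UNIV. \<gamma> k (\<gamma> l (\<Sum>i\<in>UNIV. \<Sum>j\<in>UNIV. r k l i j *\<^sub>R \<gamma> i (\<gamma> j x)))) =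
      (\<Sum>k\<in>UNIV. \<Sum>l\<in>UNIV. \<Sum>j\<in>UNIV. \<Sum>i\<in>UNIV. r k l i j *\<^sub>R \<gamma> k (\<gamma> l (\<gamma> i (\<gamma> j x))))"
    by (simp add: gam_lin) (intro sum.cong refl sum.swap)
  also have "\<dots> = (\<Sum>k\<in>UNIV. \<Sum>j\<in>UNIV. \<Sum>l\<in>UNIV. \<Sum>i\<in>UNIV. r k l i j *\<^sub>R \<gamma> k (\<gamma> l (\<gamma> i (\<gamma> j x))))"
    by (intro sum.cong refl sum.swap)
  also have "\<dots> = (\<Sum>j\<in>UNIV. \<Sum>k\<in>UNIV. \<Sum>l\<in>UNIV. \<Sum>i\<in>UNIV. r k l i j *\<^sub>R \<gamma> k (\<gamma> l (\<gamma> i (\<gamma> j x))))"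
    by (rule sum.swap)
  also have "\<dots> = (\<Sum>j\<in>UNIV. 2 *\<^sub>R (\<Sum>k\<in>UNIV. \<Sum>l\<in>UNIV. r k l k j *\<^sub>R \<gamma> l (\<gamma> j x)))"
    by (intro sum.cong refl bianchi_contraction anti bianchi)
  finally have "(\<Sum>k\<in>UNIV. \<Sum>l\<in>UNIV. \<gamma> k (\<gamma> l (\<Sum>i\<in>UNIV. \<Sum>j\<in>UNIV. r k l i j *\<^sub>R \<gamma> i (\<gamma> j x)))) \<bullet> x =
      2 * (\<Sum>j\<in>UNIV. \<Sum>k\<in>UNIV. \<Sum>l\<in>UNIV. r k l k j * (\<gamma> l (\<gamma> j x) \<bullet> x))"
    by (simp add: inner_sum_left sum_distrib_left)
  also have "\<dots> = 2 * (\<Sum>j\<in>UNIV. \<Sum>k\<in>UNIV. - r k j k j * (x \<bullet> x))"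
    by (simp add: gam_gam_inner if_distrib cong: if_cong)
  also have "\<dots> = 2 * (\<Sum>j\<in>UNIV. \<Sum>k\<in>UNIV. r k j j k * (x \<bullet> x))"
  proof -
    have "- r k j k j = r k j j k" for k j using anti2[of k j k j] by simp
    then show ?thesis by simp
  qed
  also have "\<dots> = 2 * (\<Sum>k\<in>UNIV. \<Sum>l\<in>UNIV. r k l l k) * (x \<bullet> x)"
    by (subst sum.swap) (simp add: sum_distrib_right)
  finally show ?thesis .
qed

text \<open>The part of H symmetric in k and l meets the anticommutator of the gammas and leaves
  minus its trace; the antisymmetric part will be curvature.\<close>

lemma gam_gam_split:
  "(\<Sum>k\<in>UNIV. \<Sum>l\<in>UNIV. \<gamma> k (\<gamma> l (H k l))) =
    - (\<Sum>k\<in>UNIV. H k k) + (1/2) *\<^sub>R (\<Sum>k\<in>UNIV. \<Sum>l\<in>UNIV. \<gamma> k (\<gamma> l (H k l - H l k)))"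
proof -
  have "(\<Sum>k\<in>UNIV. \<Sum>l\<in>UNIV. \<gamma> k (\<gamma> l (H l k))) + (\<Sum>k\<in>UNIV. \<Sum>l\<in>UNIV. \<gamma> k (\<gamma> l (H k l))) =
      (\<Sum>k\<in>UNIV. \<Sum>l\<in>UNIV. \<gamma> k (\<gamma> l (H l k)) + \<gamma> l (\<gamma> k (H l k)))"
    by (subst (2) sum.swap) (simp add: sum.distrib)
  also have "\<dots> = -2 *\<^sub>R (\<Sum>k\<in>UNIV. H k k)"
    by (simp add: gam_rel if_distrib if_distribR scaleR_sum_right cong: if_cong) (simp add: sum_negf)?
  finally have "(\<Sum>k\<in>UNIV. \<Sum>l\<in>UNIV. \<gamma> k (\<gamma> l (H l k))) = -2 *\<^sub>R (\<Sum>k\<in>UNIV. H k k) - (\<Sum>k\<in>UNIV. \<Sum>l\<in>UNIV. \<gamma> k (\<gamma> l (H k l)))"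
    by (simp add: eq_diff_eq)
  then have "(\<Sum>k\<in>UNIV. \<Sum>l\<in>UNIV. \<gamma> k (\<gamma> l (H k l - H l k))) =
      2 *\<^sub>R (\<Sum>k\<in>UNIV. \<Sum>l\<in>UNIV. \<gamma> k (\<gamma> l (H k l))) + 2 *\<^sub>R (\<Sum>k\<in>UNIV. H k k)"
    by (simp add: gam_lin sum_subtractf scaleR_2)
  then show ?thesis by (simp add: scaleR_add_right)
qed

text \<open>The zeroth-order part of the covariant derivative in a direction X: w i j is
  g(\<nabla>_X e_i, e_j), and c is the real number for which i c is the value of the connection form
  on s_*(X).\<close>

definition conn_op :: "('n \<Rightarrow> 'n \<Rightarrow> real) \<Rightarrow> real \<Rightarrow> 'a \<Rightarrow> 'a" where
  "conn_op w c x = (1/4) *\<^sub>R (\<Sum>i\<in>UNIV. \<Sum>j\<in>UNIV. w i j *\<^sub>R \<gamma> i (\<gamma> j x)) + (c / 2) *\<^sub>R J x"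

lemma linear_conn_op: "linear (conn_op w c)"
  by (intro linearI) (simp_all add: conn_op_def gam_lin J_lin sum.distrib scaleR_add_right scaleR_sum_right mult_ac)

lemmas conn_op_lin = linear_add[OF linear_conn_op] linear_diff[OF linear_conn_op] linear_scale[OF linear_conn_op]
  linear_sum[OF linear_conn_op]

lemma conn_op_J: "conn_op w c (J x) = J (conn_op w c x)"
  by (simp add: conn_op_def J_lin J_gam)

lemma conn_op_skew:
  assumes anti: "\<And>i j. w i j = - w j i"
  shows "conn_op w c x \<bullet> y = - (x \<bullet> conn_op w c y)"
proof -
  have "(\<Sum>i\<in>UNIV. \<Sum>j\<in>UNIV. w i j * (\<gamma> i (\<gamma> j x) \<bullet> y)) = (\<Sum>i\<in>UNIV. \<Sum>j\<in>UNIV. w i j * (x \<bullet> \<gamma> j (\<gamma> i y)))"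
    by (simp add: gam_skew)
  also have "\<dots> = (\<Sum>i\<in>UNIV. \<Sum>j\<in>UNIV. w j i * (x \<bullet> \<gamma> i (\<gamma> j y)))" by (rule sum.swap)
  also have "\<dots> = - (\<Sum>i\<in>UNIV. \<Sum>j\<in>UNIV. w i j * (x \<bullet> \<gamma> i (\<gamma> j y)))"
    unfolding sum_negf[symmetric] by (intro sum.cong refl) (metis anti mult_minus_left)
  finally show ?thesis
    by (simp add: conn_op_def inner_simps inner_sum_left inner_sum_right J_skew)
qed

text \<open>The commutator with \<open>\<gamma> l\<close> is Clifford multiplication by the
  derivative of e_l, which makes Clifford multiplication parallel. The coefficient 1/4 is right
  because the index l is met in either position of the pair, each time with a factor 2.\<close>

lemma conn_op_gam:
  assumes anti: "\<And>i j. w i j = - w j i"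
  shows "conn_op w c (\<gamma> l x) = \<gamma> l (conn_op w c x) + (\<Sum>m\<in>UNIV. w l m *\<^sub>R \<gamma> m x)"
proof -
  have "\<gamma> i (\<gamma> j (\<gamma> l x)) = \<gamma> l (\<gamma> i (\<gamma> j x)) + (if l = i then 2 *\<^sub>R \<gamma> j x else 0) - (if l = j then 2 *\<^sub>R \<gamma> i x else 0)" for i j
    using gam_swap_if[of l i "\<gamma> j x"] gam_swap_if[of l j x] by (simp add: gam_lin) (simp add: algebra_simps)?
  note rot = this
  have "w i j *\<^sub>R \<gamma> i (\<gamma> j (\<gamma> l x)) = w i j *\<^sub>R \<gamma> l (\<gamma> i (\<gamma> j x))
      + (if l = i then (2 * w i j) *\<^sub>R \<gamma> j x else 0) - (if l = j then (2 * w i j) *\<^sub>R \<gamma> i x else 0)" for i j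
    unfolding rot[of i j] by (simp add: scaleR_diff_right scaleR_add_right)
  then have "(\<Sum>i\<in>UNIV. \<Sum>j\<in>UNIV. w i j *\<^sub>R \<gamma> i (\<gamma> j (\<gamma> l x))) = (\<Sum>i\<in>UNIV. \<Sum>j\<in>UNIV. w i j *\<^sub>R \<gamma> l (\<gamma> i (\<gamma> j x)))
      + (\<Sum>i\<in>UNIV. \<Sum>j\<in>UNIV. if l = i then (2 * w i j) *\<^sub>R \<gamma> j x else 0)
      - (\<Sum>i\<in>UNIV. \<Sum>j\<in>UNIV. if l = j then (2 * w i j) *\<^sub>R \<gamma> i x else 0)"
    by (simp add: sum.distrib sum_subtractf)
  also have "(\<Sum>i\<in>UNIV. \<Sum>j\<in>UNIV. if l = i then (2 * w i j) *\<^sub>R \<gamma> j x else 0) = (\<Sum>j\<in>UNIV. (2 * w l j) *\<^sub>R \<gamma> j x)"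
    by (subst sum.swap) simp
  also have "(\<Sum>i\<in>UNIV. \<Sum>j\<in>UNIV. if l = j then (2 * w i j) *\<^sub>R \<gamma> i x else 0) = - (\<Sum>j\<in>UNIV. (2 * w l j) *\<^sub>R \<gamma> j x)"
    unfolding sum_negf[symmetric] by (simp add: anti[of _ l])
  also have "(\<Sum>i\<in>UNIV. \<Sum>j\<in>UNIV. w i j *\<^sub>R \<gamma> l (\<gamma> i (\<gamma> j x))) + (\<Sum>j\<in>UNIV. (2 * w l j) *\<^sub>R \<gamma> j x)
      - - (\<Sum>j\<in>UNIV. (2 * w l j) *\<^sub>R \<gamma> j x) = \<gamma> l (\<Sum>i\<in>UNIV. \<Sum>j\<in>UNIV. w i j *\<^sub>R \<gamma> i (\<gamma> j x)) + 4 *\<^sub>R (\<Sum>j\<in>UNIV. w l j *\<^sub>R \<gamma> j x)"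
  proof -
    have "4 *\<^sub>R (\<Sum>j\<in>UNIV. w l j *\<^sub>R \<gamma> j x) = (\<Sum>j\<in>UNIV. (2 * w l j) *\<^sub>R \<gamma> j x) + (\<Sum>j\<in>UNIV. (2 * w l j) *\<^sub>R \<gamma> j x)"
      by (simp add: scaleR_sum_right sum.distrib[symmetric] scaleR_add_left[symmetric])
    then show ?thesis by (simp add: gam_lin)
  qed
  finally have "(\<Sum>i\<in>UNIV. \<Sum>j\<in>UNIV. w i j *\<^sub>R \<gamma> i (\<gamma> j (\<gamma> l x))) =
      \<gamma> l (\<Sum>i\<in>UNIV. \<Sum>j\<in>UNIV. w i j *\<^sub>R \<gamma> i (\<gamma> j x)) + 4 *\<^sub>R (\<Sum>j\<in>UNIV. w l j *\<^sub>R \<gamma> j x)" .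
  then show ?thesis by (simp add: conn_op_def gam_lin J_gam scaleR_add_right)
qed

text \<open>The spin representation respects Lie brackets, and the scalar parts commute with
  everything. The right-hand side is the quadratic part of \<open>frameR\<close>.\<close>

lemma conn_op_commutator:
  assumes anti: "\<And>i j. w i j = - w j i" and anti': "\<And>i j. w' i j = - w' j i"
  shows "conn_op w c (conn_op w' c' x) - conn_op w' c' (conn_op w c x) =
    (1/4) *\<^sub>R (\<Sum>i\<in>UNIV. \<Sum>j\<in>UNIV. (\<Sum>m\<in>UNIV. w' i m * w m j - w i m * w' m j) *\<^sub>R \<gamma> i (\<gamma> j x))"
proof -
  have "conn_op w c (\<gamma> i (\<gamma> j x)) = \<gamma> i (\<gamma> j (conn_op w c x))
      + (\<Sum>m\<in>UNIV. w j m *\<^sub>R \<gamma> i (\<gamma> m x)) + (\<Sum>m\<in>UNIV. w i m *\<^sub>R \<gamma> m (\<gamma> j x))" for i j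
    by (simp add: conn_op_gam[OF anti] gam_lin)
  then have "conn_op w c (conn_op w' c' x) - conn_op w' c' (conn_op w c x) =
      (1/4) *\<^sub>R (\<Sum>i\<in>UNIV. \<Sum>j\<in>UNIV. w' i j *\<^sub>R ((\<Sum>m\<in>UNIV. w j m *\<^sub>R \<gamma> i (\<gamma> m x)) + (\<Sum>m\<in>UNIV. w i m *\<^sub>R \<gamma> m (\<gamma> j x))))"
    unfolding conn_op_def[of w' c'] conn_op_lin conn_op_J
    by (simp add: scaleR_add_right sum.distrib)
  also have "(\<Sum>i\<in>UNIV. \<Sum>j\<in>UNIV. w' i j *\<^sub>R ((\<Sum>m\<in>UNIV. w j m *\<^sub>R \<gamma> i (\<gamma> m x)) + (\<Sum>m\<in>UNIV. w i m *\<^sub>R \<gamma> m (\<gamma> j x)))) =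
      (\<Sum>i\<in>UNIV. \<Sum>j\<in>UNIV. \<Sum>m\<in>UNIV. (w' i j * w j m) *\<^sub>R \<gamma> i (\<gamma> m x)) +
      (\<Sum>i\<in>UNIV. \<Sum>j\<in>UNIV. \<Sum>m\<in>UNIV. (w' i j * w i m) *\<^sub>R \<gamma> m (\<gamma> j x))"
    by (simp add: scaleR_add_right sum.distrib scaleR_sum_right)
  also have "(\<Sum>i\<in>UNIV. \<Sum>j\<in>UNIV. \<Sum>m\<in>UNIV. (w' i j * w j m) *\<^sub>R \<gamma> i (\<gamma> m x)) =
      (\<Sum>i\<in>UNIV. \<Sum>j\<in>UNIV. (\<Sum>m\<in>UNIV. w' i m * w m j) *\<^sub>R \<gamma> i (\<gamma> j x))"
    by (rule sum.cong[OF refl], subst sum.swap) (simp add: scaleR_sum_left)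
  also have "(\<Sum>i\<in>UNIV. \<Sum>j\<in>UNIV. \<Sum>m\<in>UNIV. (w' i j * w i m) *\<^sub>R \<gamma> m (\<gamma> j x)) =
      (\<Sum>i\<in>UNIV. \<Sum>j\<in>UNIV. (\<Sum>m\<in>UNIV. - (w i m * w' m j)) *\<^sub>R \<gamma> i (\<gamma> j x))"
  proof -
    have "(\<Sum>i\<in>UNIV. \<Sum>j\<in>UNIV. \<Sum>m\<in>UNIV. (w' i j * w i m) *\<^sub>R \<gamma> m (\<gamma> j x)) =
        (\<Sum>i\<in>UNIV. \<Sum>m\<in>UNIV. \<Sum>j\<in>UNIV. (w' i j * w i m) *\<^sub>R \<gamma> m (\<gamma> j x))" by (intro sum.cong refl sum.swap)
    also have "\<dots> = (\<Sum>m\<in>UNIV. \<Sum>i\<in>UNIV. \<Sum>j\<in>UNIV. (w' i j * w i m) *\<^sub>R \<gamma> m (\<gamma> j x))" by (rule sum.swap)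
    also have "\<dots> = (\<Sum>m\<in>UNIV. \<Sum>j\<in>UNIV. \<Sum>i\<in>UNIV. (w' i j * w i m) *\<^sub>R \<gamma> m (\<gamma> j x))" by (intro sum.cong refl sum.swap)
    also have "\<dots> = (\<Sum>m\<in>UNIV. \<Sum>j\<in>UNIV. (\<Sum>i\<in>UNIV. - (w m i * w' i j)) *\<^sub>R \<gamma> m (\<gamma> j x))"
      unfolding scaleR_sum_left
    proof (intro sum.cong refl)
      fix m j i show "(w' i j * w i m) *\<^sub>R \<gamma> m (\<gamma> j x) = (- (w m i * w' i j)) *\<^sub>R \<gamma> m (\<gamma> j x)"
        using anti[of i m] by simp
    qed
    finally show ?thesis .
  qed
  finally show ?thesis
    by (simp add: sum.distrib[symmetric] scaleR_add_left[symmetric] del: sum_negf) (simp add: sum_subtractf sum_negf)?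
qed

end

section \<open>Covariant derivative, curvature and Laplacian of local spinors\<close>

locale spinor_geometry = frame_geometry V G e + clifford_ops \<gamma> J
  for V :: "(real^'n::finite) set" and G e and \<gamma> :: "'n \<Rightarrow> 'a::euclidean_space \<Rightarrow> 'a" and J +
  fixes a :: "'n \<Rightarrow> real^'n \<Rightarrow> real"
  assumes smooth_a: "smooth_on V (a k)"
begin

abbreviation conn :: "'n \<Rightarrow> real^'n \<Rightarrow> 'a \<Rightarrow> 'a" where
  "conn k y \<equiv> conn_op (\<lambda>i j. om k i j y) (a k y)"

definition nab :: "'n \<Rightarrow> (real^'n \<Rightarrow> 'a) \<Rightarrow> real^'n \<Rightarrow> 'a" where
  "nab k \<phi> y = dd \<phi> y (e k y) + conn k y (\<phi> y)"

lemma bounded_linear_gam: "bounded_linear (\<gamma> i)" and bounded_linear_J: "bounded_linear J"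
  using linear_gam linear_J by (simp_all add: linear_conv_bounded_linear)

lemma smooth_conn:
  assumes "smooth_on V \<phi>"
  shows "smooth_on V (\<lambda>y. conn k y (\<phi> y))"
proof -
  have "smooth_on V (\<lambda>y. (a k y * (1/2)) *\<^sub>R J (\<phi> y))"
    using assms by (intro smooth_on_scaleR smooth_on_mult smooth_a smooth_on_const smooth_on_bounded_linear[OF bounded_linear_J] open_V)
  then have 2: "smooth_on V (\<lambda>y. (a k y / 2) *\<^sub>R J (\<phi> y))" by simp
  show ?thesis
    unfolding conn_op_def using assms
    by (intro smooth_on_add[OF _ _ 2] smooth_on_scaleR smooth_on_const smooth_on_sum smooth_om open_V
        smooth_on_bounded_linear[OF bounded_linear_gam])
qed

lemma smooth_nab: "smooth_on V \<phi> \<Longrightarrow> smooth_on V (nab k \<phi>)"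
  unfolding nab_def by (intro smooth_on_add smooth_on_dd_field smooth_conn smooth_e open_V)

lemma nab_gam:
  assumes y: "y \<in> V" and \<phi>: "\<phi> differentiable (at y)"
  shows "nab k (\<lambda>z. \<gamma> l (\<phi> z)) y = \<gamma> l (nab k \<phi> y) + (\<Sum>m\<in>UNIV. om k l m y *\<^sub>R \<gamma> m (\<phi> y))"
  unfolding nab_def dd_bounded_linear[OF bounded_linear_gam \<phi>]
  by (simp add: conn_op_gam[of "\<lambda>i j. om k i j y", OF om_antisym[OF y]] gam_lin)

lemma nab_sum:
  assumes "\<And>i. i \<in> I \<Longrightarrow> \<phi> i differentiable (at y)"
  shows "nab k (\<lambda>z. \<Sum>i\<in>I. \<phi> i z) y = (\<Sum>i\<in>I. nab k (\<phi> i) y)"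
  by (simp add: nab_def dd_sum assms conn_op_lin sum.distrib)

lemma nab_scaleR: "\<phi> differentiable (at y) \<Longrightarrow> nab k (\<lambda>z. c *\<^sub>R \<phi> z) y = c *\<^sub>R nab k \<phi> y"
  unfolding nab_def dd_bounded_linear[OF bounded_linear_scaleR_right] by (simp add: conn_op_lin scaleR_add_right)

lemma nab_inner:
  assumes y: "y \<in> V" and "\<phi> differentiable (at y)" "\<eta> differentiable (at y)"
  shows "dd (\<lambda>z. \<phi> z \<bullet> \<eta> z) y (e k y) = nab k \<phi> y \<bullet> \<eta> y + \<phi> y \<bullet> nab k \<eta> y"
proof -
  have "dd (\<lambda>z. \<phi> z \<bullet> \<eta> z) y = (\<lambda>X. \<phi> y \<bullet> dd \<eta> y X + dd \<phi> y X \<bullet> \<eta> y)"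
    by (intro dd_eqI has_derivative_inner dd_works assms)
  then show ?thesis
    by (simp add: nab_def inner_simps conn_op_skew[of "\<lambda>i j. om k i j y", OF om_antisym[OF y]])
qed

text \<open>\<Omega>(e_k, e_l): the exterior derivative of the form with components a, where the
  last sum is its value on the bracket of e_k and e_l.\<close>

definition curvF :: "'n \<Rightarrow> 'n \<Rightarrow> real^'n \<Rightarrow> real" where
  "curvF k l y = dd (a l) y (e k y) - dd (a k) y (e l y) - (\<Sum>m\<in>UNIV. (om k l m y - om l k m y) * a m y)"

text \<open>Second derivatives of the spinor cancel, first-order terms assemble into the bracket,
  and the derivatives and commutators of the connection operators give \<open>frameR\<close> and
  \<open>curvF\<close>.\<close>

lemma nab_commutator:
  assumes y: "y \<in> V" and \<phi>: "smooth_on V \<phi>"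
  shows "nab k (nab l \<phi>) y - nab l (nab k \<phi>) y - (\<Sum>m\<in>UNIV. (om k l m y - om l k m y) *\<^sub>R nab m \<phi> y) =
    (1/4) *\<^sub>R (\<Sum>i\<in>UNIV. \<Sum>j\<in>UNIV. frameR k l i j y *\<^sub>R \<gamma> i (\<gamma> j (\<phi> y))) + (curvF k l y / 2) *\<^sub>R J (\<phi> y)"
proof -
  have d\<phi>: "\<phi> differentiable (at y)" using smooth_on_differentiable[OF \<phi> y] .
  have da: "a l differentiable (at y)" for l using smooth_on_differentiable[OF smooth_a y] .
  have lin: "linear (dd \<phi> y)" using linear_dd[OF d\<phi>] .
  have D: "dd (nab l \<phi>) y X = dd (\<lambda>z. dd \<phi> z (e l y)) y X + dd \<phi> y (dd (e l) y X)
      + conn_op (\<lambda>i j. dd (om l i j) y X) (dd (a l) y X) (\<phi> y) + conn l y (dd \<phi> y X)" for l X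
  proof -
    have 1: "((\<lambda>z. dd \<phi> z (e l z)) has_derivative (\<lambda>X. dd (\<lambda>z. dd \<phi> z (e l y)) y X + dd \<phi> y (dd (e l) y X))) (at y)"
      using \<phi> y by (intro dd_field[OF open_V y] linear_dd smooth_on_differentiable[OF smooth_on_dd] differentiable_e)
        (auto intro: smooth_on_differentiable)
    have 2: "((\<lambda>z. conn l z (\<phi> z)) has_derivative (\<lambda>X. (1/4) *\<^sub>R (\<Sum>i\<in>UNIV. \<Sum>j\<in>UNIV.
        om l i j y *\<^sub>R \<gamma> i (\<gamma> j (dd \<phi> y X)) + dd (om l i j) y X *\<^sub>R \<gamma> i (\<gamma> j (\<phi> y)))
        + ((a l y / 2) *\<^sub>R J (dd \<phi> y X) + (dd (a l) y X / 2) *\<^sub>R J (\<phi> y)))) (at y)"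
      unfolding conn_op_def
      by (intro has_derivative_add has_derivative_scaleR_right has_derivative_sum has_derivative_scaleR
          bounded_linear.has_derivative[OF bounded_linear_gam] bounded_linear.has_derivative[OF bounded_linear_J]
          has_derivative_divide' dd_works d\<phi> da differentiable_om y has_derivative_mult_left
          bounded_linear.has_derivative[OF bounded_linear_divide])
    show ?thesis
      unfolding nab_def[abs_def] dd_eqI[OF has_derivative_add[OF 1 2]]
      by (simp add: conn_op_def sum.distrib scaleR_add_right)
  qed
  have comm: "dd (\<lambda>z. dd \<phi> z (e l y)) y (e k y) = dd (\<lambda>z. dd \<phi> z (e k y)) y (e l y)"
    by (rule dd_dd_commute[OF open_V \<phi> y])
  have br: "dd \<phi> y (dd (e l) y (e k y)) - dd \<phi> y (dd (e k) y (e l y)) =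
      (\<Sum>m\<in>UNIV. (om k l m y - om l k m y) *\<^sub>R dd \<phi> y (e m y))"
    by (simp add: linear_diff[OF lin, symmetric] bracket_e[OF y] linear_sum[OF lin] linear_scale[OF lin])
  let ?x = "\<phi> y"
  have "nab k (nab l \<phi>) y - nab l (nab k \<phi>) y =
      dd \<phi> y (dd (e l) y (e k y)) - dd \<phi> y (dd (e k) y (e l y))
      + (conn_op (\<lambda>i j. dd (om l i j) y (e k y)) (dd (a l) y (e k y)) ?x - conn_op (\<lambda>i j. dd (om k i j) y (e l y)) (dd (a k) y (e l y)) ?x)
      + (conn k y (conn l y ?x) - conn l y (conn k y ?x))"
    unfolding nab_def[of k "nab l \<phi>"] nab_def[of l "nab k \<phi>"] D
    by (simp add: nab_def[of _ \<phi> y] conn_op_lin comm)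
  moreover have "(\<Sum>m\<in>UNIV. (om k l m y - om l k m y) *\<^sub>R nab m \<phi> y) =
      (\<Sum>m\<in>UNIV. (om k l m y - om l k m y) *\<^sub>R dd \<phi> y (e m y)) + (\<Sum>m\<in>UNIV. (om k l m y - om l k m y) *\<^sub>R conn m y ?x)"
    by (simp add: nab_def[of _ \<phi> y] scaleR_add_right sum.distrib)
  moreover have "(\<Sum>m\<in>UNIV. (om k l m y - om l k m y) *\<^sub>R conn m y ?x) =
      (1/4) *\<^sub>R (\<Sum>i\<in>UNIV. \<Sum>j\<in>UNIV. (\<Sum>m\<in>UNIV. (om k l m y - om l k m y) * om m i j y) *\<^sub>R \<gamma> i (\<gamma> j ?x))
      + ((\<Sum>m\<in>UNIV. (om k l m y - om l k m y) * a m y) / 2) *\<^sub>R J ?x"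
  proof -
    define b where "b m = om k l m y - om l k m y" for m
    have "(\<Sum>m\<in>UNIV. b m *\<^sub>R conn m y ?x) =
        (1/4) *\<^sub>R (\<Sum>m\<in>UNIV. \<Sum>i\<in>UNIV. \<Sum>j\<in>UNIV. (b m * om m i j y) *\<^sub>R \<gamma> i (\<gamma> j ?x)) + (\<Sum>m\<in>UNIV. (b m * a m y / 2) *\<^sub>R J ?x)"
      by (simp add: conn_op_def scaleR_add_right sum.distrib scaleR_sum_right mult.assoc mult.left_commute)
    also have "(\<Sum>m\<in>UNIV. \<Sum>i\<in>UNIV. \<Sum>j\<in>UNIV. (b m * om m i j y) *\<^sub>R \<gamma> i (\<gamma> j ?x)) =
        (\<Sum>i\<in>UNIV. \<Sum>m\<in>UNIV. \<Sum>j\<in>UNIV. (b m * om m i j y) *\<^sub>R \<gamma> i (\<gamma> j ?x))" by (rule sum.swap)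
    also have "\<dots> = (\<Sum>i\<in>UNIV. \<Sum>j\<in>UNIV. \<Sum>m\<in>UNIV. (b m * om m i j y) *\<^sub>R \<gamma> i (\<gamma> j ?x))" by (intro sum.cong refl sum.swap)
    finally show ?thesis by (simp add: b_def scaleR_sum_left sum_divide_distrib)
  qed
  ultimately show ?thesis
    unfolding br conn_op_commutator[of "\<lambda>i j. om k i j y" "\<lambda>i j. om l i j y", OF om_antisym[OF y] om_antisym[OF y]]
    by (simp add: conn_op_def frameR_def curvF_def scaleR_diff_left scaleR_add_left sum_subtractf sum.distrib
        scaleR_diff_right scaleR_add_right diff_divide_distrib)
qed

text \<open>The trace of the Hessian in the frame; the inner sum is the derivative of u along the
  covariant derivative of e_k in its own direction.\<close>

definition lap :: "(real^'n \<Rightarrow> real) \<Rightarrow> real^'n \<Rightarrow> real" where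
  "lap u y = (\<Sum>k\<in>UNIV. dd (\<lambda>z. dd u z (e k z)) y (e k y) - (\<Sum>m\<in>UNIV. om k k m y * dd u y (e m y)))"

text \<open>Bochner's identity: the connection is metric, so the Leibniz rule is applied
  twice.\<close>

lemma lap_norm:
  assumes y: "y \<in> V" and \<phi>: "smooth_on V \<phi>"
  shows "lap (\<lambda>z. \<phi> z \<bullet> \<phi> z) y / 2 =
    (\<Sum>k\<in>UNIV. nab k \<phi> y \<bullet> nab k \<phi> y)
    + (\<Sum>k\<in>UNIV. nab k (nab k \<phi>) y - (\<Sum>m\<in>UNIV. om k k m y *\<^sub>R nab m \<phi> y)) \<bullet> \<phi> y"
proof -
  have d: "\<phi> differentiable (at z)" "nab k \<phi> differentiable (at z)" if "z \<in> V" for z k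
    using smooth_on_differentiable[OF _ that] \<phi> smooth_nab[OF \<phi>] by blast+
  have 1: "dd (\<lambda>z. \<phi> z \<bullet> \<phi> z) z (e k z) = 2 * (nab k \<phi> z \<bullet> \<phi> z)" if "z \<in> V" for z k
    using nab_inner[OF that d(1)[OF that] d(1)[OF that]] by (simp add: inner_commute)
  have 2: "dd (\<lambda>z. dd (\<lambda>z. \<phi> z \<bullet> \<phi> z) z (e k z)) y (e k y) = 2 * (nab k (nab k \<phi>) y \<bullet> \<phi> y + nab k \<phi> y \<bullet> nab k \<phi> y)" for k
  proof -
    have "dd (\<lambda>z. dd (\<lambda>z. \<phi> z \<bullet> \<phi> z) z (e k z)) y = dd (\<lambda>z. 2 * (nab k \<phi> z \<bullet> \<phi> z)) y"
      by (rule dd_cong_open[OF open_V y]) (rule 1)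
    also have "\<dots> = (\<lambda>X. 2 * dd (\<lambda>z. nab k \<phi> z \<bullet> \<phi> z) y X)"
      using d[OF y] by (intro dd_bounded_linear bounded_linear_mult_right differentiable_inner)
    finally show ?thesis by (simp add: nab_inner[OF y d(2)[OF y] d(1)[OF y]])
  qed
  have "lap (\<lambda>z. \<phi> z \<bullet> \<phi> z) y =
      (\<Sum>k\<in>UNIV. 2 * ((nab k \<phi> y \<bullet> nab k \<phi> y) + (nab k (nab k \<phi>) y \<bullet> \<phi> y - (\<Sum>m\<in>UNIV. om k k m y * (nab m \<phi> y \<bullet> \<phi> y)))))"
    unfolding lap_def 2 1[OF y]
    by (intro sum.cong refl) (simp add: sum_distrib_left algebra_simps)
  then show ?thesis
    by (simp add: sum_distrib_left[symmetric] sum.distrib inner_sum_left inner_diff_left sum_subtractf)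
qed

text \<open>Applying the Dirac operator twice gives the Clifford sum over the second covariant
  derivative. Its trace is turned into the Laplacian of the squared norm by \<open>lap_norm\<close>;
  its antisymmetric part is the curvature evaluated by \<open>curvature_term\<close> and
  \<open>form_op\<close>.\<close>

lemma weitzenboeck:
  assumes y: "y \<in> V" and \<phi>: "smooth_on V \<phi>"
    and eigen: "\<And>z. z \<in> V \<Longrightarrow> (\<Sum>k\<in>UNIV. \<gamma> k (nab k \<phi> z)) = \<mu> *\<^sub>R \<phi> z"
  shows "\<mu>\<^sup>2 * (\<phi> y \<bullet> \<phi> y) = (\<Sum>k\<in>UNIV. nab k \<phi> y \<bullet> nab k \<phi> y) - lap (\<lambda>z. \<phi> z \<bullet> \<phi> z) y / 2
    + (\<Sum>k\<in>UNIV. \<Sum>l\<in>UNIV. frameR k l l k y) / 4 * (\<phi> y \<bullet> \<phi> y)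
    + form_op (\<lambda>k l. curvF k l y) (\<phi> y) \<bullet> \<phi> y / 2"
proof -
  have d\<phi>: "\<phi> differentiable (at y)" using smooth_on_differentiable[OF \<phi> y] .
  have dn: "nab l \<phi> differentiable (at y)" for l using smooth_on_differentiable[OF smooth_nab[OF \<phi>] y] .
  have dgn: "(\<lambda>z. \<gamma> l (nab l \<phi> z)) differentiable (at y)" for l
    by (rule smooth_on_differentiable[OF smooth_on_bounded_linear[OF bounded_linear_gam open_V smooth_nab[OF \<phi>]] y])
  \<comment> \<open>The second covariant derivative of the spinor, tensorial in both
    directions.\<close>
  define H where "H k l = nab k (nab l \<phi>) y - (\<Sum>m\<in>UNIV. om k l m y *\<^sub>R nab m \<phi> y)" for k l
  have "(\<Sum>k\<in>UNIV. \<gamma> k (nab k (\<lambda>z. \<Sum>l\<in>UNIV. \<gamma> l (nab l \<phi> z)) y)) = (\<Sum>k\<in>UNIV. \<Sum>l\<in>UNIV. \<gamma> k (\<gamma> l (H k l)))"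
  proof -
    have "(\<Sum>k\<in>UNIV. \<gamma> k (nab k (\<lambda>z. \<Sum>l\<in>UNIV. \<gamma> l (nab l \<phi> z)) y)) =
        (\<Sum>k\<in>UNIV. \<Sum>l\<in>UNIV. \<gamma> k (\<gamma> l (nab k (nab l \<phi>) y))) + (\<Sum>k\<in>UNIV. \<Sum>l\<in>UNIV. \<Sum>m\<in>UNIV. om k l m y *\<^sub>R \<gamma> k (\<gamma> m (nab l \<phi> y)))"
      by (simp add: nab_sum dgn nab_gam[OF y dn] gam_lin sum.distrib)
    also have "(\<Sum>k\<in>UNIV. \<Sum>l\<in>UNIV. \<Sum>m\<in>UNIV. om k l m y *\<^sub>R \<gamma> k (\<gamma> m (nab l \<phi> y))) =
        (\<Sum>k\<in>UNIV. \<Sum>m\<in>UNIV. \<Sum>l\<in>UNIV. om k l m y *\<^sub>R \<gamma> k (\<gamma> m (nab l \<phi> y)))" by (intro sum.cong refl sum.swap)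
    \<comment> \<open>Antisymmetry of \<open>om\<close> shifts the derivative of the frame from the
      Clifford factor to the direction of differentiation, which is exactly the correction term in
      H.\<close>
    also have "\<dots> = (\<Sum>k\<in>UNIV. \<Sum>l\<in>UNIV. - \<gamma> k (\<gamma> l (\<Sum>m\<in>UNIV. om k l m y *\<^sub>R nab m \<phi> y)))"
    proof (intro sum.cong refl)
      fix k l
      show "(\<Sum>m\<in>UNIV. om k m l y *\<^sub>R \<gamma> k (\<gamma> l (nab m \<phi> y))) = - \<gamma> k (\<gamma> l (\<Sum>m\<in>UNIV. om k l m y *\<^sub>R nab m \<phi> y))"
        by (simp add: gam_lin sum_negf[symmetric] om_antisym[OF y, of k _ l])
    qed
    finally show ?thesis by (simp add: H_def gam_lin sum_subtractf sum_negf)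
  qed
  moreover have "(\<Sum>k\<in>UNIV. \<gamma> k (nab k (\<lambda>z. \<Sum>l\<in>UNIV. \<gamma> l (nab l \<phi> z)) y)) = \<mu>\<^sup>2 *\<^sub>R \<phi> y"
  proof -
    have "dd (\<lambda>z. \<Sum>l\<in>UNIV. \<gamma> l (nab l \<phi> z)) y = dd (\<lambda>z. \<mu> *\<^sub>R \<phi> z) y"
      by (rule dd_cong_open[OF open_V y]) (rule eigen)
    then have "nab k (\<lambda>z. \<Sum>l\<in>UNIV. \<gamma> l (nab l \<phi> z)) y = nab k (\<lambda>z. \<mu> *\<^sub>R \<phi> z) y" for k
      by (simp add: nab_def[of k _ y] eigen[OF y])
    then show ?thesis
      by (simp add: nab_scaleR d\<phi> gam_lin scaleR_sum_right[symmetric] eigen[OF y] power2_eq_square)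
  qed
  ultimately have "\<mu>\<^sup>2 *\<^sub>R \<phi> y = - (\<Sum>k\<in>UNIV. H k k) + (1/2) *\<^sub>R (\<Sum>k\<in>UNIV. \<Sum>l\<in>UNIV. \<gamma> k (\<gamma> l (H k l - H l k)))"
    using gam_gam_split[of H] by simp
  note E0 = this
  have D: "H k l - H l k = (1/4) *\<^sub>R (\<Sum>i\<in>UNIV. \<Sum>j\<in>UNIV. frameR k l i j y *\<^sub>R \<gamma> i (\<gamma> j (\<phi> y))) + (curvF k l y / 2) *\<^sub>R J (\<phi> y)" for k l
    using nab_commutator[OF y \<phi>, of k l]
    by (simp add: H_def scaleR_diff_left sum_subtractf algebra_simps)
  have F: "(\<Sum>k\<in>UNIV. \<Sum>l\<in>UNIV. \<gamma> k (\<gamma> l ((1/4) *\<^sub>R (\<Sum>i\<in>UNIV. \<Sum>j\<in>UNIV. frameR k l i j y *\<^sub>R \<gamma> i (\<gamma> j (\<phi> y))) + (curvF k l y / 2) *\<^sub>R J (\<phi> y)))) =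
      (1/4) *\<^sub>R (\<Sum>k\<in>UNIV. \<Sum>l\<in>UNIV. \<gamma> k (\<gamma> l (\<Sum>i\<in>UNIV. \<Sum>j\<in>UNIV. frameR k l i j y *\<^sub>R \<gamma> i (\<gamma> j (\<phi> y)))))
      + form_op (\<lambda>k l. curvF k l y) (\<phi> y)"
  proof -
    have "form_op (\<lambda>k l. curvF k l y) (\<phi> y) = (\<Sum>k\<in>UNIV. \<Sum>l\<in>UNIV. (curvF k l y / 2) *\<^sub>R \<gamma> k (\<gamma> l (J (\<phi> y))))"
      by (simp add: form_op_def scaleR_sum_right)
    then show ?thesis
      by (simp add: linear_add[OF linear_gam] linear_scale[OF linear_gam] sum.distrib scaleR_sum_right[symmetric])
  qed
  have E: "\<mu>\<^sup>2 *\<^sub>R \<phi> y = - (\<Sum>k\<in>UNIV. H k k) + (1/2) *\<^sub>R ((1/4) *\<^sub>R (\<Sum>k\<in>UNIV. \<Sum>l\<in>UNIV. \<gamma> k (\<gamma> l (\<Sum>i\<in>UNIV. \<Sum>j\<in>UNIV. frameR k l i j y *\<^sub>R \<gamma> i (\<gamma> j (\<phi> y)))))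
      + form_op (\<lambda>k l. curvF k l y) (\<phi> y))"
    using E0 unfolding D F .
  have "\<mu>\<^sup>2 * (\<phi> y \<bullet> \<phi> y) = - ((\<Sum>k\<in>UNIV. H k k) \<bullet> \<phi> y) + (1/2) * ((1/4) * (2 * (\<Sum>k\<in>UNIV. \<Sum>l\<in>UNIV. frameR k l l k y) * (\<phi> y \<bullet> \<phi> y))
      + form_op (\<lambda>k l. curvF k l y) (\<phi> y) \<bullet> \<phi> y)"
    using arg_cong[OF E, of "\<lambda>v. v \<bullet> \<phi> y"]
    unfolding inner_add_left inner_minus_left inner_scaleR_left
      curvature_term[of "\<lambda>k l i j. frameR k l i j y", OF frameR_antisym1 frameR_antisym2[OF y] frameR_bianchi[OF y]] .
  then show ?thesis using lap_norm[OF y \<phi>] unfolding H_def by (simp add: field_simps)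
qed

end

section \<open>The strong maximum principle\<close>

lemma local_max_second_derivative:
  fixes f :: "'a::euclidean_space \<Rightarrow> real"
  assumes "open U" "smooth_on U f" "p \<in> U" "0 < \<epsilon>" and max: "\<And>y. y \<in> ball p \<epsilon> \<Longrightarrow> f y \<le> f p"
  shows "dd f p X = 0" "dd (\<lambda>z. dd f z X) p X \<le> 0"
proof -
  have "dd f p = (\<lambda>v. 0)"
    using differential_zero_maxmin[of p "ball p \<epsilon>" f "dd f p"] smooth_on_has_derivative[OF assms(2,3)] assms(4) max by auto
  then show "dd f p X = 0" by simp
  let ?B = "dd (\<lambda>z. dd f z X) p"
  have lin: "linear ?B" by (rule linear_dd[OF smooth_on_differentiable[OF smooth_on_dd[OF assms(2)] assms(3)]])
  show "?B X \<le> 0"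
  proof (rule field_le_epsilon)
    fix d :: real assume "d > 0"
    define r where "r = \<epsilon> / (norm X + 1)"
    have "r > 0" using assms(4) by (simp add: r_def add_nonneg_pos)
    have "\<forall>\<^sub>F s in at_right 0. (0::real) < s \<and> s < r"
      using \<open>r > 0\<close> by (auto simp: eventually_at_right_field)
    \<comment> \<open>With w = - X the second difference is 2 f(p) - f(p + s X) - f(p - s X),
      nonnegative at a maximum, and it approximates minus the second derivative along X times s
      squared.\<close>
    with second_difference_bound[OF assms(1-3) \<open>d > 0\<close>, of X "- X"]
    have "\<forall>\<^sub>F s in at_right (0::real). ?B X \<le> d"
    proof eventually_elim
      case (elim s)
      have in_ball: "norm (s *\<^sub>R X) < \<epsilon>"
      proof -
        have "s * norm X \<le> s * (norm X + 1)" using elim by simp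
        also have "\<dots> < r * (norm X + 1)" using elim by (intro mult_strict_right_mono) (simp_all add: add_nonneg_pos)
        also have "\<dots> = \<epsilon>" by (simp add: r_def add_nonneg_eq_0_iff)
        finally show ?thesis using elim by simp
      qed
      have "f (p + s *\<^sub>R X) \<le> f p" "f (p + s *\<^sub>R - X) \<le> f p"
        using in_ball by (intro max; simp add: dist_norm)+
      moreover have "\<bar>f p - f (p + s *\<^sub>R X) - f (p + s *\<^sub>R - X) + f p + s\<^sup>2 * ?B X\<bar> \<le> d * s\<^sup>2"
        using elim(1) by (simp add: linear_neg[OF lin])
      ultimately have "s\<^sup>2 * ?B X \<le> s\<^sup>2 * d" by (simp add: mult.commute)
      then show ?case using elim by simp
    qed
    then show "?B X \<le> 0 + d" using eventually_const[OF trivial_limit_at_right_real] by simp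
  qed
qed

lemma smooth_on_exp: "smooth_on U (exp :: real \<Rightarrow> real)"
proof -
  have "ck_on k U (\<lambda>x::real. c * exp x)" for k c
  proof (induction k arbitrary: c)
    case (Suc k)
    have d: "((\<lambda>x. c * exp x) has_derivative (\<lambda>v. (c * v) * exp x)) (at x)" for x
      by (auto intro!: derivative_eq_intros)
    show ?case using d dd_eqI[OF d] Suc by (auto simp: differentiable_def)
  qed (auto intro!: continuous_intros)
  from this[of _ 1] show ?thesis by (simp add: smooth_on_def)
qed

text \<open>The barrier of Hopf's argument: for large \<alpha> the quadratic term dominates in every
  direction X that is not orthogonal to y - q.\<close>

lemma gaussian_derivatives:
  fixes q :: "'a::euclidean_space" and \<alpha> :: real
  defines "v \<equiv> \<lambda>y. exp (- \<alpha> * ((y - q) \<bullet> (y - q)))"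
  shows "smooth_on UNIV v"
    and "dd v y X = - 2 * \<alpha> * ((y - q) \<bullet> X) * v y"
    and "dd (\<lambda>z. dd v z X) y X = (4 * \<alpha>\<^sup>2 * ((y - q) \<bullet> X)\<^sup>2 - 2 * \<alpha> * (X \<bullet> X)) * v y"
proof -
  have "smooth_on UNIV (\<lambda>y. - \<alpha> * ((y - q) \<bullet> (y - q)))"
    by (intro smooth_on_mult smooth_on_const smooth_on_inner smooth_on_diff smooth_on_id open_UNIV)
  from smooth_on_compose[OF open_UNIV open_UNIV smooth_on_exp this]
  show "smooth_on UNIV v" by (simp add: v_def)
  have d: "(v has_derivative (\<lambda>X. - 2 * \<alpha> * ((y - q) \<bullet> X) * v y)) (at y)" for y
    unfolding v_def by (auto intro!: derivative_eq_intros simp: inner_commute algebra_simps)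
  show 1: "dd v y X = - 2 * \<alpha> * ((y - q) \<bullet> X) * v y" for y X using dd_eqI[OF d] by simp
  have "((\<lambda>z. - 2 * \<alpha> * ((z - q) \<bullet> X) * v z) has_derivative
      (\<lambda>Y. - 2 * \<alpha> * ((y - q) \<bullet> X) * (- 2 * \<alpha> * ((y - q) \<bullet> Y) * v y) + - 2 * \<alpha> * (Y \<bullet> X) * v y)) (at y)"
    by (rule has_derivative_mult[OF _ d]) (auto intro!: derivative_eq_intros)
  from dd_eqI[OF this] show "dd (\<lambda>z. dd v z X) y X = (4 * \<alpha>\<^sup>2 * ((y - q) \<bullet> X)\<^sup>2 - 2 * \<alpha> * (X \<bullet> X)) * v y"
    unfolding 1 by (simp add: power2_eq_square algebra_simps)
qed

text \<open>Hopf's argument: a ball in \<open>{u < M}\<close> touching \<open>{u = M}\<close> at \<open>z\<close> gives a barrier \<open>v\<close> with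
  \<open>Lv > 0\<close> near \<open>z\<close>, and \<open>u + \<delta>v\<close> would have an interior maximum near \<open>z\<close>.\<close>

lemma strong_maximum_principle:
  fixes u :: "'a::euclidean_space \<Rightarrow> real" and E :: "'k::finite \<Rightarrow> 'a \<Rightarrow> 'a"
  assumes V: "open V" and u: "smooth_on V u"
    and E: "\<And>k. continuous_on V (E k)" and Z: "continuous_on V Z"
    and span: "\<And>y v. y \<in> V \<Longrightarrow> v \<noteq> 0 \<Longrightarrow> \<exists>k. E k y \<bullet> v \<noteq> 0"
    and sub: "\<And>y. y \<in> V \<Longrightarrow> (\<Sum>k\<in>UNIV. dd (\<lambda>z. dd u z (E k y)) y (E k y)) + dd u y (Z y) \<ge> 0"
    and max: "\<And>y. y \<in> V \<Longrightarrow> u y \<le> M" and p: "p \<in> V" "u p = M"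
  shows "\<exists>r>0. ball p r \<subseteq> V \<and> (\<forall>y\<in>ball p r. u y = M)"
proof -
  obtain R where R: "R > 0" "cball p R \<subseteq> V" using V p(1) open_contains_cball by blast
  have cu: "continuous_on V u" using u by (rule smooth_on_continuous)
  \<comment> \<open>Radius R/3: the ball about y1 reaching the nearest maximum point then stays in
    \<open>cball p R\<close>, with R/3 to spare for the neighbourhood N.\<close>
  have "u y1 = M" if y1: "y1 \<in> ball p (R/3)" for y1
  proof (rule ccontr)
    assume ne: "u y1 \<noteq> M"
    define K where "K = {y \<in> cball p R. u y = M}"
    have "closed K" unfolding K_def
      using continuous_on_subset[OF cu R(2)] by (intro continuous_closed_preimage_constant) auto
    have "p \<in> K" using p R(1) by (simp add: K_def)
    with \<open>closed K\<close> obtain z where z: "z \<in> K" "\<And>y. y \<in> K \<Longrightarrow> dist y1 z \<le> dist y1 y"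
      using distance_attains_inf[of K y1] by (metis empty_iff)
    have "y1 \<in> cball p R" using y1 R(1) by simp
    have zy: "z \<noteq> y1" using z ne by (auto simp: K_def)
    have "dist y1 z \<le> dist y1 p" using p R(1) by (intro z(2)) (auto simp: K_def)
    then have zR: "dist y1 z < R/3" using y1 by (simp add: dist_commute)
    have less: "u y < M" if "dist y1 y < dist y1 z" for y
    proof -
      have "dist p y \<le> R"
        using dist_triangle[of p y y1] that zR y1 R(1) by simp
      then have "y \<in> cball p R" by simp
      moreover have "y \<notin> K" using z(2)[of y] that by auto
      ultimately show ?thesis using max[of y] R(2) by (auto simp: K_def)
    qed
    \<comment> \<open>Halving the ball: the ball with centre q, the midpoint of y1 and z, is
      internally tangent to the larger one, so its closure meets {u = M} only at z.\<close>
    define d where "d = (1/2) *\<^sub>R (z - y1)"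
    define q where "q = y1 + d"
    define \<rho> where "\<rho> = norm d"
    have zq: "z = q + d" by (simp add: q_def d_def algebra_simps scaleR_2[symmetric])
    have d1: "dist y1 z = 2 * \<rho>" by (simp add: \<rho>_def d_def dist_norm norm_minus_commute)
    have "dist y1 z > 0" using zy by auto
    then have "\<rho> > 0" using d1 by linarith
    have touching: "u y < M" if y: "dist q y \<le> \<rho>" "y \<noteq> z" for y
    proof -
      let ?w = "y - q"
      have w: "?w \<bullet> ?w \<le> \<rho>\<^sup>2"
        using power_mono[OF y(1), of 2]
        by (simp add: dist_norm power2_norm_eq_inner) (simp add: inner_diff_left inner_diff_right inner_commute)
      have "?w - d \<noteq> 0" using y(2) zq by (auto simp: algebra_simps)
      then have "0 < (?w - d) \<bullet> (?w - d)" by (simp only: inner_gt_zero_iff) simp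
      then have "2 * (?w \<bullet> d) < ?w \<bullet> ?w + d \<bullet> d" by (simp add: inner_diff_left inner_diff_right inner_commute)
      then have "(?w + d) \<bullet> (?w + d) < 4 * \<rho>\<^sup>2"
        using w by (simp add: \<rho>_def power2_norm_eq_inner inner_add_left inner_add_right inner_commute)
      then have "(norm (?w + d))\<^sup>2 < (2 * \<rho>)\<^sup>2" unfolding power2_norm_eq_inner by (simp add: power_mult_distrib)
      then have "norm (?w + d) < 2 * \<rho>" by (rule power_less_imp_less_base) (use \<open>\<rho> > 0\<close> in simp)
      then show ?thesis by (intro less, unfold d1) (simp add: dist_norm q_def norm_minus_commute)
    qed
    \<comment> \<open>The bound \<rho>/2 keeps N away from the centre q, where the gradient of the
      barrier vanishes; the bound R/3 keeps N inside V.\<close>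
    define \<epsilon> where "\<epsilon> = min (\<rho>/2) (R/3)"
    have "\<epsilon> > 0" "\<epsilon> \<le> \<rho>/2" "\<epsilon> \<le> R/3" using \<open>\<rho> > 0\<close> R(1) by (auto simp: \<epsilon>_def)
    define N where "N = cball z \<epsilon>"
    have NV: "N \<subseteq> V"
    proof
      fix y assume "y \<in> N"
      then have "dist p y \<le> R"
        using dist_triangle[of p y z] dist_triangle[of p z y1] zR y1 \<open>\<epsilon> \<le> R/3\<close> R(1) by (simp add: N_def)
      then show "y \<in> V" using R(2) by auto
    qed
    have yq: "y \<noteq> q" if "y \<in> N" for y
    proof
      assume "y = q"
      then have "norm d \<le> \<epsilon>" using that by (simp add: N_def zq dist_norm)
      then show False using \<open>\<epsilon> \<le> \<rho>/2\<close> \<open>\<rho> > 0\<close> unfolding \<rho>_def by linarith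
    qed
    have cN: "compact N" "N \<noteq> {}" using \<open>\<epsilon> > 0\<close> by (auto simp: N_def)
    \<comment> \<open>The operator applied to the barrier gives (4 \<alpha>^2 m - 2 \<alpha> B)
      times the barrier. On the compact N, m has a positive minimum and B an upper bound, from which
      \<alpha> is chosen.\<close>
    define m where "m y = (\<Sum>k\<in>UNIV. ((y - q) \<bullet> E k y)\<^sup>2)" for y
    define B where "B y = (\<Sum>k\<in>UNIV. E k y \<bullet> E k y) + (y - q) \<bullet> Z y" for y
    have cont: "continuous_on N m" "continuous_on N B"
      unfolding m_def B_def using continuous_on_subset[OF E NV] continuous_on_subset[OF Z NV]
      by (auto intro!: continuous_intros)
    obtain y0 where y0: "y0 \<in> N" "\<And>y. y \<in> N \<Longrightarrow> m y0 \<le> m y"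
      using continuous_attains_inf[OF cN cont(1)] by blast
    have "m y0 > 0"
    proof -
      obtain k where "E k y0 \<bullet> (y0 - q) \<noteq> 0" using span[of y0 "y0 - q"] y0(1) NV yq by auto
      then have "((y0 - q) \<bullet> E k y0)\<^sup>2 > 0" by (simp add: inner_commute)
      then show ?thesis unfolding m_def by (intro sum_pos2[of _ k]) auto
    qed
    obtain C where C: "\<And>y. y \<in> N \<Longrightarrow> B y \<le> C"
      using continuous_attains_sup[OF cN cont(2)] by blast
    define \<alpha> where "\<alpha> = (\<bar>C\<bar> + 1) / m y0"
    have "\<alpha> > 0" using \<open>m y0 > 0\<close> by (simp add: \<alpha>_def add_nonneg_pos)
    define g where "g y = exp (- \<alpha> * ((y - q) \<bullet> (y - q)))" for y
    note g = gaussian_derivatives[of \<alpha> q, folded g_def]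
    have Lg: "(\<Sum>k\<in>UNIV. dd (\<lambda>z. dd g z (E k y)) y (E k y)) + dd g y (Z y) > 0" if "y \<in> N" for y
    proof -
      have "(\<Sum>k\<in>UNIV. dd (\<lambda>z. dd g z (E k y)) y (E k y)) + dd g y (Z y) =
          (4 * \<alpha>\<^sup>2 * m y - 2 * \<alpha> * B y) * g y"
        unfolding g(3) unfolding g(2) by (simp add: m_def B_def sum_distrib_left sum_distrib_right sum_subtractf algebra_simps)
      moreover have "4 * \<alpha>\<^sup>2 * m y - 2 * \<alpha> * B y > 0"
      proof -
        have "\<alpha> * m y \<ge> \<alpha> * m y0" using y0(2)[OF that] \<open>\<alpha> > 0\<close> by simp
        moreover have "\<alpha> * m y0 = \<bar>C\<bar> + 1" using \<open>m y0 > 0\<close> by (simp add: \<alpha>_def)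
        ultimately have "0 < 4 * (\<alpha> * m y) - 2 * B y" using C[OF that] by linarith
        then have "0 < \<alpha> * (4 * (\<alpha> * m y) - 2 * B y)" using \<open>\<alpha> > 0\<close> by simp
        then show ?thesis by (simp add: power2_eq_square algebra_simps)
      qed
      ultimately show ?thesis by (simp add: g_def)
    qed
    \<comment> \<open>The value of the barrier on the sphere of radius \<rho> about q:
      \<open>w\<close> equals u at z and lies below u outside that ball.\<close>
    define c where "c = exp (- \<alpha> * \<rho>\<^sup>2)"
    \<comment> \<open>On the part of the boundary of N inside the closed ball, compactness keeps u
      below M by a fixed margin. Half of that margin is the coefficient of the barrier in
      \<open>w\<close>, so \<open>w\<close> stays below M there.\<close>
    obtain \<eta> where \<eta>: "\<eta> > 0" "\<And>y. y \<in> sphere z \<epsilon> \<Longrightarrow> dist q y \<le> \<rho> \<Longrightarrow> u y \<le> M - \<eta>"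
    proof (cases "sphere z \<epsilon> \<inter> cball q \<rho> = {}")
      case True
      then have "dist q y \<le> \<rho> \<Longrightarrow> y \<notin> sphere z \<epsilon>" for y by (meson IntI disjoint_iff mem_cball)
      then show ?thesis by (intro that[of 1]) auto
    next
      case False
      have "compact (sphere z \<epsilon> \<inter> cball q \<rho>)" by (intro compact_Int_closed) auto
      moreover have "continuous_on (sphere z \<epsilon> \<inter> cball q \<rho>) u"
        using NV by (intro continuous_on_subset[OF cu]) (auto simp: N_def)
      ultimately obtain y' where y': "y' \<in> sphere z \<epsilon> \<inter> cball q \<rho>"
          "\<And>y. y \<in> sphere z \<epsilon> \<inter> cball q \<rho> \<Longrightarrow> u y \<le> u y'"
        using continuous_attains_sup False by metis
      have "u y' < M" using y'(1) \<open>\<epsilon> > 0\<close> by (intro touching) auto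
      then show ?thesis using that[of "M - u y'"] y'(2) by auto
    qed
    define w where "w y = u y + (\<eta>/2) * (g y - c)" for y
    have "continuous_on N w"
      unfolding w_def g_def using continuous_on_subset[OF cu NV] by (auto intro!: continuous_intros)
    then obtain s where s: "s \<in> N" "\<And>y. y \<in> N \<Longrightarrow> w y \<le> w s"
      using continuous_attains_sup[OF cN] by blast
    have "w z = M" using z(1) by (simp add: w_def g_def c_def zq \<rho>_def power2_norm_eq_inner K_def)
    then have ws: "M \<le> w s" using s(2)[of z] \<open>\<epsilon> > 0\<close> by (simp add: N_def)
    have "s \<notin> sphere z \<epsilon>"
    proof
      assume sph: "s \<in> sphere z \<epsilon>"
      show False
      proof (cases "dist q s \<le> \<rho>")
        case True
        have "g s \<le> 1" using \<open>\<alpha> > 0\<close> by (simp add: g_def)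
        moreover have "c > 0" by (simp add: c_def)
        ultimately have "(\<eta>/2) * (g s - c) \<le> (\<eta>/2) * 1"
          using \<eta>(1) by (intro mult_left_mono) linarith+
        then show False using \<eta>(2)[OF sph True] \<eta>(1) ws unfolding w_def by linarith
      next
        case False
        then have "\<rho>\<^sup>2 < (norm (s - q))\<^sup>2"
          using \<open>\<rho> > 0\<close> by (intro power_strict_mono) (auto simp: dist_norm norm_minus_commute)
        then have "g s < c" using \<open>\<alpha> > 0\<close> by (simp add: g_def c_def power2_norm_eq_inner)
        then have "(\<eta>/2) * (g s - c) < 0" using \<eta>(1) by (simp add: mult_pos_neg)
        then show False using ws max[of s] s(1) NV by (auto simp: w_def)
      qed
    qed
    then have "s \<in> ball z \<epsilon>" using s(1) by (auto simp: N_def)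
    then obtain r where r: "r > 0" "ball s r \<subseteq> ball z \<epsilon>" using open_contains_ball by blast
    have sV: "s \<in> V" using s(1) NV by blast
    have gV: "smooth_on V g" using g(1) smooth_on_mono by blast
    have smw: "smooth_on V w"
      unfolding w_def using gV by (intro smooth_on_add smooth_on_mult smooth_on_const smooth_on_diff u V)
    have wmax: "w y \<le> w s" if "y \<in> ball s r" for y using that r(2) by (intro s(2)) (auto simp: N_def)
    have dw: "dd w y X = dd u y X + (\<eta>/2) * dd g y X" if "y \<in> V" for y X
    proof -
      have "(w has_derivative (\<lambda>X. dd u y X + (\<eta>/2) * (dd g y X - 0))) (at y)"
        unfolding w_def using smooth_on_has_derivative[OF u that] smooth_on_has_derivative[OF gV that]
        by (intro has_derivative_add has_derivative_mult_right has_derivative_diff has_derivative_const)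
      then show ?thesis by (simp add: dd_eqI)
    qed
    have ddw: "dd (\<lambda>z. dd w z X) s X = dd (\<lambda>z. dd u z X) s X + (\<eta>/2) * dd (\<lambda>z. dd g z X) s X" for X
    proof -
      have "dd (\<lambda>z. dd w z X) s = dd (\<lambda>z. dd u z X + (\<eta>/2) * dd g z X) s"
        by (rule dd_cong_open[OF V sV]) (rule dw)
      also have "\<dots> = (\<lambda>Y. dd (\<lambda>z. dd u z X) s Y + (\<eta>/2) * dd (\<lambda>z. dd g z X) s Y)"
        using smooth_on_has_derivative[OF smooth_on_dd[OF u] sV] smooth_on_has_derivative[OF smooth_on_dd[OF gV] sV]
        by (intro dd_eqI has_derivative_add has_derivative_mult_right)
      finally show ?thesis by simp
    qed
    have "(\<Sum>k\<in>UNIV. dd (\<lambda>z. dd w z (E k s)) s (E k s)) + dd w s (Z s) \<le> 0"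
      using local_max_second_derivative[OF V smw sV r(1) wmax] by (simp add: sum_nonpos)
    moreover have "(\<Sum>k\<in>UNIV. dd (\<lambda>z. dd w z (E k s)) s (E k s)) + dd w s (Z s) =
        ((\<Sum>k\<in>UNIV. dd (\<lambda>z. dd u z (E k s)) s (E k s)) + dd u s (Z s))
        + (\<eta>/2) * ((\<Sum>k\<in>UNIV. dd (\<lambda>z. dd g z (E k s)) s (E k s)) + dd g s (Z s))"
      unfolding ddw dw[OF sV] by (simp add: sum.distrib sum_distrib_left algebra_simps)
    moreover have "(\<eta>/2) * ((\<Sum>k\<in>UNIV. dd (\<lambda>z. dd g z (E k s)) s (E k s)) + dd g s (Z s)) > 0"
      using Lg[OF s(1)] \<eta>(1) by simp
    ultimately show False using sub[OF sV] by linarith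
  qed
  then show ?thesis using R by (intro exI[of _ "R/3"]) auto
qed

section \<open>Charts and tangent vectors\<close>

locale atlas =
  fixes A :: "('m::topological_space, 'e::euclidean_space) chart set"
  assumes smooth_atlas: "smooth_atlas A"
begin

lemma chart_at: "chart_at A x \<in> A" "x \<in> fst (chart_at A x)"
proof -
  have "x \<in> (\<Union>c\<in>A. fst c)" using smooth_atlas unfolding smooth_atlas_def by blast
  then have "\<exists>c. c \<in> A \<and> x \<in> fst c" by blast
  then have "chart_at A x \<in> A \<and> x \<in> fst (chart_at A x)" unfolding chart_at_def by (rule someI_ex)
  then show "chart_at A x \<in> A" "x \<in> fst (chart_at A x)" by auto
qed

context
  fixes c assumes c: "c \<in> A"
begin

lemma chart_homeomorphism: "homeomorphism (fst c) (snd c ` fst c) (snd c) (chart_inv c)"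
  and open_chart: "open (fst c)" and open_chart_image: "open (snd c ` fst c)"
  using smooth_atlas c unfolding smooth_atlas_def by blast+

lemma chart_inv_chart: "x \<in> fst c \<Longrightarrow> chart_inv c (snd c x) = x"
  using chart_homeomorphism unfolding homeomorphism_def by blast

lemma chart_chart_inv: "p \<in> snd c ` fst c \<Longrightarrow> snd c (chart_inv c p) = p"
  using chart_homeomorphism unfolding homeomorphism_def by blast

lemma chart_inv_in: "p \<in> snd c ` fst c \<Longrightarrow> chart_inv c p \<in> fst c"
  using chart_homeomorphism unfolding homeomorphism_def by blast

lemma chart_image_iff: "p \<in> snd c ` (fst c \<inter> U) \<longleftrightarrow> p \<in> snd c ` fst c \<and> chart_inv c p \<in> U"
  using chart_inv_chart chart_chart_inv chart_inv_in by force

lemma chart_image_iff2: "p \<in> snd c ` (fst c \<inter> U \<inter> W) \<longleftrightarrow> p \<in> snd c ` fst c \<and> chart_inv c p \<in> U \<and> chart_inv c p \<in> W"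
  using chart_image_iff[of p "U \<inter> W"] by (simp add: Int_assoc)

lemma open_chart_Int: "open U \<Longrightarrow> open (snd c ` (fst c \<inter> U))"
proof -
  assume "open U"
  have "continuous_on (snd c ` fst c) (chart_inv c)"
    using chart_homeomorphism unfolding homeomorphism_def by blast
  then have "open (snd c ` fst c \<inter> chart_inv c -` U)"
    using continuous_open_preimage \<open>open U\<close> open_chart_image by blast
  moreover have "snd c ` (fst c \<inter> U) = snd c ` fst c \<inter> chart_inv c -` U"
    using chart_image_iff by blast
  ultimately show ?thesis by simp
qed

lemma continuous_chart_inv: "continuous_on (snd c ` fst c) (chart_inv c)"
  using chart_homeomorphism unfolding homeomorphism_def by blast

lemma continuous_chart: "continuous_on (fst c) (snd c)"
  using chart_homeomorphism unfolding homeomorphism_def by blast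

lemma transition_smooth: "d \<in> A \<Longrightarrow> smooth_on (snd c ` (fst c \<inter> fst d)) (snd d \<circ> chart_inv c)"
  using smooth_atlas c unfolding smooth_atlas_def by blast

lemma tvec_of_chart: "x \<in> fst c \<Longrightarrow> tvec_of A c x w c = w"
proof -
  assume x: "x \<in> fst c"
  have "dd (snd c \<circ> chart_inv c) (snd c x) = (\<lambda>v. v)"
    by (rule dd_eqI[OF has_derivative_cong_open[OF open_chart_image _ _ has_derivative_ident]])
      (use x in \<open>auto simp: chart_inv_chart\<close>)
  then show ?thesis using c x by (simp add: tvec_of_def)
qed

lemma change_chart:
  assumes d: "d \<in> A" and x: "x \<in> fst c" "x \<in> fst d" and f: "(f \<circ> chart_inv c) differentiable (at (snd c x))"
  shows "((f \<circ> chart_inv d) has_derivative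
    (\<lambda>v. dd (f \<circ> chart_inv c) (snd c x) (dd (snd c \<circ> chart_inv d) (snd d x) v))) (at (snd d x))"
proof -
  have d_inv: "chart_inv d (snd d y) = y" if "y \<in> fst d" for y
    using smooth_atlas d that unfolding smooth_atlas_def homeomorphism_def by blast
  have d_open: "open (snd d ` (fst d \<inter> fst c))"
  proof -
    have "open (snd d ` fst d)" "continuous_on (snd d ` fst d) (chart_inv d)"
      using smooth_atlas d unfolding smooth_atlas_def homeomorphism_def by blast+
    then have "open (snd d ` fst d \<inter> chart_inv d -` fst c)" using continuous_open_preimage open_chart by blast
    moreover have "snd d ` fst d \<inter> chart_inv d -` fst c = snd d ` (fst d \<inter> fst c)" using d_inv by auto
    ultimately show ?thesis by simp
  qed
  have xd: "snd d x \<in> snd d ` (fst d \<inter> fst c)" using x by blast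
  have "smooth_on (snd d ` (fst d \<inter> fst c)) (snd c \<circ> chart_inv d)"
    using smooth_atlas c d unfolding smooth_atlas_def by blast
  then have t: "((snd c \<circ> chart_inv d) has_derivative dd (snd c \<circ> chart_inv d) (snd d x)) (at (snd d x))"
    using xd smooth_on_has_derivative by blast
  have eq: "(snd c \<circ> chart_inv d) (snd d x) = snd c x" using d_inv x by simp
  from has_derivative_compose[OF t, of "f \<circ> chart_inv c", unfolded eq, OF dd_works[OF f]]
  show ?thesis
    by (rule has_derivative_cong_open[OF d_open xd, rotated]) (auto simp: d_inv chart_inv_chart)
qed

end

lemma tangent_outside: "tangent A x v \<Longrightarrow> \<not> (c \<in> A \<and> x \<in> fst c) \<Longrightarrow> v c = 0"
  unfolding tangent_def by blast

lemma tangent_change: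
  "tangent A x v \<Longrightarrow> c \<in> A \<Longrightarrow> d \<in> A \<Longrightarrow> x \<in> fst c \<Longrightarrow> x \<in> fst d \<Longrightarrow>
    v d = dd (snd d \<circ> chart_inv c) (snd c x) (v c)"
  unfolding tangent_def by blast

lemma differentiable_transition:
  "c \<in> A \<Longrightarrow> d \<in> A \<Longrightarrow> x \<in> fst c \<Longrightarrow> x \<in> fst d \<Longrightarrow> (snd d \<circ> chart_inv c) differentiable (at (snd c x))"
  using smooth_on_differentiable[OF transition_smooth] by blast

text \<open>The chain rule against the transformation law of tangent vectors. It frees
  \<open>dir_deriv\<close> and \<open>push\<close> from the chart selected by
  \<open>chart_at\<close>.\<close>

lemma chart_deriv:
  assumes "c \<in> A" "d \<in> A" "x \<in> fst c" "x \<in> fst d" "tangent A x v"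
    and "(f \<circ> chart_inv c) differentiable (at (snd c x))"
  shows "dd (f \<circ> chart_inv d) (snd d x) (v d) = dd (f \<circ> chart_inv c) (snd c x) (v c)"
  using dd_eqI[OF change_chart[OF assms(1-4,6)]] tangent_change[OF assms(5) assms(2,1,4,3)] by simp

lemma dir_deriv_chart:
  assumes "c \<in> A" "x \<in> fst c" "tangent A x v" "(f \<circ> chart_inv c) differentiable (at (snd c x))"
  shows "dir_deriv A f x v = dd (f \<circ> chart_inv c) (snd c x) (v c)"
  unfolding dir_deriv_def Let_def using chart_deriv[OF assms(1) chart_at(1) assms(2) chart_at(2) assms(3,4)] .

lemma tangent_tvec_of: "c \<in> A \<Longrightarrow> x \<in> fst c \<Longrightarrow> tangent A x (tvec_of A c x w)"
  unfolding tangent_def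
proof (intro conjI allI ballI impI)
  fix d e assume c: "c \<in> A" and x: "x \<in> fst c" and de: "d \<in> A" "e \<in> A" "x \<in> fst d" "x \<in> fst e"
  have "(snd e \<circ> chart_inv d) differentiable at (snd d x)" using differentiable_transition de by blast
  from dd_eqI[OF change_chart[OF de(1) c de(3) x this]]
  show "tvec_of A c x w e = dd (snd e \<circ> chart_inv d) (snd d x) (tvec_of A c x w d)"
    using de by (simp add: tvec_of_def)
qed (auto simp: tvec_of_def)

lemma tangent_eqI:
  assumes "c \<in> A" "x \<in> fst c" "tangent A x v" "tangent A x w" "v c = w c"
  shows "v = w"
proof
  fix d
  show "v d = w d"
  proof (cases "d \<in> A \<and> x \<in> fst d")
    case True
    then show ?thesis
      using tangent_change[OF assms(3,1), of d] tangent_change[OF assms(4,1), of d] assms(2,5) by simp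
  next
    case False
    then show ?thesis using tangent_outside[OF assms(3)] tangent_outside[OF assms(4)] by metis
  qed
qed

lemma tvec_of_self: "c \<in> A \<Longrightarrow> x \<in> fst c \<Longrightarrow> tangent A x v \<Longrightarrow> tvec_of A c x (v c) = v"
  by (rule tangent_eqI[of c]) (auto simp: tangent_tvec_of tvec_of_chart)

lemma linear_transition: "c \<in> A \<Longrightarrow> d \<in> A \<Longrightarrow> x \<in> fst c \<Longrightarrow> x \<in> fst d \<Longrightarrow> linear (dd (snd d \<circ> chart_inv c) (snd c x))"
  by (intro linear_dd differentiable_transition)

lemma tangent_linear:
  assumes "tangent A x v" "tangent A x w"
  shows "tangent A x (tadd v w)" "tangent A x (tscale r v)"
proof -
  have *: "v d + w d = dd (snd d \<circ> chart_inv c) (snd c x) (v c + w c)"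
    "r *\<^sub>R v d = dd (snd d \<circ> chart_inv c) (snd c x) (r *\<^sub>R v c)"
    if "c \<in> A" "d \<in> A" "x \<in> fst c" "x \<in> fst d" for c d
    using tangent_change[OF assms(1) that] tangent_change[OF assms(2) that]
    by (simp_all add: linear_add[OF linear_transition[OF that]] linear_scale[OF linear_transition[OF that]])
  have zero: "v c = 0" "w c = 0" if "\<not> (c \<in> A \<and> x \<in> fst c)" for c
    using assms that unfolding tangent_def by blast+
  show "tangent A x (tadd v w)" unfolding tangent_def tadd_def
    by (intro conjI allI impI ballI) (simp add: zero, rule *(1))
  show "tangent A x (tscale r v)" unfolding tangent_def tscale_def
    by (intro conjI allI impI ballI) (simp add: zero, rule *(2))
qed

lemma tvec_of_add: "c \<in> A \<Longrightarrow> x \<in> fst c \<Longrightarrow> tvec_of A c x (v + w) = tadd (tvec_of A c x v) (tvec_of A c x w)"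
  by (rule tangent_eqI[of c]) (assumption | rule tangent_tvec_of tangent_linear | simp add: tvec_of_chart tadd_def)+

lemma tvec_of_scale: "c \<in> A \<Longrightarrow> x \<in> fst c \<Longrightarrow> tvec_of A c x (r *\<^sub>R v) = tscale r (tvec_of A c x v)"
  by (rule tangent_eqI[of c]) (assumption | rule tangent_tvec_of tangent_linear | simp add: tvec_of_chart tscale_def)+

lemma smooth_map_eucl:
  assumes "smooth_map A eucl_atlas U f" "c \<in> A"
  shows "smooth_on (snd c ` (fst c \<inter> U)) (f \<circ> chart_inv c)"
  using assms unfolding smooth_map_def eucl_atlas_def by (auto simp: o_def)

end

section \<open>Smooth maps between manifolds and their push-forwards\<close>

lemma smooth_map_eucl_iff:
  "smooth_map A eucl_atlas U f \<longleftrightarrow>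
    continuous_on U f \<and> (\<forall>c\<in>A. smooth_on (snd c ` (fst c \<inter> U)) (f \<circ> chart_inv c))"
  unfolding smooth_map_def eucl_atlas_def by (simp add: o_def)

lemma atlas_eucl: "atlas (eucl_atlas :: ('e::euclidean_space, 'e) chart set)"
proof
  have inv: "chart_inv (UNIV, \<lambda>x. x) = (\<lambda>x::'e. x)"
    unfolding chart_inv_def by (auto simp: fun_eq_iff inv_into_f_eq)
  show "smooth_atlas (eucl_atlas :: ('e, 'e) chart set)"
    unfolding smooth_atlas_def eucl_atlas_def homeomorphism_def
    by (auto simp: inv o_def smooth_on_id)
qed

lemma smooth_map_mono: "smooth_map A B U F \<Longrightarrow> W \<subseteq> U \<Longrightarrow> smooth_map A B W F"
  unfolding smooth_map_def
proof (intro conjI ballI)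
  fix c d
  assume sub: "W \<subseteq> U" and F: "continuous_on U F \<and> (\<forall>c\<in>A. \<forall>d\<in>B. smooth_on (snd c ` (fst c \<inter> U \<inter> F -` fst d)) (snd d \<circ> F \<circ> chart_inv c))"
  assume cd: "c \<in> A" "d \<in> B"
  have "smooth_on (snd c ` (fst c \<inter> U \<inter> F -` fst d)) (snd d \<circ> F \<circ> chart_inv c)" using F cd by blast
  then show "smooth_on (snd c ` (fst c \<inter> W \<inter> F -` fst d)) (snd d \<circ> F \<circ> chart_inv c)"
    by (rule smooth_on_mono) (use sub in blast)
qed (auto intro: continuous_on_subset)

lemma smooth_map_chart_smooth:
  assumes "atlas A" "atlas B" "open U" "smooth_map A B U F" "c \<in> A" "d \<in> B"
  shows "open (snd c ` (fst c \<inter> U \<inter> F -` fst d))" "smooth_on (snd c ` (fst c \<inter> U \<inter> F -` fst d)) (snd d \<circ> F \<circ> chart_inv c)"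
proof -
  interpret A: atlas A by fact
  interpret B: atlas B by fact
  have "open (U \<inter> F -` fst d)"
    using assms(3,4) B.open_chart[OF assms(6)] unfolding smooth_map_def by (blast intro: continuous_open_preimage)
  then show "open (snd c ` (fst c \<inter> U \<inter> F -` fst d))" using A.open_chart_Int[OF assms(5)] by (simp add: Int_assoc)
  show "smooth_on (snd c ` (fst c \<inter> U \<inter> F -` fst d)) (snd d \<circ> F \<circ> chart_inv c)"
    using assms unfolding smooth_map_def by blast
qed

lemma smooth_map_compose:
  assumes atl: "atlas A" "atlas B" "atlas C" and U: "open U" and W: "open W"
    and F: "smooth_map A B U F" and H: "smooth_map B C W H" and FW: "F ` U \<subseteq> W"
  shows "smooth_map A C U (\<lambda>x. H (F x))"
  unfolding smooth_map_def
proof (intro conjI ballI)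
  interpret A: atlas A by fact
  interpret B: atlas B by fact
  interpret C: atlas C by fact
  have cF: "continuous_on U F" and cH: "continuous_on W H" using F H unfolding smooth_map_def by blast+
  show cHF: "continuous_on U (\<lambda>x. H (F x))" using continuous_on_compose2[OF cH cF FW] .
  fix c d assume c: "c \<in> A" and d: "d \<in> C"
  show "smooth_on (snd c ` (fst c \<inter> U \<inter> (\<lambda>x. H (F x)) -` fst d)) (snd d \<circ> (\<lambda>x. H (F x)) \<circ> chart_inv c)"
  proof (rule smooth_on_local)
    fix p assume "p \<in> snd c ` (fst c \<inter> U \<inter> (\<lambda>x. H (F x)) -` fst d)"
    then obtain x where x: "x \<in> fst c" "x \<in> U" "H (F x) \<in> fst d" "p = snd c x" by blast
    define b where "b = chart_at B (F x)"
    have b: "b \<in> B" "F x \<in> fst b" unfolding b_def by (rule B.chart_at)+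
    define V where "V = snd b ` (fst b \<inter> W \<inter> H -` fst d)"
    have V: "open V" "smooth_on V (snd d \<circ> H \<circ> chart_inv b)"
      unfolding V_def using smooth_map_chart_smooth[OF atl(2,3) W H b(1) d] by blast+
    define N where "N = snd c ` (fst c \<inter> (U \<inter> F -` fst b \<inter> (\<lambda>x. H (F x)) -` fst d))"
    have "open (U \<inter> F -` fst b)" "open (U \<inter> (\<lambda>x. H (F x)) -` fst d)"
      using cF cHF U B.open_chart[OF b(1)] C.open_chart[OF d] by (blast intro: continuous_open_preimage)+
    then have "open (U \<inter> F -` fst b \<inter> (U \<inter> (\<lambda>x. H (F x)) -` fst d))" by (rule open_Int)
    then have "open (U \<inter> F -` fst b \<inter> (\<lambda>x. H (F x)) -` fst d)" by (simp add: Int_ac)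
    then have N: "open N" unfolding N_def by (rule A.open_chart_Int[OF c])
    have sF: "smooth_on N (snd b \<circ> F \<circ> chart_inv c)"
      by (rule smooth_on_mono[OF smooth_map_chart_smooth(2)[OF atl(1,2) U F c b(1)]]) (auto simp: N_def)
    have img: "(snd b \<circ> F \<circ> chart_inv c) ` N \<subseteq> V"
      using FW by (auto simp: N_def V_def A.chart_inv_chart[OF c] intro!: imageI)
    have "smooth_on N (\<lambda>q. (snd d \<circ> H \<circ> chart_inv b) ((snd b \<circ> F \<circ> chart_inv c) q))"
      by (rule smooth_on_compose[OF N V(1) V(2) sF img])
    then have "smooth_on N (snd d \<circ> (\<lambda>x. H (F x)) \<circ> chart_inv c)"
      by (rule smooth_on_cong[OF N, rotated]) (auto simp: N_def A.chart_inv_chart[OF c] B.chart_inv_chart[OF b(1)])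
    then show "\<exists>W. open W \<and> p \<in> W \<and> smooth_on W (snd d \<circ> (\<lambda>x. H (F x)) \<circ> chart_inv c)"
      using N x b by (intro exI[of _ N]) (auto simp: N_def)
  qed
qed

lemma push_component:
  assumes "d \<in> B" "F x \<in> fst d"
  shows "push A B F x v d = dir_deriv A (snd d \<circ> F) x v"
  using assms by (simp add: push_def dir_deriv_def o_assoc)

lemma push_chart:
  assumes atl: "atlas A" "atlas B" and U: "open U" "smooth_map A B U F" "x \<in> U"
    and c: "c \<in> A" "x \<in> fst c" and d: "d \<in> B" "F x \<in> fst d" and v: "tangent A x v"
  shows "push A B F x v d = dd (snd d \<circ> F \<circ> chart_inv c) (snd c x) (v c)"
    and "(snd d \<circ> F \<circ> chart_inv c) differentiable (at (snd c x))"
proof -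
  interpret A: atlas A by fact
  have "snd c x \<in> snd c ` (fst c \<inter> U \<inter> F -` fst d)" using U c d by blast
  then show diff: "(snd d \<circ> F \<circ> chart_inv c) differentiable (at (snd c x))"
    using smooth_on_differentiable[OF smooth_map_chart_smooth(2)[OF atl U(1,2) c(1) d(1)]] by blast
  show "push A B F x v d = dd (snd d \<circ> F \<circ> chart_inv c) (snd c x) (v c)"
    unfolding push_component[of d B F x A v, OF d] using A.dir_deriv_chart[OF c v] diff by blast
qed

lemma tangent_push:
  assumes atl: "atlas A" "atlas B" and U: "open U" "smooth_map A B U F" "x \<in> U" and v: "tangent A x v"
  shows "tangent B (F x) (push A B F x v)"
  unfolding tangent_def
proof (intro conjI allI ballI impI)
  interpret A: atlas A by fact
  interpret B: atlas B by fact
  fix d e assume d: "d \<in> B" "F x \<in> fst d" and e: "e \<in> B" "F x \<in> fst e"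
  define c where "c = chart_at A x"
  have c: "c \<in> A" "x \<in> fst c" unfolding c_def by (rule A.chart_at)+
  note pd = push_chart[OF atl U c d v] and pe = push_chart[OF atl U c e v]
  have xc: "chart_inv c (snd c x) = x" using A.chart_inv_chart c by blast
  have t: "((snd e \<circ> chart_inv d) has_derivative dd (snd e \<circ> chart_inv d) (snd d (F x))) (at ((snd d \<circ> F \<circ> chart_inv c) (snd c x)))"
    using B.differentiable_transition[OF d(1) e(1) d(2) e(2)] xc by (simp add: dd_works)
  have "((snd e \<circ> F \<circ> chart_inv c) has_derivative (\<lambda>w. dd (snd e \<circ> chart_inv d) (snd d (F x)) (dd (snd d \<circ> F \<circ> chart_inv c) (snd c x) w))) (at (snd c x))"
  proof (rule has_derivative_cong_open)
    show "open (snd c ` (fst c \<inter> U \<inter> F -` fst d))" by (rule smooth_map_chart_smooth[OF atl U(1,2) c(1) d(1)])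
    show "snd c x \<in> snd c ` (fst c \<inter> U \<inter> F -` fst d)" using c d U by blast
    show "((\<lambda>w. (snd e \<circ> chart_inv d) ((snd d \<circ> F \<circ> chart_inv c) w)) has_derivative
      (\<lambda>w. dd (snd e \<circ> chart_inv d) (snd d (F x)) (dd (snd d \<circ> F \<circ> chart_inv c) (snd c x) w))) (at (snd c x))"
      by (rule has_derivative_compose[OF dd_works[OF pd(2)] t])
  qed (auto simp: A.chart_inv_chart[OF c(1)] B.chart_inv_chart[OF d(1)])
  then show "push A B F x v e = dd (snd e \<circ> chart_inv d) (snd d (F x)) (push A B F x v d)"
    by (simp add: pd(1) pe(1) dd_eqI)
qed (auto simp: push_def)

section \<open>Connections on circle bundles\<close>

lemma smooth_on_Pair:
  fixes f :: "'a::euclidean_space \<Rightarrow> 'b::euclidean_space" and g :: "'a \<Rightarrow> 'c::euclidean_space"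
  assumes "open U" "smooth_on U f" "smooth_on U g"
  shows "smooth_on U (\<lambda>x. (f x, g x))"
proof -
  have "smooth_on U (\<lambda>x. (f x, 0) + (0, g x))"
    using assms by (intro smooth_on_add
        smooth_on_bounded_linear[OF bounded_linear_Pair[OF bounded_linear_ident bounded_linear_zero]]
        smooth_on_bounded_linear[OF bounded_linear_Pair[OF bounded_linear_zero bounded_linear_ident]])
  then show ?thesis by simp
qed

lemma smooth_on_fst_compose:
  assumes "open U" "smooth_on U f"
  shows "smooth_on (U \<times> UNIV) (\<lambda>x. f (fst x))"
proof (rule smooth_on_compose[OF _ assms])
  show "open (U \<times> UNIV)" using assms(1) by (simp add: open_Times)
  then show "smooth_on (U \<times> UNIV) fst"
    using smooth_on_bounded_linear[OF bounded_linear_fst _ smooth_on_id] by blast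
qed auto

lemma smooth_on_cis: "smooth_on U cis"
proof -
  have "ck_on k U (\<lambda>x. c * cis x)" for k c
  proof (induction k arbitrary: c)
    case 0
    show ?case by (auto intro!: continuous_intros)
  next
    case (Suc k)
    have d: "((\<lambda>x. c * cis x) has_derivative (\<lambda>v. c * (v *\<^sub>R (\<i> * cis x)))) (at x)" for x
      by (intro has_derivative_mult_right has_derivative_cis has_derivative_ident)
    have "ck_on k U (\<lambda>x. dd (\<lambda>x. c * cis x) x v)" for v
    proof -
      have "(\<lambda>x. dd (\<lambda>x. c * cis x) x v) = (\<lambda>x. (c * complex_of_real v * \<i>) * cis x)"
        by (simp add: dd_eqI[OF d] scaleR_conv_of_real mult_ac)
      then show ?thesis using Suc[of "c * complex_of_real v * \<i>"] by (simp only:)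
    qed
    then show ?case using d by (auto simp: differentiable_def)
  qed
  from this[of _ 1] show ?thesis by (simp add: smooth_on_def)
qed

text \<open>Exterior derivatives commute with pullback: the product rule adds a term with the second
  derivative of F, which is symmetric and cancels.\<close>

lemma pullback_ext_deriv:
  fixes F :: "'a::euclidean_space \<Rightarrow> 'b::euclidean_space" and \<beta> :: "'b \<Rightarrow> 'b \<Rightarrow> 'c::real_normed_vector"
  assumes W: "open W" "smooth_on W F" "x \<in> W" and D: "open D" "F ` W \<subseteq> D"
    and lin: "\<And>z. z \<in> D \<Longrightarrow> linear (\<beta> z)" and sm: "\<And>v. smooth_on D (\<lambda>z. \<beta> z v)"
  shows "dd (\<lambda>o'. \<beta> (F o') (dd F o' \<eta>)) x \<xi> - dd (\<lambda>o'. \<beta> (F o') (dd F o' \<xi>)) x \<eta> =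
    dd (\<lambda>z. \<beta> z (dd F x \<eta>)) (F x) (dd F x \<xi>) - dd (\<lambda>z. \<beta> z (dd F x \<xi>)) (F x) (dd F x \<eta>)"
proof -
  have FD: "F z \<in> D" if "z \<in> W" for z using D(2) that by blast
  have 1: "((\<lambda>o'. \<beta> (F o') v) has_derivative (\<lambda>h. dd (\<lambda>z. \<beta> z v) (F x) (dd F x h))) (at x)" for v
    using has_derivative_compose[OF smooth_on_has_derivative[OF W(2,3)] smooth_on_has_derivative[OF sm FD[OF W(3)]]] .
  have 2: "dd (\<lambda>o'. \<beta> (F o') (dd F o' \<eta>)) x \<xi> =
      dd (\<lambda>z. \<beta> z (dd F x \<eta>)) (F x) (dd F x \<xi>) + \<beta> (F x) (dd (\<lambda>o'. dd F o' \<eta>) x \<xi>)" for \<xi> \<eta>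
  proof -
    have "((\<lambda>o'. \<beta> (F o') (dd F o' \<eta>)) has_derivative
        (\<lambda>h. dd (\<lambda>o'. \<beta> (F o') (dd F x \<eta>)) x h + \<beta> (F x) (dd (\<lambda>o'. dd F o' \<eta>) x h))) (at x)"
      using W FD lin 1 by (intro dd_field[OF W(1,3), where T = "\<lambda>o'. \<beta> (F o')"]
          smooth_on_differentiable[OF smooth_on_dd[OF W(2)] W(3)]) (auto simp: differentiable_def)
    from dd_eqI[OF this] show ?thesis by (simp add: dd_eqI[OF 1])
  qed
  show ?thesis unfolding 2 by (simp add: dd_dd_commute[OF W(1,2,3), of \<eta> \<xi>])
qed

locale circle_bundle = M: atlas A + Q: atlas B
  for A :: "('m::topological_space, real^'n::finite) chart set"
    and B :: "('q::topological_space, (real^'n) \<times> real) chart set" +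
  fixes \<pi> :: "'q \<Rightarrow> 'm" and act :: "'q \<Rightarrow> complex \<Rightarrow> 'q"
    and \<alpha> :: "'q \<Rightarrow> ('q, (real^'n) \<times> real) tvec \<Rightarrow> complex"
  assumes principal: "principal_bundle A {z. norm z = 1} (*) 1 B \<pi> act"
    and connection: "circle_connection B act \<alpha>"
begin

lemma proj_smooth: "smooth_map B A UNIV \<pi>"
  and act_act: "norm a = 1 \<Longrightarrow> norm b = 1 \<Longrightarrow> act (act q a) b = act q (a * b)"
  and proj_act: "norm a = 1 \<Longrightarrow> \<pi> (act q a) = \<pi> q"
  using principal unfolding principal_bundle_def by auto

definition triv :: "'m set \<Rightarrow> ('m \<Rightarrow> 'q) \<Rightarrow> ('q \<Rightarrow> complex) \<Rightarrow> bool" where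
  "triv U s \<tau> \<longleftrightarrow> open U \<and> smooth_map A B U s \<and> (\<forall>y\<in>U. \<pi> (s y) = y) \<and>
    smooth_on_subset (prod_atlas A eucl_atlas) B (U \<times> {z. norm z = 1}) (\<lambda>(y, a). act (s y) a) \<and>
    smooth_map B eucl_atlas (\<pi> -` U) \<tau> \<and>
    (\<forall>u\<in>\<pi> -` U. norm (\<tau> u) = 1 \<and> act (s (\<pi> u)) (\<tau> u) = u) \<and>
    (\<forall>y\<in>U. \<forall>a. norm a = 1 \<longrightarrow> \<tau> (act (s y) a) = a)"

lemma trivE: obtains U s \<tau> where "x \<in> U" "triv U s \<tau>"
proof -
  have "\<forall>x. \<exists>U s \<tau>. open U \<and> x \<in> U \<and> smooth_map A B U s \<and> (\<forall>y\<in>U. \<pi> (s y) = y) \<and>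
        smooth_on_subset (prod_atlas A eucl_atlas) B (U \<times> {z. norm z = 1}) (\<lambda>(y, a). act (s y) a) \<and>
        smooth_map B eucl_atlas (\<pi> -` U) \<tau> \<and>
        (\<forall>u\<in>\<pi> -` U. \<tau> u \<in> {z. norm z = 1} \<and> act (s (\<pi> u)) (\<tau> u) = u) \<and>
        (\<forall>y\<in>U. \<forall>a\<in>{z. norm z = 1}. \<tau> (act (s y) a) = a)"
    using principal unfolding principal_bundle_def by (elim conjE)
  from this[rule_format, of x] show thesis
    by (elim exE conjE, intro that) (assumption, simp add: triv_def)
qed

text \<open>The circle is not open in the complex plane, so smoothness of the action means a smooth
  local extension; \<open>\<Phi>\<close> is one in charts, and its values have meaning only where z
  has norm 1.\<close>

lemma action_local:
  assumes t: "triv U s \<tau>" and x: "x \<in> U" "c \<in> A" "x \<in> fst c" and a: "norm a = 1"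
    and d: "d \<in> B" "act (s x) a \<in> fst d"
  obtains N \<Phi> where "open N" "(snd c x, a) \<in> N" "smooth_on N \<Phi>"
    "\<And>p z. (p, z) \<in> N \<Longrightarrow> norm z = 1 \<Longrightarrow> p \<in> snd c ` (fst c \<inter> U) \<and>
      act (s (chart_inv c p)) z \<in> fst d \<and> \<Phi> (p, z) = snd d (act (s (chart_inv c p)) z)"
proof -
  have U: "open U" using t unfolding triv_def by blast
  have "(x, a) \<in> U \<times> {z. norm z = 1}" using x a by simp
  moreover have "smooth_on_subset (prod_atlas A eucl_atlas) B (U \<times> {z. norm z = 1}) (\<lambda>(y, a). act (s y) a)"
    using t unfolding triv_def by (elim conjE)
  ultimately have "\<exists>W F. open W \<and> (x, a) \<in> W \<and> smooth_map (prod_atlas A eucl_atlas) B W F \<and>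
      (\<forall>y\<in>W \<inter> (U \<times> {z. norm z = 1}). F y = (\<lambda>(y, a). act (s y) a) y)"
    unfolding smooth_on_subset_def by (rule bspec[rotated])
  then obtain W F where W: "open W" "(x, a) \<in> W" "smooth_map (prod_atlas A eucl_atlas) B W F"
      "\<And>y. y \<in> W \<inter> (U \<times> {z. norm z = 1}) \<Longrightarrow> F y = (\<lambda>(y, a). act (s y) a) y"
    by (elim exE conjE) (rule that, assumption+, erule bspec)
  define e :: "('m \<times> complex, (real^'n) \<times> complex) chart" where "e = (fst c \<times> UNIV, map_prod (snd c) (\<lambda>x. x))"
  have e: "e \<in> prod_atlas A eucl_atlas"
    unfolding e_def prod_atlas_def eucl_atlas_def using x(2) by force
  have e_inv: "chart_inv e (p, z) = (chart_inv c p, z)" if "p \<in> snd c ` fst c" for p z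
  proof -
    have "inj_on (snd c) (fst c)" using M.chart_inv_chart[OF x(2)] by (metis inj_onI)
    then have "inj_on (map_prod (snd c) (\<lambda>x::complex. x)) (fst c \<times> UNIV)" by (auto simp: inj_on_def)
    moreover have "map_prod (snd c) (\<lambda>x. x) (chart_inv c p, z) = (p, z)" "(chart_inv c p, z) \<in> fst c \<times> UNIV"
      using M.chart_chart_inv[OF x(2) that] M.chart_inv_in[OF x(2) that] by auto
    ultimately have "inv_into (fst c \<times> UNIV) (map_prod (snd c) (\<lambda>x. x)) (p, z) = (chart_inv c p, z)"
      by (intro inv_into_f_eq)
    then show ?thesis unfolding chart_inv_def[of e] by (simp add: e_def)
  qed
  have WF: "open (W \<inter> F -` fst d)"
    using W(1,3) Q.open_chart[OF d(1)] unfolding smooth_map_def by (blast intro: continuous_open_preimage)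
  define N where "N = ((snd c ` fst c) \<times> UNIV) \<inter> (\<lambda>y. (chart_inv c (fst y), snd y)) -` (W \<inter> F -` fst d \<inter> (U \<times> UNIV))"
  have "open N" unfolding N_def
  proof (rule continuous_open_preimage)
    show "continuous_on (snd c ` fst c \<times> UNIV) (\<lambda>y. (chart_inv c (fst y), snd y))"
      by (intro continuous_on_Pair continuous_on_compose2[OF M.continuous_chart_inv[OF x(2)]] continuous_intros) auto
    show "open (snd c ` fst c \<times> (UNIV::complex set))" by (intro open_Times M.open_chart_image x) simp
    show "open (W \<inter> F -` fst d \<inter> U \<times> UNIV)" by (rule open_Int[OF WF open_Times[OF U open_UNIV]])
  qed
  moreover have "(snd c x, a) \<in> N"
    using x W(2,4) a d by (auto simp: N_def M.chart_inv_chart)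
  moreover have "smooth_on N (snd d \<circ> F \<circ> chart_inv e)"
  proof (rule smooth_on_mono)
    show "smooth_on (snd e ` (fst e \<inter> W \<inter> F -` fst d)) (snd d \<circ> F \<circ> chart_inv e)"
      using W(3) e d(1) unfolding smooth_map_def by blast
    show "N \<subseteq> snd e ` (fst e \<inter> W \<inter> F -` fst d)"
    proof
      fix y assume y: "y \<in> N"
      then have "y = snd e (chart_inv c (fst y), snd y)"
        by (cases y) (auto simp: e_def N_def M.chart_inv_chart[OF x(2)])
      moreover have "(chart_inv c (fst y), snd y) \<in> fst e \<inter> W \<inter> F -` fst d"
        using y M.chart_inv_in[OF x(2)] by (auto simp: e_def N_def)
      ultimately show "y \<in> snd e ` (fst e \<inter> W \<inter> F -` fst d)" by blast
    qed
  qed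
  moreover have "p \<in> snd c ` (fst c \<inter> U) \<and> act (s (chart_inv c p)) z \<in> fst d \<and>
      (snd d \<circ> F \<circ> chart_inv e) (p, z) = snd d (act (s (chart_inv c p)) z)" if "(p, z) \<in> N" "norm z = 1" for p z
  proof -
    have p: "p \<in> snd c ` fst c" "(chart_inv c p, z) \<in> W" "F (chart_inv c p, z) \<in> fst d" "chart_inv c p \<in> U"
      using that(1) by (auto simp: N_def)
    have "F (chart_inv c p, z) = act (s (chart_inv c p)) z" using W(4)[of "(chart_inv c p, z)"] p that(2) by simp
    then show ?thesis using p e_inv[OF p(1)] M.chart_image_iff[OF x(2)] by auto
  qed
  ultimately show thesis using that by blast
qed

definition local_sec :: "'m set \<Rightarrow> ('m \<Rightarrow> 'q) \<Rightarrow> bool" where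
  "local_sec U s \<longleftrightarrow> open U \<and> smooth_map A B U s \<and> (\<forall>y\<in>U. \<pi> (s y) = y)"

text \<open>Real coordinates on the circle bundle over a section: a base point and an angle. Forms
  on the total space are computed by pulling back to these coordinates.\<close>

definition flow :: "('m \<Rightarrow> 'q) \<Rightarrow> ('m, real^'n) chart \<Rightarrow> (real^'n) \<times> real \<Rightarrow> 'q" where
  "flow s c o' = act (s (chart_inv c (fst o'))) (cis (snd o'))"

lemma flow_smooth:
  assumes s: "local_sec U s" and c: "c \<in> A" and p: "p \<in> snd c ` (fst c \<inter> U)" and d: "d \<in> B" "flow s c (p, t) \<in> fst d"
  obtains W where "open W" "(p, t) \<in> W" "smooth_on W (\<lambda>o'. snd d (flow s c o'))"
    "\<And>o'. o' \<in> W \<Longrightarrow> flow s c o' \<in> fst d \<and> fst o' \<in> snd c ` (fst c \<inter> U)"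
proof -
  define x where "x = chart_inv c p"
  have x: "x \<in> U" "x \<in> fst c" "snd c x = p"
    using p M.chart_inv_chart[OF c] by (auto simp: x_def)
  obtain U0 s0 \<tau> where x0: "x \<in> U0" and t: "triv U0 s0 \<tau>" by (rule trivE)
  have U0: "open U0" "smooth_map B eucl_atlas (\<pi> -` U0) \<tau>" and U: "open U" "smooth_map A B U s"
    using t s unfolding triv_def local_sec_def by blast+
  \<comment> \<open>Smoothness of the action is available only for a trivialising section s0; s
    differs from it by the circle-valued function h, which multiplies the angle factor.\<close>
  define h where "h y = \<tau> (s y)" for y
  have sh: "s y = act (s0 y) (h y)" "norm (h y) = 1" if "y \<in> U \<inter> U0" for y
    using t s that unfolding triv_def local_sec_def h_def by (metis IntE vimageI)+
  define V where "V = snd c ` (fst c \<inter> (U \<inter> U0))"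
  have V: "open V" unfolding V_def using U U0 by (intro M.open_chart_Int[OF c]) auto
  have h_smooth: "smooth_on V (h \<circ> chart_inv c)"
  proof -
    have "smooth_map A eucl_atlas (U \<inter> U0) (\<lambda>y. \<tau> (s y))"
    proof (rule smooth_map_compose[OF M.atlas_axioms Q.atlas_axioms atlas_eucl _ _ _ U0(2)])
      show "open (U \<inter> U0)" using U U0 by auto
      have "continuous_on UNIV \<pi>" using proj_smooth unfolding smooth_map_def by blast
      then show "open (\<pi> -` U0)" using U0(1) by (simp add: continuous_on_open_vimage)
      show "smooth_map A B (U \<inter> U0) s" using U(2) by (rule smooth_map_mono) auto
      show "s ` (U \<inter> U0) \<subseteq> \<pi> -` U0" using s unfolding local_sec_def by auto
    qed
    then show ?thesis unfolding h_def V_def by (rule M.smooth_map_eucl[OF _ c])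
  qed
  have flow_h: "flow s c (p', t') = act (s0 (chart_inv c p')) ((h \<circ> chart_inv c) p' * cis t')" if "p' \<in> V" for p' t'
  proof -
    have y: "chart_inv c p' \<in> U \<inter> U0" using that by (auto simp: V_def M.chart_inv_chart[OF c])
    show ?thesis using act_act[of "h (chart_inv c p')" "cis t'"] sh[OF y] by (simp add: flow_def)
  qed
  have pV: "p \<in> V" using x x0 by (auto simp: V_def)
  define a where "a = h x * cis t"
  have a: "norm a = 1" using sh(2)[of x] x x0 by (simp add: a_def norm_mult)
  have "act (s0 x) a \<in> fst d" using d(2) flow_h[OF pV, of t] by (simp add: a_def x_def)
  then obtain N \<Phi> where N: "open N" "(snd c x, a) \<in> N" "smooth_on N \<Phi>"
    "\<And>p z. (p, z) \<in> N \<Longrightarrow> norm z = 1 \<Longrightarrow> p \<in> snd c ` (fst c \<inter> U0) \<and>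
      act (s0 (chart_inv c p)) z \<in> fst d \<and> \<Phi> (p, z) = snd d (act (s0 (chart_inv c p)) z)"
    using action_local[OF t x0 c x(2) a d(1)] by metis
  define k where "k o' = (fst o', (h \<circ> chart_inv c) (fst o') * cis (snd o'))" for o' :: "(real^'n) \<times> real"
  have VU: "open (V \<times> (UNIV::real set))" using V by (simp add: open_Times)
  have k: "smooth_on (V \<times> UNIV) k" unfolding k_def
    using smooth_on_compose[OF VU open_UNIV smooth_on_cis smooth_on_bounded_linear[OF bounded_linear_snd VU smooth_on_id] subset_UNIV]
    by (intro smooth_on_Pair[OF VU] smooth_on_mult[OF VU] smooth_on_fst_compose[OF V h_smooth]
        smooth_on_bounded_linear[OF bounded_linear_fst VU smooth_on_id])
  define W where "W = (V \<times> UNIV) \<inter> k -` N"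
  have W: "open W" unfolding W_def by (rule continuous_open_preimage[OF smooth_on_continuous[OF k] VU N(1)])
  have *: "flow s c o' \<in> fst d \<and> fst o' \<in> snd c ` (fst c \<inter> U) \<and> \<Phi> (k o') = snd d (flow s c o')" if "o' \<in> W" for o'
  proof -
    obtain p' t' where o': "o' = (p', t')" by (cases o')
    have p': "p' \<in> V" "k (p', t') \<in> N" using that by (auto simp: W_def o')
    have "chart_inv c p' \<in> U \<inter> U0" using p'(1) by (auto simp: V_def M.chart_inv_chart[OF c])
    then have nm: "norm ((h \<circ> chart_inv c) p' * cis t') = 1" using sh(2) by (simp add: norm_mult)
    have "p' \<in> snd c ` (fst c \<inter> U)" using p'(1) by (auto simp: V_def)
    then show ?thesis
      using N(4)[OF p'(2)[unfolded k_def fst_conv snd_conv] nm] flow_h[OF p'(1), of t'] by (simp add: o' k_def)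
  qed
  have "smooth_on W (\<lambda>o'. \<Phi> (k o'))"
    by (rule smooth_on_compose[OF W N(1,3) smooth_on_mono[OF k]]) (auto simp: W_def)
  then have "smooth_on W (\<lambda>o'. snd d (flow s c o'))"
    by (rule smooth_on_cong[OF W, rotated]) (simp add: *)
  moreover have "(p, t) \<in> W" using pV N(2) x(3) by (simp add: W_def k_def a_def x_def)
  ultimately show thesis using that[OF W] * by blast
qed

lemma action_differentiable:
  assumes z: "norm z = 1" and d0: "d0 \<in> B" "q \<in> fst d0" and d: "d \<in> B" "act q z \<in> fst d"
  shows "(\<lambda>w. snd d (act (chart_inv d0 w) z)) differentiable (at (snd d0 q))"
proof -
  obtain U s \<tau> where x: "\<pi> q \<in> U" and t: "triv U s \<tau>" by (rule trivE)
  define c where "c = chart_at A (\<pi> q)"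
  have c: "c \<in> A" "\<pi> q \<in> fst c" unfolding c_def by (rule M.chart_at)+
  have U: "open U" "smooth_map B eucl_atlas (\<pi> -` U) \<tau>" using t unfolding triv_def by blast+
  have \<tau>: "norm (\<tau> r) = 1" "act (s (\<pi> r)) (\<tau> r) = r" if "\<pi> r \<in> U" for r
    using t that unfolding triv_def by blast+
  \<comment> \<open>In a trivialisation, right translation by z merely multiplies the fibre
    coordinate by z.\<close>
  have eq: "act r z = act (s (\<pi> r)) (\<tau> r * z)" if "\<pi> r \<in> U" for r
    using act_act[of "\<tau> r" z "s (\<pi> r)"] \<tau>[OF that] z by simp
  have a: "norm (\<tau> q * z) = 1" using \<tau>(1)[OF x] z by (simp add: norm_mult)
  have "act (s (\<pi> q)) (\<tau> q * z) \<in> fst d" using d(2) eq[OF x] by simp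
  then obtain N \<Phi> where N: "open N" "(snd c (\<pi> q), \<tau> q * z) \<in> N" "smooth_on N \<Phi>"
    "\<And>p z. (p, z) \<in> N \<Longrightarrow> norm z = 1 \<Longrightarrow> p \<in> snd c ` (fst c \<inter> U) \<and>
      act (s (chart_inv c p)) z \<in> fst d \<and> \<Phi> (p, z) = snd d (act (s (chart_inv c p)) z)"
    using action_local[OF t x c a d(1)] by metis
  have c\<pi>: "continuous_on UNIV \<pi>" using proj_smooth unfolding smooth_map_def by blast
  then have oU: "open (\<pi> -` U)" "open (\<pi> -` U \<inter> \<pi> -` fst c)"
    using U(1) M.open_chart[OF c(1)] by (auto simp: continuous_on_open_vimage)
  define D where "D = snd d0 ` (fst d0 \<inter> (\<pi> -` U \<inter> \<pi> -` fst c))"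
  have D: "open D" unfolding D_def by (rule Q.open_chart_Int[OF d0(1) oU(2)])
  have s1: "smooth_on D (snd c \<circ> \<pi> \<circ> chart_inv d0)"
    by (rule smooth_on_mono[OF smooth_map_chart_smooth(2)[OF Q.atlas_axioms M.atlas_axioms open_UNIV proj_smooth d0(1) c(1)]])
      (auto simp: D_def)
  have s2: "smooth_on D (\<tau> \<circ> chart_inv d0)"
    by (rule smooth_on_mono[OF Q.smooth_map_eucl[OF U(2) d0(1)]]) (auto simp: D_def)
  define k where "k w = ((snd c \<circ> \<pi> \<circ> chart_inv d0) w, (\<tau> \<circ> chart_inv d0) w * z)" for w
  have k: "smooth_on D k" unfolding k_def by (intro smooth_on_Pair smooth_on_mult s1 s2 smooth_on_const D)
  define W where "W = D \<inter> k -` N"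
  have W: "open W" unfolding W_def by (rule continuous_open_preimage[OF smooth_on_continuous[OF k] D N(1)])
  have qW: "snd d0 q \<in> W" using d0 x c N(2) by (auto simp: W_def D_def k_def Q.chart_inv_chart)
  have "smooth_on W (\<lambda>w. \<Phi> (k w))"
    by (rule smooth_on_compose[OF W N(1,3) smooth_on_mono[OF k]]) (auto simp: W_def)
  then have "smooth_on W (\<lambda>w. snd d (act (chart_inv d0 w) z))"
  proof (rule smooth_on_cong[OF W, rotated])
    fix w assume w: "w \<in> W"
    then obtain r where r: "r \<in> fst d0" "\<pi> r \<in> U" "\<pi> r \<in> fst c" "w = snd d0 r" "k w \<in> N"
      by (auto simp: W_def D_def)
    have inv: "chart_inv d0 w = r" using r Q.chart_inv_chart[OF d0(1)] by simp
    have "k w = (snd c (\<pi> r), \<tau> r * z)" by (simp add: k_def inv)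
    then show "\<Phi> (k w) = snd d (act (chart_inv d0 w) z)"
      using N(4)[of "snd c (\<pi> r)" "\<tau> r * z"] r \<tau>(1)[OF r(2)] z eq[OF r(2)] M.chart_inv_chart[OF c(1) r(3)]
      by (simp add: inv Q.chart_inv_chart[OF d0(1) r(1)] norm_mult)
  qed
  then show ?thesis using qW smooth_on_differentiable by blast
qed

definition form_at :: "('q, (real^'n) \<times> real) chart \<Rightarrow> (real^'n) \<times> real \<Rightarrow> (real^'n) \<times> real \<Rightarrow> complex" where
  "form_at d z w = \<alpha> (chart_inv d z) (tvec_of B d (chart_inv d z) w)"

lemma form_linear: "tangent B q v \<Longrightarrow> tangent B q w \<Longrightarrow> \<alpha> q (tadd v w) = \<alpha> q v + \<alpha> q w"
  "tangent B q v \<Longrightarrow> \<alpha> q (tscale r v) = r *\<^sub>R \<alpha> q v"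
  using connection unfolding circle_connection_def smooth_1form_def by blast+

lemma linear_form_at: "d \<in> B \<Longrightarrow> z \<in> snd d ` fst d \<Longrightarrow> linear (form_at d z)"
  unfolding form_at_def
  by (intro linearI) (simp_all add: Q.tvec_of_add Q.tvec_of_scale Q.chart_inv_in form_linear Q.tangent_tvec_of)

lemma smooth_form_at: "d \<in> B \<Longrightarrow> smooth_on (snd d ` fst d) (\<lambda>z. form_at d z w)"
  using connection unfolding circle_connection_def smooth_1form_def form_at_def by blast

lemma form_at_eq: "d \<in> B \<Longrightarrow> q \<in> fst d \<Longrightarrow> tangent B q v \<Longrightarrow> \<alpha> q v = form_at d (snd d q) (v d)"
  by (simp add: form_at_def Q.chart_inv_chart Q.tvec_of_self)

definition pull :: "('m \<Rightarrow> 'q) \<Rightarrow> 'm \<Rightarrow> ('m, real^'n) tvec \<Rightarrow> complex" where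
  "pull s x X = \<alpha> (s x) (push A B s x X)"

text \<open>In flow coordinates the connection form is the pulled-back form plus i dt: the angle
  direction is vertical, where the form is normalised to i, and the base directions are right
  translates of vectors tangent to the section, where invariance applies.\<close>

lemma flow_form:
  assumes s: "local_sec U s" and c: "c \<in> A" and p: "p \<in> snd c ` (fst c \<inter> U)" and d: "d \<in> B" "flow s c (p, t) \<in> fst d"
  shows "form_at d (snd d (flow s c (p, t))) (dd (\<lambda>o'. snd d (flow s c o')) (p, t) (v, r)) =
    pull s (chart_inv c p) (tvec_of A c (chart_inv c p) v) + \<i> * complex_of_real r"
proof -
  define x where "x = chart_inv c p"
  have x: "x \<in> U" "x \<in> fst c" "snd c x = p"
    using p M.chart_inv_chart[OF c] by (auto simp: x_def)
  define q where "q = flow s c (p, t)"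
  define q0 where "q0 = s x"
  have q_act: "q = act q0 (cis t)" by (simp add: q_def flow_def q0_def x_def)
  have der: "((\<lambda>o'. snd e (flow s c o')) has_derivative dd (\<lambda>o'. snd e (flow s c o')) (p, t)) (at (p, t))"
    if "e \<in> B" "q \<in> fst e" for e
    using flow_smooth[OF s c p that(1) that(2)[unfolded q_def]] smooth_on_has_derivative by metis
  let ?D = "dd (\<lambda>o'. snd d (flow s c o')) (p, t)"
  have lin: "linear ?D" "linear (form_at d (snd d q))"
    using has_derivative_linear[OF der] d linear_form_at[OF d(1)] by (auto simp: q_def)
  have vert: "form_at d (snd d q) (?D (0, 1)) = \<i>"
  proof -
    have "vector_derivative (\<lambda>t'. snd e (act q (cis t'))) (at 0) = dd (\<lambda>o'. snd e (flow s c o')) (p, t) (0, 1)"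
      if e: "e \<in> B" "q \<in> fst e" for e
    proof -
      have "((\<lambda>t'. (p, t + t')) has_derivative (\<lambda>h. (0, h))) (at 0)"
        by (auto intro!: derivative_eq_intros)
      from has_derivative_compose[OF this, of "\<lambda>o'. snd e (flow s c o')"] der[OF e]
      have "((\<lambda>t'. snd e (flow s c (p, t + t'))) has_derivative (\<lambda>h. dd (\<lambda>o'. snd e (flow s c o')) (p, t) (0, h))) (at 0)"
        by simp
      moreover have "(\<lambda>h. dd (\<lambda>o'. snd e (flow s c o')) (p, t) (0, h)) = (\<lambda>h. h *\<^sub>R dd (\<lambda>o'. snd e (flow s c o')) (p, t) (0, 1))"
      proof
        fix h show "dd (\<lambda>o'. snd e (flow s c o')) (p, t) (0, h) = h *\<^sub>R dd (\<lambda>o'. snd e (flow s c o')) (p, t) (0, 1)"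
          using linear_scale[OF has_derivative_linear[OF der[OF e]], of h "(0, 1)"]
          by (simp only: scaleR_Pair scaleR_zero_right real_scaleR_def mult_1_right)
      qed
      ultimately have "((\<lambda>t'. snd e (flow s c (p, t + t'))) has_vector_derivative dd (\<lambda>o'. snd e (flow s c o')) (p, t) (0, 1)) (at 0)"
        unfolding has_vector_derivative_def by (simp only:)
      moreover have "flow s c (p, t + t') = act q (cis t')" for t'
        using act_act[of "cis t" "cis t'" q0] by (simp add: flow_def q_act cis_mult q0_def x_def)
      ultimately have "((\<lambda>t'. snd e (act q (cis t'))) has_vector_derivative dd (\<lambda>o'. snd e (flow s c o')) (p, t) (0, 1)) (at 0)"
        by simp
      then show ?thesis by (rule vector_derivative_at)
    qed
    then have cv: "circle_vertical B act q e = (if e \<in> B \<and> q \<in> fst e then dd (\<lambda>o'. snd e (flow s c o')) (p, t) (0, 1) else 0)" for e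
      by (simp add: circle_vertical_def)
    have "tangent B q (circle_vertical B act q)"
      unfolding tangent_def
    proof (intro conjI allI ballI impI)
      fix e e' assume e: "e \<in> B" "q \<in> fst e" and e': "e' \<in> B" "q \<in> fst e'"
      obtain W where W: "open W" "(p, t) \<in> W" "\<And>o'. o' \<in> W \<Longrightarrow> flow s c o' \<in> fst e"
        using flow_smooth[OF s c p e(1) e(2)[unfolded q_def]] by metis
      have "((snd e' \<circ> chart_inv e) has_derivative dd (snd e' \<circ> chart_inv e) (snd e q)) (at (snd e (flow s c (p, t))))"
        using Q.differentiable_transition[OF e(1) e'(1) e(2) e'(2)] by (simp add: dd_works q_def)
      from has_derivative_compose[OF der[OF e] this]
      have "((\<lambda>o'. snd e' (flow s c o')) has_derivative
          (\<lambda>w. dd (snd e' \<circ> chart_inv e) (snd e q) (dd (\<lambda>o'. snd e (flow s c o')) (p, t) w))) (at (p, t))"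
        by (rule has_derivative_cong_open[OF W(1,2), rotated]) (simp add: W(3) Q.chart_inv_chart[OF e(1)])
      then show "circle_vertical B act q e' = dd (snd e' \<circ> chart_inv e) (snd e q) (circle_vertical B act q e)"
        using e e' by (simp add: cv dd_eqI)
    qed (auto simp: cv)
    from form_at_eq[OF d(1) _ this] have "\<alpha> q (circle_vertical B act q) = form_at d (snd d q) (?D (0, 1))"
      using d by (simp add: cv q_def[symmetric])
    moreover have "\<alpha> q (circle_vertical B act q) = \<i>" using connection unfolding circle_connection_def by blast
    ultimately show ?thesis by simp
  qed
  have hor: "form_at d (snd d q) (?D (v, 0)) = pull s x (tvec_of A c x v)"
  proof -
    let ?v = "tvec_of A c x v"
    define w where "w = push A B s x ?v"
    have sU: "open U" "smooth_map A B U s" using s unfolding local_sec_def by blast+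
    have tv: "tangent A x ?v" by (rule M.tangent_tvec_of[OF c x(2)])
    have tw: "tangent B q0 w" unfolding w_def q0_def by (rule tangent_push[OF M.atlas_axioms Q.atlas_axioms sU x(1) tv])
    define d0 where "d0 = chart_at B q0"
    have d0: "d0 \<in> B" "q0 \<in> fst d0" unfolding d0_def by (rule Q.chart_at)+
    have nt: "norm (cis t) = 1" by simp
    have "\<alpha> (act q0 (cis t)) (push B B (\<lambda>r. act r (cis t)) q0 w) = \<alpha> q0 w"
      using connection tw nt unfolding circle_connection_def by blast
    moreover have pd: "push B B (\<lambda>r. act r (cis t)) q0 w e = dd (\<lambda>o'. snd e (flow s c o')) (p, t) (v, 0)"
      if e: "e \<in> B" "q \<in> fst e" for e
    proof -
      note s_push = push_chart[OF M.atlas_axioms Q.atlas_axioms sU x(1) c x(2) d0[unfolded q0_def] tv]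
      have R: "((\<lambda>w. snd e (act (chart_inv d0 w) (cis t))) has_derivative
          dd (\<lambda>w. snd e (act (chart_inv d0 w) (cis t))) (snd d0 q0)) (at ((snd d0 \<circ> s \<circ> chart_inv c) (snd c x)))"
        using dd_works[OF action_differentiable[OF nt d0 e(1)]] e(2) M.chart_inv_chart[OF c x(2)] by (simp add: q_act q0_def)
      have "push B B (\<lambda>r. act r (cis t)) q0 w e = dd (\<lambda>w. snd e (act (chart_inv d0 w) (cis t))) (snd d0 q0) (w d0)"
        using e by (simp add: push_def q_act d0_def o_def Let_def)
      also have "w d0 = dd (snd d0 \<circ> s \<circ> chart_inv c) (snd c x) v"
        using s_push(1) M.tvec_of_chart[OF c x(2)] by (simp add: w_def)
      also have "dd (\<lambda>w. snd e (act (chart_inv d0 w) (cis t))) (snd d0 q0) (dd (snd d0 \<circ> s \<circ> chart_inv c) (snd c x) v) =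
          dd (\<lambda>p'. snd e (flow s c (p', t))) p v"
      proof -
        have "((\<lambda>p'. snd e (act (chart_inv d0 ((snd d0 \<circ> s \<circ> chart_inv c) p')) (cis t))) has_derivative
          (\<lambda>h. dd (\<lambda>w. snd e (act (chart_inv d0 w) (cis t))) (snd d0 q0) (dd (snd d0 \<circ> s \<circ> chart_inv c) (snd c x) h))) (at (snd c x))"
          by (rule has_derivative_compose[OF dd_works[OF s_push(2)] R])
        then have "((\<lambda>p'. snd e (flow s c (p', t))) has_derivative
          (\<lambda>h. dd (\<lambda>w. snd e (act (chart_inv d0 w) (cis t))) (snd d0 q0) (dd (snd d0 \<circ> s \<circ> chart_inv c) (snd c x) h))) (at (snd c x))"
        proof (rule has_derivative_cong_open[rotated -1])
          show "open (snd c ` (fst c \<inter> U \<inter> s -` fst d0))"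
            by (rule smooth_map_chart_smooth(1)[OF M.atlas_axioms Q.atlas_axioms sU c d0(1)])
          show "snd c x \<in> snd c ` (fst c \<inter> U \<inter> s -` fst d0)" using x d0 by (auto simp: q0_def)
        qed (auto simp: flow_def M.chart_inv_chart[OF c] Q.chart_inv_chart[OF d0(1)])
        from dd_eqI[OF this] show ?thesis by (simp add: x(3))
      qed
      also have "dd (\<lambda>p'. snd e (flow s c (p', t))) p v = dd (\<lambda>o'. snd e (flow s c o')) (p, t) (v, 0)"
      proof -
        have "((\<lambda>p'. (p', t)) has_derivative (\<lambda>h. (h, 0))) (at p)"
          by (auto intro!: derivative_eq_intros)
        from has_derivative_compose[OF this der[OF e]] show ?thesis by (simp add: dd_eqI)
      qed
      finally show ?thesis .
    qed
    moreover have "\<alpha> q (push B B (\<lambda>r. act r (cis t)) q0 w) = form_at d (snd d q) (?D (v, 0))"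
    proof -
      have "push B B (\<lambda>r. act r (cis t)) q0 w = tvec_of B d q (?D (v, 0))"
      proof
        fix e
        show "push B B (\<lambda>r. act r (cis t)) q0 w e = tvec_of B d q (?D (v, 0)) e"
        proof (cases "e \<in> B \<and> q \<in> fst e")
          case True
          have dq: "q \<in> fst d" using d by (simp add: q_def)
          obtain W where W: "open W" "(p, t) \<in> W" "\<And>o'. o' \<in> W \<Longrightarrow> flow s c o' \<in> fst d"
            using flow_smooth[OF s c p d] by metis
          have "((snd e \<circ> chart_inv d) has_derivative dd (snd e \<circ> chart_inv d) (snd d q)) (at (snd d (flow s c (p, t))))"
            using Q.differentiable_transition[OF d(1) _ dq] True by (simp add: dd_works q_def)
          from has_derivative_compose[OF der[OF d(1) dq] this]
          have "((\<lambda>o'. snd e (flow s c o')) has_derivative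
              (\<lambda>w. dd (snd e \<circ> chart_inv d) (snd d q) (?D w))) (at (p, t))"
            by (rule has_derivative_cong_open[OF W(1,2), rotated]) (simp add: W(3) Q.chart_inv_chart[OF d(1)])
          then show ?thesis using True pd by (simp add: tvec_of_def dd_eqI)
        qed (auto simp: push_def tvec_of_def q_act)
      qed
      then show ?thesis using d by (simp add: form_at_def Q.chart_inv_chart q_def)
    qed
    ultimately show ?thesis by (simp add: pull_def w_def q0_def q_act)
  qed
  have "?D (v, r) = ?D (v, 0) + r *\<^sub>R ?D (0, 1)"
    using linear_add[OF lin(1), of "(v, 0)" "r *\<^sub>R (0, 1)"] linear_scale[OF lin(1), of r "(0, 1)"] by simp
  then show ?thesis
    using vert hor by (simp add: linear_add[OF lin(2)] linear_scale[OF lin(2)] q_def[symmetric] x_def[symmetric] scaleR_conv_of_real mult.commute)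
qed

definition conn_form :: "('m \<Rightarrow> 'q) \<Rightarrow> ('m, real^'n) chart \<Rightarrow> real^'n \<Rightarrow> real^'n \<Rightarrow> complex" where
  "conn_form s c p v = pull s (chart_inv c p) (tvec_of A c (chart_inv c p) v)"

lemma pull_conn_form:
  "c \<in> A \<Longrightarrow> x \<in> fst c \<Longrightarrow> tangent A x X \<Longrightarrow> pull s x X = conn_form s c (snd c x) (X c)"
  by (simp add: conn_form_def M.chart_inv_chart M.tvec_of_self)

lemma conn_form_chart:
  assumes s: "local_sec U s" and c: "c \<in> A" and d: "d \<in> B" and p: "p \<in> snd c ` (fst c \<inter> U \<inter> s -` fst d)"
  shows "conn_form s c p v = form_at d ((snd d \<circ> s \<circ> chart_inv c) p) (dd (snd d \<circ> s \<circ> chart_inv c) p v)"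
proof -
  define x where "x = chart_inv c p"
  have x: "x \<in> fst c" "x \<in> U" "s x \<in> fst d" "snd c x = p"
    using p by (auto simp: x_def M.chart_inv_chart[OF c])
  have sU: "open U" "smooth_map A B U s" using s unfolding local_sec_def by blast+
  have t: "tangent A x (tvec_of A c x v)" by (rule M.tangent_tvec_of[OF c x(1)])
  have "pull s x (tvec_of A c x v) = form_at d (snd d (s x)) (push A B s x (tvec_of A c x v) d)"
    unfolding pull_def by (rule form_at_eq[OF d x(3) tangent_push[OF M.atlas_axioms Q.atlas_axioms sU x(2) t]])
  also have "push A B s x (tvec_of A c x v) d = dd (snd d \<circ> s \<circ> chart_inv c) p v"
    using push_chart(1)[OF M.atlas_axioms Q.atlas_axioms sU x(2) c x(1) d x(3) t]
    by (simp add: M.tvec_of_chart[OF c x(1)] x(4))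
  finally show ?thesis by (simp add: conn_form_def x_def)
qed

section \<open>The pulled-back connection form, change of section, and curvature\<close>

context
  fixes U s c
  assumes s: "local_sec U s" and c: "c \<in> A"
begin

lemma sec_chart:
  assumes "p \<in> snd c ` (fst c \<inter> U)"
  obtains d where "d \<in> B" "p \<in> snd c ` (fst c \<inter> U \<inter> s -` fst d)" "open (snd c ` (fst c \<inter> U \<inter> s -` fst d))"
    "smooth_on (snd c ` (fst c \<inter> U \<inter> s -` fst d)) (snd d \<circ> s \<circ> chart_inv c)"
proof -
  define d where "d = chart_at B (s (chart_inv c p))"
  have d: "d \<in> B" "s (chart_inv c p) \<in> fst d" unfolding d_def by (rule Q.chart_at)+
  have "p \<in> snd c ` (fst c \<inter> U \<inter> s -` fst d)"
    using assms d M.chart_image_iff2[OF c] M.chart_image_iff[OF c] by auto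
  moreover have "open U" "smooth_map A B U s" using s unfolding local_sec_def by blast+
  ultimately show thesis
    using that[OF d(1)] smooth_map_chart_smooth[OF M.atlas_axioms Q.atlas_axioms _ _ c d(1)] by blast
qed

lemma linear_conn_form:
  assumes "p \<in> snd c ` (fst c \<inter> U)"
  shows "linear (conn_form s c p)"
proof -
  obtain d where d: "d \<in> B" "p \<in> snd c ` (fst c \<inter> U \<inter> s -` fst d)"
      "smooth_on (snd c ` (fst c \<inter> U \<inter> s -` fst d)) (snd d \<circ> s \<circ> chart_inv c)"
    using sec_chart[OF assms] by metis
  have "(snd d \<circ> s \<circ> chart_inv c) p \<in> snd d ` fst d"
    using d(2) by (auto simp: M.chart_inv_chart[OF c])
  then have "linear (\<lambda>v. form_at d ((snd d \<circ> s \<circ> chart_inv c) p) (dd (snd d \<circ> s \<circ> chart_inv c) p v))"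
    using linear_compose[OF linear_dd[OF smooth_on_differentiable[OF d(3,2)]] linear_form_at[OF d(1)]] by (simp add: o_def)
  moreover have "conn_form s c p = (\<lambda>v. form_at d ((snd d \<circ> s \<circ> chart_inv c) p) (dd (snd d \<circ> s \<circ> chart_inv c) p v))"
    by (rule ext) (rule conn_form_chart[OF s c d(1,2)])
  ultimately show ?thesis by simp
qed

lemma smooth_conn_form: "smooth_on (snd c ` (fst c \<inter> U)) (\<lambda>p. conn_form s c p v)"
proof (rule smooth_on_local)
  fix p assume "p \<in> snd c ` (fst c \<inter> U)"
  then obtain d where d: "d \<in> B" and W: "p \<in> snd c ` (fst c \<inter> U \<inter> s -` fst d)" "open (snd c ` (fst c \<inter> U \<inter> s -` fst d))"
      and S: "smooth_on (snd c ` (fst c \<inter> U \<inter> s -` fst d)) (snd d \<circ> s \<circ> chart_inv c)"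
    by (rule sec_chart)
  let ?W = "snd c ` (fst c \<inter> U \<inter> s -` fst d)" and ?S = "snd d \<circ> s \<circ> chart_inv c"
  have img: "?S ` ?W \<subseteq> snd d ` fst d" by (auto simp: M.chart_inv_chart[OF c])
  have sm: "smooth_on ?W (\<lambda>p. form_at d (?S p) w)" for w
    by (rule smooth_on_compose[OF W(2) Q.open_chart_image[OF d] smooth_form_at[OF d] S img])
  have lin: "linear (form_at d (?S p))" if "p \<in> ?W" for p
    by (rule linear_form_at[OF d]) (use img that in blast)
  have "smooth_on ?W (\<lambda>p. form_at d (?S p) (dd ?S p v))"
    by (rule smooth_on_field[OF W(2) lin sm smooth_on_dd[OF S]])
  then have "smooth_on ?W (\<lambda>p. conn_form s c p v)"
    by (rule smooth_on_cong[OF W(2), rotated]) (simp only: conn_form_chart[OF s c d])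
  then show "\<exists>W. open W \<and> p \<in> W \<and> smooth_on W (\<lambda>p. conn_form s c p v)" using W by blast
qed

lemma Re_conn_form: "p \<in> snd c ` (fst c \<inter> U) \<Longrightarrow> Re (conn_form s c p v) = 0"
proof -
  assume p: "p \<in> snd c ` (fst c \<inter> U)"
  then have x: "chart_inv c p \<in> fst c" "chart_inv c p \<in> U" by (auto simp: M.chart_inv_chart[OF c])
  have "open U" "smooth_map A B U s" using s unfolding local_sec_def by blast+
  from tangent_push[OF M.atlas_axioms Q.atlas_axioms this x(2) M.tangent_tvec_of[OF c x(1)]]
  show ?thesis using connection unfolding conn_form_def pull_def circle_connection_def by blast
qed

text \<open>Locally \<open>s'(y) = s(y) e\<^sup>i\<^sup>\<theta>\<close> for a real function \<open>\<theta>\<close>.\<close>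

lemma pull_change:
  assumes s': "local_sec U s'" and x: "x \<in> U" "x \<in> fst c" and X: "tangent A x X"
    and w: "\<And>y. y \<in> U \<Longrightarrow> norm (w y) = 1" "\<And>y. y \<in> U \<Longrightarrow> s' y = act (s y) (w y)"
    and w': "((w \<circ> chart_inv c) has_derivative w') (at (snd c x))"
  shows "pull s' x X = pull s x X + cnj (w x) * w' (X c)"
proof -
  define p where "p = snd c x"
  define V where "V = snd c ` (fst c \<inter> U)"
  have sU: "open U" "smooth_map A B U s'" using s' unfolding local_sec_def by blast+
  have pV: "p \<in> V" "open V" using x M.open_chart_Int[OF c sU(1)] by (auto simp: p_def V_def)
  have cp: "chart_inv c p = x" using x by (simp add: p_def M.chart_inv_chart[OF c])
  define t where "t = Arg (w x)"
  have wx: "cis t = w x" "w x * cnj (w x) = 1"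
    using w(1)[OF x(1)] by (simp_all add: t_def cis_Arg_unique complex_norm_square[symmetric])
      (metis cis_Arg norm_zero sgn_eq zero_neq_one div_by_1 of_real_1)?
  \<comment> \<open>Multiplication by the conjugate of \<open>w x\<close> brings the argument to 1
    at x, away from the branch cut of \<open>Ln\<close>.\<close>
  define \<theta> where "\<theta> p' = t + Im (Ln ((w \<circ> chart_inv c) p' * cnj (w x)))" for p'
  have \<theta>: "cis (\<theta> p') = (w \<circ> chart_inv c) p'" if "p' \<in> V" for p'
  proof -
    let ?z = "(w \<circ> chart_inv c) p' * cnj (w x)"
    have "chart_inv c p' \<in> U" using that by (auto simp: V_def M.chart_inv_chart[OF c])
    then have nz: "norm ?z = 1" using w(1) x(1) by (simp add: norm_mult)
    then have "?z \<noteq> 0" by auto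
    then have "cis (Im (Ln ?z)) = ?z" using nz by (metis Arg_def cis_Arg div_by_1 of_real_1 sgn_eq Arg_eq_Im_Ln)
    then have "cis (\<theta> p') = w x * ?z" by (simp add: \<theta>_def cis_mult[symmetric] wx)
    also have "\<dots> = (w \<circ> chart_inv c) p'" using wx(2) by (simp add: mult_ac)
    finally show ?thesis .
  qed
  have \<theta>p: "\<theta> p = t" using wx(2) by (simp add: \<theta>_def cp)
  have "((\<lambda>p'. (w \<circ> chart_inv c) p' * cnj (w x)) has_derivative (\<lambda>v. w' v * cnj (w x))) (at p)"
    using w' by (intro has_derivative_mult_left) (simp add: p_def o_def)
  moreover have "(Ln has_derivative (*) 1) (at ((w \<circ> chart_inv c) p * cnj (w x)))"
    using has_field_derivative_Ln[of 1] wx(2) by (simp add: has_field_derivative_def cp)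
  ultimately have "((\<lambda>p'. Ln ((w \<circ> chart_inv c) p' * cnj (w x))) has_derivative (\<lambda>v. 1 * (w' v * cnj (w x)))) (at p)"
    by (rule has_derivative_compose)
  then have d\<theta>: "(\<theta> has_derivative (\<lambda>v. Im (w' v * cnj (w x)))) (at p)"
    unfolding \<theta>_def by (auto intro!: derivative_eq_intros)
  define \<theta>' where "\<theta>' v = Im (w' v * cnj (w x))" for v
  have w'\<theta>: "cnj (w x) * w' v = \<i> * complex_of_real (\<theta>' v)" for v
  proof -
    have "((\<lambda>p'. cis (\<theta> p')) has_derivative (\<lambda>v. \<theta>' v *\<^sub>R (\<i> * cis (\<theta> p)))) (at p)"
      using d\<theta> unfolding \<theta>'_def by (rule has_derivative_cis)
    then have "((w \<circ> chart_inv c) has_derivative (\<lambda>v. \<theta>' v *\<^sub>R (\<i> * cis (\<theta> p)))) (at p)"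
      by (rule has_derivative_cong_open[OF pV(2,1), rotated]) (rule \<theta>)
    then have "w' = (\<lambda>v. \<theta>' v *\<^sub>R (\<i> * w x))"
      using has_derivative_unique w' unfolding p_def[symmetric] by (metis \<theta>p wx(1))
    then show ?thesis using wx(2) by (simp add: scaleR_conv_of_real mult_ac)
  qed
  define d where "d = chart_at B (s' x)"
  have d: "d \<in> B" "s' x \<in> fst d" unfolding d_def by (rule Q.chart_at)+
  have s'_flow: "s' (chart_inv c p') = flow s c (p', \<theta> p')" if "p' \<in> V" for p'
    using w(2)[of "chart_inv c p'"] \<theta>[OF that] that by (auto simp: flow_def V_def M.chart_inv_chart[OF c])
  have df: "flow s c (p, t) \<in> fst d" "flow s c (p, t) = s' x" using s'_flow[OF pV(1)] d(2) by (simp_all add: cp \<theta>p)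
  obtain W where W: "(p, t) \<in> W" "smooth_on W (\<lambda>o'. snd d (flow s c o'))"
    using flow_smooth[OF s c pV(1)[unfolded V_def] d(1) df(1)] by metis
  have "((\<lambda>p'. (p', \<theta> p')) has_derivative (\<lambda>v. (v, \<theta>' v))) (at p)"
    unfolding \<theta>'_def by (intro has_derivative_Pair has_derivative_ident d\<theta>)
  from has_derivative_compose[OF this, of "\<lambda>o'. snd d (flow s c o')"] smooth_on_has_derivative[OF W(2,1)]
  have "((\<lambda>p'. snd d (flow s c (p', \<theta> p'))) has_derivative (\<lambda>v. dd (\<lambda>o'. snd d (flow s c o')) (p, t) (v, \<theta>' v))) (at p)"
    by (simp add: \<theta>p)
  then have "((snd d \<circ> s' \<circ> chart_inv c) has_derivative (\<lambda>v. dd (\<lambda>o'. snd d (flow s c o')) (p, t) (v, \<theta>' v))) (at p)"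
    by (rule has_derivative_cong_open[OF pV(2,1), rotated]) (simp add: s'_flow)
  then have "push A B s' x X d = dd (\<lambda>o'. snd d (flow s c o')) (p, t) (X c, \<theta>' (X c))"
    using push_chart(1)[OF M.atlas_axioms Q.atlas_axioms sU x(1) c x(2) d X] by (simp add: dd_eqI p_def)
  then have "pull s' x X = form_at d (snd d (flow s c (p, t))) (dd (\<lambda>o'. snd d (flow s c o')) (p, t) (X c, \<theta>' (X c)))"
    unfolding pull_def
    using form_at_eq[OF d tangent_push[OF M.atlas_axioms Q.atlas_axioms sU x(1) X]] by (simp add: df(2))
  also have "\<dots> = conn_form s c p (X c) + \<i> * complex_of_real (\<theta>' (X c))"
    unfolding flow_form[OF s c pV(1)[unfolded V_def] d(1) df(1)] conn_form_def ..
  finally show ?thesis using pull_conn_form[OF c x(2) X, of s] by (simp add: w'\<theta> p_def)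
qed

lemma fibre_flow:
  assumes "\<pi> q = x" "x \<in> U" "x \<in> fst c"
  shows "\<exists>t. q = flow s c (snd c x, t)"
proof -
  obtain U0 s0 \<tau> where x0: "x \<in> U0" and t: "triv U0 s0 \<tau>" by (rule trivE)
  have \<tau>: "norm (\<tau> r) = 1" "act (s0 x) (\<tau> r) = r" if "\<pi> r = x" for r
    using t that x0 unfolding triv_def by (metis vimageI)+
  have sx: "\<pi> (s x) = x" using s assms(2) unfolding local_sec_def by blast
  define z where "z = cnj (\<tau> (s x)) * \<tau> q"
  have z: "norm z = 1" "\<tau> (s x) * z = \<tau> q"
    using \<tau>(1)[OF sx] \<tau>(1)[OF assms(1)] by (simp_all add: z_def norm_mult mult.assoc[symmetric] complex_norm_square[symmetric])
  have "act (s x) z = act (act (s0 x) (\<tau> (s x))) z" by (simp add: \<tau>(2)[OF sx])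
  also have "\<dots> = q" using act_act[OF \<tau>(1)[OF sx] z(1)] z(2) \<tau>(2)[OF assms(1)] by simp
  finally have "q = act (s x) z" by simp
  moreover have "z = cis (Arg z)" using z(1) by (metis cis_Arg div_by_1 norm_zero of_real_1 sgn_eq zero_neq_one)
  ultimately show ?thesis by (intro exI[of _ "Arg z"]) (simp add: flow_def M.chart_inv_chart[OF c assms(3)])
qed

lemma proj_flow: "p \<in> snd c ` (fst c \<inter> U) \<Longrightarrow> \<pi> (flow s c (p, t)) = chart_inv c p"
  using s proj_act[of "cis t" "s (chart_inv c p)"] by (auto simp: flow_def local_sec_def M.chart_inv_chart[OF c])

definition curvature_at :: "'m \<Rightarrow> ('m, real^'n) tvec \<Rightarrow> ('m, real^'n) tvec \<Rightarrow> complex" where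
  "curvature_at x X Y = dd (\<lambda>p. conn_form s c p (Y c)) (snd c x) (X c) - dd (\<lambda>p. conn_form s c p (X c)) (snd c x) (Y c)"

context
  fixes x d t
  assumes x: "x \<in> U" "x \<in> fst c" and d: "d \<in> B" "flow s c (snd c x, t) \<in> fst d"
begin

text \<open>Differentiates the fact that projecting a flow point returns its base
  coordinate.\<close>

lemma flow_section_inverse:
  "dd (snd c \<circ> \<pi> \<circ> chart_inv d) (snd d (flow s c (snd c x, t))) (dd (\<lambda>o'. snd d (flow s c o')) (snd c x, t) (v, r)) = v"
proof -
  let ?p = "snd c x"
  have p: "?p \<in> snd c ` (fst c \<inter> U)" using x by blast
  obtain W where W: "open W" "(?p, t) \<in> W" "smooth_on W (\<lambda>o'. snd d (flow s c o'))"
      "\<And>o'. o' \<in> W \<Longrightarrow> flow s c o' \<in> fst d \<and> fst o' \<in> snd c ` (fst c \<inter> U)"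
    using flow_smooth[OF s c p d] by metis
  have "\<pi> (flow s c (?p, t)) \<in> fst c" using proj_flow[OF p] x by (simp add: M.chart_inv_chart[OF c])
  then have "snd d (flow s c (?p, t)) \<in> snd d ` (fst d \<inter> UNIV \<inter> \<pi> -` fst c)" using d by auto
  then have "(snd c \<circ> \<pi> \<circ> chart_inv d) differentiable (at (snd d (flow s c (?p, t))))"
    using smooth_on_differentiable[OF smooth_map_chart_smooth(2)[OF Q.atlas_axioms M.atlas_axioms open_UNIV proj_smooth d(1) c]] by blast
  from has_derivative_compose[OF smooth_on_has_derivative[OF W(3,2)] dd_works[OF this]]
  have "((\<lambda>o'. fst o') has_derivative (\<lambda>h. dd (snd c \<circ> \<pi> \<circ> chart_inv d) (snd d (flow s c (?p, t))) (dd (\<lambda>o'. snd d (flow s c o')) (?p, t) h))) (at (?p, t))"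
  proof (rule has_derivative_cong_open[OF W(1,2), rotated])
    fix o' assume o': "o' \<in> W"
    then show "(snd c \<circ> \<pi> \<circ> chart_inv d) (snd d (flow s c o')) = fst o'"
      using W(4)[OF o'] proj_flow[of "fst o'" "snd o'"] M.chart_chart_inv[OF c, of "fst o'"]
      by (auto simp: Q.chart_inv_chart[OF d(1)])
  qed
  then have "(\<lambda>h. dd (snd c \<circ> \<pi> \<circ> chart_inv d) (snd d (flow s c (?p, t))) (dd (\<lambda>o'. snd d (flow s c o')) (?p, t) h)) = fst"
    using has_derivative_unique[OF _ has_derivative_fst[OF has_derivative_ident]] by blast
  from fun_cong[OF this, of "(v, r)"] show ?thesis by simp
qed

lemma linear_flow_deriv: "linear (dd (\<lambda>o'. snd d (flow s c o')) (snd c x, t))"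
proof -
  have p: "snd c x \<in> snd c ` (fst c \<inter> U)" using x by blast
  show ?thesis using flow_smooth[OF s c p d] linear_dd smooth_on_differentiable by metis
qed

text \<open>Injectivity suffices by equality of dimensions: the projection detects v, and then the
  connection form, equal to i on the angle direction, detects r.\<close>

lemma surj_flow_deriv: "surj (dd (\<lambda>o'. snd d (flow s c o')) (snd c x, t))"
proof (rule linear_injective_imp_surjective[OF linear_flow_deriv])
  let ?D = "dd (\<lambda>o'. snd d (flow s c o')) (snd c x, t)"
  have p: "snd c x \<in> snd c ` (fst c \<inter> U)" using x by blast
  have "h = 0" if "?D h = 0" for h
  proof -
    obtain v r where h: "h = (v, r)" by (cases h)
    have "linear (dd (snd c \<circ> \<pi> \<circ> chart_inv d) (snd d (flow s c (snd c x, t))))"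
    proof (rule linear_dd)
      have "\<pi> (flow s c (snd c x, t)) \<in> fst c" using proj_flow[OF p] x by (simp add: M.chart_inv_chart[OF c])
      then have "snd d (flow s c (snd c x, t)) \<in> snd d ` (fst d \<inter> UNIV \<inter> \<pi> -` fst c)" using d by auto
      then show "(snd c \<circ> \<pi> \<circ> chart_inv d) differentiable (at (snd d (flow s c (snd c x, t))))"
        using smooth_on_differentiable[OF smooth_map_chart_smooth(2)[OF Q.atlas_axioms M.atlas_axioms open_UNIV proj_smooth d(1) c]] by blast
    qed
    from linear_0[OF this] have v: "v = 0" using flow_section_inverse[of v r] that by (simp add: h)
    have lf: "linear (form_at d (snd d (flow s c (snd c x, t))))" using d by (intro linear_form_at) auto
    have "conn_form s c (snd c x) v + \<i> * complex_of_real r = 0"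
      using flow_form[OF s c p d, of v r] linear_0[OF lf] that by (simp add: h conn_form_def)
    then have "r = 0" using linear_0[OF linear_conn_form[OF p]] v by simp
    then show ?thesis using v h by (simp add: zero_prod_def)
  qed
  then show "inj ?D" by (simp add: linear_injective_0[OF linear_flow_deriv])
qed simp

text \<open>By \<open>flow_form\<close> the pullback differs from the form on the base by i dt,
  which is closed, so the angular components r1 and r2 leave no trace.\<close>

lemma ext_deriv_flow:
  "dd (\<lambda>z. form_at d z (dd (\<lambda>o'. snd d (flow s c o')) (snd c x, t) (w, r2))) (snd d (flow s c (snd c x, t))) (dd (\<lambda>o'. snd d (flow s c o')) (snd c x, t) (v, r1))
   - dd (\<lambda>z. form_at d z (dd (\<lambda>o'. snd d (flow s c o')) (snd c x, t) (v, r1))) (snd d (flow s c (snd c x, t))) (dd (\<lambda>o'. snd d (flow s c o')) (snd c x, t) (w, r2))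
   = dd (\<lambda>p. conn_form s c p w) (snd c x) v - dd (\<lambda>p. conn_form s c p v) (snd c x) w"
proof -
  let ?p = "snd c x"
  define F where "F = (\<lambda>o'. snd d (flow s c o'))"
  have p: "?p \<in> snd c ` (fst c \<inter> U)" using x by blast
  obtain W where W: "open W" "(?p, t) \<in> W" "smooth_on W F"
      "\<And>o'. o' \<in> W \<Longrightarrow> flow s c o' \<in> fst d \<and> fst o' \<in> snd c ` (fst c \<inter> U)"
    using flow_smooth[OF s c p d] unfolding F_def by metis
  have FW: "F ` W \<subseteq> snd d ` fst d" using W(4) by (auto simp: F_def)
  have val: "form_at d (F o') (dd F o' (v, r)) = conn_form s c (fst o') v + \<i> * complex_of_real r" if "o' \<in> W" for o' v r
  proof -
    obtain p' t' where o': "o' = (p', t')" by (cases o')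
    show ?thesis using flow_form[OF s c _ d(1), of p' t' v r] W(4)[OF that] by (simp add: F_def o' conn_form_def)
  qed
  have der: "dd (\<lambda>o'. form_at d (F o') (dd F o' (v, r))) (?p, t) (v', r') = dd (\<lambda>p. conn_form s c p v) ?p v'" for v r v' r'
  proof -
    have "((\<lambda>p. conn_form s c p v) has_derivative dd (\<lambda>p. conn_form s c p v) ?p) (at (fst (?p, t)))"
      using smooth_on_has_derivative[OF smooth_conn_form p] by simp
    from has_derivative_add_const[OF has_derivative_compose[OF has_derivative_fst[OF has_derivative_ident] this], of "\<i> * complex_of_real r"]
    have "((\<lambda>o'. form_at d (F o') (dd F o' (v, r))) has_derivative (\<lambda>h. dd (\<lambda>p. conn_form s c p v) ?p (fst h))) (at (?p, t))"
      by (rule has_derivative_cong_open[OF W(1,2), rotated]) (simp only: val)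
    from dd_eqI[OF this] show ?thesis by simp
  qed
  show ?thesis
    using pullback_ext_deriv[OF W(1,3,2) Q.open_chart_image[OF d(1)] FW linear_form_at[OF d(1)] smooth_form_at[OF d(1)], of "(w, r2)" "(v, r1)"]
    unfolding der by (simp add: F_def)
qed

end

text \<open>These three facts make the definite description in \<open>curv\<close> proper: the value
  is imaginary, it is the same for all lifts of X and Y, and lifts exist.\<close>

lemma curvature_form:
  assumes x: "x \<in> U" "x \<in> fst c" and X: "tangent A x X" and Y: "tangent A x Y"
  shows "Re (curvature_at x X Y) = 0"
    and "\<And>q v w. \<pi> q = x \<Longrightarrow> tangent B q v \<Longrightarrow> tangent B q w \<Longrightarrow> push B A \<pi> q v = X \<Longrightarrow> push B A \<pi> q w = Y \<Longrightarrow>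
      ext_deriv B \<alpha> q v w = curvature_at x X Y"
    and "\<exists>q v w. \<pi> q = x \<and> tangent B q v \<and> tangent B q w \<and> push B A \<pi> q v = X \<and> push B A \<pi> q w = Y"
proof -
  let ?p = "snd c x"
  have p: "?p \<in> snd c ` (fst c \<inter> U)" using x by blast
  have oV: "open (snd c ` (fst c \<inter> U))" using s M.open_chart_Int[OF c] unfolding local_sec_def by blast
  have "Re (dd (\<lambda>p. conn_form s c p v) ?p w) = 0" for v w
  proof -
    have "((\<lambda>p. Re (conn_form s c p v)) has_derivative (\<lambda>h. Re (dd (\<lambda>p. conn_form s c p v) ?p h))) (at ?p)"
      by (intro has_derivative_Re smooth_on_has_derivative[OF smooth_conn_form p])
    moreover have "((\<lambda>p. Re (conn_form s c p v)) has_derivative (\<lambda>h. 0)) (at ?p)"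
      by (rule has_derivative_cong_open[OF oV p _ has_derivative_const]) (simp add: Re_conn_form)
    ultimately show ?thesis using has_derivative_unique by metis
  qed
  then show "Re (curvature_at x X Y) = 0" by (simp add: curvature_at_def)
  have push_c: "push B A \<pi> q v c = dd (snd c \<circ> \<pi> \<circ> chart_inv d) (snd d q) (v d)"
    if "\<pi> q = x" "tangent B q v" "d \<in> B" "q \<in> fst d" for q v d
    using push_chart(1)[OF Q.atlas_axioms M.atlas_axioms open_UNIV proj_smooth UNIV_I that(3,4) c _ that(2)] x that(1) by simp
  show "ext_deriv B \<alpha> q v w = curvature_at x X Y"
    if q: "\<pi> q = x" and v: "tangent B q v" "push B A \<pi> q v = X" and w: "tangent B q w" "push B A \<pi> q w = Y" for q v w
  proof -
    obtain t where t: "q = flow s c (?p, t)" using fibre_flow[OF q x] by blast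
    define d where "d = chart_at B q"
    have d: "d \<in> B" "flow s c (?p, t) \<in> fst d" unfolding d_def t by (rule Q.chart_at)+
    obtain h1 where h1: "v d = dd (\<lambda>o'. snd d (flow s c o')) (?p, t) h1" using surj_flow_deriv[OF x d] by (metis surjD)
    obtain h2 where h2: "w d = dd (\<lambda>o'. snd d (flow s c o')) (?p, t) h2" using surj_flow_deriv[OF x d] by (metis surjD)
    have "fst h1 = X c" "fst h2 = Y c"
      using push_c[OF q v(1) d(1)] push_c[OF q w(1) d(1)] d(2) v(2) w(2)
        flow_section_inverse[OF x d, of "fst h1" "snd h1"] flow_section_inverse[OF x d, of "fst h2" "snd h2"]
      by (simp_all add: t[symmetric] h1 h2)
    then have vw: "v d = dd (\<lambda>o'. snd d (flow s c o')) (?p, t) (X c, snd h1)" "w d = dd (\<lambda>o'. snd d (flow s c o')) (?p, t) (Y c, snd h2)"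
      using h1 h2 by (metis prod.collapse)+
    have "ext_deriv B \<alpha> q v w = dd (\<lambda>z. form_at d z (w d)) (snd d q) (v d) - dd (\<lambda>z. form_at d z (v d)) (snd d q) (w d)"
      by (simp add: ext_deriv_def Let_def form_at_def d_def)
    then show ?thesis
      using ext_deriv_flow[OF x d, where v = "X c" and w = "Y c" and ?r1.0 = "snd h1" and ?r2.0 = "snd h2"]
      by (simp only: vw curvature_at_def t)
  qed
  \<comment> \<open>Angle 0 is the point of the section itself; the lifts of tangent vectors are
    taken tangent to the section.\<close>
  define d where "d = chart_at B (flow s c (?p, 0))"
  define q where "q = flow s c (?p, 0)"
  have d: "d \<in> B" "flow s c (?p, 0) \<in> fst d" unfolding d_def by (rule Q.chart_at)+
  have q: "\<pi> q = x" using proj_flow[OF p] x by (simp add: q_def M.chart_inv_chart[OF c])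
  have lift: "tangent B q (tvec_of B d q (dd (\<lambda>o'. snd d (flow s c o')) (?p, 0) (Z c, 0))) \<and>
      push B A \<pi> q (tvec_of B d q (dd (\<lambda>o'. snd d (flow s c o')) (?p, 0) (Z c, 0))) = Z" if Z: "tangent A x Z" for Z
  proof
    show t: "tangent B q (tvec_of B d q (dd (\<lambda>o'. snd d (flow s c o')) (?p, 0) (Z c, 0)))"
      using d by (intro Q.tangent_tvec_of) (auto simp: q_def)
    have tp: "tangent A x (push B A \<pi> q (tvec_of B d q (dd (\<lambda>o'. snd d (flow s c o')) (?p, 0) (Z c, 0))))"
      using tangent_push[OF Q.atlas_axioms M.atlas_axioms open_UNIV proj_smooth UNIV_I t] q by simp
    show "push B A \<pi> q (tvec_of B d q (dd (\<lambda>o'. snd d (flow s c o')) (?p, 0) (Z c, 0))) = Z"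
      by (rule M.tangent_eqI[OF c x(2) tp Z])
        (use d push_c[OF q t d(1)] flow_section_inverse[OF x d] in \<open>simp add: q_def Q.tvec_of_chart\<close>)
  qed
  show "\<exists>q v w. \<pi> q = x \<and> tangent B q v \<and> tangent B q w \<and> push B A \<pi> q v = X \<and> push B A \<pi> q w = Y"
    using lift[OF X] lift[OF Y] q by blast
qed

end

end

section \<open>The group \<open>Spin\<^sup>c\<close>\<close>

lemma inner_hermitian: "\<sigma> \<bullet> \<tau> = Re (hermitian \<sigma> \<tau>)"
  by (simp add: inner_vec_def hermitian_def inner_complex_def)

lemma mat_vector_scaleR: "(A :: complex^'s^'s::finite) *v (r *\<^sub>R x) = r *\<^sub>R (A *v x)"
  by (simp add: vec_eq_iff matrix_vector_mult_def scaleR_sum_right)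

lemma mat_vector_vscale: "(A :: complex^'s^'s::finite) *v (z *s x) = z *s (A *v x)"
  by (simp add: vec_eq_iff matrix_vector_mult_def sum_distrib_left mult_ac)

lemma scaleR_mat_vector: "(r *\<^sub>R (A :: complex^'s^'s::finite)) *v x = r *\<^sub>R (A *v x)"
  by (simp add: vec_eq_iff matrix_vector_mult_def scaleR_sum_right)

lemma sum_mat_vector: "(\<Sum>i\<in>I. A i :: complex^'s^'s::finite) *v x = (\<Sum>i\<in>I. A i *v x)"
  by (induction I rule: infinite_finite_induct) (simp_all add: matrix_vector_mult_add_rdistrib)

lemma mat_vector: "(mat z :: complex^'s^'s::finite) *v x = z *s x"
  by (simp add: vec_eq_iff matrix_vector_mult_def mat_def mult_delta_left)

lemma linear_mat_vector: "linear ((*v) (A :: complex^'s^'s::finite))"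
  by (intro linearI) (simp_all add: matrix_vector_right_distrib mat_vector_scaleR)

lemma matrix_mult_scaleR:
  "(r *\<^sub>R (A :: complex^'s^'s::finite)) ** B = r *\<^sub>R (A ** B)" "A ** (r *\<^sub>R B) = r *\<^sub>R (A ** B)"
  by (simp_all add: vec_eq_iff matrix_matrix_mult_def scaleR_sum_right)

lemma matrix_mult_add:
  "((A :: complex^'s^'s::finite) + C) ** B = A ** B + C ** B" "A ** (B + C) = A ** B + A ** C"
  by (simp_all add: vec_eq_iff matrix_matrix_mult_def sum.distrib algebra_simps)

lemma matrix_mult_minus:
  "(- (A :: complex^'s^'s::finite)) ** B = - (A ** B)" "A ** (- B) = - (A ** B)"
  by (simp_all add: vec_eq_iff matrix_matrix_mult_def sum_negf)

lemma trace_mat: "trace (mat z :: complex^'s^'s::finite) = z * of_nat CARD('s)"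
  by (simp add: trace_def mat_def mult.commute)

lemma matrix_eqI: "(\<And>x. A *v x = B *v x) \<Longrightarrow> (A :: complex^'s^'s::finite) = B"
  by (simp add: matrix_eq)

lemma neg_mat_vector: "(- (A :: complex^'s^'s::finite)) *v x = - (A *v x)"
  by (simp add: vec_eq_iff matrix_vector_mult_def sum_negf)

lemma mat_mult_commute: "(mat z :: complex^'s^'s::finite) ** A = (A :: complex^'s^'s) ** mat z"
  by (rule matrix_eqI) (simp add: matrix_vector_mul_assoc[symmetric] mat_vector mat_vector_vscale)

lemma mat_mult_mat: "(mat z :: complex^'s^'s::finite) ** mat w = mat (z * w)"
  by (rule matrix_eqI) (simp add: matrix_vector_mul_assoc[symmetric] mat_vector vec_eq_iff)

lemma trace_mat_mult: "trace ((mat z :: complex^'s^'s::finite) ** A) = z * trace A"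
  by (simp add: trace_def matrix_matrix_mult_def mat_def mult_delta_left sum_distrib_left)

lemma trace_scaleR: "trace (r *\<^sub>R (A :: complex^'s^'s::finite)) = r *\<^sub>R trace A"
  by (simp add: trace_def scaleR_sum_right)

lemma trace_minus: "trace (- (A :: complex^'s^'s::finite)) = - trace A"
  by (simp add: trace_def sum_negf)

lemma trace_one: "trace (mat 1 :: complex^'s^'s::finite) = of_nat CARD('s)"
  by (simp add: trace_def mat_def)

definition adj :: "complex^'s^'s::finite \<Rightarrow> complex^'s^'s" where
  "adj A = (\<chi> i j. cnj (A $ j $ i))"

lemma hermitian_adj: "hermitian (A *v x) y = hermitian x (adj A *v y)"
proof -
  have "hermitian (A *v x) y = (\<Sum>k\<in>UNIV. \<Sum>j\<in>UNIV. A $ k $ j * x $ j * cnj (y $ k))"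
    by (simp add: hermitian_def matrix_vector_mult_def sum_distrib_right)
  also have "\<dots> = (\<Sum>j\<in>UNIV. \<Sum>k\<in>UNIV. A $ k $ j * x $ j * cnj (y $ k))" by (rule sum.swap)
  also have "\<dots> = hermitian x (adj A *v y)"
    by (simp add: hermitian_def matrix_vector_mult_def adj_def sum_distrib_left mult_ac)
  finally show ?thesis .
qed

lemma linear_adj: "linear adj"
  by (intro linearI) (simp_all add: adj_def vec_eq_iff)

lemma complex_eq_of_real: "Im t = 0 \<Longrightarrow> t = complex_of_real (Re t)"
  by (simp add: complex_eq_iff)

lemma hermitian_inner_eqI:
  assumes "\<And>x. (x :: complex^'s::finite) \<bullet> y = x \<bullet> z"
  shows "y = z"
  using assms vector_eq_ldot by blast

locale clifford_matrices =
  fixes \<gamma> :: "'n::finite \<Rightarrow> complex^'s^'s::finite"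
  assumes module: "clifford_module \<gamma>"
begin

lemma card_s: "CARD('s) = 2 ^ (CARD('n) div 2)"
  and gam_mult: "\<gamma> i ** \<gamma> j + \<gamma> j ** \<gamma> i = mat (if i = j then -2 else 0)"
  and gam_herm: "hermitian (\<gamma> i *v \<sigma>) \<tau> = - hermitian \<sigma> (\<gamma> i *v \<tau>)"
  using module unfolding clifford_module_def by auto

sublocale clifford_ops "\<lambda>i x. \<gamma> i *v x" "\<lambda>x. \<i> *s x"
proof (rule clifford_ops.intro)
  show "linear ((*v) (\<gamma> i))" for i by (rule linear_mat_vector)
  show "linear (\<lambda>x::complex^'s. \<i> *s x)" by (intro linearI) (simp_all add: vec_eq_iff algebra_simps)
  show "\<gamma> i *v (\<gamma> j *v x) + \<gamma> j *v (\<gamma> i *v x) = (if i = j then - 2 else 0) *\<^sub>R x" for i j x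
  proof -
    have "\<gamma> i *v (\<gamma> j *v x) + \<gamma> j *v (\<gamma> i *v x) = (\<gamma> i ** \<gamma> j + \<gamma> j ** \<gamma> i) *v x"
      by (simp add: matrix_vector_mult_add_rdistrib matrix_vector_mul_assoc)
    then show ?thesis unfolding gam_mult mat_vector by (auto simp: vec_eq_iff scaleR_conv_of_real)
  qed
  show "(\<gamma> i *v x) \<bullet> y = - (x \<bullet> (\<gamma> i *v y))" for i x y by (simp add: inner_hermitian gam_herm)
  show "\<i> *s (\<i> *s x) = - x" for x :: "complex^'s" by (simp add: vec_eq_iff)
  show "(\<i> *s x) \<bullet> y = - (x \<bullet> (\<i> *s y))" for x y :: "complex^'s"
    by (simp add: inner_vec_def inner_complex_def sum_negf[symmetric])
  show "\<i> *s (\<gamma> i *v x) = \<gamma> i *v (\<i> *s x)" for i x by (simp add: mat_vector_vscale)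
qed

lemma dim_spinors: "DIM(complex^'s) = 2 * 2 ^ (CARD('n) div 2)"
  by (simp add: card_s)

lemma clifford_vec: "clifford \<gamma> v *v x = cl v x"
  by (simp add: clifford_def cl_def sum_mat_vector scaleR_mat_vector)

lemma clifford_mult: "clifford \<gamma> v ** clifford \<gamma> w = - (clifford \<gamma> w ** clifford \<gamma> v) + (-2 * (v \<bullet> w)) *\<^sub>R mat 1"
proof (rule matrix_eqI)
  fix x
  show "(clifford \<gamma> v ** clifford \<gamma> w) *v x = (- (clifford \<gamma> w ** clifford \<gamma> v) + (-2 * (v \<bullet> w)) *\<^sub>R mat 1) *v x"
  proof -
    have "(- (clifford \<gamma> w ** clifford \<gamma> v) + (-2 * (v \<bullet> w)) *\<^sub>R mat 1) *v x = - cl w (cl v x) + (-2 * (v \<bullet> w)) *\<^sub>R x"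
      by (simp add: matrix_vector_mult_add_rdistrib scaleR_mat_vector neg_mat_vector
          matrix_vector_mult_diff_rdistrib matrix_vector_mul_assoc[symmetric] clifford_vec)
    also have "\<dots> = cl v (cl w x)" unfolding cl_rel[of v w x, symmetric] by simp
    finally show ?thesis by (simp add: matrix_vector_mul_assoc[symmetric] clifford_vec)
  qed
qed

lemma clifford_sq: "clifford \<gamma> v ** clifford \<gamma> v = - ((v \<bullet> v) *\<^sub>R mat 1)"
  by (rule matrix_eqI)
    (simp add: matrix_vector_mul_assoc[symmetric] clifford_vec cl_sq scaleR_mat_vector flip: scaleR_minus_left)

lemma clifford_linear: "clifford \<gamma> (v + w) = clifford \<gamma> v + clifford \<gamma> w" "clifford \<gamma> (r *\<^sub>R v) = r *\<^sub>R clifford \<gamma> v"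
  by (simp_all add: clifford_def scaleR_add_left sum.distrib scaleR_sum_right)

lemma clifford_inj: "clifford \<gamma> v = clifford \<gamma> w \<Longrightarrow> v = w"
proof -
  assume "clifford \<gamma> v = clifford \<gamma> w"
  then have "clifford \<gamma> (v - w) = 0"
    using clifford_linear(1)[of "v - w" w] by simp
  then have "cl (v - w) x = 0" for x by (simp add: clifford_vec[symmetric])
  then have "((v - w) \<bullet> (v - w)) * (x \<bullet> x) = 0" for x :: "complex^'s" by (simp add: cl_inner[symmetric])
  from this[of "axis undefined 1"] show "v = w" by (simp add: inner_axis_axis)
qed

definition prodv :: "(real^'n) list \<Rightarrow> complex^'s^'s" where
  "prodv vs = foldr (\<lambda>v M. clifford \<gamma> v ** M) vs (mat 1)"

lemma prodv_simps: "prodv [] = mat 1" "prodv (v # vs) = clifford \<gamma> v ** prodv vs"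
  by (simp_all add: prodv_def)

lemma prodv_append: "prodv (vs @ ws) = prodv vs ** prodv ws"
  by (induction vs) (simp_all add: prodv_simps matrix_mul_assoc)

lemma spinc_product_prodv: "spinc_product \<gamma> z vs = mat z ** prodv vs"
  by (simp add: spinc_product_def prodv_def)

text \<open>Cancelling from the middle, each unit vector contributes -1, and there are evenly
  many.\<close>

lemma prodv_rev: "\<forall>v\<in>set vs. norm v = 1 \<Longrightarrow> even (length vs) \<Longrightarrow> prodv vs ** prodv (rev vs) = mat 1"
proof -
  have "prodv vs ** prodv (rev vs) = (-1) ^ length vs *\<^sub>R mat 1" if "\<forall>v\<in>set vs. norm v = 1" for vs
    using that
  proof (induction vs)
    case (Cons v vs)
    have "prodv (v # vs) ** prodv (rev (v # vs)) = clifford \<gamma> v ** (prodv vs ** prodv (rev vs)) ** clifford \<gamma> v"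
      by (simp add: prodv_simps prodv_append matrix_mul_assoc)
    also have "\<dots> = (-1) ^ length vs *\<^sub>R (clifford \<gamma> v ** clifford \<gamma> v)"
      using Cons by (simp add: matrix_mult_scaleR)
    finally show ?case using Cons.prems by (simp add: clifford_sq dot_square_norm)
  qed (simp add: prodv_simps)
  then show "\<forall>v\<in>set vs. norm v = 1 \<Longrightarrow> even (length vs) \<Longrightarrow> prodv vs ** prodv (rev vs) = mat 1" by simp
qed

text \<open>Moving the first vector of an even product to the end changes the sign of the product and
  produces shorter even products; hence traces of even products are real.\<close>

lemma clifford_prodv_commute:
  "clifford \<gamma> v ** prodv vs - (-1) ^ length vs *\<^sub>R (prodv vs ** clifford \<gamma> v)
    \<in> span {prodv ws | ws. Suc (length ws) = length vs}"
proof (induction vs)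
  case Nil
  then show ?case by (simp add: prodv_simps span_zero)
next
  case (Cons w vs)
  define r where "r = clifford \<gamma> v ** prodv vs - (-1) ^ length vs *\<^sub>R (prodv vs ** clifford \<gamma> v)"
  have eq: "clifford \<gamma> v ** prodv (w # vs) - (-1) ^ length (w # vs) *\<^sub>R (prodv (w # vs) ** clifford \<gamma> v) =
      - (clifford \<gamma> w ** r) + (-2 * (v \<bullet> w)) *\<^sub>R prodv vs"
  proof -
    have "clifford \<gamma> v ** prodv (w # vs) = (clifford \<gamma> v ** clifford \<gamma> w) ** prodv vs"
      by (simp add: prodv_simps matrix_mul_assoc)
    also have "\<dots> = - (clifford \<gamma> w ** (clifford \<gamma> v ** prodv vs)) + (-2 * (v \<bullet> w)) *\<^sub>R prodv vs"
      unfolding clifford_mult[of v w] by (simp only: matrix_mult_add matrix_mult_minus matrix_mult_scaleR matrix_mul_assoc matrix_mul_lid)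
    also have "clifford \<gamma> v ** prodv vs = r + (-1) ^ length vs *\<^sub>R (prodv vs ** clifford \<gamma> v)" by (simp add: r_def)
    finally show ?thesis
      by (simp add: matrix_mult_add matrix_mult_scaleR prodv_simps matrix_mul_assoc)
  qed
  have lin: "linear (\<lambda>M :: complex^'s^'s. clifford \<gamma> w ** M)" by (intro linearI) (simp_all add: matrix_mult_add matrix_mult_scaleR)
  have "clifford \<gamma> w ** r \<in> span ((\<lambda>M. clifford \<gamma> w ** M) ` {prodv ws | ws. Suc (length ws) = length vs})"
    using Cons.IH unfolding r_def[symmetric] by (simp add: linear_span_image[OF lin])
  moreover have "(\<lambda>M. clifford \<gamma> w ** M) ` {prodv ws | ws. Suc (length ws) = length vs} \<subseteq> {prodv ws | ws. Suc (length ws) = length (w # vs)}"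
  proof clarify
    fix ws :: "(real^'n) list" assume "Suc (length ws) = length vs"
    then show "\<exists>us. clifford \<gamma> w ** prodv ws = prodv us \<and> Suc (length us) = length (w # vs)"
      by (intro exI[of _ "w # ws"]) (simp add: prodv_simps)
  qed
  from span_mono[OF this] have "span ((\<lambda>M. clifford \<gamma> w ** M) ` {prodv ws | ws. Suc (length ws) = length vs}) \<subseteq> span {prodv ws | ws. Suc (length ws) = length (w # vs)}" .
  ultimately have "clifford \<gamma> w ** r \<in> span {prodv ws | ws. Suc (length ws) = length (w # vs)}" by blast
  moreover have "prodv vs \<in> span {prodv ws | ws. Suc (length ws) = length (w # vs)}" by (intro span_base) auto
  ultimately show ?case unfolding eq by (intro span_add span_neg span_scale)
qed

lemma trace_prodv_real: "even (length vs) \<Longrightarrow> Im (trace (prodv vs)) = 0"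
proof (induction "length vs" arbitrary: vs rule: less_induct)
  case less
  show ?case
  proof (cases vs)
    case Nil
    then show ?thesis by (simp add: prodv_simps trace_one)
  next
    case (Cons v us)
    define r where "r = clifford \<gamma> v ** prodv us - (-1) ^ length us *\<^sub>R (prodv us ** clifford \<gamma> v)"
    have "r \<in> span {prodv ws | ws. Suc (length ws) = length us}" unfolding r_def by (rule clifford_prodv_commute)
    then have "Im (trace r) = 0"
    proof (induction rule: span_induct_alt)
      case base
      then show ?case by (simp add: trace_def)
    next
      case (step c x y)
      then obtain ws where ws: "x = prodv ws" "Suc (length ws) = length us" by auto
      have "even (length ws)" using ws(2) less.prems Cons by (metis even_Suc length_Cons)
      then have "Im (trace x) = 0" unfolding ws(1) using ws(2) Cons by (intro less.hyps) auto
      then show ?case using step by (simp add: trace_add trace_scaleR)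
    qed
    \<comment> \<open>The tail \<open>us\<close> has odd length, so r is a sum, and by cyclicity its
      trace is twice that of \<open>prodv vs\<close>.\<close>
    moreover have "r = prodv vs + prodv us ** clifford \<gamma> v" using Cons less.prems by (simp add: r_def prodv_simps)
    moreover have "trace (prodv us ** clifford \<gamma> v) = trace (prodv vs)"
      using trace_mul_sym[of "prodv us" "clifford \<gamma> v"] by (simp add: Cons prodv_simps)
    ultimately show ?thesis by (simp add: trace_add)
  qed
qed

definition unit_even :: "(real^'n) list \<Rightarrow> bool" where
  "unit_even vs \<longleftrightarrow> even (length vs) \<and> (\<forall>v\<in>set vs. norm v = 1)"

lemma spincE:
  assumes "a \<in> spinc_group \<gamma>"
  obtains z vs where "a = mat z ** prodv vs" "norm z = 1" "unit_even vs"
proof -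
  from assms obtain z vs where "a = spinc_product \<gamma> z vs" "norm z = 1" "even (length vs)" "\<forall>v\<in>set vs. norm v = 1"
    unfolding spinc_group_def by auto
  then show thesis using that[of z vs] by (simp add: spinc_product_prodv unit_even_def)
qed

lemma spincI: "norm z = 1 \<Longrightarrow> unit_even vs \<Longrightarrow> mat z ** prodv vs \<in> spinc_group \<gamma>"
  unfolding spinc_group_def spinc_product_prodv[symmetric] unit_even_def by auto

lemma unit_even_simps: "unit_even []" "unit_even vs \<Longrightarrow> unit_even ws \<Longrightarrow> unit_even (vs @ ws)" "unit_even (rev vs) = unit_even vs"
  by (auto simp: unit_even_def)

lemma prodv_rev': "unit_even vs \<Longrightarrow> prodv vs ** prodv (rev vs) = mat 1"
  using prodv_rev unfolding unit_even_def by blast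

lemma spinc_one: "mat 1 \<in> spinc_group \<gamma>"
  using spincI[of 1 "[]"] by (simp add: unit_even_simps prodv_simps)

lemma spinc_mult: "a \<in> spinc_group \<gamma> \<Longrightarrow> b \<in> spinc_group \<gamma> \<Longrightarrow> a ** b \<in> spinc_group \<gamma>"
proof -
  assume "a \<in> spinc_group \<gamma>" "b \<in> spinc_group \<gamma>"
  then obtain z vs w ws where a: "a = mat z ** prodv vs" "norm z = 1" "unit_even vs"
    and b: "b = mat w ** prodv ws" "norm w = 1" "unit_even ws" by (metis spincE)
  have "a ** b = mat z ** (prodv vs ** mat w) ** prodv ws" by (simp add: a b matrix_mul_assoc)
  also have "\<dots> = mat (z * w) ** prodv (vs @ ws)"
    by (simp add: mat_mult_commute[of w "prodv vs", symmetric] matrix_mul_assoc mat_mult_mat prodv_append)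
  finally show ?thesis using a b by (simp add: spincI norm_mult unit_even_simps)
qed

lemma hermitian_clifford: "hermitian (clifford \<gamma> v *v x) y = - hermitian x (clifford \<gamma> v *v y)"
proof -
  have "hermitian (\<Sum>i\<in>UNIV. v $ i *\<^sub>R (\<gamma> i *v x)) y = (\<Sum>i\<in>UNIV. v $ i *\<^sub>R hermitian (\<gamma> i *v x) y)" for x y
    unfolding hermitian_def
    by (simp add: scaleR_sum_right sum_distrib_right) (rule sum.swap)
  moreover have "hermitian x (\<Sum>i\<in>UNIV. v $ i *\<^sub>R (\<gamma> i *v y)) = (\<Sum>i\<in>UNIV. v $ i *\<^sub>R hermitian x (\<gamma> i *v y))" for x y
    unfolding hermitian_def
    by (simp add: scaleR_sum_right sum_distrib_left) (rule sum.swap)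
  ultimately show ?thesis by (simp add: clifford_vec cl_def gam_herm sum_negf)
qed

lemma hermitian_prodv: "\<forall>v\<in>set vs. norm v = 1 \<Longrightarrow> hermitian (prodv vs *v x) (prodv vs *v y) = hermitian x y"
proof (induction vs arbitrary: x y)
  case (Cons v vs)
  have "hermitian (clifford \<gamma> v *v p) (clifford \<gamma> v *v q) = hermitian p q" for p q
    using Cons.prems
    by (simp add: hermitian_clifford matrix_vector_mul_assoc clifford_sq dot_square_norm neg_mat_vector)
      (simp add: hermitian_def sum_negf)
  then show ?case using Cons by (simp add: prodv_simps matrix_vector_mul_assoc[symmetric])
qed (simp add: prodv_simps)

lemma hermitian_spinc:
  assumes "a \<in> spinc_group \<gamma>"
  shows "hermitian (a *v x) (a *v y) = hermitian x y"
proof -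
  obtain z vs where a: "a = mat z ** prodv vs" "norm z = 1" "unit_even vs" using assms by (rule spincE)
  have "hermitian (z *s p) (z *s q) = hermitian p q" for p q :: "complex^'s"
  proof -
    have "z * cnj z = 1" using complex_norm_square[of z] a(2) by simp
    then have u: "z * u * (cnj z * v) = u * v" for u v
      using mult.assoc[of "z * cnj z" u v] by (simp add: mult_ac)
    show ?thesis by (simp only: hermitian_def vector_smult_component complex_cnj_mult u)
  qed
  then show ?thesis
    using hermitian_prodv[of vs] a by (simp add: unit_even_def matrix_vector_mul_assoc[symmetric] mat_vector)
qed

text \<open>Group elements are unitary, and the inverse of z times an even product is the conjugate
  of z times the reversed product. Hence the adjoint is the inverse and remains in the
  group.\<close>

lemma spinc_adj:
  assumes "a \<in> spinc_group \<gamma>"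
  shows "adj a ** a = mat 1" "a ** adj a = mat 1" "adj a \<in> spinc_group \<gamma>"
proof -
  have "x \<bullet> ((adj a ** a) *v y) = x \<bullet> (mat 1 *v y)" for x y
    by (simp add: inner_hermitian hermitian_adj[symmetric] matrix_vector_mul_assoc[symmetric] hermitian_spinc[OF assms])
  then have "(adj a ** a) *v y = mat 1 *v y" for y by (intro hermitian_inner_eqI)
  then show 1: "adj a ** a = mat 1" by (rule matrix_eqI)
  then show 2: "a ** adj a = mat 1" by (simp add: matrix_left_right_inverse)
  obtain z vs where a: "a = mat z ** prodv vs" "norm z = 1" "unit_even vs" using assms by (rule spincE)
  define b where "b = mat (cnj z) ** prodv (rev vs)"
  have "a ** b = mat z ** (prodv vs ** mat (cnj z)) ** prodv (rev vs)" by (simp add: a b_def matrix_mul_assoc)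
  also have "\<dots> = mat (z * cnj z) ** (prodv vs ** prodv (rev vs))"
    by (simp add: mat_mult_commute[of "cnj z" "prodv vs", symmetric] matrix_mul_assoc mat_mult_mat)
  also have "\<dots> = mat 1" using complex_norm_square[of z] a by (simp add: prodv_rev')
  finally have "b = adj a" by (metis 1 matrix_mul_assoc matrix_mul_lid matrix_mul_rid)
  moreover have "b \<in> spinc_group \<gamma>" using a by (simp add: b_def spincI unit_even_simps)
  ultimately show "adj a \<in> spinc_group \<gamma>" by simp
qed

lemma prodv_rotation: "\<forall>v\<in>set vs. norm v = 1 \<Longrightarrow> \<exists>R. \<forall>v. prodv vs ** clifford \<gamma> v = clifford \<gamma> (R *v v) ** prodv vs"
proof (induction vs)
  case Nil
  show ?case by (intro exI[of _ "mat 1"]) (simp add: prodv_simps)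
next
  case (Cons u vs)
  then obtain R where R: "\<And>v. prodv vs ** clifford \<gamma> v = clifford \<gamma> (R *v v) ** prodv vs" by auto
  \<comment> \<open>Conjugation by a unit vector u: minus the reflection in the hyperplane
    orthogonal to u.\<close>
  define T :: "real^'n^'n" where "T = matrix (\<lambda>w. 2 *\<^sub>R (u \<bullet> w) *\<^sub>R u - w)"
  have T: "T *v w = 2 *\<^sub>R (u \<bullet> w) *\<^sub>R u - w" for w
      proof -
    have "linear (\<lambda>w. 2 *\<^sub>R (u \<bullet> w) *\<^sub>R u - w)"
      by (intro linearI) (simp_all add: algebra_simps inner_add_right scaleR_add_left)
    from fun_cong[OF matrix_vector_mul(2)[OF this], of w] show ?thesis by (simp add: T_def)
  qed
  have refl: "clifford \<gamma> u ** clifford \<gamma> w = clifford \<gamma> (T *v w) ** clifford \<gamma> u" for w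
  proof -
    have "clifford \<gamma> (T *v w) = (2 * (u \<bullet> w)) *\<^sub>R clifford \<gamma> u - clifford \<gamma> w"
      unfolding T using clifford_linear(1)[of "2 *\<^sub>R (u \<bullet> w) *\<^sub>R u" "(-1) *\<^sub>R w"] by (simp add: clifford_linear(2)[of "-1" w, simplified] clifford_linear(2))
    then have "clifford \<gamma> (T *v w) ** clifford \<gamma> u = (2 * (u \<bullet> w)) *\<^sub>R (clifford \<gamma> u ** clifford \<gamma> u) - clifford \<gamma> w ** clifford \<gamma> u"
      by (simp only: diff_conv_add_uminus matrix_mult_add matrix_mult_minus matrix_mult_scaleR)
    then show ?thesis using Cons.prems by (simp add: clifford_sq dot_square_norm clifford_mult[of u w])
  qed
  have "prodv (u # vs) ** clifford \<gamma> v = clifford \<gamma> ((T ** R) *v v) ** prodv (u # vs)" for v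
  proof -
    have "prodv (u # vs) ** clifford \<gamma> v = clifford \<gamma> u ** (clifford \<gamma> (R *v v) ** prodv vs)"
      by (simp add: prodv_simps matrix_mul_assoc[symmetric] R)
    also have "\<dots> = (clifford \<gamma> u ** clifford \<gamma> (R *v v)) ** prodv vs" by (simp add: matrix_mul_assoc)
    also have "\<dots> = clifford \<gamma> (T *v (R *v v)) ** prodv (u # vs)" unfolding refl by (simp add: prodv_simps matrix_mul_assoc)
    finally show ?thesis by (simp add: matrix_vector_mul_assoc)
  qed
  then show ?case by blast
qed

definition rotation :: "complex^'s^'s \<Rightarrow> real^'n^'n" where "rotation a = fst (spinc_xi \<gamma> a)"

text \<open>Settles the definite description in \<open>spinc_xi\<close>: existence comes from
  composing reflections, uniqueness from the injectivity of \<open>clifford\<close>.\<close>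

lemma rotation:
  assumes "a \<in> spinc_group \<gamma>"
  shows "a ** clifford \<gamma> v = clifford \<gamma> (rotation a *v v) ** a"
proof -
  obtain z vs where a: "a = mat z ** prodv vs" "norm z = 1" "unit_even vs" using assms by (rule spincE)
  obtain R where R: "\<And>v. prodv vs ** clifford \<gamma> v = clifford \<gamma> (R *v v) ** prodv vs"
    using prodv_rotation a(3) unfolding unit_even_def by blast
  have aR: "a ** clifford \<gamma> v = clifford \<gamma> (R *v v) ** a" for v
  proof -
    have "a ** clifford \<gamma> v = (mat z ** clifford \<gamma> (R *v v)) ** prodv vs" by (simp add: a matrix_mul_assoc[symmetric] R)
    also have "\<dots> = clifford \<gamma> (R *v v) ** a" unfolding mat_mult_commute by (simp add: a matrix_mul_assoc)
    finally show ?thesis .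
  qed
  have "\<exists>!R. \<forall>v. a ** clifford \<gamma> v = clifford \<gamma> (R *v v) ** a"
  proof (rule ex1I[of _ R])
    fix R' assume R': "\<forall>v. a ** clifford \<gamma> v = clifford \<gamma> (R' *v v) ** a"
    have "R' *v v = R *v v" for v
    proof (rule clifford_inj)
      have "clifford \<gamma> (R' *v v) ** a = clifford \<gamma> (R *v v) ** a" using R' aR by metis
      then have "clifford \<gamma> (R' *v v) ** a ** adj a = clifford \<gamma> (R *v v) ** a ** adj a" by simp
      then show "clifford \<gamma> (R' *v v) = clifford \<gamma> (R *v v)"
        by (simp add: matrix_mul_assoc[symmetric] spinc_adj[OF assms])
    qed
    then show "R' = R" by (simp add: matrix_eq)
  qed (use aR in blast)
  from theI'[OF this] show ?thesis unfolding rotation_def spinc_xi_def fst_conv by (rule spec)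
qed

lemma rotation_cl: "a \<in> spinc_group \<gamma> \<Longrightarrow> a *v cl v x = cl (rotation a *v v) (a *v x)"
  using rotation[of a v] by (metis clifford_vec matrix_vector_mul_assoc)

lemma norm_rotation:
  assumes "a \<in> spinc_group \<gamma>"
  shows "(rotation a *v v) \<bullet> (rotation a *v w) = v \<bullet> w"
proof -
  have sq: "(rotation a *v v) \<bullet> (rotation a *v v) = v \<bullet> v" for v
  proof -
    let ?x = "axis undefined 1 :: complex^'s"
    have iso: "(a *v p) \<bullet> (a *v q) = p \<bullet> q" for p q by (simp add: inner_hermitian hermitian_spinc[OF assms])
    have "((rotation a *v v) \<bullet> (rotation a *v v)) * (?x \<bullet> ?x) = (v \<bullet> v) * (?x \<bullet> ?x)"
      using iso[of "cl v ?x" "cl v ?x"] iso[of ?x ?x] by (simp add: rotation_cl[OF assms] cl_inner)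
    then show ?thesis by (simp add: inner_axis_axis)
  qed
  show ?thesis
    using sq[of "v + w"] sq[of v] sq[of w]
    by (simp add: matrix_vector_right_distrib inner_add_left inner_add_right inner_commute)
qed

definition charge :: "complex^'s^'s \<Rightarrow> complex" where "charge a = snd (spinc_xi \<gamma> a)"

text \<open>The matrix determines z up to sign. After multiplication by the reverse of
  \<open>ws\<close>, the trace of an even product is real, so w is z times a real number, which the
  norms force to be 1 or -1. This makes \<open>charge\<close> well defined.\<close>

lemma trace_real_ratio:
  assumes "norm z = 1" "norm w = 1" "unit_even vs" "unit_even ws" "mat z ** prodv vs = mat w ** prodv ws"
  shows "z\<^sup>2 = w\<^sup>2"
proof -
  have "trace (mat w ** prodv ws ** prodv (rev ws)) = w * of_nat CARD('s)"
    using assms(4) by (simp add: matrix_mul_assoc[symmetric] prodv_rev' trace_mat_mult trace_mat)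
  moreover have "trace (mat z ** prodv vs ** prodv (rev ws)) = z * trace (prodv (vs @ rev ws))"
    by (simp add: matrix_mul_assoc[symmetric] prodv_append trace_mat_mult)
  moreover have "Im (trace (prodv (vs @ rev ws))) = 0"
    using assms(3,4) by (intro trace_prodv_real) (auto simp: unit_even_def)
  ultimately obtain r :: real where r: "z * complex_of_real r = w * of_nat CARD('s)"
    using assms(5) by (metis complex_eq_of_real)
  then have "norm (z * complex_of_real r) = norm (w * of_nat CARD('s))" by simp
  then have "\<bar>r\<bar> = real CARD('s)" using assms(1,2) by (simp add: norm_mult)
  then have "r\<^sup>2 = (real CARD('s))\<^sup>2" by (metis power2_abs)
  moreover have "z\<^sup>2 * complex_of_real (r\<^sup>2) = w\<^sup>2 * complex_of_real ((real CARD('s))\<^sup>2)"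
    using arg_cong[OF r, of "\<lambda>u. u\<^sup>2"] by (simp add: power_mult_distrib)
  ultimately show ?thesis by simp
qed

lemma charge:
  assumes "norm z = 1" "unit_even vs"
  shows "charge (mat z ** prodv vs) = z\<^sup>2"
proof -
  have "(THE w. \<exists>z' vs'. norm z' = 1 \<and> even (length vs') \<and> (\<forall>v\<in>set vs'. norm v = 1) \<and>
      mat z ** prodv vs = spinc_product \<gamma> z' vs' \<and> w = z'\<^sup>2) = z\<^sup>2"
  proof (rule the_equality)
    show "\<exists>z' vs'. norm z' = 1 \<and> even (length vs') \<and> (\<forall>v\<in>set vs'. norm v = 1) \<and>
      mat z ** prodv vs = spinc_product \<gamma> z' vs' \<and> z\<^sup>2 = z'\<^sup>2"
      using assms unfolding unit_even_def spinc_product_prodv by blast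
    fix w assume "\<exists>z' vs'. norm z' = 1 \<and> even (length vs') \<and> (\<forall>v\<in>set vs'. norm v = 1) \<and>
      mat z ** prodv vs = spinc_product \<gamma> z' vs' \<and> w = z'\<^sup>2"
    then obtain z' vs' where "norm z' = 1" "unit_even vs'" "mat z ** prodv vs = mat z' ** prodv vs'" "w = z'\<^sup>2"
      unfolding unit_even_def spinc_product_prodv by blast
    then show "w = z\<^sup>2" using trace_real_ratio[of z z' vs vs'] assms by simp
  qed
  then show ?thesis by (simp add: charge_def spinc_xi_def)
qed

lemma norm_charge: "a \<in> spinc_group \<gamma> \<Longrightarrow> norm (charge a) = 1"
  by (erule spincE) (simp add: charge norm_power)

lemma linear_trace: "linear (trace :: complex^'s^'s \<Rightarrow> complex)"
  by (intro linearI) (simp_all add: trace_add trace_scaleR)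

text \<open>Near \<open>a\<^sub>0 = z\<^sub>0s\<^sub>0\<close> the function \<open>f(a) = tr(a s\<^sub>0\<^sup>-\<^sup>1)\<close> equals \<open>z\<close> times a nonzero real number, so that
  \<open>charge a = f(a) / cnj f(a)\<close> there.\<close>

lemma charge_derivative:
  fixes a :: "'b::euclidean_space \<Rightarrow> complex^'s^'s"
  assumes V: "open V" "p \<in> V" and a: "\<And>y. y \<in> V \<Longrightarrow> a y \<in> spinc_group \<gamma>"
    and a': "(a has_derivative a') (at p)"
    and skew: "\<And>v. Re (trace (adj (a p) ** a' v)) = 0"
  shows "((\<lambda>y. charge (a y)) has_derivative (\<lambda>v. charge (a p) * (2 / of_nat CARD('s)) * trace (adj (a p) ** a' v))) (at p)"
proof -
  let ?N = "complex_of_nat CARD('s)"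
  obtain z vs where z: "a p = mat z ** prodv vs" "norm z = 1" "unit_even vs" using a[OF V(2)] by (rule spincE)
  define f where "f y = trace (a y ** prodv (rev vs))" for y
  have linf: "linear (\<lambda>M. trace (M ** prodv (rev vs)))"
    by (intro linearI) (simp_all add: matrix_mult_add matrix_mult_scaleR trace_add trace_scaleR)
  have f': "(f has_derivative (\<lambda>v. trace (a' v ** prodv (rev vs)))) (at p)"
    unfolding f_def using linf by (intro bounded_linear.has_derivative[OF _ a']) (simp add: linear_conv_bounded_linear)
  have fp: "f p = z * ?N"
    using z(3) by (simp add: f_def z matrix_mul_assoc[symmetric] prodv_rev' trace_mat_mult trace_mat)
  have nz: "f p \<noteq> 0" using z(2) by (auto simp: fp)
  have zz: "z * cnj z = 1" using complex_norm_square[of z] z(2) by simp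
  have chg: "charge (a y) = f y / cnj (f y)" if y: "y \<in> V" "f y \<noteq> 0" for y
  proof -
    obtain w ws where w: "a y = mat w ** prodv ws" "norm w = 1" "unit_even ws" using a[OF y(1)] by (rule spincE)
    have "f y = w * trace (prodv (ws @ rev vs))"
      by (simp add: f_def w matrix_mul_assoc[symmetric] prodv_append trace_mat_mult)
    moreover have "Im (trace (prodv (ws @ rev vs))) = 0"
      using z(3) w(3) by (intro trace_prodv_real) (auto simp: unit_even_def)
    ultimately obtain r :: real where r: "f y = w * complex_of_real r" by (metis complex_eq_of_real)
    have ww: "w * cnj w = 1" using complex_norm_square[of w] w(2) by simp
    have "f y / cnj (f y) = w / cnj w" using y(2) by (simp add: r)
    also have "\<dots> = w\<^sup>2" using ww by (auto simp: divide_simps power2_eq_square mult_ac) (metis mult.assoc mult.right_neutral)?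
    finally show ?thesis using w by (simp add: charge)
  qed
  have "continuous (at p) f" using f' has_derivative_continuous by blast
  then have "\<forall>\<^sub>F y in at p. f y \<noteq> 0"
    using nz unfolding continuous_at by (auto intro: tendsto_imp_eventually_ne)
  then obtain W where W0: "open W" "p \<in> W" "\<And>y. y \<in> W \<Longrightarrow> y \<noteq> p \<Longrightarrow> f y \<noteq> 0"
    unfolding eventually_at_topological by auto
  have W: "f y \<noteq> 0" if "y \<in> W" for y using W0 nz that by (cases "y = p") simp_all
  have pVW: "p \<in> V \<inter> W" using V(2) W0(2) by simp
  define t where "t v = trace (adj (a p) ** a' v)" for v
  have tv: "trace (a' v ** prodv (rev vs)) = z * t v" for v
  proof -
    have "prodv (rev vs) = mat z ** adj (a p)"
    proof -
      have "a p ** (mat z ** adj (a p)) = mat z" using spinc_adj(2)[OF a[OF V(2)]] 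
        by (simp add: mat_mult_commute matrix_mul_assoc)
      moreover have "a p ** prodv (rev vs) = mat z" using z(3) by (simp add: z matrix_mul_assoc[symmetric] prodv_rev')
      ultimately have "adj (a p) ** (a p ** (mat z ** adj (a p))) = adj (a p) ** (a p ** prodv (rev vs))" by simp
      then show ?thesis by (simp add: matrix_mul_assoc spinc_adj(1)[OF a[OF V(2)]])
    qed
    then have "trace (a' v ** prodv (rev vs)) = trace (mat z ** adj (a p) ** a' v)"
      using trace_mul_sym[of "a' v" "prodv (rev vs)"] by simp
    then show ?thesis by (simp add: matrix_mul_assoc[symmetric] trace_mat_mult t_def)
  qed
  have "((\<lambda>y. f y / cnj (f y)) has_derivative
      (\<lambda>v. - f p * (inverse (cnj (f p)) * cnj (trace (a' v ** prodv (rev vs))) * inverse (cnj (f p)))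
        + trace (a' v ** prodv (rev vs)) / cnj (f p))) (at p)"
    using nz by (intro has_derivative_divide f' has_derivative_cnj) simp
  moreover have "- f p * (inverse (cnj (f p)) * cnj (trace (a' v ** prodv (rev vs))) * inverse (cnj (f p)))
        + trace (a' v ** prodv (rev vs)) / cnj (f p) = charge (a p) * (2 / ?N) * t v" for v
  proof -
    \<comment> \<open>A purely imaginary logarithmic derivative makes both terms of the quotient
      rule equal, whence the factor 2.\<close>
    have ct: "cnj (t v) = - t v" using skew[of v] by (simp add: t_def complex_eq_iff)
    have "inverse (cnj z) = z" using zz by (metis inverse_unique mult.commute)
    then have "inverse (cnj (f p)) = z / ?N" by (simp add: fp divide_inverse)
    then have "- f p * (inverse (cnj (f p)) * cnj (trace (a' v ** prodv (rev vs))) * inverse (cnj (f p)))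
        + trace (a' v ** prodv (rev vs)) / cnj (f p) = (z * cnj z) * (z * z * t v / ?N) + z * z * t v / ?N"
      by (simp add: tv fp ct divide_inverse)
    also have "\<dots> = z\<^sup>2 * (2 / ?N) * t v" unfolding zz by (simp add: power2_eq_square)
    finally show ?thesis using charge[OF z(2,3)] by (simp add: z(1))
  qed
  ultimately have "((\<lambda>y. f y / cnj (f y)) has_derivative (\<lambda>v. charge (a p) * (2 / ?N) * t v)) (at p)"
    by (rule has_derivative_eq_rhs[OF _ ext])
  then show ?thesis
    unfolding t_def by (rule has_derivative_cong_open[OF open_Int[OF V(1) W0(1)] pVW, rotated]) (use W chg in auto)
qed

end

section \<open>Adjoints, traces and the gauge transformation law\<close>

lemma adj_mult: "adj (A ** B) = adj B ** adj A"
  by (simp add: adj_def matrix_matrix_mult_def vec_eq_iff mult.commute)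

lemma adj_adj: "adj (adj A) = A"
  by (simp add: adj_def vec_eq_iff)

lemma trace_adj: "trace (adj A) = cnj (trace A)"
  by (simp add: trace_def adj_def)

lemma bounded_bilinear_matrix_mult:
  "bounded_bilinear ((**) :: complex^'s^'s::finite \<Rightarrow> complex^'s^'s \<Rightarrow> complex^'s^'s)"
  by (simp add: bilinear_conv_bounded_bilinear[symmetric] bilinear_def)
    (auto intro!: linearI simp: matrix_mult_add matrix_mult_scaleR)

lemma bounded_linear_adj: "bounded_linear adj"
  using linear_adj by (simp add: linear_conv_bounded_linear)

context clifford_matrices begin

definition conn_mat :: "('n \<Rightarrow> 'n \<Rightarrow> real) \<Rightarrow> real \<Rightarrow> complex^'s^'s" where
  "conn_mat w c = (1/4) *\<^sub>R (\<Sum>i\<in>UNIV. \<Sum>j\<in>UNIV. w i j *\<^sub>R (\<gamma> i ** \<gamma> j)) + mat (\<i> * complex_of_real (c / 2))"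

lemma conn_mat_vec: "conn_mat w c *v x = conn_op w c x"
proof -
  have "mat (\<i> * complex_of_real (c / 2)) *v x = (c / 2) *\<^sub>R (\<i> *s x)"
    by (simp add: mat_vector vec_eq_iff complex_eq_iff)
  then show ?thesis
    by (simp add: conn_mat_def conn_op_def matrix_vector_mult_add_rdistrib scaleR_mat_vector sum_mat_vector
        matrix_vector_mul_assoc)
qed

lemma trace_sum: "trace (\<Sum>i\<in>I. A i :: complex^'s^'s) = (\<Sum>i\<in>I. trace (A i))"
  by (rule linear_sum[OF linear_trace])

text \<open>Products of two distinct gammas anticommute and are traceless, and w vanishes on the
  diagonal, so the trace reads off the scalar part c.\<close>

lemma trace_conn_mat:
  assumes anti: "\<And>i j. w i j = - w j i"
  shows "trace (conn_mat w c) = \<i> * complex_of_real (c / 2) * of_nat CARD('s)"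
proof -
  have "w i j *\<^sub>R trace (\<gamma> i ** \<gamma> j) = 0" for i j
  proof (cases "i = j")
    case True
    then show ?thesis using anti[of i i] by simp
  next
    case False
    have "\<gamma> i ** \<gamma> j = - (\<gamma> j ** \<gamma> i)"
      using gam_mult[of i j] False by (simp add: eq_neg_iff_add_eq_0 mat_def vec_eq_iff)
    then have "trace (\<gamma> i ** \<gamma> j) = - trace (\<gamma> i ** \<gamma> j)"
      using trace_mul_sym[of "\<gamma> j" "\<gamma> i"] by (simp add: trace_minus)
    then show ?thesis by simp
  qed
  note zero = this
  have "trace (\<Sum>i\<in>UNIV. \<Sum>j\<in>UNIV. w i j *\<^sub>R (\<gamma> i ** \<gamma> j)) = 0"
    by (simp only: trace_sum trace_scaleR zero sum.neutral_const)
  then show ?thesis by (simp add: conn_mat_def trace_add trace_scaleR trace_mat)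
qed

lemma cl_axis: "cl (axis k 1) x = \<gamma> k *v x"
  by (simp add: cl_def axis_def if_distrib if_distribR cong: if_cong)

lemma cl_linear: "cl (v + w) x = cl v x + cl w x" "cl (r *\<^sub>R v) x = r *\<^sub>R cl v x" "cl v (x + y) = cl v x + cl v y"
  "cl (- v) x = - cl v x" "cl (v - w) x = cl v x - cl w x"
  by (simp_all add: cl_def scaleR_add_left scaleR_diff_left sum.distrib sum_subtractf scaleR_sum_right gam_lin scaleR_add_right sum_negf)

lemma conn_op_cl:
  assumes anti: "\<And>i j. w i j = - w j i"
  shows "conn_op w c (cl v x) = cl v (conn_op w c x) + cl (\<chi> m. \<Sum>l\<in>UNIV. v $ l * w l m) x"
proof -
  have "conn_op w c (cl v x) = (\<Sum>l\<in>UNIV. v $ l *\<^sub>R (\<gamma> l *v conn_op w c x + (\<Sum>m\<in>UNIV. w l m *\<^sub>R (\<gamma> m *v x))))"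
    by (simp add: cl_def conn_op_lin conn_op_gam[of w, OF anti])
  also have "\<dots> = cl v (conn_op w c x) + (\<Sum>l\<in>UNIV. \<Sum>m\<in>UNIV. (v $ l * w l m) *\<^sub>R (\<gamma> m *v x))"
    by (simp add: cl_def scaleR_add_right sum.distrib scaleR_sum_right)
  also have "(\<Sum>l\<in>UNIV. \<Sum>m\<in>UNIV. (v $ l * w l m) *\<^sub>R (\<gamma> m *v x)) = cl (\<chi> m. \<Sum>l\<in>UNIV. v $ l * w l m) x"
    by (subst sum.swap) (simp add: cl_def scaleR_sum_left)
  finally show ?thesis .
qed

lemma rotation_orthogonal:
  assumes "a \<in> spinc_group \<gamma>"
  shows "transpose (rotation a) ** rotation a = mat 1" "rotation a ** transpose (rotation a) = mat 1"
proof -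
  have "v \<bullet> ((transpose (rotation a) ** rotation a) *v w) = v \<bullet> w" for v w
    using norm_rotation[OF assms, of v w]
    by (metis dot_lmul_matrix matrix_vector_mul_assoc transpose_transpose vector_transpose_matrix)
  then have "(transpose (rotation a) ** rotation a) *v w = mat 1 *v w" for w
    using vector_eq_ldot by (metis matrix_vector_mul_lid)
  then show 1: "transpose (rotation a) ** rotation a = mat 1" by (simp add: matrix_eq)
  then show "rotation a ** transpose (rotation a) = mat 1" by (simp add: matrix_left_right_inverse)
qed

lemma adj_rotation_cl:
  assumes a: "a \<in> spinc_group \<gamma>"
  shows "adj a *v cl v x = cl (transpose (rotation a) *v v) (adj a *v x)"
proof -
  have "a *v cl (transpose (rotation a) *v v) (adj a *v x) = cl v x"
    using spinc_adj(2)[OF a] rotation_orthogonal(2)[OF a]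
    by (simp add: rotation_cl[OF a] matrix_vector_mul_assoc del: transpose_matrix_vector)
  then show ?thesis using spinc_adj(1)[OF a] by (metis matrix_vector_mul_assoc matrix_vector_mul_lid)
qed

text \<open>The difference of the two sides commutes with Clifford multiplication and is skew, hence is a
  multiple of \<open>i\<close>; its trace vanishes.\<close>

lemma gauge_transformation:
  fixes w w' :: "'n \<Rightarrow> 'n \<Rightarrow> real" and a a' :: "complex^'s^'s" and R' :: "real^'n^'n"
  assumes a: "a \<in> spinc_group \<gamma>"
    and a': "\<And>v. a' ** clifford \<gamma> v = clifford \<gamma> (R' *v v) ** a + clifford \<gamma> (rotation a *v v) ** a'"
    and skew: "adj a' ** a + adj a ** a' = 0"
    and anti: "\<And>i j. w i j = - w j i" and anti': "\<And>i j. w' i j = - w' j i"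
    and w': "\<And>j l. w' j l = (\<Sum>m\<in>UNIV. rotation a $ m $ l * (R' $ m $ j + (\<Sum>i\<in>UNIV. rotation a $ i $ j * w i m)))"
    and c': "\<i> * complex_of_real (c' - c) = 2 / of_nat CARD('s) * trace (adj a ** a')"
  shows "a *v conn_op w' c' y = a' *v y + conn_op w c (a *v y)"
proof -
  define T where "T y = adj a *v (a' *v y + conn_op w c (a *v y)) - conn_op w' c' y" for y
  define M where "M = adj a ** (a' + conn_mat w c ** a) - conn_mat w' c'"
  have TM: "T y = M *v y" for y
    by (simp add: T_def M_def matrix_vector_mult_diff_rdistrib matrix_vector_mul_assoc[symmetric]
        matrix_vector_mult_add_rdistrib conn_mat_vec)
  have inner_adj: "(A *v x) \<bullet> y = x \<bullet> (adj A *v y)" for A :: "complex^'s^'s" and x y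
    by (simp add: inner_hermitian hermitian_adj)
  have "\<exists>\<mu>. \<forall>x. T x = \<mu> *\<^sub>R (\<i> *s x)"
  proof (rule skew_commutant[OF dim_spinors])
    show "linear T" unfolding TM by (rule linear_mat_vector)
    show "T x \<bullet> y = - (x \<bullet> T y)" for x y
    proof -
      have 1: "(adj a *v (a' *v x)) \<bullet> y = - (x \<bullet> (adj a *v (a' *v y)))"
      proof -
        have "(adj a *v (a' *v x)) \<bullet> y = x \<bullet> ((adj a' ** a) *v y)"
          by (simp add: inner_adj adj_adj matrix_vector_mul_assoc[symmetric])
        also have "adj a' ** a = - (adj a ** a')" using skew by (simp add: eq_neg_iff_add_eq_0)
        finally show ?thesis by (simp add: neg_mat_vector matrix_vector_mul_assoc)
      qed
      have 2: "(adj a *v conn_op w c (a *v x)) \<bullet> y = - (x \<bullet> (adj a *v conn_op w c (a *v y)))"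
        by (simp add: inner_adj[of "adj a"] adj_adj conn_op_skew[of w, OF anti] inner_adj[of a])
      show ?thesis
        using 1 2 conn_op_skew[of w' c' x y, OF anti']
        by (simp add: T_def inner_diff_left inner_diff_right inner_add_left inner_add_right matrix_vector_right_distrib)
    qed
    show "T (\<i> *s x) = \<i> *s T x" for x unfolding TM by (rule mat_vector_vscale)
    show "T (\<gamma> k *v x) = \<gamma> k *v T x" for k x
    proof -
      let ?R = "rotation a" and ?e = "axis k 1 :: real^'n"
      have A: "a' *v (\<gamma> k *v x) = cl (R' *v ?e) (a *v x) + cl (?R *v ?e) (a' *v x)"
      proof -
        have "a' *v (\<gamma> k *v x) = (a' ** clifford \<gamma> ?e) *v x"
          by (simp add: matrix_vector_mul_assoc[symmetric] clifford_vec cl_axis)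
        then show ?thesis unfolding a'
          by (simp add: matrix_vector_mult_add_rdistrib matrix_vector_mul_assoc[symmetric] clifford_vec)
      qed
      have B: "conn_op w c (a *v (\<gamma> k *v x)) =
          cl (?R *v ?e) (conn_op w c (a *v x)) + cl (\<chi> m. \<Sum>l\<in>UNIV. (?R *v ?e) $ l * w l m) (a *v x)"
      proof -
        have "a *v (\<gamma> k *v x) = cl (?R *v ?e) (a *v x)"
          using rotation_cl[OF a, of ?e x] unfolding cl_axis .
        then show ?thesis using conn_op_cl[of w c "?R *v ?e" "a *v x", OF anti] by metis
      qed
      have C: "conn_op w' c' (\<gamma> k *v x) = \<gamma> k *v conn_op w' c' x + cl (\<chi> m. \<Sum>l\<in>UNIV. ?e $ l * w' l m) x"
        using conn_op_cl[of w' c' ?e x, OF anti'] unfolding cl_axis .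
      have RR: "transpose ?R *v (?R *v ?e) = ?e"
        by (simp add: matrix_vector_mul_assoc rotation_orthogonal[OF a] del: transpose_matrix_vector)
      have aa: "adj a *v (a *v x) = x" by (simp add: matrix_vector_mul_assoc spinc_adj[OF a])
      have "T (\<gamma> k *v x) = \<gamma> k *v T x + cl (transpose ?R *v (R' *v ?e) + transpose ?R *v (\<chi> m. \<Sum>l\<in>UNIV. (?R *v ?e) $ l * w l m)
          - (\<chi> m. \<Sum>l\<in>UNIV. ?e $ l * w' l m)) x"
        unfolding T_def A B C
        unfolding matrix_vector_right_distrib adj_rotation_cl[OF a] RR aa cl_axis cl_linear matrix_vector_mult_diff_distrib
        by (simp only: add_ac diff_conv_add_uminus minus_add_distrib)
      \<comment> \<open>Commutation with the k-th gamma comes down to the transformation law of the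
        Levi-Civita coefficients, which is the hypothesis \<open>w'\<close>.\<close>
      moreover have "transpose ?R *v (R' *v ?e) + transpose ?R *v (\<chi> m. \<Sum>l\<in>UNIV. (?R *v ?e) $ l * w l m)
          - (\<chi> m. \<Sum>l\<in>UNIV. ?e $ l * w' l m) = 0"
      proof -
        have "(transpose ?R *v (R' *v ?e) + transpose ?R *v (\<chi> m. \<Sum>l\<in>UNIV. (?R *v ?e) $ l * w l m)) $ l = w' k l" for l
          by (simp add: w' matrix_vector_mult_basis column_def transpose_def sum.distrib distrib_left
              del: transpose_matrix_vector) (simp add: matrix_vector_mult_def)
        then show ?thesis by (simp add: vec_eq_iff sum_axis)
      qed
      moreover have "cl 0 x = 0" by (simp add: cl_def)
      ultimately show ?thesis by (simp only: add_0_right)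
    qed
  qed
  then obtain \<mu> where \<mu>: "\<And>x. T x = \<mu> *\<^sub>R (\<i> *s x)" by blast
  have "M = mat (\<i> * complex_of_real \<mu>)"
    by (rule matrix_eqI) (simp add: TM[symmetric] \<mu> mat_vector vec_eq_iff complex_eq_iff)
  then have "trace M = \<i> * complex_of_real \<mu> * of_nat CARD('s)" by (simp add: trace_mat)
  moreover have "trace M = trace (adj a ** a') + trace (conn_mat w c) - trace (conn_mat w' c')"
  proof -
    have "trace (adj a ** (conn_mat w c ** a)) = trace (conn_mat w c)"
      using trace_mul_sym[of "adj a" "conn_mat w c ** a"] spinc_adj(2)[OF a]
      by (simp add: matrix_mul_assoc[symmetric])
    then show ?thesis by (simp add: M_def matrix_mult_add trace_sub trace_add)
  qed
  moreover have "trace (adj a ** a') = \<i> * complex_of_real (c' - c) * of_nat CARD('s) / 2"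
    unfolding c' by simp
  ultimately have "\<mu> = 0"
    by (simp add: trace_conn_mat[of w, OF anti] trace_conn_mat[of w', OF anti'] field_simps)
  then have "T y = 0" using \<mu>[of y] by simp
  then have "a *v (adj a *v (a' *v y + conn_op w c (a *v y))) = a *v conn_op w' c' y" by (simp add: T_def)
  then show ?thesis by (simp add: matrix_vector_mul_assoc spinc_adj[OF a])
qed

end

section \<open>The spinor bundle\<close>

locale spinc_structure =
  fixes S :: "('m::{t2_space,second_countable_topology}, 'n::finite, 'p::topological_space,
    'e::euclidean_space, 'q::topological_space, 's::finite) spinc"
  assumes spinc: "spinc_manifold S"
begin

lemma spinc_facts:
  shows "smooth_atlas (base_atlas S)" "riemannian_metric (base_atlas S) (base_metric S)" "clifford_module (gam S)"
    and spin_bundle: "principal_bundle (base_atlas S) (spinc_group (gam S)) (**) (mat 1) (spin_atlas S) (spin_proj S) (spin_act S)"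
    and circ_bundle: "principal_bundle (base_atlas S) {z. norm z = 1} (*) 1 (circ_atlas S) (circ_proj S) (circ_act S)"
    and circ_connection: "circle_connection (circ_atlas S) (circ_act S) (conn S)"
    and theta_frame: "SO_frame (base_atlas S) (base_metric S) (spin_proj S u) (fst (theta S u))"
    and theta_proj: "circ_proj S (snd (theta S u)) = spin_proj S u"
    and theta_smooth1: "c \<in> base_atlas S \<Longrightarrow>
          smooth_map (spin_atlas S) eucl_atlas (spin_proj S -` fst c) (\<lambda>u. fst (theta S u) i c)"
    and theta_smooth2: "smooth_map (spin_atlas S) (circ_atlas S) UNIV (\<lambda>u. snd (theta S u))"
    and theta_act: "a \<in> spinc_group (gam S) \<Longrightarrow> theta S (spin_act S u a) =
            (frame_act (fst (theta S u)) (fst (spinc_xi (gam S) a)),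
             circ_act S (snd (theta S u)) (snd (spinc_xi (gam S) a)))"
  using spinc unfolding spinc_manifold_def by (elim conjE; simp; fail)+

sublocale circle_bundle "base_atlas S" "circ_atlas S" "circ_proj S" "circ_act S" "conn S"
  using spinc_facts(1) circ_bundle circ_connection
  by (intro circle_bundle.intro atlas.intro circle_bundle_axioms.intro) (simp_all add: principal_bundle_def)

sublocale clifford_matrices "gam S"
  by unfold_locales (rule spinc_facts)

sublocale P: atlas "spin_atlas S"
  using spin_bundle by unfold_locales (simp add: principal_bundle_def)

abbreviation "Gr \<equiv> spinc_group (gam S)"
abbreviation "cls \<equiv> spinor_class S"

lemma spin_proj_smooth: "smooth_map (spin_atlas S) (base_atlas S) UNIV (spin_proj S)"
  and spin_act_one: "spin_act S u (mat 1) = u"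
  and spin_act_act: "a \<in> Gr \<Longrightarrow> b \<in> Gr \<Longrightarrow> spin_act S (spin_act S u a) b = spin_act S u (a ** b)"
  and spin_proj_act: "a \<in> Gr \<Longrightarrow> spin_proj S (spin_act S u a) = spin_proj S u"
  using spin_bundle unfolding principal_bundle_def by auto

lemma spin_trivE:
  obtains U s \<tau> where "open U" "x \<in> U" "smooth_map (base_atlas S) (spin_atlas S) U s" "\<And>y. y \<in> U \<Longrightarrow> spin_proj S (s y) = y"
    "smooth_map (spin_atlas S) eucl_atlas (spin_proj S -` U) \<tau>"
    "\<And>u. spin_proj S u \<in> U \<Longrightarrow> \<tau> u \<in> Gr \<and> spin_act S (s (spin_proj S u)) (\<tau> u) = u"
    "\<And>y a. y \<in> U \<Longrightarrow> a \<in> Gr \<Longrightarrow> \<tau> (spin_act S (s y) a) = a"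
proof -
  have "\<forall>x. \<exists>U s \<tau>. open U \<and> x \<in> U \<and> smooth_map (base_atlas S) (spin_atlas S) U s \<and> (\<forall>y\<in>U. spin_proj S (s y) = y) \<and>
        smooth_on_subset (prod_atlas (base_atlas S) eucl_atlas) (spin_atlas S) (U \<times> Gr) (\<lambda>(y, a). spin_act S (s y) a) \<and>
        smooth_map (spin_atlas S) eucl_atlas (spin_proj S -` U) \<tau> \<and>
        (\<forall>u\<in>spin_proj S -` U. \<tau> u \<in> Gr \<and> spin_act S (s (spin_proj S u)) (\<tau> u) = u) \<and>
        (\<forall>y\<in>U. \<forall>a\<in>Gr. \<tau> (spin_act S (s y) a) = a)"
    using spin_bundle unfolding principal_bundle_def by (elim conjE)
  from this[rule_format, of x] show thesis
    by (elim exE conjE, intro that) (assumption | simp)+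
qed

lemma spin_act_free:
  assumes "a \<in> Gr" "b \<in> Gr" "spin_act S u a = spin_act S u b"
  shows "a = b"
proof -
  obtain U s \<tau> where t: "spin_proj S u \<in> U"
    "\<And>u. spin_proj S u \<in> U \<Longrightarrow> \<tau> u \<in> Gr \<and> spin_act S (s (spin_proj S u)) (\<tau> u) = u"
    "\<And>y a. y \<in> U \<Longrightarrow> a \<in> Gr \<Longrightarrow> \<tau> (spin_act S (s y) a) = a"
    using spin_trivE[of "spin_proj S u"] by metis
  have \<tau>: "\<tau> u \<in> Gr" using t by blast
  have "\<tau> (spin_act S u a) = \<tau> u ** a" if "a \<in> Gr" for a
  proof -
    have "spin_act S u a = spin_act S (s (spin_proj S u)) (\<tau> u ** a)"
      using t(2)[OF t(1)] spin_act_act[OF \<tau> that, of "s (spin_proj S u)"] by simp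
    then show ?thesis using t(3)[OF t(1)] spinc_mult[OF \<tau> that] by simp
  qed
  then have "\<tau> u ** a = \<tau> u ** b" using assms by metis
  then have "adj (\<tau> u) ** (\<tau> u ** a) = adj (\<tau> u) ** (\<tau> u ** b)" by simp
  then show ?thesis by (simp add: matrix_mul_assoc spinc_adj[OF \<tau>])
qed

lemma spin_act_trans:
  assumes "spin_proj S u = spin_proj S v"
  shows "\<exists>a\<in>Gr. v = spin_act S u a"
proof -
  obtain U s \<tau> where t: "spin_proj S u \<in> U"
    "\<And>u. spin_proj S u \<in> U \<Longrightarrow> \<tau> u \<in> Gr \<and> spin_act S (s (spin_proj S u)) (\<tau> u) = u"
    using spin_trivE[of "spin_proj S u"] by metis
  have \<tau>: "\<tau> u \<in> Gr" "\<tau> v \<in> Gr" using t assms by auto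
  have "spin_act S u (adj (\<tau> u) ** \<tau> v) = spin_act S (spin_act S (s (spin_proj S u)) (\<tau> u)) (adj (\<tau> u) ** \<tau> v)"
    using t by simp
  also have "\<dots> = spin_act S (s (spin_proj S u)) (\<tau> u ** (adj (\<tau> u) ** \<tau> v))"
    using \<tau> by (intro spin_act_act spinc_mult spinc_adj)
  also have "\<dots> = v" using t(2)[of v] t(1) assms by (simp add: matrix_mul_assoc spinc_adj[OF \<tau>(1)])
  finally show ?thesis using \<tau> by (intro bexI[of _ "adj (\<tau> u) ** \<tau> v"] spinc_mult spinc_adj) simp
qed

lemma class_memE:
  assumes "(v, \<tau>) \<in> cls u \<sigma>"
  obtains a where "a \<in> Gr" "v = spin_act S u a" "a *v \<tau> = \<sigma>"
  using assms unfolding spinor_class_def by blast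

lemma class_memI: "a \<in> Gr \<Longrightarrow> a *v \<tau> = \<sigma> \<Longrightarrow> (spin_act S u a, \<tau>) \<in> cls u \<sigma>"
  unfolding spinor_class_def by blast

lemma class_mem: "a \<in> Gr \<Longrightarrow> (spin_act S u a, \<tau>) \<in> cls u \<sigma> \<longleftrightarrow> a *v \<tau> = \<sigma>"
  using class_memI spin_act_free by (metis class_memE)

lemma class_mem_self: "(u, \<tau>) \<in> cls u \<sigma> \<longleftrightarrow> \<tau> = \<sigma>"
  using class_mem[OF spinc_one, of u \<tau> \<sigma>] by (simp add: spin_act_one)

lemma adj_vec: "a \<in> Gr \<Longrightarrow> adj a *v (a *v x) = x" "a \<in> Gr \<Longrightarrow> a *v (adj a *v x) = x"
  by (simp_all add: matrix_vector_mul_assoc spinc_adj)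

lemma class_act:
  assumes a: "a \<in> Gr"
  shows "cls (spin_act S u a) \<sigma> = cls u (a *v \<sigma>)"
proof (intro equalityI subrelI)
  fix v \<tau> assume "(v, \<tau>) \<in> cls (spin_act S u a) \<sigma>"
  then obtain b where b: "b \<in> Gr" "v = spin_act S (spin_act S u a) b" "b *v \<tau> = \<sigma>" by (rule class_memE)
  then show "(v, \<tau>) \<in> cls u (a *v \<sigma>)"
    using class_memI[OF spinc_mult[OF a b(1)], of \<tau> "a *v \<sigma>" u] by (simp add: spin_act_act[OF a] matrix_vector_mul_assoc[symmetric])
next
  fix v \<tau> assume "(v, \<tau>) \<in> cls u (a *v \<sigma>)"
  then obtain b where b: "b \<in> Gr" "v = spin_act S u b" "b *v \<tau> = a *v \<sigma>" by (rule class_memE)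
  have ab: "adj a ** b \<in> Gr" using a b spinc_mult spinc_adj by blast
  have "(spin_act S (spin_act S u a) (adj a ** b), \<tau>) \<in> cls (spin_act S u a) \<sigma>"
    using b a by (intro class_memI[OF ab]) (simp add: matrix_vector_mul_assoc[symmetric] adj_vec)
  then show "(v, \<tau>) \<in> cls (spin_act S u a) \<sigma>"
    using b(2) a by (simp add: spin_act_act[OF a ab] matrix_mul_assoc spinc_adj)
qed

lemma coord_class: "spinor_coord (cls u \<sigma>) u = \<sigma>"
  unfolding spinor_coord_def class_mem_self by simp

lemma class_inj: "cls u \<sigma> = cls u \<tau> \<longleftrightarrow> \<sigma> = \<tau>"
  by (metis coord_class)

lemma fibre_class:
  assumes "c \<in> spinor_fibre S x" "spin_proj S u = x"
  shows "c = cls u (spinor_coord c u)"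
proof -
  obtain v \<sigma> where c: "c = cls v \<sigma>" "spin_proj S v = x" using assms(1) unfolding spinor_fibre_def by blast
  then obtain a where a: "a \<in> Gr" "v = spin_act S u a" using spin_act_trans[of u v] assms(2) by auto
  then have "c = cls u (a *v \<sigma>)" using c class_act by simp
  then show ?thesis by (simp add: coord_class)
qed

text \<open>An operation on representatives descends to spinors when it is equivariant. Scaling,
  Clifford multiplication and the action of \<Omega> are all of this form.\<close>

lemma class_map:
  assumes "\<And>a \<tau>. a \<in> Gr \<Longrightarrow> a *v F (spin_act S u a) \<tau> = F u (a *v \<tau>)"
  shows "{(v, F v \<tau>) | v \<tau>. (v, \<tau>) \<in> cls u \<sigma>} = cls u (F u \<sigma>)"
proof (intro equalityI subrelI)
  fix v \<tau>' assume "(v, \<tau>') \<in> {(v, F v \<tau>) | v \<tau>. (v, \<tau>) \<in> cls u \<sigma>}"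
  then obtain \<tau> where \<tau>: "\<tau>' = F v \<tau>" "(v, \<tau>) \<in> cls u \<sigma>" by blast
  then obtain a where a: "a \<in> Gr" "v = spin_act S u a" "a *v \<tau> = \<sigma>" by (auto elim: class_memE)
  then show "(v, \<tau>') \<in> cls u (F u \<sigma>)" using assms[OF a(1), of \<tau>] by (simp add: \<tau> class_memI)
next
  fix v \<tau>' assume "(v, \<tau>') \<in> cls u (F u \<sigma>)"
  then obtain a where a: "a \<in> Gr" "v = spin_act S u a" "a *v \<tau>' = F u \<sigma>" by (auto elim: class_memE)
  have "a *v F v (adj a *v \<sigma>) = a *v \<tau>'" using assms[OF a(1), of "adj a *v \<sigma>"] a by (simp add: adj_vec)
  then have "\<tau>' = F v (adj a *v \<sigma>)" by (metis a(1) adj_vec(1))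
  moreover have "(v, adj a *v \<sigma>) \<in> cls u \<sigma>" using a by (simp add: class_memI adj_vec)
  ultimately show "(v, \<tau>') \<in> {(v, F v \<tau>) | v \<tau>. (v, \<tau>) \<in> cls u \<sigma>}" by blast
qed

lemma scale_class: "spinor_scale z (cls u \<sigma>) = cls u (z *s \<sigma>)"
  unfolding spinor_scale_def by (rule class_map) (simp add: mat_vector_vscale)

lemma add_class: "spinor_add (cls u \<sigma>) (cls u \<tau>) = cls u (\<sigma> + \<tau>)"
proof (intro equalityI subrelI)
  fix v \<rho> assume "(v, \<rho>) \<in> spinor_add (cls u \<sigma>) (cls u \<tau>)"
  then obtain \<sigma>' \<tau>' where *: "\<rho> = \<sigma>' + \<tau>'" "(v, \<sigma>') \<in> cls u \<sigma>" "(v, \<tau>') \<in> cls u \<tau>"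
    unfolding spinor_add_def by blast
  obtain a where a: "a \<in> Gr" "v = spin_act S u a" "a *v \<sigma>' = \<sigma>" using *(2) by (rule class_memE)
  then have "a *v \<tau>' = \<tau>" using *(3) class_mem by blast
  then show "(v, \<rho>) \<in> cls u (\<sigma> + \<tau>)" using a * by (simp add: class_memI matrix_vector_right_distrib)
next
  fix v \<rho> assume "(v, \<rho>) \<in> cls u (\<sigma> + \<tau>)"
  then obtain a where a: "a \<in> Gr" "v = spin_act S u a" "a *v \<rho> = \<sigma> + \<tau>" by (rule class_memE)
  have "\<rho> = adj a *v \<sigma> + adj a *v \<tau>" using a by (metis adj_vec(1) matrix_vector_right_distrib)
  moreover have "(v, adj a *v \<sigma>) \<in> cls u \<sigma>" "(v, adj a *v \<tau>) \<in> cls u \<tau>" using a by (simp_all add: class_memI adj_vec)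
  ultimately show "(v, \<rho>) \<in> spinor_add (cls u \<sigma>) (cls u \<tau>)" unfolding spinor_add_def by blast
qed

lemma herm_class: "spinor_herm (cls u \<sigma>) (cls u \<tau>) = hermitian \<sigma> \<tau>"
  unfolding spinor_herm_def
proof (rule the_equality)
  show "\<forall>v \<sigma>' \<tau>'. (v, \<sigma>') \<in> cls u \<sigma> \<and> (v, \<tau>') \<in> cls u \<tau> \<longrightarrow> hermitian \<sigma> \<tau> = hermitian \<sigma>' \<tau>'"
  proof (intro allI impI, elim conjE)
    fix v \<sigma>' \<tau>' assume *: "(v, \<sigma>') \<in> cls u \<sigma>" "(v, \<tau>') \<in> cls u \<tau>"
    obtain a where a: "a \<in> Gr" "v = spin_act S u a" "a *v \<sigma>' = \<sigma>" using *(1) by (rule class_memE)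
    then have "a *v \<tau>' = \<tau>" using *(2) class_mem by blast
    then show "hermitian \<sigma> \<tau> = hermitian \<sigma>' \<tau>'" using hermitian_spinc[OF a(1), of \<sigma>' \<tau>'] a by simp
  qed
qed (use class_mem_self in blast)

lemma norm2_class: "spinor_norm2 (cls u \<sigma>) = \<sigma> \<bullet> \<sigma>"
  by (simp add: spinor_norm2_def herm_class inner_hermitian)

lemma zero_class: "spin_proj S u = x \<Longrightarrow> spinor_zero S x = cls u 0"
proof (intro equalityI subrelI)
  fix v \<tau> assume u: "spin_proj S u = x" and "(v, \<tau>) \<in> spinor_zero S x"
  then have v: "spin_proj S v = x" "\<tau> = 0" unfolding spinor_zero_def by auto
  then obtain a where "a \<in> Gr" "v = spin_act S u a" using spin_act_trans[of u v] u by auto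
  then show "(v, \<tau>) \<in> cls u 0" using v by (simp add: class_memI)
next
  fix v \<tau> assume u: "spin_proj S u = x" and "(v, \<tau>) \<in> cls u 0"
  then obtain a where a: "a \<in> Gr" "v = spin_act S u a" "a *v \<tau> = 0" by (auto elim: class_memE)
  then have "\<tau> = 0" by (metis adj_vec(1) matrix_vector_mult_0_right)
  then show "(v, \<tau>) \<in> spinor_zero S x" using a u spin_proj_act unfolding spinor_zero_def by simp
qed

section \<open>Metric, frames and local sections of the Spin^c bundle\<close>

lemma metric_facts:
  assumes "tangent (base_atlas S) x X" "tangent (base_atlas S) x Y" "tangent (base_atlas S) x Z"
  shows "base_metric S x X Y = base_metric S x Y X"
    "base_metric S x (tadd X Y) Z = base_metric S x X Z + base_metric S x Y Z"
    "base_metric S x (tscale r X) Y = r * base_metric S x X Y"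
  using spinc_facts(2) assms unfolding riemannian_metric_def by blast+

lemma metric_chart:
  assumes c: "c \<in> base_atlas S" "x \<in> fst c" and X: "tangent (base_atlas S) x X" and Y: "tangent (base_atlas S) x Y"
  shows "base_metric S x X Y = X c \<bullet> (gram (base_atlas S) (base_metric S) c (snd c x) *v Y c)"
proof -
  let ?t = "tvec_of (base_atlas S) c x"
  note t = M.tangent_tvec_of[OF c]
  have lin: "linear (\<lambda>v. base_metric S x (?t v) Z)" if "tangent (base_atlas S) x Z" for Z
    using metric_facts t that by (intro linearI) (simp_all add: M.tvec_of_add[OF c] M.tvec_of_scale[OF c])
  have expand: "base_metric S x (?t v) Z = (\<Sum>i\<in>UNIV. v $ i * base_metric S x (?t (axis i 1)) Z)"
    if Z: "tangent (base_atlas S) x Z" for v Z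
  proof -
    have "v = (\<Sum>i\<in>UNIV. v $ i *\<^sub>R axis i 1)"
      by (simp add: vec_eq_iff axis_def if_distrib cong: if_cong)
    then have "base_metric S x (?t v) Z = base_metric S x (?t (\<Sum>i\<in>UNIV. v $ i *\<^sub>R axis i 1)) Z" by simp
    also have "\<dots> = (\<Sum>i\<in>UNIV. v $ i *\<^sub>R base_metric S x (?t (axis i 1)) Z)"
      using linear_sum[OF lin[OF Z], of "\<lambda>i. v $ i *\<^sub>R axis i 1" UNIV] linear_scale[OF lin[OF Z]] by (simp only:)
    finally show ?thesis by simp
  qed
  have "base_metric S x X Y = base_metric S x (?t (X c)) (?t (Y c))"
    using M.tvec_of_self[OF c] X Y by simp
  also have "\<dots> = (\<Sum>i\<in>UNIV. X c $ i * base_metric S x (?t (axis i 1)) (?t (Y c)))"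
    by (rule expand[OF t])
  also have "\<dots> = (\<Sum>i\<in>UNIV. X c $ i * (\<Sum>j\<in>UNIV. Y c $ j * base_metric S x (?t (axis i 1)) (?t (axis j 1))))"
  proof -
    have sym: "base_metric S x (?t v) (?t w) = base_metric S x (?t w) (?t v)" for v w by (rule metric_facts(1)[OF t t t])
    have "base_metric S x (?t v) (?t (Y c)) = (\<Sum>j\<in>UNIV. Y c $ j * base_metric S x (?t v) (?t (axis j 1)))" for v
      unfolding sym[of v "Y c"] expand[OF t, of "Y c"] by (intro sum.cong refl) (metis sym)
    then show ?thesis by (simp only:)
  qed
  finally show ?thesis
    using c by (simp add: inner_vec_def matrix_vector_mult_def gram_def M.chart_inv_chart mult.commute)
qed

lemma frame_tangent: "spin_proj S u = x \<Longrightarrow> tangent (base_atlas S) x (fst (theta S u) i)"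
  and frame_orthonormal: "spin_proj S u = x \<Longrightarrow> base_metric S x (fst (theta S u) i) (fst (theta S u) j) = (if i = j then 1 else 0)"
  using theta_frame[of u] unfolding SO_frame_def orthonormal_frame_def by auto

lemma theta_rotation:
  "a \<in> Gr \<Longrightarrow> fst (theta S (spin_act S u a)) j c = (\<Sum>i\<in>UNIV. rotation a $ i $ j *\<^sub>R fst (theta S u) i c)"
  "a \<in> Gr \<Longrightarrow> snd (theta S (spin_act S u a)) = circ_act S (snd (theta S u)) (charge a)"
  by (simp_all add: theta_act frame_act_def rotation_def charge_def)

lemma frame_coords_act:
  assumes a: "a \<in> Gr" and X: "tangent (base_atlas S) (spin_proj S u) X"
  shows "frame_coords S (spin_act S u a) X = transpose (rotation a) *v frame_coords S u X"
proof -
  define x where "x = spin_proj S u"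
  define c where "c = chart_at (base_atlas S) x"
  have c: "c \<in> base_atlas S" "x \<in> fst c" unfolding c_def by (rule M.chart_at)+
  have x: "spin_proj S u = x" "spin_proj S (spin_act S u a) = x" using spin_proj_act[OF a] by (simp_all add: x_def)
  have X': "tangent (base_atlas S) x X" using X by (simp add: x_def)
  let ?g = "gram (base_atlas S) (base_metric S) c (snd c x)"
  have "frame_coords S (spin_act S u a) X $ j = (\<Sum>i\<in>UNIV. rotation a $ i $ j * frame_coords S u X $ i)" for j
  proof -
    have "frame_coords S (spin_act S u a) X $ j = X c \<bullet> (?g *v (\<Sum>i\<in>UNIV. rotation a $ i $ j *\<^sub>R fst (theta S u) i c))"
      by (simp add: frame_coords_def x metric_chart[OF c X' frame_tangent[OF x(2)]] theta_rotation[OF a])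
    also have "\<dots> = (\<Sum>i\<in>UNIV. rotation a $ i $ j * (X c \<bullet> (?g *v fst (theta S u) i c)))"
      by (simp add: linear_sum[OF matrix_vector_mul_linear] matrix_vector_mult_scaleR inner_sum_right)
    finally show ?thesis by (simp add: frame_coords_def x metric_chart[OF c X' frame_tangent[OF x(1)]])
  qed
  then show ?thesis by (simp add: vec_eq_iff matrix_vector_mult_def transpose_def del: transpose_matrix_vector)
qed

lemma cliff_class:
  assumes X: "tangent (base_atlas S) (spin_proj S u) X"
  shows "cliff_mult S X (cls u \<sigma>) = cls u (cl (frame_coords S u X) \<sigma>)"
  unfolding cliff_mult_def clifford_vec
proof (rule class_map)
  fix a \<tau> assume a: "a \<in> Gr"
  show "a *v cl (frame_coords S (spin_act S u a) X) \<tau> = cl (frame_coords S u X) (a *v \<tau>)"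
    unfolding rotation_cl[OF a] frame_coords_act[OF a X] matrix_vector_mul_assoc rotation_orthogonal[OF a] by simp
qed

lemma local_section_exists: "\<exists>U b. x \<in> U \<and> local_section S U b"
  by (rule spin_trivE[of x]) (auto simp: local_section_def)

text \<open>With the fibre coordinate \<tau> of one trivialisation, the transition function is the
  inverse of \<tau>(b) times \<tau>(b'). The inverse is the adjoint, a linear operation, so
  smoothness is immediate.\<close>

lemma section_transition:
  assumes b: "local_section S U b" "local_section S U' b'" and x: "x \<in> U" "x \<in> U'" and c: "c \<in> base_atlas S" "x \<in> fst c"
  obtains W a where "open W" "x \<in> W" "W \<subseteq> U \<inter> U'" "\<And>y. y \<in> W \<Longrightarrow> a y \<in> Gr \<and> b' y = spin_act S (b y) (a y)"
    "smooth_on (snd c ` (fst c \<inter> W)) (\<lambda>p. a (chart_inv c p))"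
proof -
  obtain V s \<tau> where V: "open V" "x \<in> V" "smooth_map (spin_atlas S) eucl_atlas (spin_proj S -` V) \<tau>"
    "\<And>u. spin_proj S u \<in> V \<Longrightarrow> \<tau> u \<in> Gr \<and> spin_act S (s (spin_proj S u)) (\<tau> u) = u"
    using spin_trivE[of x] by metis
  define W where "W = U \<inter> U' \<inter> V"
  have W: "open W" "x \<in> W" "W \<subseteq> U \<inter> U'"
    using V x b unfolding W_def local_section_def by auto
  define a where "a y = adj (\<tau> (b y)) ** \<tau> (b' y)" for y
  have oV: "open (spin_proj S -` V)"
    using spin_proj_smooth V(1) unfolding smooth_map_def by (simp add: continuous_on_open_vimage)
  have sm: "smooth_on (snd c ` (fst c \<inter> W)) (\<lambda>p. \<tau> (b (chart_inv c p)))" if "local_section S U b" "W \<subseteq> U" for U b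
  proof -
    have "smooth_map (base_atlas S) eucl_atlas W (\<lambda>y. \<tau> (b y))"
    proof (rule smooth_map_compose[OF M.atlas_axioms P.atlas_axioms atlas_eucl W(1) oV _ V(3)])
      show "smooth_map (base_atlas S) (spin_atlas S) W b"
        using that smooth_map_mono unfolding local_section_def by blast
      show "b ` W \<subseteq> spin_proj S -` V" using that unfolding local_section_def W_def by auto
    qed
    from M.smooth_map_eucl[OF this c(1)] show ?thesis by (simp add: o_def)
  qed
  have oW: "open (snd c ` (fst c \<inter> W))" by (rule M.open_chart_Int[OF c(1) W(1)])
  have "smooth_on (snd c ` (fst c \<inter> W)) (\<lambda>p. a (chart_inv c p))"
    unfolding a_def using b W(3)
    by (intro smooth_on_bounded_bilinear[OF bounded_bilinear_matrix_mult] smooth_on_bounded_linear[OF bounded_linear_adj] oW sm) auto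
  moreover have "a y \<in> Gr \<and> b' y = spin_act S (b y) (a y)" if y: "y \<in> W" for y
  proof -
    have "spin_proj S (b y) = y" "spin_proj S (b' y) = y" using y b W(3) unfolding local_section_def by auto
    then have t: "\<tau> (b y) \<in> Gr" "\<tau> (b' y) \<in> Gr" "spin_act S (s y) (\<tau> (b y)) = b y" "spin_act S (s y) (\<tau> (b' y)) = b' y"
      using V(4)[of "b y"] V(4)[of "b' y"] y by (auto simp: W_def)
    have a: "a y \<in> Gr" unfolding a_def using t by (intro spinc_mult spinc_adj)
    have "spin_act S (b y) (a y) = spin_act S (s y) (\<tau> (b y) ** a y)" using spin_act_act[OF t(1) a, of "s y"] t(3) by simp
    also have "\<tau> (b y) ** a y = \<tau> (b' y)" by (simp add: a_def matrix_mul_assoc spinc_adj[OF t(1)])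
    finally show ?thesis using a t by simp
  qed
  ultimately show thesis using that[OF W] by blast
qed

end

section \<open>The covariant derivative in local frames\<close>

text \<open>Naturality of the Lie bracket for related vector fields; the second derivatives of
  \<phi> are symmetric and cancel.\<close>

lemma bracket_transform:
  fixes \<phi> :: "'a::euclidean_space \<Rightarrow> 'b::euclidean_space"
  assumes W: "open W" "p \<in> W" and \<phi>: "smooth_on W \<phi>"
    and X: "X differentiable (at p)" "Y differentiable (at p)"
    and X': "X' differentiable (at (\<phi> p))" "Y' differentiable (at (\<phi> p))"
    and rel: "\<And>z. z \<in> W \<Longrightarrow> X' (\<phi> z) = dd \<phi> z (X z)" "\<And>z. z \<in> W \<Longrightarrow> Y' (\<phi> z) = dd \<phi> z (Y z)"
  shows "dd Y' (\<phi> p) (X' (\<phi> p)) - dd X' (\<phi> p) (Y' (\<phi> p)) = dd \<phi> p (dd Y p (X p) - dd X p (Y p))"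
proof -
  have *: "dd Z' (\<phi> p) (dd \<phi> p v) = dd (\<lambda>z. dd \<phi> z (Z p)) p v + dd \<phi> p (dd Z p v)"
    if Z: "Z differentiable (at p)" and Z': "Z' differentiable (at (\<phi> p))"
      and rel: "\<And>z. z \<in> W \<Longrightarrow> Z' (\<phi> z) = dd \<phi> z (Z z)" for Z Z' v
  proof -
    have "((\<lambda>z. dd \<phi> z (Z z)) has_derivative (\<lambda>v. dd (\<lambda>z. dd \<phi> z (Z p)) p v + dd \<phi> p (dd Z p v))) (at p)"
      by (rule dd_field[OF W linear_dd[OF smooth_on_differentiable[OF \<phi>]]
            smooth_on_differentiable[OF smooth_on_dd[OF \<phi>] W(2)] Z])
    then have "((\<lambda>z. Z' (\<phi> z)) has_derivative (\<lambda>v. dd (\<lambda>z. dd \<phi> z (Z p)) p v + dd \<phi> p (dd Z p v))) (at p)"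
      by (rule has_derivative_cong_open[OF W, rotated]) (simp add: rel)
    from fun_cong[OF has_derivative_unique[OF has_derivative_compose[OF smooth_on_has_derivative[OF \<phi> W(2)] dd_works[OF Z']] this], of v]
    show ?thesis .
  qed
  have lin: "linear (dd \<phi> p)" using \<phi> W linear_dd smooth_on_differentiable by blast
  show ?thesis
    using *[OF X(2) X'(2) rel(2), of "X p"] *[OF X(1) X'(1) rel(1), of "Y p"] dd_dd_commute[OF W(1) \<phi> W(2), of "X p" "Y p"]
    by (simp add: rel[OF W(2)] linear_diff[OF lin])
qed

context frame_geometry begin

lemma cov_linear_vec:
  assumes "y \<in> V" "F differentiable (at y)"
  shows "linear (\<lambda>X. cov y X F)"
  using linear_dd[OF assms(2)]
  by (intro linearI) (simp_all add: cov_def linear_add linear_scale linear_add[OF linear_Gam(2)] linear_scale[OF linear_Gam(2)] scaleR_add_right)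

lemma cov_e_om:
  assumes y: "y \<in> V"
  shows "ip y (cov y X (e j)) (e l y) = (\<Sum>k\<in>UNIV. ip y X (e k y) * om k j l y)"
proof -
  note lin = cov_linear_vec[OF y differentiable_e[OF y]]
  have "cov y X (e j) = cov y (\<Sum>k\<in>UNIV. ip y X (e k y) *\<^sub>R e k y) (e j)"
    by (simp add: frame_expand[OF y, symmetric])
  also have "\<dots> = (\<Sum>k\<in>UNIV. ip y X (e k y) *\<^sub>R cov y (e k y) (e j))"
    by (simp only: linear_sum[OF lin] linear_scale[OF lin])
  finally show ?thesis by (simp add: ip_lin om_def)
qed

end

context spinc_structure begin

text \<open>With \<open>\<theta> \<circ> b = (e,s)\<close>: \<open>wfun\<close> is \<open>g(\<nabla>\<^sub>Xe\<^sub>j, e\<^sub>l)\<close>, \<open>acomp\<close> the component \<open>-i s\<^sup>*A(e\<^sub>k)\<close>, \<open>sh\<close> the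
  function \<open>\<sigma>\<close> with \<open>\<psi> = [b,\<sigma>]\<close>, and \<open>\<nabla>\<^sub>X\<psi> = [b, nabc]\<close>.\<close>

abbreviation "Gm c \<equiv> gram (base_atlas S) (base_metric S) c"

definition E :: "('m \<Rightarrow> 'p) \<Rightarrow> ('m, real^'n) chart \<Rightarrow> 'n \<Rightarrow> real^'n \<Rightarrow> real^'n" where
  "E b c j p = fst (theta S (b (chart_inv c p))) j c"

definition sec :: "('m \<Rightarrow> 'p) \<Rightarrow> 'm \<Rightarrow> 'q" where "sec b y = snd (theta S (b y))"

definition acomp :: "('m \<Rightarrow> 'p) \<Rightarrow> ('m, real^'n) chart \<Rightarrow> 'n \<Rightarrow> real^'n \<Rightarrow> real" where
  "acomp b c k p = Im (conn_form (sec b) c p (E b c k p))"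

definition sh :: "('m \<Rightarrow> 'p) \<Rightarrow> ('m, real^'n) chart \<Rightarrow> ('m \<Rightarrow> ('p, 's) spinor) \<Rightarrow> real^'n \<Rightarrow> complex^'s" where
  "sh b c \<psi> p = spinor_coord (\<psi> (chart_inv c p)) (b (chart_inv c p))"

definition wfun :: "('m \<Rightarrow> 'p) \<Rightarrow> ('m, real^'n) chart \<Rightarrow> real^'n \<Rightarrow> real^'n \<Rightarrow> 'n \<Rightarrow> 'n \<Rightarrow> real" where
  "wfun b c p X j l = frame_geometry.ip (Gm c) p (frame_geometry.cov (Gm c) p X (E b c j)) (E b c l p)"

definition nabc :: "('m \<Rightarrow> 'p) \<Rightarrow> ('m, real^'n) chart \<Rightarrow> ('m \<Rightarrow> ('p, 's) spinor) \<Rightarrow> 'm \<Rightarrow> ('m, real^'n) tvec \<Rightarrow> complex^'s" where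
  "nabc b c \<psi> x X = dd (sh b c \<psi>) (snd c x) (X c)
    + conn_op (wfun b c (snd c x) (X c)) (Im (pull (sec b) x X)) (sh b c \<psi> (snd c x))"

lemma smooth_gram: "c \<in> base_atlas S \<Longrightarrow> smooth_on (snd c ` fst c) (Gm c)"
  unfolding gram_def[abs_def]
  by (intro smooth_on_vec_lambda M.open_chart_image) (use spinc_facts(2) in \<open>auto simp: riemannian_metric_def\<close>)

context
  fixes U b c
  assumes b: "local_section S U b" and c: "c \<in> base_atlas S"
begin

abbreviation (input) "Vc \<equiv> snd c ` (fst c \<inter> U)"

lemma section_facts: "open U" "smooth_map (base_atlas S) (spin_atlas S) U b" "y \<in> U \<Longrightarrow> spin_proj S (b y) = y"
  using b unfolding local_section_def by auto

lemma Vc_facts: "p \<in> Vc \<Longrightarrow> chart_inv c p \<in> U" "p \<in> Vc \<Longrightarrow> chart_inv c p \<in> fst c" "p \<in> Vc \<Longrightarrow> snd c (chart_inv c p) = p"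
  by (auto simp: M.chart_inv_chart[OF c])

lemma open_Vc: "open Vc" by (rule M.open_chart_Int[OF c section_facts(1)])

lemma frame_geom: "frame_geometry Vc (Gm c) (E b c)"
proof
  show "open Vc" by (rule open_Vc)
  show "smooth_on Vc (Gm c)" by (rule smooth_on_mono[OF smooth_gram[OF c]]) auto
  show "Gm c y $ i $ j = Gm c y $ j $ i" if "y \<in> Vc" for y i j
    unfolding gram_def vec_lambda_beta
    by (rule metric_facts(1)) (rule M.tangent_tvec_of[OF c Vc_facts(2)[OF that]])+
  show "smooth_on Vc (E b c i)" for i
  proof -
    have "smooth_map (base_atlas S) eucl_atlas (U \<inter> fst c) (\<lambda>y. fst (theta S (b y)) i c)"
    proof (rule smooth_map_compose[OF M.atlas_axioms P.atlas_axioms atlas_eucl])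
      show "open (U \<inter> fst c)" using section_facts(1) M.open_chart[OF c] by auto
      show "open (spin_proj S -` fst c)"
        using spin_proj_smooth M.open_chart[OF c] unfolding smooth_map_def by (simp add: continuous_on_open_vimage)
      show "smooth_map (base_atlas S) (spin_atlas S) (U \<inter> fst c) b" by (rule smooth_map_mono[OF section_facts(2)]) auto
      show "smooth_map (spin_atlas S) eucl_atlas (spin_proj S -` fst c) (\<lambda>u. fst (theta S u) i c)" by (rule theta_smooth1[OF c])
      show "b ` (U \<inter> fst c) \<subseteq> spin_proj S -` fst c" using section_facts(3) by auto
    qed
    from M.smooth_map_eucl[OF this c] have "smooth_on (snd c ` (fst c \<inter> (U \<inter> fst c))) (E b c i)"
      by (simp add: E_def[abs_def] o_def)
    then show ?thesis by (simp add: Int_ac)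
  qed
  show "E b c i y \<bullet> (Gm c y *v E b c j y) = (if i = j then 1 else 0)" if "y \<in> Vc" for y i j
  proof -
    have x: "chart_inv c y \<in> fst c" "spin_proj S (b (chart_inv c y)) = chart_inv c y" "snd c (chart_inv c y) = y"
      using Vc_facts[OF that] section_facts(3) by auto
    show ?thesis
      using metric_chart[OF c x(1) frame_tangent[OF x(2), of i] frame_tangent[OF x(2), of j]] frame_orthonormal[OF x(2), of i j]
      by (simp add: E_def x(3))
  qed
qed

lemma sec_local: "local_sec U (sec b)"
  unfolding local_sec_def
proof (intro conjI ballI section_facts(1))
  show "smooth_map (base_atlas S) (circ_atlas S) U (sec b)"
    unfolding sec_def by (rule smooth_map_compose[OF M.atlas_axioms P.atlas_axioms Q.atlas_axioms section_facts(1) open_UNIV section_facts(2) theta_smooth2]) auto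
  show "circ_proj S (sec b y) = y" if "y \<in> U" for y using section_facts(3)[OF that] by (simp add: sec_def theta_proj)
qed

lemma spinor_geom: "spinor_geometry Vc (Gm c) (E b c) (\<lambda>i x. gam S i *v x) (\<lambda>x. \<i> *s x) (acomp b c)"
proof -
  interpret FG: frame_geometry Vc "Gm c" "E b c" by (rule frame_geom)
  show ?thesis
  proof
    show "smooth_on Vc (acomp b c k)" for k
      unfolding acomp_def[abs_def]
      by (intro smooth_on_bounded_linear[OF bounded_linear_Im] open_Vc
          smooth_on_field[OF open_Vc linear_conn_form[OF sec_local c] smooth_conn_form[OF sec_local c] FG.smooth_e])
  qed
qed

lemma smooth_sh: "spinor_field S \<psi> \<Longrightarrow> smooth_on Vc (sh b c \<psi>)"
proof -
  assume "spinor_field S \<psi>"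
  then have "smooth_map (base_atlas S) eucl_atlas U (\<lambda>y. spinor_coord (\<psi> y) (b y))"
    using b unfolding spinor_field_def by blast
  from M.smooth_map_eucl[OF this c] show ?thesis by (simp add: sh_def[abs_def] o_def)
qed

lemma psi_sh: "spinor_field S \<psi> \<Longrightarrow> x \<in> U \<Longrightarrow> x \<in> fst c \<Longrightarrow> \<psi> x = cls (b x) (sh b c \<psi> (snd c x))"
  using fibre_class[of "\<psi> x" x "b x"] section_facts(3) by (simp add: sh_def M.chart_inv_chart[OF c] spinor_field_def)

end

text \<open>Isolates the section and the chart selected inside \<open>nabla\<close>, so that
  \<open>nabc_chart\<close> and \<open>nabc_gauge\<close> can replace them by prescribed
  ones.\<close>

lemma nabla_unfold:
  assumes X: "tangent (base_atlas S) x X"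
  obtains U b where "x \<in> U" "local_section S U b" "nabla S \<psi> x X = cls (b x) (nabc b (chart_at (base_atlas S) x) \<psi> x X)"
proof -
  define b where "b = (SOME b. \<exists>U. x \<in> U \<and> local_section S U b)"
  have "\<exists>b U. x \<in> U \<and> local_section S U b" using local_section_exists[of x] by blast
  then have "\<exists>U. x \<in> U \<and> local_section S U b" unfolding b_def by (rule someI_ex)
  then obtain U where U: "x \<in> U" "local_section S U b" by blast
  define c where "c = chart_at (base_atlas S) x"
  have c: "c \<in> base_atlas S" "x \<in> fst c" unfolding c_def by (rule M.chart_at)+
  have xc: "chart_inv c (snd c x) = x" by (rule M.chart_inv_chart[OF c])
  have bx: "spin_proj S (b x) = x" using U unfolding local_section_def by auto
  interpret FG: frame_geometry "snd c ` (fst c \<inter> U)" "Gm c" "E b c" by (rule frame_geom[OF U(2) c(1)])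
  let ?p = "snd c x" and ?s = "sh b c \<psi> (snd c x)"
  have sx: "spinor_coord (\<psi> x) (b x) = ?s" by (simp add: sh_def xc)
  have fc: "frame_coords S (b x) (levi_civita (base_atlas S) (base_metric S) x X (\<lambda>y. fst (theta S (b y)) j)) $ l = wfun b c ?p (X c) j l" for j l
  proof -
    have "levi_civita (base_atlas S) (base_metric S) x X (\<lambda>y. fst (theta S (b y)) j) = tvec_of (base_atlas S) c x (FG.cov ?p (X c) (E b c j))"
      unfolding levi_civita_def Let_def c_def[symmetric] FG.cov_def dir_deriv_def Gam_def symb_def christoffel_def
      by (simp add: E_def[abs_def] o_def xc)
    then show ?thesis
      using metric_chart[OF c M.tangent_tvec_of[OF c] frame_tangent[OF bx, of l]]
      by (simp add: frame_coords_def bx wfun_def FG.ip_def M.tvec_of_chart[OF c] E_def xc)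
  qed
  have "Re (pull (sec b) x X) = 0"
    using Re_conn_form[OF sec_local[OF U(2) c(1)] c(1), of ?p "X c"] pull_conn_form[OF c X, of "sec b"] U(1) c by auto
  then have pl: "(1/2 * pull (sec b) x X) *s ?s = (Im (pull (sec b) x X) / 2) *\<^sub>R (\<i> *s ?s)"
    by (simp add: vec_eq_iff complex_eq_iff)
  have "nabla S \<psi> x X = cls (b x) (dd (sh b c \<psi>) ?p (X c)
      + (1/4) *\<^sub>R (\<Sum>j\<in>UNIV. gam S j *v (clifford (gam S)
               (frame_coords S (b x) (levi_civita (base_atlas S) (base_metric S) x X (\<lambda>y. fst (theta S (b y)) j))) *v ?s))
      + (1/2 * pull (sec b) x X) *s ?s)"
    unfolding nabla_def Let_def b_def[symmetric] dir_deriv_def c_def[symmetric] sx pull_def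
    by (simp add: sh_def[abs_def] sec_def[abs_def] o_def)
  also have "(1/4) *\<^sub>R (\<Sum>j\<in>UNIV. gam S j *v (clifford (gam S)
               (frame_coords S (b x) (levi_civita (base_atlas S) (base_metric S) x X (\<lambda>y. fst (theta S (b y)) j))) *v ?s)) =
      (1/4) *\<^sub>R (\<Sum>j\<in>UNIV. \<Sum>l\<in>UNIV. wfun b c ?p (X c) j l *\<^sub>R (gam S j *v (gam S l *v ?s)))"
    by (simp add: clifford_vec cl_def fc gam_lin)
  finally have "nabla S \<psi> x X = cls (b x) (nabc b c \<psi> x X)"
    unfolding pl nabc_def conn_op_def by (simp add: add.assoc)
  then show thesis using that U by (simp add: c_def)
qed

text \<open>The inhomogeneous transformation law of Christoffel symbols is avoided: by
  \<open>om_koszul\<close> the coefficients depend only on the metric and the brackets of the frame,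
  and both are natural under the transition map.\<close>

lemma wfun_chart:
  assumes b: "local_section S U b" and x: "x \<in> U" and c: "c \<in> base_atlas S" "x \<in> fst c" and d: "d \<in> base_atlas S" "x \<in> fst d"
    and X: "tangent (base_atlas S) x X"
  shows "wfun b d (snd d x) (X d) = wfun b c (snd c x) (X c)"
proof (intro ext)
  fix j l
  interpret C: frame_geometry "snd c ` (fst c \<inter> U)" "Gm c" "E b c" by (rule frame_geom[OF b c(1)])
  interpret D: frame_geometry "snd d ` (fst d \<inter> U)" "Gm d" "E b d" by (rule frame_geom[OF b d(1)])
  let ?p = "snd c x" and ?q = "snd d x"
  have p: "?p \<in> snd c ` (fst c \<inter> U)" and q: "?q \<in> snd d ` (fst d \<inter> U)" using x c d by auto
  have inv: "chart_inv c ?p = x" "chart_inv d ?q = x" using c d M.chart_inv_chart by auto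
  have bx: "spin_proj S (b y) = y" if "y \<in> U" for y using b that unfolding local_section_def by auto
  have tE: "tangent (base_atlas S) y (fst (theta S (b y)) k)" if "y \<in> U" for y k by (rule frame_tangent[OF bx[OF that]])
  define \<phi> where "\<phi> = snd d \<circ> chart_inv c"
  define W where "W = snd c ` (fst c \<inter> (U \<inter> fst d))"
  have U: "open U" using b unfolding local_section_def by auto
  have W: "open W" "?p \<in> W" unfolding W_def using U M.open_chart[OF d(1)] x c d by (auto intro!: M.open_chart_Int[OF c(1)])
  have \<phi>: "smooth_on W \<phi>"
    unfolding \<phi>_def by (rule smooth_on_mono[OF M.transition_smooth[OF c(1) d(1)]]) (auto simp: W_def)
  have \<phi>p: "\<phi> ?p = ?q" by (simp add: \<phi>_def inv)
  have rel: "E b d k (\<phi> z) = dd \<phi> z (E b c k z)" if z: "z \<in> W" for k z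
  proof -
    obtain y where y: "y \<in> fst c" "y \<in> U" "y \<in> fst d" "z = snd c y" using z by (auto simp: W_def)
    show ?thesis
      using M.tangent_change[OF tE[OF y(2), of k] c(1) d(1) y(1,3)] y
      by (simp add: E_def \<phi>_def M.chart_inv_chart[OF c(1)] M.chart_inv_chart[OF d(1)])
  qed
  have ip: "D.ip ?q (dd \<phi> ?p v) (dd \<phi> ?p w) = C.ip ?p v w" for v w
  proof -
    note tv = M.tangent_tvec_of[OF c]
    have "tvec_of (base_atlas S) c x v d = dd \<phi> ?p v" for v using d by (simp add: tvec_of_def \<phi>_def)
    then show ?thesis
      using metric_chart[OF c tv tv, of v w] metric_chart[OF d tv tv, of v w]
      by (simp add: D.ip_def C.ip_def M.tvec_of_chart[OF c])
  qed
  have "D.bracket_coeff k l m ?q = C.bracket_coeff k l m ?p" for k l m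
  proof -
    have "dd (E b d l) ?q (E b d k ?q) - dd (E b d k) ?q (E b d l ?q) = dd \<phi> ?p (dd (E b c l) ?p (E b c k ?p) - dd (E b c k) ?p (E b c l ?p))"
      using bracket_transform[OF W \<phi> C.differentiable_e[OF p, of k] C.differentiable_e[OF p, of l], of "E b d k" "E b d l"]
        D.differentiable_e[OF q] rel by (simp add: \<phi>p)
    then show ?thesis unfolding D.bracket_coeff_def C.bracket_coeff_def using rel[OF W(2), of m] by (simp add: ip \<phi>p)
  qed
  then have om: "D.om k j l ?q = C.om k j l ?p" for k
    using D.om_koszul[OF q, of k j l] C.om_koszul[OF p, of k j l] by simp
  have "D.ip ?q (X d) (E b d k ?q) = C.ip ?p (X c) (E b c k ?p)" for k
    using metric_chart[OF c X tE[OF x]] metric_chart[OF d X tE[OF x]] by (simp add: D.ip_def C.ip_def E_def inv)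
  then show "wfun b d ?q (X d) j l = wfun b c ?p (X c) j l"
    unfolding wfun_def D.cov_e_om[OF q] C.cov_e_om[OF p] by (simp add: om)
qed

lemma nabc_chart:
  assumes b: "local_section S U b" and x: "x \<in> U" and c: "c \<in> base_atlas S" "x \<in> fst c" and d: "d \<in> base_atlas S" "x \<in> fst d"
    and X: "tangent (base_atlas S) x X" and \<psi>: "spinor_field S \<psi>"
  shows "nabc b d \<psi> x X = nabc b c \<psi> x X"
proof -
  have f: "sh b c \<psi> = (\<lambda>y. spinor_coord (\<psi> y) (b y)) \<circ> chart_inv c" for c by (auto simp: sh_def)
  have "sh b c \<psi> differentiable (at (snd c x))"
    by (rule smooth_on_differentiable[OF smooth_sh[OF b c(1) \<psi>]]) (use c x in auto)
  then have "dd (sh b d \<psi>) (snd d x) (X d) = dd (sh b c \<psi>) (snd c x) (X c)"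
    unfolding f by (intro M.chart_deriv[OF c(1) d(1) c(2) d(2) X])
  moreover have "sh b d \<psi> (snd d x) = sh b c \<psi> (snd c x)"
    using M.chart_inv_chart[OF c] M.chart_inv_chart[OF d] by (simp add: sh_def)
  ultimately show ?thesis unfolding nabc_def wfun_chart[OF b x c d X] by simp
qed

text \<open>With b' = b a, the coordinates satisfy \<sigma> = a \<sigma>', and differentiation
  produces a term a' \<sigma>'. The hypotheses of \<open>gauge_transformation\<close> that absorb it
  come from differentiating unitarity of a, its relation to the rotation, the change of frame, and
  its charge.\<close>

lemma nabc_gauge:
  assumes b: "local_section S U b" "local_section S U' b'" and x: "x \<in> U" "x \<in> U'"
    and c: "c \<in> base_atlas S" "x \<in> fst c" and X: "tangent (base_atlas S) x X" and \<psi>: "spinor_field S \<psi>"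
  shows "cls (b x) (nabc b c \<psi> x X) = cls (b' x) (nabc b' c \<psi> x X)"
proof -
  obtain W a where W: "open W" "x \<in> W" "W \<subseteq> U \<inter> U'" and a: "\<And>y. y \<in> W \<Longrightarrow> a y \<in> Gr \<and> b' y = spin_act S (b y) (a y)"
    and sa: "smooth_on (snd c ` (fst c \<inter> W)) (\<lambda>p. a (chart_inv c p))"
    using section_transition[OF b x c] by metis
  have bW: "local_section S W b" "local_section S W b'"
    using b W smooth_map_mono unfolding local_section_def by blast+
  let ?V = "snd c ` (fst c \<inter> W)" and ?p = "snd c x" and ?X = "X c"
  interpret F: frame_geometry ?V "Gm c" "E b c" by (rule frame_geom[OF bW(1) c(1)])
  interpret F': frame_geometry ?V "Gm c" "E b' c" by (rule frame_geom[OF bW(2) c(1)])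
  have p: "?p \<in> ?V" using W c by auto
  note oV = F.open_V
  have xc: "chart_inv c ?p = x" by (rule M.chart_inv_chart[OF c])
  have inV: "chart_inv c q \<in> W" if "q \<in> ?V" for q using that M.chart_inv_chart[OF c(1)] by auto
  define ah where "ah q = a (chart_inv c q)" for q
  have ahG: "ah q \<in> Gr" if "q \<in> ?V" for q using a inV[OF that] by (simp add: ah_def)
  define a0 where "a0 = ah ?p"
  have a0: "a0 \<in> Gr" using ahG[OF p] by (simp add: a0_def)
  define a' where "a' = dd ah ?p"
  have dah: "(ah has_derivative a') (at ?p)"
    unfolding a'_def using smooth_on_has_derivative[OF sa p] by (simp add: ah_def[abs_def])
  have E': "E b' c j q = (\<Sum>i\<in>UNIV. rotation (ah q) $ i $ j *\<^sub>R E b c i q)" if "q \<in> ?V" for j q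
    using a[OF inV[OF that]] by (simp add: E_def ah_def theta_rotation)
  \<comment> \<open>The rotation is recovered from inner products of the two frames, which exhibits
    it as a smooth function although \<open>rotation\<close> is a definite description.\<close>
  define R where "R i j q = F.ip q (E b' c j q) (E b c i q)" for i j q
  have R: "rotation (ah q) $ i $ j = R i j q" if "q \<in> ?V" for i j q
    unfolding R_def E'[OF that] by (simp add: F.ip_lin F.ip_e[OF that] if_distrib cong: if_cong)
  have sR: "smooth_on ?V (R i j)" for i j
    unfolding R_def[abs_def] by (rule F.smooth_ip[OF F'.smooth_e F.smooth_e])
  have dR: "(R i j has_derivative dd (R i j) ?p) (at ?p)" for i j by (rule smooth_on_has_derivative[OF sR p])
  define R' :: "real^'n^'n" where "R' = (\<chi> i j. dd (R i j) ?p ?X)"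
  define w w' c0 c0' where "w = wfun b c ?p ?X" and "w' = wfun b' c ?p ?X"
    and "c0 = Im (pull (sec b) x X)" and "c0' = Im (pull (sec b') x X)"
  have anti: "w j l = - w l j" "w' j l = - w' l j" for j l
    unfolding w_def w'_def wfun_def using F.cov_e_antisym[OF p] F'.cov_e_antisym[OF p] by blast+
  have w': "w' j l = (\<Sum>m\<in>UNIV. rotation a0 $ m $ l * (R' $ m $ j + (\<Sum>i\<in>UNIV. rotation a0 $ i $ j * w i m)))" for j l
  proof -
    have "dd (E b' c j) ?p = dd (\<lambda>q. \<Sum>i\<in>UNIV. R i j q *\<^sub>R E b c i q) ?p"
      by (rule dd_cong_open[OF oV p]) (simp add: E' R)
    also have "\<dots> = (\<lambda>v. \<Sum>i\<in>UNIV. R i j ?p *\<^sub>R dd (E b c i) ?p v + dd (R i j) ?p v *\<^sub>R E b c i ?p)"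
      by (intro dd_eqI has_derivative_sum has_derivative_scaleR dR dd_works F.differentiable_e[OF p])
    finally have "F.cov ?p ?X (E b' c j) = (\<Sum>i\<in>UNIV. R i j ?p *\<^sub>R F.cov ?p ?X (E b c i) + dd (R i j) ?p ?X *\<^sub>R E b c i ?p)"
      using E'[OF p, of j]
      by (simp add: F.cov_def R[OF p] linear_sum[OF linear_Gam(1)] linear_scale[OF linear_Gam(1)] sum.distrib scaleR_add_right)
    then have "F.ip ?p (F.cov ?p ?X (E b' c j)) (E b c m ?p) = (\<Sum>i\<in>UNIV. R i j ?p * w i m) + dd (R m j) ?p ?X" for m
      by (simp add: F.ip_lin w_def wfun_def sum.distrib F.ip_e[OF p] if_distrib cong: if_cong)
    moreover have "w' j l = (\<Sum>m\<in>UNIV. R m l ?p * F.ip ?p (F.cov ?p ?X (E b' c j)) (E b c m ?p))"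
      unfolding w'_def wfun_def using E'[OF p, of l] by (simp add: F.ip_lin R[OF p])
    ultimately show ?thesis by (simp add: a0_def R[OF p] R'_def add.commute)
  qed
  have skew: "adj (a' v) ** a0 + adj a0 ** a' v = 0" for v
  proof -
    have "((\<lambda>q. adj (ah q) ** ah q) has_derivative (\<lambda>v. adj (ah ?p) ** a' v + adj (a' v) ** ah ?p)) (at ?p)"
      by (intro bounded_bilinear.FDERIV[OF bounded_bilinear_matrix_mult] bounded_linear.has_derivative[OF bounded_linear_adj] dah)
    moreover have "((\<lambda>q. adj (ah q) ** ah q) has_derivative (\<lambda>v. 0)) (at ?p)"
      by (rule has_derivative_cong_open[OF oV p _ has_derivative_const]) (simp add: spinc_adj[OF ahG])
    ultimately have "(\<lambda>v. adj (ah ?p) ** a' v + adj (a' v) ** ah ?p) = (\<lambda>v. 0)" by (rule has_derivative_unique)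
    from fun_cong[OF this, of v] show ?thesis by (simp add: a0_def add.commute)
  qed
  have rot: "a' ?X ** clifford (gam S) v = clifford (gam S) (R' *v v) ** a0 + clifford (gam S) (rotation a0 *v v) ** a' ?X" for v
  proof -
    have "((\<lambda>q. ah q ** clifford (gam S) v) has_derivative (\<lambda>u. a' u ** clifford (gam S) v)) (at ?p)"
      by (intro bounded_linear.has_derivative[OF bounded_bilinear.bounded_linear_left[OF bounded_bilinear_matrix_mult]] dah)
    moreover have "((\<lambda>q. ah q ** clifford (gam S) v) has_derivative
        (\<lambda>u. clifford (gam S) (\<chi> i. \<Sum>j\<in>UNIV. R i j ?p * v $ j) ** a' u + clifford (gam S) (\<chi> i. \<Sum>j\<in>UNIV. dd (R i j) ?p u * v $ j) ** ah ?p)) (at ?p)"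
    proof (rule has_derivative_cong_open[OF oV p])
      show "((\<lambda>q. clifford (gam S) (\<chi> i. \<Sum>j\<in>UNIV. R i j q * v $ j) ** ah q) has_derivative
        (\<lambda>u. clifford (gam S) (\<chi> i. \<Sum>j\<in>UNIV. R i j ?p * v $ j) ** a' u + clifford (gam S) (\<chi> i. \<Sum>j\<in>UNIV. dd (R i j) ?p u * v $ j) ** ah ?p)) (at ?p)"
        unfolding clifford_def vec_lambda_beta
        by (intro bounded_bilinear.FDERIV[OF bounded_bilinear_matrix_mult] has_derivative_sum has_derivative_scaleR_left
            has_derivative_mult_left dR dah)
      show "clifford (gam S) (\<chi> i. \<Sum>j\<in>UNIV. R i j q * v $ j) ** ah q = ah q ** clifford (gam S) v" if "q \<in> ?V" for q
        using rotation[OF ahG[OF that], of v] by (simp add: matrix_vector_mult_def R[OF that])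
    qed
    ultimately have "(\<lambda>u. a' u ** clifford (gam S) v) = (\<lambda>u. clifford (gam S) (\<chi> i. \<Sum>j\<in>UNIV. R i j ?p * v $ j) ** a' u + clifford (gam S) (\<chi> i. \<Sum>j\<in>UNIV. dd (R i j) ?p u * v $ j) ** ah ?p)"
      by (rule has_derivative_unique)
    from fun_cong[OF this, of ?X] show ?thesis
      by (simp add: matrix_vector_mult_def R'_def a0_def R[OF p] add.commute)
  qed
  \<comment> \<open>The change of the circle connection is measured twice: by
    \<open>pull_change\<close> for the two sections, and by \<open>charge_derivative\<close> through
    the trace.\<close>
  have charge: "\<i> * complex_of_real (c0' - c0) = 2 / of_nat CARD('s) * trace (adj a0 ** a' ?X)"
  proof -
    have Re0: "Re (trace (adj a0 ** a' v)) = 0" for v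
    proof -
      have "trace (adj (adj a0 ** a' v)) = - trace (adj a0 ** a' v)"
      proof -
        have "trace (adj (a' v) ** a0) + trace (adj a0 ** a' v) = trace (adj (a' v) ** a0 + adj a0 ** a' v)"
          by (rule trace_add[symmetric])
        also have "\<dots> = 0" unfolding skew by (simp add: trace_def)
        finally show ?thesis by (simp add: adj_mult adj_adj eq_neg_iff_add_eq_0)
      qed
      then show ?thesis by (simp add: trace_adj complex_eq_iff)
    qed
    have "((\<lambda>q. charge (ah q)) has_derivative (\<lambda>v. charge a0 * (2 / of_nat CARD('s)) * trace (adj a0 ** a' v))) (at ?p)"
      unfolding a0_def by (rule charge_derivative[OF oV p ahG dah]) (use Re0 in \<open>simp_all add: a0_def\<close>)
    then have dw: "(((\<lambda>y. charge (a y)) \<circ> chart_inv c) has_derivative (\<lambda>v. charge a0 * (2 / of_nat CARD('s)) * trace (adj a0 ** a' v))) (at ?p)"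
      by (simp add: o_def ah_def)
    have "pull (sec b') x X = pull (sec b) x X + cnj (charge (a x)) * (charge a0 * (2 / of_nat CARD('s)) * trace (adj a0 ** a' ?X))"
      by (rule pull_change[OF sec_local[OF bW(1) c(1)] c(1) sec_local[OF bW(2) c(1)] W(2) c(2) X _ _ dw])
        (use a in \<open>auto simp: norm_charge sec_def theta_rotation(2)\<close>)
    moreover have "cnj (charge (a x)) * charge a0 = 1"
      using norm_charge[OF a0] complex_norm_square[of "charge a0"] by (simp add: a0_def ah_def xc mult.commute)
    ultimately have "pull (sec b') x X - pull (sec b) x X = 2 / of_nat CARD('s) * trace (adj a0 ** a' ?X)"
      by (simp add: mult.assoc[symmetric])
    moreover have "Re (pull (sec b) x X) = 0" if "local_section S W b" for b
      using Re_conn_form[OF sec_local[OF that c(1)] c(1) p, of ?X] pull_conn_form[OF c X, of "sec b"] by simp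
    then have "pull (sec b) x X = \<i> * complex_of_real c0" "pull (sec b') x X = \<i> * complex_of_real c0'"
      using bW by (simp_all add: complex_eq_iff c0_def c0'_def)
    ultimately show ?thesis by (simp add: right_diff_distrib)
  qed
  have shs: "sh b c \<psi> q = ah q *v sh b' c \<psi> q" if "q \<in> ?V" for q
  proof -
    let ?y = "chart_inv c q"
    have y: "?y \<in> W" "?y \<in> fst c" "snd c ?y = q" using that M.chart_inv_chart[OF c(1)] by auto
    have "\<psi> ?y = cls (b' ?y) (sh b' c \<psi> q)" "\<psi> ?y = cls (b ?y) (sh b c \<psi> q)"
      using psi_sh[OF bW(2) c(1) \<psi> y(1,2)] psi_sh[OF bW(1) c(1) \<psi> y(1,2)] by (simp_all add: y(3))
    moreover have "cls (b' ?y) (sh b' c \<psi> q) = cls (b ?y) (ah q *v sh b' c \<psi> q)"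
      using a[OF y(1)] class_act[of "ah q" "b ?y"] by (simp add: ah_def)
    ultimately show ?thesis by (metis class_inj)
  qed
  have bbv: "bounded_bilinear ((*v) :: complex^'s^'s \<Rightarrow> complex^'s \<Rightarrow> complex^'s)"
    by (simp add: bilinear_conv_bounded_bilinear[symmetric] bilinear_def linear_mat_vector)
      (auto intro!: linearI simp: matrix_vector_mult_add_rdistrib scaleR_mat_vector)
  have "dd (sh b c \<psi>) ?p = dd (\<lambda>q. ah q *v sh b' c \<psi> q) ?p"
    by (rule dd_cong_open[OF oV p shs])
  also have "\<dots> = (\<lambda>v. ah ?p *v dd (sh b' c \<psi>) ?p v + a' v *v sh b' c \<psi> ?p)"
    by (intro dd_eqI bounded_bilinear.FDERIV[OF bbv] dah smooth_on_has_derivative[OF smooth_sh[OF bW(2) c(1) \<psi>] p])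
  finally have "dd (sh b c \<psi>) ?p ?X = a0 *v dd (sh b' c \<psi>) ?p ?X + a' ?X *v sh b' c \<psi> ?p" by (simp add: a0_def)
  then have "nabc b c \<psi> x X = a0 *v nabc b' c \<psi> x X"
    using gauge_transformation[of a0 "a' ?X" R' w w' c0' c0 "sh b' c \<psi> ?p", OF a0 rot skew anti(1) anti(2) w' charge] shs[OF p]
    by (simp add: nabc_def w_def w'_def c0_def c0'_def a0_def matrix_vector_right_distrib)
  moreover have "cls (b' x) \<sigma> = cls (b x) (a0 *v \<sigma>)" for \<sigma>
    using a[OF W(2)] class_act[of a0 "b x" \<sigma>] by (simp add: a0_def ah_def xc)
  ultimately show ?thesis by simp
qed

lemma nabla_local:
  assumes b: "local_section S U b" "x \<in> U" and c: "c \<in> base_atlas S" "x \<in> fst c" and X: "tangent (base_atlas S) x X"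
    and \<psi>: "spinor_field S \<psi>"
  shows "nabla S \<psi> x X = cls (b x) (nabc b c \<psi> x X)"
proof -
  obtain U0 b0 where b0: "x \<in> U0" "local_section S U0 b0"
    "nabla S \<psi> x X = cls (b0 x) (nabc b0 (chart_at (base_atlas S) x) \<psi> x X)"
    using nabla_unfold[OF X, of \<psi>] by metis
  have "nabc b0 (chart_at (base_atlas S) x) \<psi> x X = nabc b0 c \<psi> x X"
    by (rule nabc_chart[OF b0(2,1) c M.chart_at X \<psi>])
  then show ?thesis using b0(3) nabc_gauge[OF b0(2) b(1) b0(1) b(2) c X \<psi>] by simp
qed

end

lemma orthonormal_sum_squares:
  fixes Q :: "real^'n^'n"
  assumes "Q ** transpose Q = mat 1"
  shows "(\<Sum>i\<in>UNIV. (\<Sum>k\<in>UNIV. Q $ k $ i * v $ k)\<^sup>2) = (\<Sum>k\<in>UNIV. (v $ k)\<^sup>2)"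
proof -
  have "(\<Sum>i\<in>UNIV. (\<Sum>k\<in>UNIV. Q $ k $ i * v $ k)\<^sup>2) = (transpose Q *v v) \<bullet> (transpose Q *v v)"
    by (simp add: inner_vec_def matrix_vector_mult_def transpose_def power2_eq_square del: transpose_matrix_vector)
  also have "\<dots> = v \<bullet> (Q *v (transpose Q *v v))"
    by (metis dot_lmul_matrix transpose_matrix_vector)
  also have "\<dots> = v \<bullet> v" by (simp only: matrix_vector_mul_assoc assms matrix_vector_mul_lid)
  finally show ?thesis by (simp add: inner_vec_def power2_eq_square)
qed

section \<open>Spinor calculus over a chart with a local section\<close>

locale spinc_chart = spinc_structure S
  for S :: "('m::{t2_space,second_countable_topology}, 'n::finite, 'p::topological_space,
    'e::euclidean_space, 'q::topological_space, 's::finite) spinc" +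
  fixes U :: "'m set" and b :: "'m \<Rightarrow> 'p" and c :: "('m, real^'n) chart"
  assumes b: "local_section S U b" and c: "c \<in> base_atlas S"
begin

abbreviation "V \<equiv> snd c ` (fst c \<inter> U)"

sublocale G: spinor_geometry V "Gm c" "E b c" "\<lambda>i x. gam S i *v x" "\<lambda>x. \<i> *s x" "acomp b c"
  by (rule spinor_geom[OF b c])

definition fr :: "'n \<Rightarrow> 'm \<Rightarrow> ('m, real^'n) tvec" where "fr k x = fst (theta S (b x)) k"

lemma fr_c: "x \<in> fst c \<Longrightarrow> fr k x c = E b c k (snd c x)"
  by (simp add: fr_def E_def M.chart_inv_chart[OF c])

lemma proj_b: "x \<in> U \<Longrightarrow> spin_proj S (b x) = x"
  using b unfolding local_section_def by auto

lemma tangent_fr: "x \<in> U \<Longrightarrow> tangent (base_atlas S) x (fr k x)"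
  unfolding fr_def by (rule frame_tangent[OF proj_b])

lemma metric_ip:
  assumes "x \<in> fst c" "tangent (base_atlas S) x X" "tangent (base_atlas S) x Y"
  shows "base_metric S x X Y = G.ip (snd c x) (X c) (Y c)"
  unfolding G.ip_def by (rule metric_chart[OF c assms])

lemma frame_coords_ip:
  assumes "x \<in> fst c" "x \<in> U" "tangent (base_atlas S) x X"
  shows "frame_coords S (b x) X $ k = G.ip (snd c x) (X c) (E b c k (snd c x))"
  using metric_ip[OF assms(1,3) tangent_fr[OF assms(2)], of k] assms(1,2) by (simp add: frame_coords_def proj_b fr_c fr_def[symmetric])

context
  fixes x
  assumes x: "x \<in> fst c" "x \<in> U"
begin

lemma p: "snd c x \<in> V"
  using x by blast

lemma frame_coords_fr: "frame_coords S (b x) (fr k x) = axis k 1"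
  using x by (simp add: vec_eq_iff frame_coords_ip tangent_fr fr_c G.ip_e[OF p] axis_def)

lemma frame_coords_inj:
  assumes "tangent (base_atlas S) x X" "tangent (base_atlas S) x Y" "frame_coords S (b x) X = frame_coords S (b x) Y"
  shows "X = Y"
proof (rule M.tangent_eqI[OF c x(1) assms(1,2)])
  show "X c = Y c"
    by (rule G.frame_eqI[OF p]) (metis assms frame_coords_ip x)
qed

lemma metric_frame_coords:
  assumes "tangent (base_atlas S) x X" "tangent (base_atlas S) x Y"
  shows "base_metric S x X Y = frame_coords S (b x) X \<bullet> frame_coords S (b x) Y"
  using metric_ip[OF x(1) assms] G.ip_frame_sum[OF p, of "X c" "Y c"] assms x by (simp add: frame_coords_ip inner_vec_def)

definition of_coords :: "real^'n \<Rightarrow> ('m, real^'n) tvec" where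
  "of_coords v = tvec_of (base_atlas S) c x (\<Sum>k\<in>UNIV. v $ k *\<^sub>R E b c k (snd c x))"

lemma tangent_of_coords: "tangent (base_atlas S) x (of_coords v)"
  unfolding of_coords_def by (rule M.tangent_tvec_of[OF c x(1)])

lemma frame_coords_of_coords: "frame_coords S (b x) (of_coords v) = v"
  using x by (simp add: vec_eq_iff frame_coords_ip[OF x tangent_of_coords])
    (simp add: of_coords_def M.tvec_of_chart[OF c] G.ip_lin G.ip_e[OF p] if_distrib cong: if_cong)

lemma chart_frame_coords: "tangent (base_atlas S) x X \<Longrightarrow> X c = (\<Sum>k\<in>UNIV. frame_coords S (b x) X $ k *\<^sub>R E b c k (snd c x))"
  using G.frame_expand[OF p, of "X c"] by (simp add: frame_coords_ip x)

lemma nabla_frame: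
  assumes X: "tangent (base_atlas S) x X" and \<psi>: "spinor_field S \<psi>"
  shows "nabla S \<psi> x X = cls (b x) (\<Sum>k\<in>UNIV. frame_coords S (b x) X $ k *\<^sub>R G.nab k (sh b c \<psi>) (snd c x))"
proof -
  let ?v = "frame_coords S (b x) X" and ?p = "snd c x" and ?s = "sh b c \<psi>"
  have d: "linear (dd ?s ?p)" using linear_dd smooth_on_differentiable[OF smooth_sh[OF b c \<psi>] p] by blast
  have f: "linear (conn_form (sec b) c ?p)" by (rule linear_conn_form[OF sec_local[OF b c] c p])
  have "dd ?s ?p (X c) = (\<Sum>k\<in>UNIV. ?v $ k *\<^sub>R dd ?s ?p (E b c k ?p))"
    unfolding chart_frame_coords[OF X] by (simp add: linear_sum[OF d] linear_scale[OF d])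
  moreover have "wfun b c ?p (X c) = (\<lambda>j l. \<Sum>k\<in>UNIV. ?v $ k * G.om k j l ?p)"
    by (intro ext) (simp add: wfun_def G.cov_e_om[OF p] frame_coords_ip[OF x X])
  moreover have "Im (pull (sec b) x X) = (\<Sum>k\<in>UNIV. ?v $ k * acomp b c k ?p)"
    unfolding pull_conn_form[OF c x(1) X] chart_frame_coords[OF X] acomp_def
    by (simp add: linear_sum[OF f] linear_scale[OF f])
  moreover have "conn_op (\<lambda>j l. \<Sum>k\<in>UNIV. ?v $ k * G.om k j l ?p) (\<Sum>k\<in>UNIV. ?v $ k * acomp b c k ?p) (?s ?p) =
      (\<Sum>k\<in>UNIV. ?v $ k *\<^sub>R G.conn k ?p (?s ?p))"
  proof -
    have 1: "conn_op (\<lambda>i j. w i j + r * w' i j) (u + r * u') y = conn_op w u y + r *\<^sub>R conn_op w' u' y" for w w' u u' r y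
      by (simp add: conn_op_def scaleR_add_left scaleR_add_right sum.distrib scaleR_sum_right add_divide_distrib mult_ac)
    have 0: "conn_op (\<lambda>i j. 0) 0 y = 0" for y by (simp add: conn_op_def)
    have "conn_op (\<lambda>j l. \<Sum>k\<in>K. ?v $ k * G.om k j l ?p) (\<Sum>k\<in>K. ?v $ k * acomp b c k ?p) (?s ?p) =
      (\<Sum>k\<in>K. ?v $ k *\<^sub>R G.conn k ?p (?s ?p))" if "finite K" for K
      using that
    proof induction
      case (insert k K)
      then show ?case
        using 1[of "\<lambda>j l. \<Sum>k\<in>K. ?v $ k * G.om k j l ?p" "?v $ k" "\<lambda>j l. G.om k j l ?p" "\<Sum>k\<in>K. ?v $ k * acomp b c k ?p" "acomp b c k ?p"]
        by (simp add: add.commute)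
    qed (simp add: 0)
    then show ?thesis by simp
  qed
  ultimately have "nabc b c \<psi> x X = (\<Sum>k\<in>UNIV. ?v $ k *\<^sub>R G.nab k ?s ?p)"
    unfolding nabc_def G.nab_def by (simp add: scaleR_add_right sum.distrib)
  then show ?thesis using nabla_local[OF b x(2) c x(1) X \<psi>] by simp
qed

text \<open>The frame selected inside \<open>dirac\<close> is a rotation of that of b; the Clifford
  contraction is invariant because the adjoint of a intertwines both Clifford actions.\<close>

lemma dirac_local:
  assumes \<psi>: "spinor_field S \<psi>"
  shows "dirac S \<psi> x = cls (b x) (\<Sum>k\<in>UNIV. gam S k *v G.nab k (sh b c \<psi>) (snd c x))"
proof -
  define u where "u = (SOME u. spin_proj S u = x)"
  have u: "spin_proj S u = x" unfolding u_def by (rule someI[of _ "b x"]) (rule proj_b[OF x(2)])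
  obtain a where a: "a \<in> Gr" "u = spin_act S (b x) a" using spin_act_trans[of "b x" u] u proj_b[OF x(2)] by auto
  let ?D = "\<lambda>k. G.nab k (sh b c \<psi>) (snd c x)"
  have act: "cls (b x) \<sigma> = cls u (adj a *v \<sigma>)" for \<sigma>
    unfolding a(2) class_act[OF a(1)] by (simp add: adj_vec a(1))
  have coords: "frame_coords S (b x) (fst (theta S u) i) $ k = rotation a $ k $ i" for i k
  proof -
    have t: "tangent (base_atlas S) x (fst (theta S u) i)" by (rule frame_tangent[OF u])
    have "fst (theta S u) i c = (\<Sum>k\<in>UNIV. rotation a $ k $ i *\<^sub>R E b c k (snd c x))"
      unfolding a(2) theta_rotation(1)[OF a(1)] using fr_c[OF x(1)] by (simp add: fr_def)
    then show ?thesis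
      by (simp add: frame_coords_ip[OF x t] G.ip_lin G.ip_e[OF p] if_distrib cong: if_cong)
  qed
  have "spinor_coord (nabla S \<psi> x (fst (theta S u) i)) u = (\<Sum>k\<in>UNIV. rotation a $ k $ i *\<^sub>R (adj a *v ?D k))" for i
    unfolding nabla_frame[OF frame_tangent[OF u] \<psi>] act coord_class coords
    by (simp add: linear_sum[OF linear_mat_vector] mat_vector_scaleR)
  then have "(\<Sum>i\<in>UNIV. gam S i *v spinor_coord (nabla S \<psi> x (fst (theta S u) i)) u) =
      (\<Sum>i\<in>UNIV. \<Sum>k\<in>UNIV. rotation a $ k $ i *\<^sub>R (gam S i *v (adj a *v ?D k)))"
    by (simp add: gam_lin)
  also have "\<dots> = (\<Sum>k\<in>UNIV. cl (transpose (rotation a) *v axis k 1) (adj a *v ?D k))"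
    by (subst sum.swap) (simp add: cl_def matrix_vector_mult_def transpose_def sum_axis del: transpose_matrix_vector)
  also have "\<dots> = adj a *v (\<Sum>k\<in>UNIV. gam S k *v ?D k)"
    by (simp only: adj_rotation_cl[OF a(1), symmetric] cl_axis linear_sum[OF linear_mat_vector])
  finally show ?thesis unfolding dirac_def Let_def u_def[symmetric] act by simp
qed

lemma sh_zero: "spinor_field S \<psi> \<Longrightarrow> \<psi> x = spinor_zero S x \<longleftrightarrow> sh b c \<psi> (snd c x) = 0"
  using psi_sh[OF b c _ x(2,1), of \<psi>] zero_class[OF proj_b[OF x(2)]] by (simp add: class_inj)

lemma sh_norm2: "spinor_field S \<psi> \<Longrightarrow> spinor_norm2 (\<psi> x) = sh b c \<psi> (snd c x) \<bullet> sh b c \<psi> (snd c x)"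
  using psi_sh[OF b c _ x(2,1), of \<psi>] by (simp add: norm2_class)

end

lemma eigenspinor_chart:
  assumes "eigenspinor S (complex_of_real lam) \<psi>" "y \<in> V"
  shows "(\<Sum>k\<in>UNIV. gam S k *v G.nab k (sh b c \<psi>) y) = lam *\<^sub>R sh b c \<psi> y"
proof -
  obtain x where x: "x \<in> fst c" "x \<in> U" "y = snd c x" using assms(2) by blast
  have \<psi>: "spinor_field S \<psi>" and "dirac S \<psi> x = spinor_scale (complex_of_real lam) (\<psi> x)"
    using assms(1) unfolding eigenspinor_def by auto
  then have "cls (b x) (\<Sum>k\<in>UNIV. gam S k *v G.nab k (sh b c \<psi>) y) = cls (b x) (complex_of_real lam *s sh b c \<psi> y)"
    using dirac_local[OF x(1,2) \<psi>] psi_sh[OF b c \<psi> x(2,1)] by (simp add: scale_class x(3))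
  then show ?thesis by (simp add: class_inj vec_eq_iff complex_eq_iff)
qed

end

section \<open>The curvature form and the endomorphism \<open>\<ell>\<^sup>\<psi>\<close> in local frames\<close>

lemma sum_swap4: "(\<Sum>i\<in>A. \<Sum>j\<in>B. \<Sum>k\<in>C. \<Sum>l\<in>D. h i j k l) = (\<Sum>k\<in>C. \<Sum>l\<in>D. \<Sum>i\<in>A. \<Sum>j\<in>B. h i j k l)"
proof -
  have "(\<Sum>i\<in>A. \<Sum>j\<in>B. \<Sum>k\<in>C. \<Sum>l\<in>D. h i j k l) = (\<Sum>i\<in>A. \<Sum>k\<in>C. \<Sum>j\<in>B. \<Sum>l\<in>D. h i j k l)"
    by (intro sum.cong refl sum.swap)
  also have "\<dots> = (\<Sum>k\<in>C. \<Sum>i\<in>A. \<Sum>j\<in>B. \<Sum>l\<in>D. h i j k l)" by (rule sum.swap)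
  also have "\<dots> = (\<Sum>k\<in>C. \<Sum>l\<in>D. \<Sum>i\<in>A. \<Sum>j\<in>B. h i j k l)"
    by (intro sum.cong refl trans[OF sum.cong[OF refl sum.swap] sum.swap])
  finally show ?thesis .
qed

context spinc_chart begin

context
  fixes x
  assumes x: "x \<in> fst c" "x \<in> U"
begin

lemma curv_chart:
  assumes X: "tangent (base_atlas S) x X" and Y: "tangent (base_atlas S) x Y"
  shows "curv S x X Y = Im (dd (\<lambda>z. conn_form (sec b) c z (Y c)) (snd c x) (X c) - dd (\<lambda>z. conn_form (sec b) c z (X c)) (snd c x) (Y c))"
proof -
  note cf = curvature_form[OF sec_local[OF b c] c x(2,1) X Y]
  let ?C = "curvature_at (sec b) c x X Y"
  have C: "?C = \<i> * complex_of_real (Im ?C)" using cf(1) by (simp add: complex_eq_iff)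
  have "curv S x X Y = Im ?C"
    unfolding curv_def
  proof (rule the_equality)
    show "\<forall>q v w. circ_proj S q = x \<longrightarrow> tangent (circ_atlas S) q v \<longrightarrow> tangent (circ_atlas S) q w \<longrightarrow>
     push (circ_atlas S) (base_atlas S) (circ_proj S) q v = X \<longrightarrow>
     push (circ_atlas S) (base_atlas S) (circ_proj S) q w = Y \<longrightarrow>
     ext_deriv (circ_atlas S) (conn S) q v w = \<i> * complex_of_real (Im ?C)"
      using cf(2) C by metis
  next
    fix r assume r: "\<forall>q v w. circ_proj S q = x \<longrightarrow> tangent (circ_atlas S) q v \<longrightarrow> tangent (circ_atlas S) q w \<longrightarrow>
     push (circ_atlas S) (base_atlas S) (circ_proj S) q v = X \<longrightarrow>
     push (circ_atlas S) (base_atlas S) (circ_proj S) q w = Y \<longrightarrow>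
     ext_deriv (circ_atlas S) (conn S) q v w = \<i> * complex_of_real r"
    obtain q v w where q: "circ_proj S q = x" "tangent (circ_atlas S) q v" "tangent (circ_atlas S) q w"
        "push (circ_atlas S) (base_atlas S) (circ_proj S) q v = X" "push (circ_atlas S) (base_atlas S) (circ_proj S) q w = Y"
      using cf(3) by blast
    then have "?C = \<i> * complex_of_real r" using r cf(2)[OF q] by simp
    then show "r = Im ?C" by simp
  qed
  then show ?thesis unfolding curvature_at_def[OF sec_local[OF b c] c] .
qed

text \<open>\<open>curv_chart\<close> differentiates along constant coordinate fields,
  \<open>curvF\<close> along frame fields; the bracket term in \<open>curvF\<close> compensates
  exactly the derivatives of the frame.\<close>

lemma curv_frame:
  assumes X: "tangent (base_atlas S) x X" and Y: "tangent (base_atlas S) x Y"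
  shows "curv S x X Y = (\<Sum>k\<in>UNIV. \<Sum>l\<in>UNIV. frame_coords S (b x) X $ k * frame_coords S (b x) Y $ l * G.curvF k l (snd c x))"
proof -
  let ?p = "snd c x" and ?f = "conn_form (sec b) c" and ?e = "\<lambda>k. E b c k (snd c x)"
  note p = p[OF x] and ps = smooth_conn_form[OF sec_local[OF b c] c]
  define C where "C v w = dd (\<lambda>z. ?f z w) ?p v" for v w
  have lin: "linear (?f z)" if "z \<in> V" for z by (rule linear_conn_form[OF sec_local[OF b c] c that])
  have df: "(\<lambda>z. ?f z w) differentiable (at ?p)" for w by (rule smooth_on_differentiable[OF ps p])
  have C1: "linear (\<lambda>v. C v w)" for w unfolding C_def using linear_dd[OF df] .
  have C2: "C v (\<Sum>l\<in>UNIV. y l *\<^sub>R ?e l) = (\<Sum>l\<in>UNIV. y l *\<^sub>R C v (?e l))" for v y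
  proof -
    have "dd (\<lambda>z. ?f z (\<Sum>l\<in>UNIV. y l *\<^sub>R ?e l)) ?p = dd (\<lambda>z. \<Sum>l\<in>UNIV. y l *\<^sub>R ?f z (?e l)) ?p"
      by (rule dd_cong_open[OF G.open_V p]) (simp add: linear_sum[OF lin] linear_scale[OF lin])
    also have "\<dots> = (\<lambda>v. \<Sum>l\<in>UNIV. y l *\<^sub>R C v (?e l))"
      unfolding C_def by (intro dd_eqI has_derivative_sum has_derivative_scaleR_right dd_works df)
    finally show ?thesis unfolding C_def by (rule fun_cong)
  qed
  have CC: "C (\<Sum>k\<in>UNIV. v k *\<^sub>R ?e k) (\<Sum>l\<in>UNIV. y l *\<^sub>R ?e l) = (\<Sum>k\<in>UNIV. \<Sum>l\<in>UNIV. (v k * y l) *\<^sub>R C (?e k) (?e l))" for v y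
    by (simp add: C2 linear_sum[OF C1] linear_scale[OF C1] scaleR_sum_right) (subst sum.swap, simp add: mult.commute)
  have F: "Im (C (?e k) (?e l) - C (?e l) (?e k)) = G.curvF k l ?p" for k l
  proof -
    have "dd (acomp b c l) ?p v = Im (C v (?e l)) + Im (?f ?p (dd (E b c l) ?p v))" for l v
    proof -
      have "(acomp b c l has_derivative (\<lambda>X. Im (dd (\<lambda>z. ?f z (?e l)) ?p X + ?f ?p (dd (E b c l) ?p X)))) (at ?p)"
        unfolding acomp_def[abs_def]
        by (rule bounded_linear.has_derivative[OF bounded_linear_Im dd_field[OF G.open_V p lin df G.differentiable_e[OF p]]])
      from dd_eqI[OF this] show ?thesis by (simp add: C_def)
    qed
    moreover have "?f ?p (dd (E b c l) ?p (?e k)) - ?f ?p (dd (E b c k) ?p (?e l)) = ?f ?p (\<Sum>m\<in>UNIV. (G.om k l m ?p - G.om l k m ?p) *\<^sub>R ?e m)"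
      by (simp add: linear_diff[OF lin[OF p], symmetric] G.bracket_e[OF p])
    then have "Im (?f ?p (dd (E b c l) ?p (?e k))) - Im (?f ?p (dd (E b c k) ?p (?e l))) = (\<Sum>m\<in>UNIV. (G.om k l m ?p - G.om l k m ?p) * acomp b c m ?p)"
      by (simp add: linear_sum[OF lin[OF p]] linear_scale[OF lin[OF p]] acomp_def flip: minus_complex.sel)
    ultimately show ?thesis unfolding G.curvF_def by simp
  qed
  let ?v = "\<lambda>k. frame_coords S (b x) X $ k" and ?w = "\<lambda>k. frame_coords S (b x) Y $ k"
  have "curv S x X Y = Im (C (\<Sum>k\<in>UNIV. ?v k *\<^sub>R ?e k) (\<Sum>l\<in>UNIV. ?w l *\<^sub>R ?e l) - C (\<Sum>k\<in>UNIV. ?w k *\<^sub>R ?e k) (\<Sum>l\<in>UNIV. ?v l *\<^sub>R ?e l))"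
    unfolding curv_chart[OF X Y] C_def[symmetric] chart_frame_coords[OF x X, symmetric] chart_frame_coords[OF x Y, symmetric] ..
  also have "C (\<Sum>k\<in>UNIV. ?w k *\<^sub>R ?e k) (\<Sum>l\<in>UNIV. ?v l *\<^sub>R ?e l) = (\<Sum>k\<in>UNIV. \<Sum>l\<in>UNIV. (?v k * ?w l) *\<^sub>R C (?e l) (?e k))"
    unfolding CC by (subst sum.swap) (simp add: mult.commute)
  finally show ?thesis
    unfolding CC F[symmetric] by (simp add: sum_subtractf[symmetric] scaleR_diff_right[symmetric])
qed

lemma curv_self: "tangent (base_atlas S) x X \<Longrightarrow> curv S x X X = 0"
  by (simp add: curv_chart)

text \<open>\<open>frame_at\<close> is orthonormal but of unspecified orientation, so it is compared
  with the frame of b through an orthogonal matrix.\<close>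

lemma frame_at_coords:
  obtains Q :: "real^'n^'n" where "Q ** transpose Q = mat 1" "\<And>i. tangent (base_atlas S) x (frame_at S x i)"
    "\<And>i k. frame_coords S (b x) (frame_at S x i) $ k = Q $ k $ i"
proof -
  have "orthonormal_frame (base_atlas S) (base_metric S) x (fst (theta S (b x)))"
    using theta_frame[of "b x"] proj_b[OF x(2)] unfolding SO_frame_def by simp
  then have f: "orthonormal_frame (base_atlas S) (base_metric S) x (frame_at S x)" unfolding frame_at_def
    by (rule someI[of "orthonormal_frame (base_atlas S) (base_metric S) x"])
  define Q :: "real^'n^'n" where "Q = (\<chi> k i. frame_coords S (b x) (frame_at S x i) $ k)"
  have "(transpose Q ** Q) $ i $ j = mat 1 $ i $ j" for i j
    using f metric_frame_coords[OF x, of "frame_at S x i" "frame_at S x j"]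
    by (simp add: orthonormal_frame_def Q_def matrix_matrix_mult_def transpose_def mat_def inner_vec_def)
  then have "transpose Q ** Q = mat 1" by (simp add: vec_eq_iff)
  then show thesis
    using f by (intro that[of Q]) (simp_all add: matrix_left_right_inverse Q_def orthonormal_frame_def)
qed

lemma sum_offdiag: "(\<And>i. h i i = 0) \<Longrightarrow> (\<Sum>i\<in>UNIV. \<Sum>j\<in>UNIV - {i}. h i j) = (\<Sum>i\<in>(UNIV::'n set). \<Sum>j\<in>(UNIV::'n set). h i j :: 'z::comm_monoid_add)"
  by (intro sum.cong refl sum.mono_neutral_left) auto

text \<open>The Frobenius norm is invariant under an orthogonal matrix acting on one index; this is
  applied to each of the two indices.\<close>

lemma curv_norm_frame: "(curv_norm S x)\<^sup>2 = (\<Sum>k\<in>UNIV. \<Sum>l\<in>UNIV. (G.curvF k l (snd c x))\<^sup>2) / 2" "curv_norm S x \<ge> 0"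
proof -
  obtain Q :: "real^'n^'n" where Q: "Q ** transpose Q = mat 1" "\<And>i. tangent (base_atlas S) x (frame_at S x i)"
    "\<And>i k. frame_coords S (b x) (frame_at S x i) $ k = Q $ k $ i" by (rule frame_at_coords) blast
  let ?F = "\<lambda>k l. G.curvF k l (snd c x)" and ?c = "\<lambda>i j. curv S x (frame_at S x i) (frame_at S x j)"
  have c: "?c i j = (\<Sum>k\<in>UNIV. Q $ k $ i * (\<chi> k. \<Sum>l\<in>UNIV. Q $ l $ j * ?F k l) $ k)" for i j
    by (simp add: curv_frame[OF Q(2) Q(2)] Q(3) sum_distrib_left mult.assoc)
  have "(\<Sum>i\<in>UNIV. \<Sum>j\<in>UNIV. (?c i j)\<^sup>2) = (\<Sum>j\<in>UNIV. \<Sum>i\<in>UNIV. (?c i j)\<^sup>2)" by (rule sum.swap)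
  also have "\<dots> = (\<Sum>j\<in>UNIV. \<Sum>k\<in>UNIV. (\<Sum>l\<in>UNIV. Q $ l $ j * (\<chi> l. ?F k l) $ l)\<^sup>2)"
    unfolding c orthonormal_sum_squares[OF Q(1)] by simp
  also have "\<dots> = (\<Sum>k\<in>UNIV. \<Sum>j\<in>UNIV. (\<Sum>l\<in>UNIV. Q $ l $ j * (\<chi> l. ?F k l) $ l)\<^sup>2)" by (rule sum.swap)
  also have "\<dots> = (\<Sum>k\<in>UNIV. \<Sum>l\<in>UNIV. (?F k l)\<^sup>2)"
    unfolding orthonormal_sum_squares[OF Q(1)] by simp
  finally show "(curv_norm S x)\<^sup>2 = (\<Sum>k\<in>UNIV. \<Sum>l\<in>UNIV. (?F k l)\<^sup>2) / 2"
    unfolding curv_norm_def by (subst sum_offdiag) (simp_all add: curv_self Q sum_nonneg)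
  show "curv_norm S x \<ge> 0" unfolding curv_norm_def by (simp add: sum_nonneg)
qed

lemma curv_mult_frame:
  "curv_mult S x (cls (b x) \<sigma>) =
    cls (b x) ((1/2) *\<^sub>R (\<Sum>k\<in>UNIV. \<Sum>l\<in>UNIV. G.curvF k l (snd c x) *\<^sub>R (gam S k *v (gam S l *v \<sigma>))))"
proof -
  let ?K = "\<lambda>k l. G.curvF k l (snd c x)" and ?e = "\<lambda>u i. fst (theta S u) i"
  define F where "F u \<sigma> = (1/2) *\<^sub>R (\<Sum>i\<in>UNIV. \<Sum>j\<in>UNIV - {i}. curv S x (?e u i) (?e u j) *\<^sub>R (gam S i *v (gam S j *v \<sigma>)))" for u \<sigma>
  \<comment> \<open>In any representative over x, the operator is rewritten with the components of
    \<Omega> in the fixed frame of b; only the Clifford factors are rotated, which makes its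
    equivariance visible.\<close>
  have F: "F (spin_act S (b x) a) \<tau> = (1/2) *\<^sub>R (\<Sum>k\<in>UNIV. \<Sum>l\<in>UNIV. ?K k l *\<^sub>R
      cl (transpose (rotation a) *v axis k 1) (cl (transpose (rotation a) *v axis l 1) \<tau>))" if a: "a \<in> Gr" for a \<tau>
  proof -
    let ?u = "spin_act S (b x) a"
    have u: "spin_proj S ?u = x" by (simp add: spin_proj_act[OF a] proj_b[OF x(2)])
    have R: "transpose (rotation a) *v axis k 1 = (\<chi> i. rotation a $ k $ i)" for k
      by (simp add: vec_eq_iff matrix_vector_mult_def transpose_def sum_axis del: transpose_matrix_vector)
    have coords: "frame_coords S (b x) (?e ?u i) $ k = rotation a $ k $ i" for i k
      unfolding frame_coords_ip[OF x frame_tangent[OF u]] theta_rotation(1)[OF a] fr_def[symmetric] fr_c[OF x(1)]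
      by (simp add: G.ip_lin G.ip_e[OF p[OF x]] if_distrib cong: if_cong)
    have "F ?u \<tau> = (1/2) *\<^sub>R (\<Sum>i\<in>UNIV. \<Sum>j\<in>UNIV. curv S x (?e ?u i) (?e ?u j) *\<^sub>R (gam S i *v (gam S j *v \<tau>)))"
      unfolding F_def by (subst sum_offdiag) (simp_all add: curv_self[OF frame_tangent[OF u]])
    also have "(\<Sum>i\<in>UNIV. \<Sum>j\<in>UNIV. curv S x (?e ?u i) (?e ?u j) *\<^sub>R (gam S i *v (gam S j *v \<tau>))) =
        (\<Sum>i\<in>UNIV. \<Sum>j\<in>UNIV. \<Sum>k\<in>UNIV. \<Sum>l\<in>UNIV. (rotation a $ k $ i * rotation a $ l $ j * ?K k l) *\<^sub>R (gam S i *v (gam S j *v \<tau>)))"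
      unfolding curv_frame[OF frame_tangent[OF u] frame_tangent[OF u]] coords by (simp only: scaleR_sum_left)
    also have "\<dots> = (\<Sum>k\<in>UNIV. \<Sum>l\<in>UNIV. \<Sum>i\<in>UNIV. \<Sum>j\<in>UNIV. (rotation a $ k $ i * rotation a $ l $ j * ?K k l) *\<^sub>R (gam S i *v (gam S j *v \<tau>)))"
      by (rule sum_swap4)
    also have "\<dots> = (\<Sum>k\<in>UNIV. \<Sum>l\<in>UNIV. ?K k l *\<^sub>R cl (transpose (rotation a) *v axis k 1) (cl (transpose (rotation a) *v axis l 1) \<tau>))"
      unfolding R cl_def vec_lambda_beta by (simp add: gam_lin scaleR_sum_right mult_ac)
    finally show ?thesis .
  qed
  have "curv_mult S x (cls (b x) \<sigma>) = cls (b x) (F (b x) \<sigma>)"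
    unfolding curv_mult_def F_def[symmetric]
  proof (rule class_map)
    fix a \<tau> assume a: "a \<in> Gr"
    have g: "a *v cl (transpose (rotation a) *v axis k 1) y = gam S k *v (a *v y)" for k y
      by (simp add: rotation_cl[OF a] matrix_vector_mul_assoc rotation_orthogonal[OF a] cl_axis del: transpose_matrix_vector)
    have one: "mat 1 \<in> Gr" by (rule spinc_one)
    have "a *v F (spin_act S (b x) a) \<tau> = (1/2) *\<^sub>R (\<Sum>k\<in>UNIV. \<Sum>l\<in>UNIV. ?K k l *\<^sub>R (gam S k *v (gam S l *v (a *v \<tau>))))"
      unfolding F[OF a] by (simp only: mat_vector_scaleR linear_sum[OF linear_mat_vector] g)
    also have "\<dots> = F (b x) (a *v \<tau>)"
    proof -
      have "cl (transpose (rotation (mat 1)) *v axis k 1) y = gam S k *v y" for k y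
        using rotation_cl[OF one, of "transpose (rotation (mat 1)) *v axis k 1" y]
        by (simp only: matrix_vector_mul_lid matrix_vector_mul_assoc rotation_orthogonal[OF one] cl_axis)
      then show ?thesis using F[OF one, of "a *v \<tau>"] by (simp add: spin_act_one del: transpose_matrix_vector)
    qed
    finally show "a *v F (spin_act S (b x) a) \<tau> = F (b x) (a *v \<tau>)" .
  qed
  moreover have "F (b x) \<sigma> = (1/2) *\<^sub>R (\<Sum>i\<in>UNIV. \<Sum>j\<in>UNIV. curv S x (fr i x) (fr j x) *\<^sub>R (gam S i *v (gam S j *v \<sigma>)))"
    unfolding F_def fr_def[symmetric] by (subst sum_offdiag) (simp_all add: curv_self[OF tangent_fr[OF x(2)]])
  moreover have "curv S x (fr i x) (fr j x) = ?K i j" for i j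
    unfolding curv_frame[OF tangent_fr[OF x(2)] tangent_fr[OF x(2)]] frame_coords_fr[OF x]
    by (simp add: sum_axis sum_distrib_left[symmetric] mult.assoc)
  ultimately show ?thesis by simp
qed

text \<open>\<open>form_op\<close> includes a factor i, so the eigenvalue i r of \<Omega> becomes -
  r; for r = c_n |\<Omega>| / 2 this is the lowest value allowed by
  \<open>form_op_lower_bound\<close>.\<close>

lemma curv_mult_form_op:
  "curv_mult S x (cls (b x) \<sigma>) = spinor_scale (\<i> * complex_of_real r) (cls (b x) \<sigma>) \<longleftrightarrow>
    form_op (\<lambda>k l. G.curvF k l (snd c x)) \<sigma> = - r *\<^sub>R \<sigma>"
proof -
  define \<omega> where "\<omega> = (1/2) *\<^sub>R (\<Sum>k\<in>UNIV. \<Sum>l\<in>UNIV. G.curvF k l (snd c x) *\<^sub>R (gam S k *v (gam S l *v \<sigma>)))"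
  have "form_op (\<lambda>k l. G.curvF k l (snd c x)) \<sigma> = \<i> *s \<omega>"
    unfolding form_op_def \<omega>_def by (simp add: J_lin J_gam)
  moreover have "\<omega> = (\<i> * complex_of_real r) *s \<sigma> \<longleftrightarrow> \<i> *s \<omega> = - r *\<^sub>R \<sigma>"
    by (auto simp: vec_eq_iff complex_eq_iff)
  ultimately show ?thesis unfolding curv_mult_frame \<omega>_def[symmetric] scale_class class_inj by simp
qed

end

end

section \<open>The endomorphism field as the symmetric part of the derivative\<close>

context clifford_ops begin

text \<open>For N k the derivative of a spinor along e_k and x its value, this is the matrix of the
  endomorphism \<ell> of that spinor in the frame.\<close>

definition sym_part :: "('n \<Rightarrow> 'a) \<Rightarrow> 'a \<Rightarrow> 'n \<Rightarrow> 'n \<Rightarrow> real" where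
  "sym_part N x k l = (\<gamma> k (N l) + \<gamma> l (N k)) \<bullet> x / (2 * (x \<bullet> x))"

lemma sym_part_sym: "sym_part N x k l = sym_part N x l k"
  by (simp add: sym_part_def add.commute)

text \<open>The field \<open>X \<mapsto> \<nabla>\<^sub>X\<psi> + \<ell>(X)\<cdot>\<psi>\<close> is the part of \<open>\<nabla>\<psi>\<close> orthogonal to all symmetric \<open>X \<mapsto> L(X)\<cdot>\<psi>\<close>.\<close>

lemma sym_part_norm:
  assumes x: "x \<noteq> 0"
  shows "(\<Sum>k\<in>UNIV. (N k + cl (\<chi> l. sym_part N x k l) x) \<bullet> (N k + cl (\<chi> l. sym_part N x k l) x)) =
    (\<Sum>k\<in>UNIV. N k \<bullet> N k) - (\<Sum>k\<in>UNIV. \<Sum>l\<in>UNIV. (sym_part N x k l)\<^sup>2) * (x \<bullet> x)"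
proof -
  let ?L = "sym_part N x" and ?u = "x \<bullet> x"
  have u: "?u \<noteq> 0" using x by simp
  define T where "T = (\<Sum>k\<in>UNIV. \<Sum>l\<in>UNIV. ?L k l * (\<gamma> l (N k) \<bullet> x))"
  have "T = (\<Sum>k\<in>UNIV. \<Sum>l\<in>UNIV. ?L k l * (\<gamma> k (N l) \<bullet> x))"
    unfolding T_def by (subst sum.swap) (simp add: sym_part_sym[of N x])
  then have "2 * T = (\<Sum>k\<in>UNIV. \<Sum>l\<in>UNIV. ?L k l * ((\<gamma> k (N l) + \<gamma> l (N k)) \<bullet> x))"
    by (simp add: T_def inner_add_left distrib_left sum.distrib)
  also have "\<dots> = (\<Sum>k\<in>UNIV. \<Sum>l\<in>UNIV. 2 * ((?L k l)\<^sup>2 * ?u))"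
  proof -
    have "(\<gamma> k (N l) + \<gamma> l (N k)) \<bullet> x = 2 * ?L k l * ?u" for k l using u by (simp add: sym_part_def)
    then show ?thesis by (simp add: power2_eq_square mult_ac)
  qed
  finally have T: "T = (\<Sum>k\<in>UNIV. \<Sum>l\<in>UNIV. (?L k l)\<^sup>2) * ?u"
    by (simp add: sum_distrib_left[symmetric] sum_distrib_right[symmetric])
  have "(N k + cl v x) \<bullet> (N k + cl v x) = N k \<bullet> N k - 2 * (\<Sum>l\<in>UNIV. v $ l * (\<gamma> l (N k) \<bullet> x)) + (v \<bullet> v) * ?u" for k v
  proof -
    have "cl v x \<bullet> N k = - (\<Sum>l\<in>UNIV. v $ l * (\<gamma> l (N k) \<bullet> x))"
      unfolding cl_skew[of v x] by (simp add: cl_def inner_sum_right inner_commute[of x])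
    then show ?thesis by (simp add: inner_add_left inner_add_right inner_commute[of "N k" "cl v x"] cl_inner)
  qed
  then have "(\<Sum>k\<in>UNIV. (N k + cl (\<chi> l. ?L k l) x) \<bullet> (N k + cl (\<chi> l. ?L k l) x)) =
      (\<Sum>k\<in>UNIV. N k \<bullet> N k) - 2 * T + (\<Sum>k\<in>UNIV. \<Sum>l\<in>UNIV. (?L k l)\<^sup>2) * ?u"
    by (simp add: sum.distrib sum_subtractf T_def sum_distrib_left sum_distrib_right inner_vec_def power2_eq_square)
  then show ?thesis by (simp add: T)
qed

end

context spinc_chart begin

definition Lc :: "('m \<Rightarrow> ('p, 's) spinor) \<Rightarrow> real^'n \<Rightarrow> 'n \<Rightarrow> 'n \<Rightarrow> real" where
  "Lc \<psi> y k l = sym_part (\<lambda>k. G.nab k (sh b c \<psi>) y) (sh b c \<psi> y) k l"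

lemma om_chart:
  assumes d: "d \<in> base_atlas S" and y: "y \<in> fst c" "y \<in> fst d" "y \<in> U"
  shows "frame_geometry.om (Gm d) (E b d) k j l (snd d y) = G.om k j l (snd c y)"
proof -
  interpret D: spinc_chart S U b d by unfold_locales (rule b d)+
  have "wfun b d (snd d y) (fr k y d) j l = wfun b c (snd c y) (fr k y c) j l"
    using wfun_chart[OF b y(3) c y(1) d y(2) tangent_fr[OF y(3)], of k] by simp
  then show ?thesis unfolding wfun_def fr_c[OF y(1)] D.fr_c[OF y(2), unfolded D.fr_def, folded fr_def] G.om_def D.G.om_def .
qed

text \<open>\<open>scal\<close> is computed in the chart selected by \<open>chart_at\<close>. The
  coefficients \<open>om\<close> do not depend on the chart and neither do their derivatives along
  the frame, so the frame curvature can be carried to the chart c.\<close>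

lemma frameR_chart:
  assumes d: "d \<in> base_atlas S" and x: "x \<in> fst c" "x \<in> fst d" "x \<in> U"
  shows "frame_geometry.frameR (Gm d) (E b d) k l i j (snd d x) = G.frameR k l i j (snd c x)"
proof -
  interpret D: spinc_chart S U b d by unfold_locales (rule b d)+
  have U: "open U" using b unfolding local_section_def by auto
  have dom: "dd (D.G.om l i j) (snd d x) (E b d k (snd d x)) = dd (G.om l i j) (snd c x) (E b c k (snd c x))" for k l i j
  proof -
    define f where "f y = G.om l i j (snd c y)" for y
    have V: "snd c x \<in> V" "snd d x \<in> D.V \<inter> snd d ` (fst d \<inter> fst c)" using x by blast+
    have c': "((f \<circ> chart_inv c) has_derivative dd (G.om l i j) (snd c x)) (at (snd c x))"
      by (rule has_derivative_cong_open[OF G.open_V V(1) _ smooth_on_has_derivative[OF G.smooth_om V(1)]])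
        (auto simp: f_def M.chart_inv_chart[OF c])
    have o: "open (D.V \<inter> snd d ` (fst d \<inter> fst c))" using D.G.open_V M.open_chart_Int[OF d M.open_chart[OF c]] by auto
    have "dd (f \<circ> chart_inv d) (snd d x) = dd (D.G.om l i j) (snd d x)"
      by (rule dd_cong_open[OF o V(2)]) (auto simp: f_def M.chart_inv_chart[OF d] om_chart[OF d] dest!: M.chart_image_iff[OF d, THEN iffD1])
    moreover have "dd (f \<circ> chart_inv d) (snd d x) (fr k x d) = dd (f \<circ> chart_inv c) (snd c x) (fr k x c)"
      by (rule M.chart_deriv[OF c d x(1,2) tangent_fr[OF x(3)]]) (use c' in \<open>auto simp: differentiable_def\<close>)
    ultimately show ?thesis
      using dd_eqI[OF c'] by (simp add: fr_c[OF x(1)] D.fr_c[OF x(2), unfolded D.fr_def, folded fr_def])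
  qed
  show ?thesis unfolding D.G.frameR_def G.frameR_def dom om_chart[OF d x] ..
qed

context
  fixes x
  assumes x: "x \<in> fst c" "x \<in> U"
begin

lemma scal_frame: "scal (base_atlas S) (base_metric S) x = (\<Sum>k\<in>UNIV. \<Sum>l\<in>UNIV. G.frameR k l l k (snd c x))"
proof -
  let ?d = "chart_at (base_atlas S) x"
  interpret D: spinc_chart S U b ?d by unfold_locales (rule b M.chart_at)+
  have "riem (base_atlas S) (base_metric S) ?d = riem_comp (Gm ?d)"
    by (intro ext) (simp add: riem_def riem_comp_def christoffel_def[abs_def] symb_def[abs_def])
  then have "scal (base_atlas S) (base_metric S) x = (\<Sum>k\<in>UNIV. \<Sum>l\<in>UNIV. D.G.frameR k l l k (snd ?d x))"
    unfolding scal_def Let_def using D.G.scal_frameR[OF D.p[OF M.chart_at(2) x(2)]] by simp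
  then show ?thesis unfolding frameR_chart[OF M.chart_at(1) x(1) M.chart_at(2) x(2)] .
qed

context
  fixes \<psi> assumes \<psi>: "spinor_field S \<psi>" and nz: "sh b c \<psi> (snd c x) \<noteq> 0"
begin

text \<open>Testing the defining condition against the frame vectors shows that the description in
  \<open>ell\<close> has exactly one solution; its coordinates are a row combination of the
  symmetric matrix \<open>Lc\<close>.\<close>

lemma ell_frame:
  assumes X: "tangent (base_atlas S) x X"
  shows "tangent (base_atlas S) x (ell S \<psi> x X)"
    and "frame_coords S (b x) (ell S \<psi> x X) = (\<chi> l. \<Sum>k\<in>UNIV. frame_coords S (b x) X $ k * Lc \<psi> (snd c x) k l)"
proof -
  let ?fc = "frame_coords S (b x)" and ?s = "sh b c \<psi> (snd c x)" and ?N = "\<lambda>k. G.nab k (sh b c \<psi>) (snd c x)"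
  define w where "w = (\<chi> l. \<Sum>k\<in>UNIV. ?fc X $ k * Lc \<psi> (snd c x) k l)"
  have px: "spin_proj S (b x) = x" by (rule proj_b[OF x(2)])
  have \<psi>x: "\<psi> x = cls (b x) ?s" by (rule psi_sh[OF b c \<psi> x(2,1)])
  have rhs: "1/2 * Re (spinor_herm
            (spinor_add (cliff_mult S X (nabla S \<psi> x Y)) (cliff_mult S Y (nabla S \<psi> x X)))
            (spinor_scale (complex_of_real (1 / spinor_norm2 (\<psi> x))) (\<psi> x))) = w \<bullet> ?fc Y"
    if Y: "tangent (base_atlas S) x Y" for Y
  proof -
    let ?v = "?fc X" and ?y = "?fc Y"
    have "complex_of_real (1 / (?s \<bullet> ?s)) *s ?s = (1 / (?s \<bullet> ?s)) *\<^sub>R ?s" by (simp add: vec_eq_iff complex_eq_iff)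
    moreover have "cliff_mult S Z (cls (b x) \<sigma>) = cls (b x) (cl (?fc Z) \<sigma>)" if "tangent (base_atlas S) x Z" for Z \<sigma>
      using cliff_class[of "b x" Z \<sigma>] that px by simp
    ultimately have "1/2 * Re (spinor_herm
            (spinor_add (cliff_mult S X (nabla S \<psi> x Y)) (cliff_mult S Y (nabla S \<psi> x X)))
            (spinor_scale (complex_of_real (1 / spinor_norm2 (\<psi> x))) (\<psi> x))) =
        1/2 * ((cl ?v (\<Sum>l\<in>UNIV. ?y $ l *\<^sub>R ?N l) + cl ?y (\<Sum>k\<in>UNIV. ?v $ k *\<^sub>R ?N k)) \<bullet> ?s / (?s \<bullet> ?s))"
      using X Y unfolding nabla_frame[OF x X \<psi>] nabla_frame[OF x Y \<psi>] \<psi>x norm2_class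
      by (simp add: scale_class add_class herm_class inner_hermitian[symmetric] del: of_real_divide)
    also have "cl ?v (\<Sum>l\<in>UNIV. ?y $ l *\<^sub>R ?N l) = (\<Sum>k\<in>UNIV. \<Sum>l\<in>UNIV. (?v $ k * ?y $ l) *\<^sub>R (gam S k *v ?N l))"
      by (simp add: cl_def gam_lin scaleR_sum_right)
    also have "cl ?y (\<Sum>k\<in>UNIV. ?v $ k *\<^sub>R ?N k) = (\<Sum>k\<in>UNIV. \<Sum>l\<in>UNIV. (?v $ k * ?y $ l) *\<^sub>R (gam S l *v ?N k))"
      by (simp add: cl_def gam_lin scaleR_sum_right) (subst sum.swap, simp add: mult.commute)
    also have "1/2 * (((\<Sum>k\<in>UNIV. \<Sum>l\<in>UNIV. (?v $ k * ?y $ l) *\<^sub>R (gam S k *v ?N l)) +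
        (\<Sum>k\<in>UNIV. \<Sum>l\<in>UNIV. (?v $ k * ?y $ l) *\<^sub>R (gam S l *v ?N k))) \<bullet> ?s / (?s \<bullet> ?s)) =
        (\<Sum>k\<in>UNIV. \<Sum>l\<in>UNIV. ?v $ k * ?y $ l * Lc \<psi> (snd c x) k l)"
      by (simp add: inner_add_left inner_sum_left sum.distrib[symmetric] distrib_left[symmetric] sum_distrib_left
          sum_divide_distrib Lc_def sym_part_def)
    also have "\<dots> = w \<bullet> ?y"
      unfolding w_def inner_vec_def by (subst sum.swap) (simp add: sum_distrib_left sum_distrib_right mult_ac)
    finally show ?thesis .
  qed
  have "ell S \<psi> x X = of_coords x w"
    unfolding ell_def
  proof (rule the_equality)
    show "tangent (base_atlas S) x (of_coords x w) \<and> (\<forall>Y. tangent (base_atlas S) x Y \<longrightarrow>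
        base_metric S x (of_coords x w) Y =
          1/2 * Re (spinor_herm
            (spinor_add (cliff_mult S X (nabla S \<psi> x Y)) (cliff_mult S Y (nabla S \<psi> x X)))
            (spinor_scale (complex_of_real (1 / spinor_norm2 (\<psi> x))) (\<psi> x))))"
      using metric_frame_coords[OF x tangent_of_coords[OF x, of w]] tangent_of_coords[OF x, of w] frame_coords_of_coords[OF x, of w] rhs
      by metis
  next
    fix Z assume Z: "tangent (base_atlas S) x Z \<and> (\<forall>Y. tangent (base_atlas S) x Y \<longrightarrow>
        base_metric S x Z Y =
          1/2 * Re (spinor_herm
            (spinor_add (cliff_mult S X (nabla S \<psi> x Y)) (cliff_mult S Y (nabla S \<psi> x X)))
            (spinor_scale (complex_of_real (1 / spinor_norm2 (\<psi> x))) (\<psi> x))))"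
    have "?fc Z \<bullet> axis k 1 = w \<bullet> axis k 1" for k
      using Z metric_frame_coords[OF x _ tangent_fr[OF x(2)], of Z k] rhs[OF tangent_fr[OF x(2)], of k] tangent_fr[OF x(2), of k]
      by (metis frame_coords_fr[OF x])
    then have "?fc Z = w" by (simp add: inner_axis vec_eq_iff)
    then show "Z = of_coords x w"
      using Z by (intro frame_coords_inj[OF x] tangent_of_coords[OF x]) (simp_all add: frame_coords_of_coords[OF x])
  qed
  then show "tangent (base_atlas S) x (ell S \<psi> x X)" "?fc (ell S \<psi> x X) = (\<chi> l. \<Sum>k\<in>UNIV. ?fc X $ k * Lc \<psi> (snd c x) k l)"
    using tangent_of_coords[OF x] frame_coords_of_coords[OF x] by (simp_all add: w_def)
qed

lemma ell_norm2_frame: "ell_norm2 S \<psi> x = (\<Sum>k\<in>UNIV. \<Sum>l\<in>UNIV. (Lc \<psi> (snd c x) k l)\<^sup>2)"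
proof -
  obtain Q :: "real^'n^'n" where Q: "Q ** transpose Q = mat 1" "\<And>i. tangent (base_atlas S) x (frame_at S x i)"
    "\<And>i k. frame_coords S (b x) (frame_at S x i) $ k = Q $ k $ i" by (rule frame_at_coords[OF x]) blast
  have "ell_norm2 S \<psi> x = (\<Sum>i\<in>UNIV. \<Sum>l\<in>UNIV. (\<Sum>k\<in>UNIV. Q $ k $ i * (\<chi> k. Lc \<psi> (snd c x) k l) $ k)\<^sup>2)"
    unfolding ell_norm2_def metric_frame_coords[OF x ell_frame(1)[OF Q(2)] ell_frame(1)[OF Q(2)]] ell_frame(2)[OF Q(2)] Q(3)
    by (simp add: inner_vec_def power2_eq_square)
  also have "\<dots> = (\<Sum>l\<in>UNIV. \<Sum>i\<in>UNIV. (\<Sum>k\<in>UNIV. Q $ k $ i * (\<chi> k. Lc \<psi> (snd c x) k l) $ k)\<^sup>2)"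
    by (rule sum.swap)
  also have "\<dots> = (\<Sum>l\<in>UNIV. \<Sum>k\<in>UNIV. (Lc \<psi> (snd c x) k l)\<^sup>2)"
    unfolding orthonormal_sum_squares[OF Q(1)] by simp
  finally show ?thesis by (subst sum.swap)
qed

lemma twistor_frame:
  assumes X: "tangent (base_atlas S) x X"
  shows "nabla S \<psi> x X = spinor_scale (- 1) (cliff_mult S (ell S \<psi> x X) (\<psi> x)) \<longleftrightarrow>
    (\<Sum>k\<in>UNIV. frame_coords S (b x) X $ k *\<^sub>R (G.nab k (sh b c \<psi>) (snd c x) + cl (\<chi> l. Lc \<psi> (snd c x) k l) (sh b c \<psi> (snd c x)))) = 0"
proof -
  let ?v = "frame_coords S (b x) X" and ?s = "sh b c \<psi> (snd c x)"
  have px: "spin_proj S (b x) = x" by (rule proj_b[OF x(2)])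
  have "cliff_mult S (ell S \<psi> x X) (\<psi> x) = cls (b x) (cl (\<chi> l. \<Sum>k\<in>UNIV. ?v $ k * Lc \<psi> (snd c x) k l) ?s)"
    using cliff_class[of "b x" "ell S \<psi> x X" ?s] ell_frame[OF X] px psi_sh[OF b c \<psi> x(2,1)] by simp
  moreover have "cl (\<chi> l. \<Sum>k\<in>UNIV. ?v $ k * Lc \<psi> (snd c x) k l) ?s = (\<Sum>k\<in>UNIV. ?v $ k *\<^sub>R cl (\<chi> l. Lc \<psi> (snd c x) k l) ?s)"
    by (simp add: cl_def scaleR_sum_left scaleR_sum_right) (subst sum.swap, simp)
  moreover have "- 1 *s y = - y" for y :: "complex^'s" by (simp add: vec_eq_iff)
  ultimately show ?thesis
    unfolding nabla_frame[OF x X \<psi>]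
    by (simp add: scale_class class_inj scaleR_add_right sum.distrib eq_neg_iff_add_eq_0)
qed

text \<open>\<open>weitzenboeck\<close> with the squared derivative replaced through
  \<open>sym_part_norm\<close>. Since c_n / 4 is half of
  \<open>sqrt (real (CARD('n) div 2))\<close>, the curvature terms combine into half of the
  nonnegative defect in \<open>form_op_bound\<close>.\<close>

lemma pointwise_identity:
  assumes eigen: "eigenspinor S (complex_of_real lam) \<psi>"
  defines "u \<equiv> spinor_norm2 (\<psi> x)" and "N \<equiv> curv_norm S x"
  shows "(1/4 * scal (base_atlas S) (base_metric S) x - c_const CARD('n) / 4 * N + ell_norm2 S \<psi> x) * u =
    lam\<^sup>2 * u + G.lap (\<lambda>y. sh b c \<psi> y \<bullet> sh b c \<psi> y) (snd c x) / 2
    - (\<Sum>k\<in>UNIV. (norm (G.nab k (sh b c \<psi>) (snd c x) + cl (\<chi> l. Lc \<psi> (snd c x) k l) (sh b c \<psi> (snd c x))))\<^sup>2)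
    - (form_op (\<lambda>k l. G.curvF k l (snd c x)) (sh b c \<psi> (snd c x)) \<bullet> sh b c \<psi> (snd c x) + sqrt (real (CARD('n) div 2)) * N * u) / 2"
proof -
  have u: "u = sh b c \<psi> (snd c x) \<bullet> sh b c \<psi> (snd c x)" unfolding u_def by (rule sh_norm2[OF x \<psi>])
  note W = G.weitzenboeck[OF p[OF x] smooth_sh[OF b c \<psi>] eigenspinor_chart[OF eigen]]
  note T = sym_part_norm[OF nz, of "\<lambda>k. G.nab k (sh b c \<psi>) (snd c x)", folded Lc_def u]
  show ?thesis
    using W unfolding scal_frame ell_norm2_frame c_const_def power2_norm_eq_inner T u[symmetric] by (simp add: algebra_simps)
qed

end

end

end

section \<open>Vector fields with prescribed value at a point\<close>

text \<open>The powers of 1/t make the family closed under differentiation: each derivative is a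
  combination of members with larger k.\<close>

definition flat_fun :: "nat \<Rightarrow> real \<Rightarrow> real" where
  "flat_fun k t = (if t > 0 then exp (- (1 / t)) / t ^ k else 0)"

lemma flat_fun_tendsto: "(flat_fun k \<longlongrightarrow> 0) (at 0)"
proof (rule filterlim_split_at)
  have "((\<lambda>t::real. inverse t ^ k / exp (inverse t)) \<longlongrightarrow> 0) (at_right 0)"
    by (rule filterlim_compose[OF tendsto_power_div_exp_0 filterlim_inverse_at_top_right])
  moreover have "eventually (\<lambda>t. inverse t ^ k / exp (inverse t) = flat_fun k t) (at_right 0)"
    unfolding eventually_at_right_field
    by (intro exI[of _ 1]) (auto simp: flat_fun_def exp_minus divide_simps)
  ultimately show "(flat_fun k \<longlongrightarrow> 0) (at_right 0)" by (rule Lim_transform_eventually)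
  have "eventually (\<lambda>t. 0 = flat_fun k t) (at_left 0)"
    unfolding eventually_at_left_field by (intro exI[of _ "-1"]) (auto simp: flat_fun_def)
  with tendsto_const show "(flat_fun k \<longlongrightarrow> 0) (at_left 0)" by (rule Lim_transform_eventually)
qed

lemma flat_fun_derivative:
  "(flat_fun k has_real_derivative flat_fun (k + 2) t - real k * flat_fun (k + 1) t) (at t)"
proof -
  consider "t > 0" | "t < 0" | "t = 0" by linarith
  then show ?thesis
  proof cases
    case 1
    have "((\<lambda>t. exp (- (1 / t)) / t ^ k) has_real_derivative exp (- (1 / t)) / t ^ (k + 2) - real k * (exp (- (1 / t)) / t ^ (k + 1))) (at t)"
    proof (cases k)
      case (Suc m)
      show ?thesis unfolding Suc using 1
        by (auto intro!: derivative_eq_intros simp del: power_Suc) (simp add: field_simps power2_eq_square)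
    qed (use 1 in \<open>auto intro!: derivative_eq_intros simp: field_simps power2_eq_square\<close>)
    then have "(flat_fun k has_real_derivative exp (- (1 / t)) / t ^ (k + 2) - real k * (exp (- (1 / t)) / t ^ (k + 1))) (at t)"
      by (rule has_field_derivative_transform_within_open[of _ _ _ "{0<..}"]) (use 1 in \<open>auto simp: flat_fun_def\<close>)
    then show ?thesis using 1 by (simp add: flat_fun_def)
  next
    case 2
    have "(flat_fun k has_real_derivative 0) (at t)"
      by (rule has_field_derivative_transform_within_open[of "\<lambda>_. 0" _ _ "{..<0}"]) (use 2 in \<open>auto simp: flat_fun_def\<close>)
    then show ?thesis using 2 by (simp add: flat_fun_def)
  next
    case 3
    \<comment> \<open>At 0 the difference quotient of one member is the next member of the family,
      which tends to 0.\<close>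
    have "eventually (\<lambda>h. flat_fun (Suc k) h = (flat_fun k (0 + h) - flat_fun k 0) / h) (at 0)"
      unfolding eventually_at_filter by (rule always_eventually) (simp add: flat_fun_def)
    with flat_fun_tendsto[of "Suc k"] have "(flat_fun k has_real_derivative 0) (at 0)"
      unfolding DERIV_def by (rule Lim_transform_eventually)
    then show ?thesis by (simp add: 3 flat_fun_def)
  qed
qed

lemma smooth_flat_fun: "smooth_on UNIV (flat_fun k)"
proof -
  have d: "(flat_fun k has_derivative (\<lambda>v. v *\<^sub>R (flat_fun (k + 2) t - real k * flat_fun (k + 1) t))) (at t)" for k t
    using flat_fun_derivative[of k t] by (simp add: has_field_derivative_def mult_commute_abs)
  have "ck_on n UNIV (flat_fun k)" for n
  proof (induction n arbitrary: k)
    case 0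
    show ?case using has_derivative_continuous[OF d] by (simp add: continuous_at_imp_continuous_on)
  next
    case (Suc n)
    have "ck_on n UNIV (\<lambda>t. v *\<^sub>R (flat_fun (k + 2) t + (- real k) *\<^sub>R flat_fun (k + 1) t))" for v
      by (intro ck_on_bounded_linear[OF bounded_linear_scaleR_right] ck_on_add Suc open_UNIV)
    then show ?case using d by (auto simp: dd_eqI[OF d] differentiable_def)
  qed
  then show ?thesis by (simp add: smooth_on_def)
qed

lemma bump_function:
  fixes p :: "'a::euclidean_space"
  assumes r: "r > 0"
  obtains \<beta> :: "'a \<Rightarrow> real" where "smooth_on UNIV \<beta>" "\<beta> p = 1" "\<And>y. y \<notin> cball p r \<Longrightarrow> \<beta> y = 0"
proof
  define \<beta> where "\<beta> y = flat_fun 0 (r\<^sup>2 - (y - p) \<bullet> (y - p)) * (1 / flat_fun 0 (r\<^sup>2))" for y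
  have "smooth_on UNIV (\<lambda>y. r\<^sup>2 - (y - p) \<bullet> (y - p))"
    by (intro smooth_on_diff smooth_on_inner smooth_on_const smooth_on_id open_UNIV)
  from smooth_on_compose[OF open_UNIV open_UNIV smooth_flat_fun this]
  show "smooth_on UNIV \<beta>" unfolding \<beta>_def[abs_def] by (intro smooth_on_mult smooth_on_const open_UNIV) auto
  show "\<beta> p = 1" using r by (simp add: \<beta>_def flat_fun_def)
  show "\<beta> y = 0" if "y \<notin> cball p r" for y
  proof -
    have "r < norm (y - p)" using that by (simp add: dist_norm norm_minus_commute)
    then have "r\<^sup>2 < (y - p) \<bullet> (y - p)" using r by (metis less_le not_le power2_norm_eq_inner power_strict_mono zero_less_numeral)
    then show ?thesis by (simp add: \<beta>_def flat_fun_def)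
  qed
qed

context atlas begin

lemma smooth_map_chart_fun:
  assumes c: "c \<in> A" and W: "open W" and F: "smooth_on (snd c ` (fst c \<inter> W)) F"
  shows "smooth_map A eucl_atlas (fst c \<inter> W) (\<lambda>y. F (snd c y))"
  unfolding smooth_map_eucl_iff
proof (intro conjI ballI)
  show "continuous_on (fst c \<inter> W) (\<lambda>y. F (snd c y))"
    by (rule continuous_on_compose2[OF smooth_on_continuous[OF F] continuous_on_subset[OF continuous_chart[OF c]]]) auto
  fix e assume e: "e \<in> A"
  have o: "open (snd e ` (fst e \<inter> (fst c \<inter> W)))" using open_chart_Int[OF e] open_chart[OF c] W by blast
  have "smooth_on (snd e ` (fst e \<inter> (fst c \<inter> W))) (\<lambda>z. F ((snd c \<circ> chart_inv e) z))"
    by (rule smooth_on_compose[OF o open_chart_Int[OF c W] F smooth_on_mono[OF transition_smooth[OF e c]]])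
      (auto simp: chart_inv_chart[OF e])
  then show "smooth_on (snd e ` (fst e \<inter> (fst c \<inter> W))) ((\<lambda>y. F (snd c y)) \<circ> chart_inv e)" by (simp add: o_def)
qed

lemma smooth_map_cong:
  assumes W: "open W" and eq: "\<And>y. y \<in> W \<Longrightarrow> f y = g y" and f: "smooth_map A eucl_atlas W f"
  shows "smooth_map A eucl_atlas W g"
  unfolding smooth_map_eucl_iff
proof (intro conjI ballI)
  show "continuous_on W g" using f eq continuous_on_eq unfolding smooth_map_eucl_iff by blast
  fix c assume c: "c \<in> A"
  show "smooth_on (snd c ` (fst c \<inter> W)) (g \<circ> chart_inv c)"
    by (rule smooth_on_cong[OF open_chart_Int[OF c W] _ smooth_map_eucl[OF f c]]) (auto simp: eq chart_inv_chart[OF c])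
qed

lemma smooth_map_local:
  assumes "\<And>x. x \<in> U \<Longrightarrow> \<exists>W. open W \<and> x \<in> W \<and> smooth_map A eucl_atlas W f"
  shows "smooth_map A eucl_atlas U f"
  unfolding smooth_map_eucl_iff
proof (intro conjI ballI)
  show "continuous_on U f"
  proof (rule continuous_on_subset)
    show "continuous_on (\<Union>W\<in>{W. open W \<and> smooth_map A eucl_atlas W f}. W) f"
      by (rule continuous_on_open_UN) (auto simp: smooth_map_eucl_iff)
    show "U \<subseteq> (\<Union>W\<in>{W. open W \<and> smooth_map A eucl_atlas W f}. W)" using assms by blast
  qed
  fix c assume c: "c \<in> A"
  show "smooth_on (snd c ` (fst c \<inter> U)) (f \<circ> chart_inv c)"
  proof (rule smooth_on_local)
    fix p assume "p \<in> snd c ` (fst c \<inter> U)"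
    then obtain x where x: "x \<in> fst c" "x \<in> U" "p = snd c x" by blast
    obtain W where "open W" "x \<in> W" "smooth_map A eucl_atlas W f" using assms[OF x(2)] by blast
    then show "\<exists>W. open W \<and> p \<in> W \<and> smooth_on W (f \<circ> chart_inv c)"
      using x c open_chart_Int[OF c] by (intro exI[of _ "snd c ` (fst c \<inter> W)"]) (auto simp: smooth_map_eucl_iff)
  qed
qed

end

text \<open>The first condition of the theorem is stated for smooth vector fields, while the local
  argument needs it for a single tangent vector; a cut-off constant field in a chart passes from one
  to the other.\<close>

lemma vector_field_extension:
  fixes A :: "('m::t2_space, 'e::euclidean_space) chart set"
  assumes A: "smooth_atlas A" and v: "tangent A x v"
  shows "\<exists>X. smooth_vfield A X \<and> X x = v"
proof -
  interpret atlas A by unfold_locales (rule A)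
  define c where "c = chart_at A x"
  have c: "c \<in> A" "x \<in> fst c" unfolding c_def by (rule chart_at)+
  obtain r where r: "r > 0" "cball (snd c x) r \<subseteq> snd c ` fst c"
    using open_chart_image[OF c(1)] c(2) open_contains_cball by blast
  obtain \<beta> :: "'e \<Rightarrow> real" where \<beta>: "smooth_on UNIV \<beta>" "\<beta> (snd c x) = 1" "\<And>y. y \<notin> cball (snd c x) r \<Longrightarrow> \<beta> y = 0"
    using bump_function[OF r(1), of "snd c x"] by metis
  define K where "K = chart_inv c ` cball (snd c x) r"
  \<comment> \<open>The Hausdorff property makes the compact support closed, so extension by zero is
    smooth across the edge of the chart domain.\<close>
  have "compact K"
    unfolding K_def by (rule compact_continuous_image[OF continuous_on_subset[OF continuous_chart_inv[OF c(1)] r(2)] compact_cball])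
  then have K: "open (- K)" using compact_imp_closed by blast
  have KV: "K \<subseteq> fst c" unfolding K_def using r(2) chart_inv_in[OF c(1)] by blast
  have out: "\<beta> (snd c y) = 0" if "y \<in> fst c" "y \<notin> K" for y
    using that \<beta>(3)[of "snd c y"] chart_inv_chart[OF c(1) that(1)] unfolding K_def by (metis image_eqI)
  define X where "X y = (if y \<in> fst c then tvec_of A c y (\<beta> (snd c y) *\<^sub>R v c) else (\<lambda>d. 0))" for y
  have zero: "tvec_of A c y 0 = (\<lambda>d. 0)" if "y \<in> fst c" for y
    using linear_0[OF linear_transition[OF c(1)]] that by (intro ext) (simp add: tvec_of_def)
  have tangent_zero: "tangent A y (\<lambda>d. 0)" for y
    using linear_0[OF linear_transition] by (auto simp: tangent_def)
  have X0: "X y = (\<lambda>d. 0)" if "y \<notin> K" for y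
    using out zero that by (auto simp: X_def)
  have "smooth_vfield A X"
    unfolding smooth_vfield_def
  proof (intro conjI allI ballI)
    show "tangent A y (X y)" for y using tangent_tvec_of[OF c(1)] tangent_zero by (simp add: X_def)
    fix d assume d: "d \<in> A"
    show "smooth_map A eucl_atlas (fst d) (\<lambda>y. X y d)"
    proof (rule smooth_map_local)
      fix y assume y: "y \<in> fst d"
      show "\<exists>W. open W \<and> y \<in> W \<and> smooth_map A eucl_atlas W (\<lambda>y. X y d)"
      proof (cases "y \<in> K")
        case True
        have "smooth_on (snd c ` (fst c \<inter> fst d)) (\<lambda>p. dd (snd d \<circ> chart_inv c) p (\<beta> p *\<^sub>R v c))"
          by (intro smooth_on_dd_field transition_smooth c d smooth_on_scaleR smooth_on_mono[OF \<beta>(1)] smooth_on_const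
              open_chart_Int[OF c(1) open_chart[OF d]]) auto
        from smooth_map_chart_fun[OF c(1) open_chart[OF d] this]
        have "smooth_map A eucl_atlas (fst c \<inter> fst d) (\<lambda>y. X y d)"
          by (rule smooth_map_cong[rotated 2]) (use d open_chart[OF c(1)] open_chart[OF d] in \<open>auto simp: X_def tvec_of_def\<close>)
        then show ?thesis using True KV y open_chart[OF c(1)] open_chart[OF d] by (intro exI[of _ "fst c \<inter> fst d"]) auto
      next
        case False
        have "smooth_map A eucl_atlas (- K) (\<lambda>y. 0 :: 'e)"
          unfolding smooth_map_eucl_iff by (auto simp: o_def intro: smooth_on_const)
        then have "smooth_map A eucl_atlas (- K) (\<lambda>y. X y d)"
          by (rule smooth_map_cong[OF K, rotated]) (simp add: X0)
        then show ?thesis using False K by blast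
      qed
    qed
  qed
  moreover have "X x = v" using c v \<beta>(2) by (simp add: X_def tvec_of_self)
  ultimately show ?thesis by blast
qed

section \<open>The equality case\<close>

lemma continuous_on_UNIV_local:
  assumes "\<And>x. \<exists>W. open W \<and> x \<in> W \<and> continuous_on W f"
  shows "continuous_on UNIV f"
proof -
  have "continuous_on (\<Union>W\<in>{W. open W \<and> continuous_on W f}. W) f"
    by (rule continuous_on_open_UN) auto
  moreover have "(\<Union>W\<in>{W. open W \<and> continuous_on W f}. W) = UNIV" using assms by blast
  ultimately show ?thesis by simp
qed

context spinor_geometry begin

lemma smooth_frameR: "smooth_on V (frameR k l i j)"
  unfolding frameR_def[abs_def]
  by (intro smooth_on_add smooth_on_diff smooth_on_sum smooth_on_mult smooth_on_dd_field smooth_om smooth_e open_V)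

lemma smooth_curvF: "smooth_on V (curvF k l)"
  unfolding curvF_def[abs_def]
  by (intro smooth_on_diff smooth_on_sum smooth_on_mult smooth_on_dd_field smooth_om smooth_e smooth_a open_V)

text \<open>Freezing the directions at y turns the Laplacian into pure second derivatives plus a
  drift, the form treated by \<open>strong_maximum_principle\<close>.\<close>

lemma lap_drift:
  assumes y: "y \<in> V" and u: "smooth_on V u"
  shows "lap u y = (\<Sum>k\<in>UNIV. dd (\<lambda>z. dd u z (e k y)) y (e k y))
    + dd u y (\<Sum>k\<in>UNIV. dd (e k) y (e k y) - (\<Sum>m\<in>UNIV. om k k m y *\<^sub>R e m y))"
proof -
  have lin: "linear (dd u z)" if "z \<in> V" for z by (rule linear_dd[OF smooth_on_differentiable[OF u that]])
  have "dd (\<lambda>z. dd u z (e k z)) y (e k y) = dd (\<lambda>z. dd u z (e k y)) y (e k y) + dd u y (dd (e k) y (e k y))" for k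
    using fun_cong[OF dd_eqI[OF dd_field[OF open_V y lin smooth_on_differentiable[OF smooth_on_dd[OF u] y] differentiable_e[OF y]]]] .
  then show ?thesis
    by (simp add: lap_def linear_sum[OF lin[OF y]] linear_diff[OF lin[OF y]] linear_scale[OF lin[OF y]] sum.distrib sum_subtractf)
qed

lemma lap_zero:
  assumes W: "open W" "y \<in> W" and u: "\<And>z X. z \<in> W \<Longrightarrow> dd u z X = 0"
  shows "lap u y = 0"
proof -
  have "dd (\<lambda>z. dd u z (e k z)) y = dd (\<lambda>z. 0 :: real) y" for k by (rule dd_cong_open[OF W]) (rule u)
  moreover have "dd (\<lambda>z. 0 :: real) y = (\<lambda>v. 0)" by (rule dd_eqI) simp
  ultimately show ?thesis by (simp add: lap_def u[OF W(2)])
qed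

end

context spinc_chart begin

lemma open_dom: "open (fst c \<inter> U)"
  using b M.open_chart[OF c] unfolding local_section_def by auto

lemma continuous_chart_fun:
  assumes "continuous_on V H" "\<And>y. y \<in> fst c \<Longrightarrow> y \<in> U \<Longrightarrow> h y = H (snd c y)"
  shows "continuous_on (fst c \<inter> U) h"
proof (rule continuous_on_eq)
  show "continuous_on (fst c \<inter> U) (\<lambda>y. H (snd c y))"
    by (rule continuous_on_compose2[OF assms(1) continuous_on_subset[OF M.continuous_chart[OF c]]]) auto
qed (use assms(2) in auto)

lemma continuous_curvature: "continuous_on (fst c \<inter> U) (\<lambda>y. scal (base_atlas S) (base_metric S) y)" "continuous_on (fst c \<inter> U) (curv_norm S)"
proof -
  show "continuous_on (fst c \<inter> U) (\<lambda>y. scal (base_atlas S) (base_metric S) y)"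
    by (rule continuous_chart_fun[where H = "\<lambda>p. \<Sum>k\<in>UNIV. \<Sum>l\<in>UNIV. G.frameR k l l k p"])
      (intro smooth_on_continuous smooth_on_sum G.smooth_frameR G.open_V, rule scal_frame)
  show "continuous_on (fst c \<inter> U) (curv_norm S)"
  proof (rule continuous_chart_fun)
    show "continuous_on V (\<lambda>p. sqrt ((\<Sum>k\<in>UNIV. \<Sum>l\<in>UNIV. (G.curvF k l p)\<^sup>2) / 2))"
      by (intro continuous_intros smooth_on_continuous[OF G.smooth_curvF]) auto
    show "curv_norm S y = sqrt ((\<Sum>k\<in>UNIV. \<Sum>l\<in>UNIV. (G.curvF k l (snd c y))\<^sup>2) / 2)" if "y \<in> fst c" "y \<in> U" for y
      using curv_norm_frame[OF that] by (metis real_sqrt_abs abs_of_nonneg)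
  qed
qed

lemma smooth_norm2: "spinor_field S \<psi> \<Longrightarrow> smooth_on V (\<lambda>y. sh b c \<psi> y \<bullet> sh b c \<psi> y)"
  by (intro smooth_on_inner smooth_sh[OF b c] G.open_V)

lemma continuous_norm2: "spinor_field S \<psi> \<Longrightarrow> continuous_on (fst c \<inter> U) (\<lambda>y. spinor_norm2 (\<psi> y))"
  by (rule continuous_chart_fun[where H = "\<lambda>y. sh b c \<psi> y \<bullet> sh b c \<psi> y"])
    (rule smooth_on_continuous[OF smooth_norm2], assumption, rule sh_norm2)

lemma form_op_bound:
  assumes "x \<in> fst c" "x \<in> U"
  shows "0 \<le> form_op (\<lambda>k l. G.curvF k l (snd c x)) \<sigma> \<bullet> \<sigma> + sqrt (real (CARD('n) div 2)) * curv_norm S x * (\<sigma> \<bullet> \<sigma>)"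
  using form_op_lower_bound[OF curv_norm_frame[OF assms], of \<sigma>] by simp

context
  fixes \<psi> lam
  assumes eigen: "eigenspinor S (complex_of_real lam) \<psi>"
begin

lemma field: "spinor_field S \<psi>" using eigen unfolding eigenspinor_def by blast

text \<open>Where u > 0, the lower bound and \<open>pointwise_identity\<close> make the Laplacian of
  u nonnegative, and the strong maximum principle applies at x.\<close>

lemma locally_constant_at_max:
  assumes x: "x \<in> fst c" "x \<in> U" and max: "\<And>y. spinor_norm2 (\<psi> y) \<le> M" "spinor_norm2 (\<psi> x) = M" "M > 0"
    and lower: "\<And>y. \<psi> y \<noteq> spinor_zero S y \<Longrightarrow>
      lam\<^sup>2 \<le> 1/4 * scal (base_atlas S) (base_metric S) y - c_const CARD('n) / 4 * curv_norm S y + ell_norm2 S \<psi> y"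
  shows "\<exists>W. open W \<and> x \<in> W \<and> (\<forall>y\<in>W. spinor_norm2 (\<psi> y) = M)"
proof -
  let ?u = "\<lambda>y. sh b c \<psi> y \<bullet> sh b c \<psi> y"
  \<comment> \<open>Zeros of the spinor are removed, since \<open>lower\<close> says nothing about
    them; M > 0 ensures that x survives.\<close>
  define V' where "V' = V \<inter> ?u -` {0<..}"
  have su: "smooth_on V ?u" by (rule smooth_norm2[OF field])
  have V': "open V'" "V' \<subseteq> V"
    unfolding V'_def using continuous_open_preimage[OF smooth_on_continuous[OF su] G.open_V open_greaterThan] by auto
  define Z where "Z y = (\<Sum>k\<in>UNIV. dd (E b c k) y (E b c k y) - (\<Sum>m\<in>UNIV. G.om k k m y *\<^sub>R E b c m y))" for y
  have u: "spinor_norm2 (\<psi> y) = ?u (snd c y)" if "y \<in> fst c" "y \<in> U" for y by (rule sh_norm2[OF that field])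
  have "\<exists>r>0. ball (snd c x) r \<subseteq> V' \<and> (\<forall>y\<in>ball (snd c x) r. ?u y = M)"
  proof (rule strong_maximum_principle[where E = "E b c" and Z = Z])
    show "open V'" "smooth_on V' ?u" using V' smooth_on_mono[OF su] by auto
    show "continuous_on V' (E b c k)" for k
      by (rule continuous_on_subset[OF smooth_on_continuous[OF G.smooth_e] V'(2)])
    have "smooth_on V Z" unfolding Z_def[abs_def]
      by (intro smooth_on_sum smooth_on_diff smooth_on_scaleR smooth_on_dd_field G.smooth_e G.smooth_om G.open_V)
    then show "continuous_on V' Z" by (rule continuous_on_subset[OF smooth_on_continuous V'(2)])
    show "\<exists>k. E b c k y \<bullet> v \<noteq> 0" if "y \<in> V'" "v \<noteq> 0" for y v
    proof (rule ccontr)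
      assume "\<nexists>k. E b c k y \<bullet> v \<noteq> 0"
      moreover have "v \<bullet> v = (\<Sum>k\<in>UNIV. G.ip y v (E b c k y) *\<^sub>R E b c k y) \<bullet> v"
        using G.frame_expand[of y v] that(1) V'(2) by auto
      ultimately show False using that(2) by (simp add: inner_sum_left)
    qed
    show "0 \<le> (\<Sum>k\<in>UNIV. dd (\<lambda>z. dd ?u z (E b c k y)) y (E b c k y)) + dd ?u y (Z y)" if y: "y \<in> V'" for y
    proof -
      obtain z where z: "z \<in> fst c" "z \<in> U" "y = snd c z" using y V'(2) by blast
      have nz: "sh b c \<psi> (snd c z) \<noteq> 0" using y z by (auto simp: V'_def)
      let ?f = "1/4 * scal (base_atlas S) (base_metric S) z - c_const CARD('n) / 4 * curv_norm S z + ell_norm2 S \<psi> z"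
      have "lam\<^sup>2 * spinor_norm2 (\<psi> z) \<le> ?f * spinor_norm2 (\<psi> z)"
        using lower[of z] sh_zero[OF z(1,2) field] nz by (intro mult_right_mono) (auto simp: u[OF z(1,2)])
      moreover have "0 \<le> L" if "l \<le> f" "f = l + L / 2 - r - s / 2" "0 \<le> r" "0 \<le> s" for l f L r s :: real
        using that by linarith
      ultimately have "0 \<le> G.lap ?u y"
        using pointwise_identity[OF z(1,2) field nz eigen] form_op_bound[OF z(1,2), of "sh b c \<psi> (snd c z)"]
          sum_nonneg[of UNIV "\<lambda>k. (norm (G.nab k (sh b c \<psi>) (snd c z) + cl (\<chi> l. Lc \<psi> (snd c z) k l) (sh b c \<psi> (snd c z))))\<^sup>2"]
        unfolding z(3) u[OF z(1,2)] by (meson zero_le_power2)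
      then show ?thesis using G.lap_drift[OF _ su, of y] y V'(2) by (auto simp: Z_def)
    qed
    show "?u y \<le> M" if "y \<in> V'" for y 
    proof -
      obtain z where "z \<in> fst c" "z \<in> U" "y = snd c z" using \<open>y \<in> V'\<close> V'(2) by blast
      then show ?thesis using max(1)[of z] u by simp
    qed
    show "snd c x \<in> V'" "?u (snd c x) = M" using max u[OF x] p[OF x] by (auto simp: V'_def)
  qed
  then obtain r where r: "r > 0" "\<And>y. y \<in> ball (snd c x) r \<Longrightarrow> ?u y = M" by blast
  have "open ((fst c \<inter> U) \<inter> snd c -` ball (snd c x) r)"
    by (rule continuous_open_preimage[OF continuous_on_subset[OF M.continuous_chart[OF c]] open_dom]) auto
  then show ?thesis
    using r u x by (intro exI[of _ "(fst c \<inter> U) \<inter> snd c -` ball (snd c x) r"]) auto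
qed

text \<open>For constant u the Laplacian disappears from \<open>pointwise_identity\<close>, and two
  nonnegative defects have a nonpositive sum, so both vanish. \<open>form_op_equality\<close> turns
  the second into the eigenvalue equation for \<Omega>.\<close>

lemma rigidity_frame:
  assumes x: "x \<in> fst c" "x \<in> U" and const: "\<And>y. spinor_norm2 (\<psi> y) = M" "M > 0"
    and lower: "lam\<^sup>2 \<le> 1/4 * scal (base_atlas S) (base_metric S) x - c_const CARD('n) / 4 * curv_norm S x + ell_norm2 S \<psi> x"
  shows "tangent (base_atlas S) x X \<Longrightarrow> nabla S \<psi> x X = spinor_scale (- 1) (cliff_mult S (ell S \<psi> x X) (\<psi> x))"
    and "curv_mult S x (\<psi> x) = spinor_scale (\<i> * complex_of_real (c_const CARD('n) / 2 * curv_norm S x)) (\<psi> x)"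
proof -
  let ?u = "\<lambda>y. sh b c \<psi> y \<bullet> sh b c \<psi> y" and ?s = "sh b c \<psi> (snd c x)"
  have u: "?u y = M" if "y \<in> V" for y using that sh_norm2[OF _ _ field] const(1) by force
  have nz: "?s \<noteq> 0" using u[OF p[OF x]] const(2) by auto
  have "dd ?u y = dd (\<lambda>y. M) y" if "y \<in> V" for y by (rule dd_cong_open[OF G.open_V that u])
  moreover have "dd (\<lambda>y. M) y = (\<lambda>v. 0)" for y :: "real^'n" by (rule dd_eqI) simp
  ultimately have lap: "G.lap ?u (snd c x) = 0" by (intro G.lap_zero[OF G.open_V p[OF x]]) simp
  let ?N = "\<lambda>k. G.nab k (sh b c \<psi>) (snd c x) + cl (\<chi> l. Lc \<psi> (snd c x) k l) ?s"
  let ?f = "1/4 * scal (base_atlas S) (base_metric S) x - c_const CARD('n) / 4 * curv_norm S x + ell_norm2 S \<psi> x"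
  have "lam\<^sup>2 * M \<le> ?f * M" using lower const(2) by (intro mult_right_mono) auto
  then have le: "(\<Sum>k\<in>UNIV. (norm (?N k))\<^sup>2) + (form_op (\<lambda>k l. G.curvF k l (snd c x)) ?s \<bullet> ?s
      + sqrt (real (CARD('n) div 2)) * curv_norm S x * (?s \<bullet> ?s)) / 2 \<le> 0"
    using pointwise_identity[OF x field nz eigen, unfolded const lap] unfolding u[OF p[OF x]] by linarith
  have nonneg: "(\<Sum>k\<in>UNIV. (norm (?N k))\<^sup>2) \<ge> 0" by (simp add: sum_nonneg)
  have "r = 0 \<and> s = 0" if "r + s / 2 \<le> 0" "0 \<le> r" "0 \<le> s" for r s :: real using that by linarith
  note this[OF le nonneg form_op_bound[OF x]]
  then have "(\<Sum>k\<in>UNIV. (norm (?N k))\<^sup>2) = 0" and *: "form_op (\<lambda>k l. G.curvF k l (snd c x)) ?s \<bullet> ?s =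
      - (sqrt (real (CARD('n) div 2)) * curv_norm S x * (?s \<bullet> ?s))"
    by (simp_all only: add_eq_0_iff2)
  then have N: "?N k = 0" for k by (simp add: sum_nonneg_eq_0_iff)
  show "nabla S \<psi> x X = spinor_scale (- 1) (cliff_mult S (ell S \<psi> x X) (\<psi> x))" if "tangent (base_atlas S) x X"
    unfolding twistor_frame[OF x field nz that] N by simp
  have "G.curvF k l y = - G.curvF l k y" for k l y by (simp add: G.curvF_def algebra_simps sum_subtractf)
  from form_op_equality[OF curv_norm_frame[OF x] this *]
  show "curv_mult S x (\<psi> x) = spinor_scale (\<i> * complex_of_real (c_const CARD('n) / 2 * curv_norm S x)) (\<psi> x)"
    unfolding psi_sh[OF b c field x(2,1)] curv_mult_form_op[OF x] by (simp add: c_const_def)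
qed

text \<open>Clifford multiplication by a vector is skew, so the first equation kills the gradient of
  u. The Laplacian needs this on a neighbourhood of x, which is why \<open>twistor\<close> ranges
  over all points where the spinor is nonzero.\<close>

lemma equality_frame:
  assumes x: "x \<in> fst c" "x \<in> U" and nz: "\<psi> x \<noteq> spinor_zero S x"
    and twistor: "\<And>y X. \<psi> y \<noteq> spinor_zero S y \<Longrightarrow> tangent (base_atlas S) y X \<Longrightarrow>
      nabla S \<psi> y X = spinor_scale (- 1) (cliff_mult S (ell S \<psi> y X) (\<psi> y))"
    and curvature: "curv_mult S x (\<psi> x) = spinor_scale (\<i> * complex_of_real (c_const CARD('n) / 2 * curv_norm S x)) (\<psi> x)"
  shows "1/4 * scal (base_atlas S) (base_metric S) x - c_const CARD('n) / 4 * curv_norm S x + ell_norm2 S \<psi> x = lam\<^sup>2"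
proof -
  let ?s = "sh b c \<psi>" and ?u = "\<lambda>y. sh b c \<psi> y \<bullet> sh b c \<psi> y"
  let ?N = "\<lambda>y k. G.nab k ?s y + cl (\<chi> l. Lc \<psi> y k l) (?s y)"
  define V' where "V' = V \<inter> ?s -` (- {0})"
  have ss: "smooth_on V ?s" by (rule smooth_sh[OF b c field])
  have V': "open V'" "V' \<subseteq> V"
    unfolding V'_def using continuous_open_preimage[OF smooth_on_continuous[OF ss] G.open_V, of "- {0}"] by auto
  have N: "?N y k = 0" if y: "y \<in> V'" for y k
  proof -
    obtain z where z: "z \<in> fst c" "z \<in> U" "y = snd c z" "?s (snd c z) \<noteq> 0" using y by (auto simp: V'_def)
    have "nabla S \<psi> z (fr k z) = spinor_scale (- 1) (cliff_mult S (ell S \<psi> z (fr k z)) (\<psi> z))"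
      using twistor[OF _ tangent_fr[OF z(2)]] sh_zero[OF z(1,2) field] z(4) by blast
    then have "(\<Sum>i\<in>UNIV. axis k 1 $ i *\<^sub>R ?N y i) = 0"
      unfolding twistor_frame[OF z(1,2) field z(4) tangent_fr[OF z(2)]] frame_coords_fr[OF z(1,2)] z(3) .
    then show ?thesis by (simp add: axis_def if_distrib if_distribR cong: if_cong)
  qed
  have "dd ?u y X = 0" if y: "y \<in> V'" for y X
  proof -
    have yV: "y \<in> V" using y V' by blast
    have d: "?s differentiable (at y)" by (rule smooth_on_differentiable[OF ss yV])
    have lin: "linear (dd ?u y)" by (rule linear_dd[OF smooth_on_differentiable[OF smooth_norm2[OF field] yV]])
    have "dd ?u y (E b c k y) = 0" for k
    proof -
      have "cl v (?s y) \<bullet> ?s y = 0" for v using cl_skew[of v "?s y" "?s y"] by (simp add: inner_commute)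
      moreover have "G.nab k ?s y = - cl (\<chi> l. Lc \<psi> y k l) (?s y)" using N[OF y, of k] by (simp add: eq_neg_iff_add_eq_0)
      ultimately show ?thesis unfolding G.nab_inner[OF yV d d] by (simp add: inner_commute[of "?s y"])
    qed
    moreover have "dd ?u y X = dd ?u y (\<Sum>k\<in>UNIV. G.ip y X (E b c k y) *\<^sub>R E b c k y)"
      by (simp add: G.frame_expand[OF yV, symmetric])
    ultimately show ?thesis by (simp add: linear_sum[OF lin] linear_scale[OF lin])
  qed
  moreover have nz': "?s (snd c x) \<noteq> 0" using nz sh_zero[OF x field] by blast
  then have xV': "snd c x \<in> V'" using p[OF x] by (simp add: V'_def)
  ultimately have lap: "G.lap ?u (snd c x) = 0" using G.lap_zero[OF V'(1)] by blast
  have u: "spinor_norm2 (\<psi> x) = ?u (snd c x)" by (rule sh_norm2[OF x field])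
  have "form_op (\<lambda>k l. G.curvF k l (snd c x)) (?s (snd c x)) = - (c_const CARD('n) / 2 * curv_norm S x) *\<^sub>R ?s (snd c x)"
    using curvature unfolding psi_sh[OF b c field x(2,1)] curv_mult_form_op[OF x] .
  then have "form_op (\<lambda>k l. G.curvF k l (snd c x)) (?s (snd c x)) \<bullet> ?s (snd c x) +
      sqrt (real (CARD('n) div 2)) * curv_norm S x * spinor_norm2 (\<psi> x) = 0"
    by (simp add: u c_const_def)
  then have "(1/4 * scal (base_atlas S) (base_metric S) x - c_const CARD('n) / 4 * curv_norm S x + ell_norm2 S \<psi> x) * ?u (snd c x) =
      lam\<^sup>2 * ?u (snd c x)"
    using pointwise_identity[OF x field nz' eigen] N[OF xV'] by (simp add: lap u)
  then show ?thesis using nz' by simp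
qed

end

end

section \<open>The global argument: compactness and connectedness\<close>

context spinc_structure begin

lemma spinc_chart_exists: "\<exists>U b c. spinc_chart S U b c \<and> x \<in> fst c \<and> x \<in> U"
proof -
  obtain U b where "x \<in> U" "local_section S U b" using local_section_exists by blast
  then show ?thesis
    using M.chart_at[of x] spinc_structure_axioms
    by (intro exI[of _ U] exI[of _ b] exI[of _ "chart_at (base_atlas S) x"]) (simp add: spinc_chart_def spinc_chart_axioms_def)
qed

lemma continuous_on_UNIV_chart:
  assumes "\<And>U b c. spinc_chart S U b c \<Longrightarrow> continuous_on (fst c \<inter> U) f"
  shows "continuous_on UNIV f"
  by (rule continuous_on_UNIV_local)
    (use spinc_chart_exists assms spinc_chart.open_dom in \<open>metis IntI\<close>)

text \<open>The set of nonzeros of the spinor need not be compact, and \<ell> may be unbounded near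
  its edge. But the squared norm of \<ell> is nonnegative, so a bound on the curvature part,
  continuous on all of M, suffices for the infimum.\<close>

lemma curvature_bounded_below:
  assumes "compact (UNIV :: 'm set)"
  obtains B where "\<And>x. B \<le> 1/4 * scal (base_atlas S) (base_metric S) x - c_const CARD('n) / 4 * curv_norm S x"
proof -
  let ?h = "\<lambda>x. 1/4 * scal (base_atlas S) (base_metric S) x - c_const CARD('n) / 4 * curv_norm S x"
  have "continuous_on UNIV (scal (base_atlas S) (base_metric S))" "continuous_on UNIV (curv_norm S)"
    by (rule continuous_on_UNIV_chart, erule spinc_chart.continuous_curvature)+
  then have "continuous_on UNIV ?h" by (intro continuous_intros)
  from continuous_attains_inf[OF assms _ this] show thesis using that by blast
qed

text \<open>The set where u attains its maximum is closed, nonempty, and open by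
  \<open>locally_constant_at_max\<close>; connectedness makes it all of M. In particular the spinor
  has no zeros.\<close>

lemma norm2_constant:
  assumes cpt: "compact (UNIV :: 'm set)" "connected (UNIV :: 'm set)"
    and eigen: "eigenspinor S (complex_of_real lam) \<psi>"
    and lower: "\<And>y. \<psi> y \<noteq> spinor_zero S y \<Longrightarrow>
      lam\<^sup>2 \<le> 1/4 * scal (base_atlas S) (base_metric S) y - c_const CARD('n) / 4 * curv_norm S y + ell_norm2 S \<psi> y"
  obtains M where "M > 0" "\<And>x. spinor_norm2 (\<psi> x) = M"
proof -
  let ?u = "\<lambda>x. spinor_norm2 (\<psi> x)"
  have \<psi>: "spinor_field S \<psi>" and ne: "\<exists>x. \<psi> x \<noteq> spinor_zero S x" using eigen unfolding eigenspinor_def by blast+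
  have cu: "continuous_on UNIV ?u" using \<psi> by (intro continuous_on_UNIV_chart spinc_chart.continuous_norm2)
  obtain x0 where x0: "\<And>y. ?u y \<le> ?u x0" using continuous_attains_sup[OF cpt(1) _ cu] by blast
  obtain x1 where x1: "\<psi> x1 \<noteq> spinor_zero S x1" using ne by blast
  have "?u x1 > 0"
  proof -
    obtain U b c where C: "spinc_chart S U b c" and x: "x1 \<in> fst c" "x1 \<in> U" using spinc_chart_exists by blast
    interpret C: spinc_chart S U b c by (rule C)
    show ?thesis using C.sh_norm2[OF x \<psi>] C.sh_zero[OF x \<psi>] x1 by simp
  qed
  then have M: "?u x0 > 0" using x0[of x1] by simp
  have "open (?u -` {?u x0})"
    unfolding open_subopen[of "?u -` _"]
  proof (intro ballI)
    fix x assume x: "x \<in> ?u -` {?u x0}"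
    obtain U b c where C: "spinc_chart S U b c" and xc: "x \<in> fst c" "x \<in> U" using spinc_chart_exists by blast
    interpret C: spinc_chart S U b c by (rule C)
    show "\<exists>T. open T \<and> x \<in> T \<and> T \<subseteq> ?u -` {?u x0}"
      using C.locally_constant_at_max[OF eigen xc x0 _ M lower] x by fastforce
  qed
  moreover have "closed (?u -` {?u x0})" by (rule closed_vimage[OF closed_singleton cu])
  ultimately have "?u -` {?u x0} = UNIV" using cpt(2) unfolding connected_clopen by auto
  then show thesis using that[OF M] by auto
qed

end

theorem proposition5p1:
  fixes S :: "('m::{t2_space,second_countable_topology}, 'n::finite,
               'p::{t2_space,second_countable_topology}, 'e::euclidean_space,
               'q::{t2_space,second_countable_topology}, 's::finite) spinc"
    and lam :: real
    and \<psi> :: "'m \<Rightarrow> ('p, 's) spinor"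
  assumes "spinc_manifold S"
    and "compact (UNIV :: 'm set)"
    and "connected (UNIV :: 'm set)"
    and "CARD('n) \<ge> 2"
    and "first_eigenvalue S lam"
    and "eigenspinor S (complex_of_real lam) \<psi>"
  shows "lam\<^sup>2 = (INF x\<in>{x. \<psi> x \<noteq> spinor_zero S x}.
             1/4 * scal (base_atlas S) (base_metric S) x
             - c_const CARD('n) / 4 * curv_norm S x + ell_norm2 S \<psi> x)
         \<longleftrightarrow>
         (\<forall>X. smooth_vfield (base_atlas S) X \<longrightarrow>
            (\<forall>x. \<psi> x \<noteq> spinor_zero S x \<longrightarrow>
               nabla S \<psi> x (X x) = spinor_scale (- 1) (cliff_mult S (ell S \<psi> x (X x)) (\<psi> x)))) \<and>
         (\<forall>x. curv_mult S x (\<psi> x) =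
            spinor_scale (\<i> * complex_of_real (c_const CARD('n) / 2 * curv_norm S x)) (\<psi> x))"
    (is "lam\<^sup>2 = (INF x\<in>?A. ?f x) \<longleftrightarrow> ?twistor \<and> ?curv")
proof -
  interpret spinc_structure S by unfold_locales (rule assms(1))
  note eigen = assms(6)
  have \<psi>: "spinor_field S \<psi>" and ne: "?A \<noteq> {}" using eigen unfolding eigenspinor_def by blast+
  show ?thesis
  proof
    assume eq: "lam\<^sup>2 = (INF x\<in>?A. ?f x)"
    obtain B where B: "\<And>x. B \<le> 1/4 * scal (base_atlas S) (base_metric S) x - c_const CARD('n) / 4 * curv_norm S x"
      by (rule curvature_bounded_below[OF assms(2)]) blast
    have "B \<le> ?f x" if x: "x \<in> ?A" for x
    proof -
      obtain U b c where C: "spinc_chart S U b c" and xc: "x \<in> fst c" "x \<in> U" using spinc_chart_exists by blast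
      interpret C: spinc_chart S U b c by (rule C)
      have "ell_norm2 S \<psi> x \<ge> 0"
        using C.ell_norm2_frame[OF xc \<psi>] C.sh_zero[OF xc \<psi>] x by (simp add: sum_nonneg)
      then show ?thesis using B[of x] by simp
    qed
    \<comment> \<open>Over the reals, an infimum is known to be a lower bound only when the set is
      bounded below.\<close>
    then have "bdd_below (?f ` ?A)" by (auto intro!: bdd_belowI[of _ B])
    then have lower: "lam\<^sup>2 \<le> ?f x" if "\<psi> x \<noteq> spinor_zero S x" for x
      unfolding eq using that by (intro cINF_lower) auto
    obtain M where M: "M > 0" "\<And>x. spinor_norm2 (\<psi> x) = M"
      using norm2_constant[OF assms(2,3) eigen lower] by blast
    have "(tangent (base_atlas S) x X \<longrightarrow> nabla S \<psi> x X = spinor_scale (- 1) (cliff_mult S (ell S \<psi> x X) (\<psi> x))) \<and>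
      curv_mult S x (\<psi> x) = spinor_scale (\<i> * complex_of_real (c_const CARD('n) / 2 * curv_norm S x)) (\<psi> x)" for x X
    proof -
      obtain U b c where C: "spinc_chart S U b c" and xc: "x \<in> fst c" "x \<in> U" using spinc_chart_exists by blast
      interpret C: spinc_chart S U b c by (rule C)
      \<comment> \<open>The constant value of the squared norm is positive, so every point is a
        nonzero of the spinor and the lower bound holds everywhere.\<close>
      have "lam\<^sup>2 \<le> ?f x"
        using C.sh_norm2[OF xc \<psi>] C.sh_zero[OF xc \<psi>] M by (intro lower) auto
      then show ?thesis using C.rigidity_frame[OF eigen xc M(2,1)] by blast
    qed
    then show "?twistor \<and> ?curv" unfolding smooth_vfield_def by blast
  next
    assume R: "?twistor \<and> ?curv"
    \<comment> \<open>Every tangent vector is the value of some smooth vector field, so the first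
      condition holds vector by vector.\<close>
    have twistor: "nabla S \<psi> y Y = spinor_scale (- 1) (cliff_mult S (ell S \<psi> y Y) (\<psi> y))"
      if "\<psi> y \<noteq> spinor_zero S y" "tangent (base_atlas S) y Y" for y Y
      using R vector_field_extension[OF spinc_facts(1) that(2)] that(1) by blast
    have "?f x = lam\<^sup>2" if x: "x \<in> ?A" for x
    proof -
      obtain U b c where C: "spinc_chart S U b c" and xc: "x \<in> fst c" "x \<in> U" using spinc_chart_exists by blast
      interpret C: spinc_chart S U b c by (rule C)
      show ?thesis using C.equality_frame[OF eigen xc _ twistor] x R by blast
    qed
    then have "?f ` ?A = {lam\<^sup>2}" using ne by force
    then show "lam\<^sup>2 = (INF x\<in>?A. ?f x)" by simp
  qed
qed

end
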